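(* Let $f\colon\mathbf R^n\to\mathbf R^n$ and $g\colon\mathbf R^n\to\mathbf R^{n\times n}$ be smooth, let $\tfrac13<\alpha<\beta<\tfrac12$, let $u_0,\bar u_0\in\mathcal C^\beta$ and let $\Psi,\bar\Psi\in\mathcal C(\mathbf R_+,\mathcal D^\alpha)\cap\mathcal C(\mathbf R_+,\mathcal C^\beta)$ (i.e. continuous with values in $\mathcal D^\alpha$, with path components continuous with values in $\mathcal C^\beta$). Denote by $u$, $\bar u$ the corresponding local (mild) solutions and by $\tau$, $\bar\tau$ their blow-up times. Then, for every such $u_0$ and $\Psi$, every $T<\tau$ and every $\varepsilon>0$, there exists $\delta>0$ such that $\bar\tau\ge T$ and $$\sup_{t\le T}\|u_t-\bar u_t\|_{\mathcal C^\beta}\le\varepsilon$$ for all $\bar u_0\in\mathcal C^\beta$ and all $\bar\Psi\in\mathcal C(\mathbf R_+,\mathcal D^\alpha)\cap\mathcal C(\mathbf R_+,\mathcal C^\beta)$ such that $$\|u_0-\bar u_0\|_{\mathcal C^\beta}+\sup_{t\le T}\|\Psi_t-\bar\Psi_t\|_{\mathcal C^\beta}+\sup_{t\le T}\|\boldsymbol\Psi_t-\bar{\boldsymbol\Psi}_t\|_{2\alpha}\le\delta,$$ where $\boldsymbol\Psi_t$, $\bar{\boldsymbol\Psi}_t$ denote the area processes of $\Psi_t$, $\bar\Psi_t$.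
   Context: **Hölder spaces.** $\mathcal C^\alpha$ is the space of $\alpha$-Hölder continuous functions on $[0,2\pi]$, with seminorm $\|u\|_\alpha=\sup_{x\ne y}|u(x)-u(y)|/|x-y|^\alpha$ and norm $\|u\|_{\mathcal C^\alpha}=\|u\|_\alpha+\|u\|_\infty$. $\mathcal C$ denotes continuous functions, $\mathcal C^1$ continuously differentiable ones. All functions of $x$ (including $x\mapsto\Psi_t(x)$) are $2\pi$-periodic. **Rough paths (in the variable $x$).** Write $\delta X_{x,y}=X_y-X_x$. For $\alpha\in(0,\frac12)$, $\mathcal D^\alpha$ is the set of pairs $(X,\mathbf X)$ with $X\in\mathcal C^\alpha([0,2\pi],\mathbf R^n)$ and area process $\mathbf X\colon[0,2\pi]^2\to\mathbf R^{n\times n}$ continuous, vanishing on the diagonal, satisfying $\mathbf X^{ij}_{x,z}-\mathbf X^{ij}_{y,z}-\mathbf X^{ij}_{x,y}=\delta X^i_{x,y}\,\delta X^j_{y,z}$ for all $x,y,z,i,j$, and $\|\mathbf X\|_{2\alpha}=\sup_{x\neq y}|\mathbf X_{x,y}|/|x-y|^{2\alpha}<\infty$; distances are measured by $\|X-\bar X\|_{\mathcal C^\alpha}+\|\mathbf X-\bar{\mathbf X}\|_{2\alpha}$. A pair $(Y,Y')$ of $\mathcal C^\alpha$ functions is controlled by $X$ if $R_{x,y}=\delta Y_{x,y}-Y'_x\,\delta X_{x,y}$ satisfies $\|R\|_{2\alpha}<\infty$. For $\alpha>\frac13$ the rough integral is $$\int Y\,dX=\lim_{|\mathcal P|\to0}\sum_{[x,y]\in\mathcal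 P}\bigl(Y_x\,\delta X_{x,y}+Y'_x\,\mathbf X_{x,y}\bigr)$$ over partitions $\mathcal P$; for matrix-valued $Y=(Y_{ij})$ with $Y'=(Y'_{ij,k})$ the $i$-th component of the summand is $\sum_jY_{ij}\,\delta X^j+\sum_{j,k}Y'_{ij,k}\,\mathbf X^{kj}$. **Solutions.** Everything here is deterministic. Let $S_t$ be the semigroup generated by $\partial_x^2-1$ with periodic boundary conditions, $p_t$ its periodic kernel, and $\hat f(u)=f(u)+u$. Given $u_0$ and a rough-path valued function $t\mapsto\Psi_t$ (whose path component is also written $\Psi_t$), a mild solution on $[0,T]$ is a function $u$ such that $v_t=u_t-\Psi_t$ belongs to $\mathcal C([0,T],\mathcal C)\cap L^1([0,T],\mathcal C^1)$ and for all $x\in[0,2\pi]$, $t\in(0,T]$, $$v_t(x)=\bigl(S_t(u_0-\Psi_0)\bigr)(x)+\int_0^t\bigl(S_{t-s}\bigl(g(u_s)\,\partial_xv_s+\hat f(u_s)\bigr)\bigr)(x)\,ds+\int_0^t\int_0^{2\pi}p_{t-s}(x-y)\,g(u_s(y))\,d\Psi_s(y)\,ds,$$ the inner integral being a rough integral, with integrand controlled by $\Psi_s$ with derivative process $y\mapsto p_{t-s}(x-y)\,Dg(u_s(y))$. For $f$, $g$ smooth, $\tfrac13<\alpha<\beta<\tfrac12$, $u_0\in\mathcal C^\beta$ and $\Psi\in\mathcal C(\mathbf R_+,\mathcal D^\alpha)\cap\mathcal C(\mathbf R_+,\mathcal C^\beta)$ there is a unique local solution, defined up to a blow-up time $\tau\in(0,\infty]$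 with $\lim_{t\to\tau}\|u_t\|_{\mathcal C^\beta}=+\infty$ if $\tau<\infty$. (In the motivating application $\Psi$ is the rough path lift of the stationary solution of $d\psi=(\partial_x^2-1)\psi\,dt+\sigma\,dW$, and $u$ solves $du=\partial_x^2u\,dt+f(u)\,dt+g(u)\,\partial_xu\,dt+\sigma\,dW$.) *)

theory Defs
  imports "HOL-Analysis.Analysis"
begin

section \<open>Smooth maps\<close>

primrec Ck :: "nat \<Rightarrow> ('a::real_normed_vector \<Rightarrow> 'b::real_normed_vector) \<Rightarrow> bool" where
  "Ck 0 h \<longleftrightarrow> continuous_on UNIV h"
| "Ck (Suc k) h \<longleftrightarrow> (\<forall>x. h differentiable (at x)) \<and>
     (\<forall>v. Ck k (\<lambda>x. frechet_derivative h (at x) v))"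

definition smooth :: "('a::real_normed_vector \<Rightarrow> 'b::real_normed_vector) \<Rightarrow> bool" where
  "smooth h \<longleftrightarrow> (\<forall>k. Ck k h)"


section \<open>Function spaces on the circle\<close>

text \<open>Functions of the space variable are total functions on the line that are periodic with
  period \<open>2 * pi\<close>; all norms only look at the fundamental interval \<open>{0..2*pi}\<close>. Norms take values
  in the extended nonnegative reals, so that a supremum is \<open>\<infinity>\<close> exactly when it is not finite.\<close>

definition periodic :: "(real \<Rightarrow> 'a) \<Rightarrow> bool" where
  "periodic w \<longleftrightarrow> (\<forall>x. w (x + 2 * pi) = w x)"

definition sup_norm :: "(real \<Rightarrow> 'a::real_normed_vector) \<Rightarrow> ennreal" where
  "sup_norm w = (SUP x\<in>{0..2*pi}. ennreal (norm (w x)))"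

definition two_param_norm :: "real \<Rightarrow> (real \<Rightarrow> real \<Rightarrow> 'a::real_normed_vector) \<Rightarrow> ennreal" where
  "two_param_norm \<gamma> A =
     (SUP (x, y) \<in> {(x, y). x \<in> {0..2*pi} \<and> y \<in> {0..2*pi} \<and> x \<noteq> y}.
        ennreal (norm (A x y) / \<bar>x - y\<bar> powr \<gamma>))"

definition incr :: "(real \<Rightarrow> 'a::real_normed_vector) \<Rightarrow> real \<Rightarrow> real \<Rightarrow> 'a" where
  "incr w x y = w y - w x"

definition hoelder_norm :: "real \<Rightarrow> (real \<Rightarrow> 'a::real_normed_vector) \<Rightarrow> ennreal" where
  "hoelder_norm \<gamma> w = two_param_norm \<gamma> (incr w) + sup_norm w"

definition hoelder_space :: "real \<Rightarrow> (real \<Rightarrow> 'a::real_normed_vector) set" where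
  "hoelder_space \<gamma> = {w. periodic w \<and> hoelder_norm \<gamma> w < \<infinity>}"

definition C_space :: "(real \<Rightarrow> 'a::real_normed_vector) set" where
  "C_space = {w. periodic w \<and> continuous_on UNIV w}"

definition C1_space :: "(real \<Rightarrow> 'a::real_normed_vector) set" where
  "C1_space = {w. periodic w \<and> w C1_differentiable_on UNIV}"

definition deriv_x :: "(real \<Rightarrow> 'a::real_normed_vector) \<Rightarrow> real \<Rightarrow> 'a" where
  "deriv_x w x = vector_derivative w (at x)"

definition C1_norm :: "(real \<Rightarrow> 'a::real_normed_vector) \<Rightarrow> ennreal" where
  "C1_norm w = sup_norm w + sup_norm (deriv_x w)"

text \<open>Continuity in time of a function with values in \<open>E\<close>, for the distance \<open>d\<close>.\<close>

definition time_continuous ::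
  "real set \<Rightarrow> 'e set \<Rightarrow> ('e \<Rightarrow> 'e \<Rightarrow> ennreal) \<Rightarrow> (real \<Rightarrow> 'e) \<Rightarrow> bool" where
  "time_continuous J E d F \<longleftrightarrow>
     (\<forall>t\<in>J. F t \<in> E \<and> ((\<lambda>s. d (F s) (F t)) \<longlongrightarrow> 0) (at t within J))"

text \<open>Bochner integrable functions on \<open>{0..T}\<close> with values in the Banach space of continuously
  differentiable periodic functions: almost everywhere a limit of simple functions, with
  integrable norm. That space is not a type, so the library notion does not apply.\<close>

definition L1_C1 :: "real \<Rightarrow> (real \<Rightarrow> real \<Rightarrow> 'a::real_normed_vector) \<Rightarrow> bool" where
  "L1_C1 T v \<longleftrightarrow>
     (AE t in lebesgue. t \<in> {0..T} \<longrightarrow> v t \<in> C1_space) \<and>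
     (\<exists>\<phi> :: nat \<Rightarrow> real \<Rightarrow> real \<Rightarrow> 'a.
        (\<forall>k. finite (\<phi> k ` {0..T}) \<and> \<phi> k ` {0..T} \<subseteq> C1_space \<and>
             (\<forall>w. {t \<in> {0..T}. \<phi> k t = w} \<in> sets lebesgue)) \<and>
        (AE t in lebesgue. t \<in> {0..T} \<longrightarrow>
             (\<lambda>k. C1_norm (\<lambda>x. v t x - \<phi> k t x)) \<longlonglongrightarrow> 0)) \<and>
     (\<integral>\<^sup>+ t\<in>{0..T}. C1_norm (v t) \<partial>lebesgue) < \<infinity>"


section \<open>Rough paths in the space variable\<close>

type_synonym 'n path = "real \<Rightarrow> real ^ 'n"
type_synonym 'n area = "real \<Rightarrow> real \<Rightarrow> real ^ 'n ^ 'n"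

definition rough_paths :: "real \<Rightarrow> ('n::finite path \<times> 'n area) set" where
  "rough_paths \<alpha> = {(X, A).
     X \<in> hoelder_space \<alpha> \<and>
     continuous_on ({0..2*pi} \<times> {0..2*pi}) (\<lambda>(x, y). A x y) \<and>
     (\<forall>x\<in>{0..2*pi}. A x x = 0) \<and>
     (\<forall>x\<in>{0..2*pi}. \<forall>y\<in>{0..2*pi}. \<forall>z\<in>{0..2*pi}. \<forall>i j.
        A x z $ i $ j - A y z $ i $ j - A x y $ i $ j = incr X x y $ i * incr X y z $ j) \<and>
     two_param_norm (2 * \<alpha>) A < \<infinity>}"

definition rough_dist ::
  "real \<Rightarrow> 'n::finite path \<times> 'n area \<Rightarrow> 'n path \<times> 'n area \<Rightarrow> ennreal" where
  "rough_dist \<alpha> R R' =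
     hoelder_norm \<alpha> (\<lambda>x. fst R x - fst R' x) +
     two_param_norm (2 * \<alpha>) (\<lambda>x y. snd R x y - snd R' x y)"

text \<open>Matrix-valued paths controlled by \<open>X\<close>; the component with indices \<open>ij,k\<close> of \<open>Y'\<close> is
  \<open>Y' x $ i $ j $ k\<close>.\<close>

definition controlled ::
  "real \<Rightarrow> 'n::finite path \<Rightarrow> (real \<Rightarrow> real ^ 'n ^ 'n) \<Rightarrow> (real \<Rightarrow> real ^ 'n ^ 'n ^ 'n) \<Rightarrow> bool" where
  "controlled \<alpha> X Y Y' \<longleftrightarrow>
     Y \<in> hoelder_space \<alpha> \<and> Y' \<in> hoelder_space \<alpha> \<and>
     two_param_norm (2 * \<alpha>)
       (\<lambda>x y. incr Y x y - (\<chi> i j. \<Sum>k\<in>UNIV. Y' x $ i $ j $ k * incr X x y $ k)) < \<infinity>"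

definition rough_summand ::
  "'n::finite path \<times> 'n area \<Rightarrow> (real \<Rightarrow> real ^ 'n ^ 'n) \<Rightarrow> (real \<Rightarrow> real ^ 'n ^ 'n ^ 'n)
     \<Rightarrow> real \<Rightarrow> real \<Rightarrow> real ^ 'n" where
  "rough_summand R Y Y' x y =
     (\<chi> i. (\<Sum>j\<in>UNIV. Y x $ i $ j * incr (fst R) x y $ j) +
          (\<Sum>j\<in>UNIV. \<Sum>k\<in>UNIV. Y' x $ i $ j $ k * snd R x y $ k $ j))"

text \<open>A division may contain one-point intervals; for a rough path these contribute nothing.\<close>

definition has_rough_integral ::
  "'n::finite path \<times> 'n area \<Rightarrow> (real \<Rightarrow> real ^ 'n ^ 'n) \<Rightarrow> (real \<Rightarrow> real ^ 'n ^ 'n ^ 'n)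
     \<Rightarrow> real ^ 'n \<Rightarrow> bool" where
  "has_rough_integral R Y Y' I \<longleftrightarrow>
     (\<forall>\<epsilon>>0. \<exists>\<eta>>0. \<forall>P. P division_of {0..2*pi} \<and> (\<forall>K\<in>P. Sup K - Inf K < \<eta>) \<longrightarrow>
        norm ((\<Sum>K\<in>P. rough_summand R Y Y' (Inf K) (Sup K)) - I) < \<epsilon>)"

definition rough_integral ::
  "'n::finite path \<times> 'n area \<Rightarrow> (real \<Rightarrow> real ^ 'n ^ 'n) \<Rightarrow> (real \<Rightarrow> real ^ 'n ^ 'n ^ 'n)
     \<Rightarrow> real ^ 'n" where
  "rough_integral R Y Y' = (THE I. has_rough_integral R Y Y' I)"

text \<open>Driving rough paths, continuous in time on the half line both for the rough path distance
  and, as far as the path component is concerned, in the stronger Hoelder norm of exponent \<open>\<beta>\<close>.\<close>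

definition drivers :: "real \<Rightarrow> real \<Rightarrow> (real \<Rightarrow> 'n::finite path \<times> 'n area) set" where
  "drivers \<alpha> \<beta> = {\<Psi>.
     time_continuous {0..} (rough_paths \<alpha>) (rough_dist \<alpha>) \<Psi> \<and>
     time_continuous {0..} (hoelder_space \<beta>) (\<lambda>w w'. hoelder_norm \<beta> (\<lambda>x. w x - w' x))
       (\<lambda>t. fst (\<Psi> t))}"


section \<open>The semigroup generated by the Laplacian minus one\<close>

text \<open>The fundamental solution of \<open>\<partial>\<^sub>t q = \<partial>\<^sub>x\<^sup>2 q - q\<close> on the line; the kernel on the circle is its
  periodization.\<close>

definition line_kernel :: "real \<Rightarrow> real \<Rightarrow> real" where
  "line_kernel t x = exp (- t) * (exp (- (x\<^sup>2) / (4 * t)) / sqrt (4 * pi * t))"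

definition heat_kernel :: "real \<Rightarrow> real \<Rightarrow> real" where
  "heat_kernel t x = (\<Sum>\<^sub>\<infinity>k\<in>(UNIV::int set). line_kernel t (x - 2 * pi * of_int k))"

definition heat_semigroup :: "real \<Rightarrow> (real \<Rightarrow> real ^ 'n) \<Rightarrow> real \<Rightarrow> real ^ 'n::finite" where
  "heat_semigroup t w x =
     (if t = 0 then w x else (LINT y:{0..2*pi}|lebesgue. heat_kernel t (x - y) *\<^sub>R w y))"

lemma line_kernel_solves:
  assumes "t > 0"
  shows "\<exists>q'. (\<forall>x. (line_kernel t has_real_derivative q' x) (at x)) \<and>
    (\<forall>x. \<exists>q''. (q' has_real_derivative q'') (at x) \<and>
       ((\<lambda>s. line_kernel s x) has_real_derivative q'' - line_kernel t x) (at t))"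
proof -
  define q' where "q' x = - x / (2 * t) * line_kernel t x" for x
  have 1: "(line_kernel t has_real_derivative q' x) (at x)" for x
    unfolding line_kernel_def q'_def using assms
    by (auto intro!: derivative_eq_intros simp: field_simps)
  have 2: "(q' has_real_derivative (x\<^sup>2 / (4 * t\<^sup>2) - 1 / (2 * t)) * line_kernel t x) (at x)" for x
    unfolding q'_def using assms
    by (rule_tac DERIV_cong[OF DERIV_mult[OF _ 1]])
       (auto intro!: derivative_eq_intros simp: field_simps power2_eq_square q'_def)
  have sq: "sqrt (4 * pi * t) \<noteq> 0" "sqrt (4 * pi * t) * sqrt (4 * pi * t) = 4 * pi * t"
    using assms by auto
  have e: "((\<lambda>s. exp (- s) * exp (- (x\<^sup>2) / (4 * s))) has_real_derivative
      (x\<^sup>2 / (4 * t\<^sup>2) - 1) * (exp (- t) * exp (- (x\<^sup>2) / (4 * t)))) (at t)" for x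
    using assms
    by (auto intro!: derivative_eq_intros simp: field_simps power2_eq_square)
  have r: "((\<lambda>s. inverse (sqrt (4 * pi * s))) has_real_derivative
      - (1 / (2 * t)) * inverse (sqrt (4 * pi * t))) (at t)"
  proof -
    have "((\<lambda>s. sqrt (4 * pi * s)) has_real_derivative
        inverse (sqrt (4 * pi * t)) / 2 * (4 * pi)) (at t)"
      using assms by (auto intro!: derivative_eq_intros simp: mult_less_0_iff)
    from DERIV_inverse'[OF this sq(1)]
    have "((\<lambda>s. inverse (sqrt (4 * pi * s))) has_real_derivative
        - (inverse (sqrt (4 * pi * t)) * (inverse (sqrt (4 * pi * t)) / 2 * (4 * pi)) *
          inverse (sqrt (4 * pi * t)))) (at t)" .
    moreover have "inverse (sqrt (4 * pi * t)) * inverse (sqrt (4 * pi * t)) = 1 / (4 * pi * t)"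
      using sq by (metis inverse_eq_divide inverse_mult_distrib)
    then have "inverse (sqrt (4 * pi * t)) * (inverse (sqrt (4 * pi * t)) / 2 * (4 * pi)) =
        1 / (4 * pi * t) / 2 * (4 * pi)"
      by (metis (no_types, lifting) times_divide_eq_right mult.assoc times_divide_eq_left)
    then have "inverse (sqrt (4 * pi * t)) * (inverse (sqrt (4 * pi * t)) / 2 * (4 * pi)) =
        1 / (2 * t)"
      using assms by (simp add: field_simps)
    ultimately show ?thesis by (simp only: minus_mult_left)
  qed
  have 3: "((\<lambda>s. line_kernel s x) has_real_derivative
      (x\<^sup>2 / (4 * t\<^sup>2) - 1 / (2 * t)) * line_kernel t x - line_kernel t x) (at t)" for x
  proof -
    define E where "E s = exp (- s) * exp (- (x\<^sup>2) / (4 * s))" for s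
    define R where "R s = inverse (sqrt (4 * pi * s))" for s
    have lk: "line_kernel s x = E s * R s" for s
      unfolding line_kernel_def E_def R_def by (simp only: divide_inverse ac_simps)
    have "((\<lambda>s. E s * R s) has_real_derivative
        (x\<^sup>2 / (4 * t\<^sup>2) - 1) * E t * R t + (- (1 / (2 * t)) * R t) * E t) (at t)"
      using DERIV_mult[OF e[of x, folded E_def] r[folded R_def]] .
    then show ?thesis
      unfolding lk by (rule DERIV_cong) algebra
  qed
  from 1 2 3 show ?thesis by blast
qed


section \<open>Mild solutions and blow-up\<close>

definition reaction ::
  "(real ^ 'n \<Rightarrow> real ^ 'n) \<Rightarrow> (real ^ 'n \<Rightarrow> real ^ 'n ^ 'n) \<Rightarrow> 'n path \<Rightarrow> 'n path \<Rightarrow> 'n::finite path" where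
  "reaction f g us vs y = g (us y) *v deriv_x vs y + (f (us y) + us y)"

definition integrand ::
  "(real ^ 'n \<Rightarrow> real ^ 'n ^ 'n) \<Rightarrow> real \<Rightarrow> real \<Rightarrow> 'n path \<Rightarrow> real \<Rightarrow> real ^ 'n ^ 'n::finite" where
  "integrand g r x us y = heat_kernel r (x - y) *\<^sub>R g (us y)"

definition integrand' ::
  "(real ^ 'n \<Rightarrow> real ^ 'n ^ 'n) \<Rightarrow> real \<Rightarrow> real \<Rightarrow> 'n path \<Rightarrow> real \<Rightarrow> real ^ 'n ^ 'n ^ 'n::finite" where
  "integrand' g r x us y =
     (\<chi> i j k. heat_kernel r (x - y) * frechet_derivative g (at (us y)) (axis k 1) $ i $ j)"

definition mild_solution ::
  "(real ^ 'n \<Rightarrow> real ^ 'n) \<Rightarrow> (real ^ 'n \<Rightarrow> real ^ 'n ^ 'n) \<Rightarrow> real \<Rightarrow> 'n path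
     \<Rightarrow> (real \<Rightarrow> 'n path \<times> 'n area) \<Rightarrow> real \<Rightarrow> (real \<Rightarrow> 'n::finite path) \<Rightarrow> bool" where
  "mild_solution f g \<alpha> u0 \<Psi> T u \<longleftrightarrow>
     (let v = (\<lambda>t x. u t x - fst (\<Psi> t) x) in
       time_continuous {0..T} C_space (\<lambda>w w'. sup_norm (\<lambda>x. w x - w' x)) v \<and>
       L1_C1 T v \<and>
       (\<forall>t\<in>{0<..T}. \<forall>x\<in>{0..2*pi}.
          (AE s in lebesgue. s \<in> {0..<t} \<longrightarrow>
             controlled \<alpha> (fst (\<Psi> s)) (integrand g (t - s) x (u s)) (integrand' g (t - s) x (u s))) \<and>
          set_integrable lebesgue {0..t} (\<lambda>s. heat_semigroup (t - s) (reaction f g (u s) (v s)) x) \<and>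
          set_integrable lebesgue {0..t}
            (\<lambda>s. rough_integral (\<Psi> s) (integrand g (t - s) x (u s)) (integrand' g (t - s) x (u s))) \<and>
          v t x =
            heat_semigroup t (\<lambda>y. u0 y - fst (\<Psi> 0) y) x +
            (LINT s:{0..t}|lebesgue. heat_semigroup (t - s) (reaction f g (u s) (v s)) x) +
            (LINT s:{0..t}|lebesgue.
               rough_integral (\<Psi> s) (integrand g (t - s) x (u s)) (integrand' g (t - s) x (u s)))))"

text \<open>\<open>u\<close> is the local solution, defined up to its blow-up time \<open>\<tau>\<close>; the values \<open>u t\<close> for
  \<open>t \<ge> \<tau>\<close> are irrelevant.\<close>

definition local_solution ::
  "(real ^ 'n \<Rightarrow> real ^ 'n) \<Rightarrow> (real ^ 'n \<Rightarrow> real ^ 'n ^ 'n) \<Rightarrow> real \<Rightarrow> real \<Rightarrow> 'n path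
     \<Rightarrow> (real \<Rightarrow> 'n path \<times> 'n area) \<Rightarrow> (real \<Rightarrow> 'n::finite path) \<Rightarrow> ereal \<Rightarrow> bool" where
  "local_solution f g \<alpha> \<beta> u0 \<Psi> u \<tau> \<longleftrightarrow>
     0 < \<tau> \<and>
     (\<forall>T>0. ereal T < \<tau> \<longrightarrow> mild_solution f g \<alpha> u0 \<Psi> T u) \<and>
     (\<tau> < \<infinity> \<longrightarrow> ((\<lambda>t. hoelder_norm \<beta> (u t)) \<longlongrightarrow> \<infinity>) (at_left (real_of_ereal \<tau>)))"

end

theory Submission
  imports Defs
begin

text \<open>Write \<open>u = v + \<Psi>\<close>. For fixed time the germ \<open>g(u\<^sub>a) (X\<^sub>b - X\<^sub>a) + Dg(u\<^sub>a) A\<^sub>a\<^sub>b\<close> has defect of order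
  \<open>3\<alpha> > 1\<close>, so it can be sewn to a path \<open>Z\<close>, and the rough integral against the heat kernel is the
  Stieltjes convolution of the kernel with \<open>Z\<close>. Taylor expansion up to order 3 bounds the \<open>\<alpha>\<close>-Hoelder
  seminorm of \<open>Z - Z'\<close> by a multiple of \<open>E = d (1 + Lip v) + Lip (v - v')\<close>, where \<open>d\<close> is the distance
  of the rough paths plus the sup norm of \<open>v - v'\<close>; here the Lipschitz seminorms enter linearly.
  The smoothing of the heat semigroup turns this into a bound \<open>r powr ((\<alpha> - 2) / 2) * E\<close> for the
  Lipschitz seminorm of the drift, which is integrable at \<open>r = 0\<close>.

  Comparison with the zero state and a Gronwall inequality with singular kernel give
  \<open>Lip v\<^sub>t \<le> C t powr - \<kappa>\<close> with \<open>\<kappa> = (1 - \<beta>) / 2\<close>. The same inequality, applied to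
  \<open>t powr - \<kappa> (\<eta> + sup |v - v'|) + Lip (v - v')\<close>, gives a difference of order \<open>\<eta>\<close> as long as
  \<open>sup |v - v'| \<le> 1\<close>, \<open>\<eta>\<close> being the distance of the data; for small \<open>\<eta>\<close> this restriction is removed
  by continuity in time. Finally \<open>u'\<close> stays bounded in the Hoelder norm, so it cannot blow up before
  time \<open>T\<close>.\<close>

section \<open>The sewing lemma\<close>

text \<open>A perturbed solution comes with no quantitative bound on its Lipschitz seminorm, only
  with integrability in time. Hence every spatial estimate is arranged so that the seminorm of the
  fixed solution alone multiplies \<open>d\<close>, and the constants do not depend on the
  perturbation. A priori these seminorms are known to be finite only at almost every time, so the
  Gronwall inequality is proved for measurable functions with values in \<open>ennreal\<close> and
  holds almost everywhere; sup and Hoelder norms at every positive time are then recovered by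
  inserting the result into the mild equation once more.

  The exponent \<kappa> is the rate at which the heat semigroup turns \<beta>-Hoelder data into
  Lipschitz functions. The sup norm of the drift has the singularity
  \<open>a0 = (1 - \<alpha>) / 2\<close>, its \<beta>-Hoelder seminorm the interpolated
  \<open>a1 = (1 - \<alpha> + \<beta>) / 2\<close>. Both \<open>a0 + \<kappa>\<close> and
  \<open>a1 + \<kappa>\<close> are below 1, so no singularity at time 0 survives in the
  \<beta>-Hoelder norm.\<close>

definition sew_const :: "real \<Rightarrow> real" where
  "sew_const \<theta> = 2 / (1 - 2 powr (1 - \<theta>))"

lemma sew_const_pos: "\<theta> > 1 \<Longrightarrow> sew_const \<theta> > 0"
  unfolding sew_const_def using powr_less_mono[of "1 - \<theta>" 0 2] by simp

text \<open>\<open>sew_const\<close> is the solution of this fixed point equation, which reflects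
  the induction in \<open>partition_germ_bound\<close>: two blocks of at most half the length
  contribute \<open>sew_const \<theta> * (1 / 2) powr \<theta>\<close> each, and two germ defects
  contribute 1 each. For \<theta> > 1 the factor \<open>2 powr (1 - \<theta>)\<close> is below
  1.\<close>

lemma sew_const_fix:
  assumes "\<theta> > 1"
  shows "2 * (sew_const \<theta> * (1 / 2) powr \<theta>) + 2 = sew_const \<theta>"
proof -
  have "2 * (1 / 2::real) powr \<theta> = 2 powr (1 - \<theta>)"
    by (simp add: powr_diff powr_divide)
  moreover have "1 - (2::real) powr (1 - \<theta>) \<noteq> 0" using powr_less_mono[of "1 - \<theta>" 0 2] assms by simp
  ultimately show ?thesis
    unfolding sew_const_def by (simp add: field_simps)
qed

lemma sum_lessThan_add:
  fixes f :: "nat \<Rightarrow> 'a::ab_group_add"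
  shows "(\<Sum>i<m + n. f i) = (\<Sum>i<m. f i) + (\<Sum>i<n. f (m + i))"
  by (induction n) (simp_all add: ac_simps)

text \<open>The point is that the constant does not depend on \<open>n\<close>. In the induction the
  cell containing the midpoint of the whole interval is singled out, so that the blocks on both
  sides of it have at most half the length; inserting the two end points of this cell into the germ
  costs two defects.\<close>

lemma partition_germ_bound:
  fixes \<xi> :: "real \<Rightarrow> real \<Rightarrow> 'a::real_normed_vector"
  assumes \<theta>: "\<theta> > 1" and M: "M \<ge> 0"
    and diag: "\<And>a. 0 \<le> a \<Longrightarrow> a \<le> L \<Longrightarrow> \<xi> a a = 0"
    and germ: "\<And>a b c. 0 \<le> a \<Longrightarrow> a \<le> b \<Longrightarrow> b \<le> c \<Longrightarrow> c \<le> L \<Longrightarrow>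
      norm (\<xi> a c - \<xi> a b - \<xi> b c) \<le> M * (c - a) powr \<theta>"
    and "mono x" "0 \<le> x 0" "x n \<le> L"
  shows "norm ((\<Sum>i<n. \<xi> (x i) (x (Suc i))) - \<xi> (x 0) (x n)) \<le> sew_const \<theta> * M * (x n - x 0) powr \<theta>"
  using assms(5-7)
proof (induction n arbitrary: x rule: less_induct)
  case (less n)
  let ?C = "sew_const \<theta>"
  show ?case
  proof (cases "n = 0")
    case True
    then show ?thesis using less.prems diag by simp
  next
    case False
    define m where "m = (x 0 + x n) / 2"
    have x0n: "x 0 \<le> x n" using less.prems(1) by (simp add: monoD)
    \<comment> \<open>The last index before \<open>n\<close> whose point is not beyond the midpoint:
      the midpoint lies in the cell from \<open>x k\<close> to \<open>x (Suc k)\<close>.\<close>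
    define k where "k = Max {k. k < n \<and> x k \<le> m}"
    have fin: "finite {k. k < n \<and> x k \<le> m}" by simp
    have "0 \<in> {k. k < n \<and> x k \<le> m}" using False x0n by (simp add: m_def)
    then have kin: "k \<in> {k. k < n \<and> x k \<le> m}"
      unfolding k_def using Max_in[OF fin] by blast
    have k1: "m \<le> x (Suc k)"
    proof (cases "Suc k = n")
      case True then show ?thesis using x0n by (simp add: m_def)
    next
      case False
      show ?thesis
      proof (rule ccontr)
        assume "\<not> m \<le> x (Suc k)"
        then have "Suc k \<in> {k. k < n \<and> x k \<le> m}" using False kin by auto
        then have "Suc k \<le> k" unfolding k_def using Max_ge[OF fin] by blast
        then show False by simp
      qed
    qed
    have mono: "x i \<le> x j" if "i \<le> j" for i j using less.prems(1) that by (simp add: monoD)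
    have kn: "k < n" "x k \<le> m" using kin by auto
    define y where "y i = x (Suc k + i)" for i
    have ymono: "mono y" unfolding y_def by (rule monoI, rule mono) simp
    have y0: "y 0 = x (Suc k)" by (simp add: y_def)
    have yn: "y (n - Suc k) = x n" using kn by (simp add: y_def)
    have "norm ((\<Sum>i<k. \<xi> (x i) (x (Suc i))) - \<xi> (x 0) (x k)) \<le> ?C * M * (x k - x 0) powr \<theta>"
      by (rule less.IH) (use kn less.prems mono[of k n] in auto)
    also have "\<dots> \<le> ?C * M * ((x n - x 0) / 2) powr \<theta>"
      using M sew_const_pos[OF \<theta>] kn mono[of 0 k] \<theta>
      by (intro mult_left_mono powr_mono2) (auto simp: m_def field_simps)
    finally have l: "norm ((\<Sum>i<k. \<xi> (x i) (x (Suc i))) - \<xi> (x 0) (x k)) \<le> ?C * M * ((x n - x 0) / 2) powr \<theta>" .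
    have "norm ((\<Sum>i<n - Suc k. \<xi> (y i) (y (Suc i))) - \<xi> (y 0) (y (n - Suc k)))
        \<le> ?C * M * (y (n - Suc k) - y 0) powr \<theta>"
      using kn less.prems mono[of 0 "Suc k"] ymono yn y0 by (intro less.IH) simp_all
    also have "\<dots> \<le> ?C * M * ((x n - x 0) / 2) powr \<theta>"
      unfolding yn using M sew_const_pos[OF \<theta>] kn k1 mono[of "Suc k" n] \<theta>
      by (intro mult_left_mono powr_mono2) (auto simp: m_def field_simps y_def)
    finally have r: "norm ((\<Sum>i<n - Suc k. \<xi> (y i) (y (Suc i))) - \<xi> (x (Suc k)) (x n))
        \<le> ?C * M * ((x n - x 0) / 2) powr \<theta>" using yn by (simp add: y_def)
    have e1: "norm (\<xi> (x 0) (x n) - \<xi> (x 0) (x k) - \<xi> (x k) (x n)) \<le> M * (x n - x 0) powr \<theta>"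
      by (rule germ) (use less.prems mono kn in auto)
    have "norm (\<xi> (x k) (x n) - \<xi> (x k) (x (Suc k)) - \<xi> (x (Suc k)) (x n)) \<le> M * (x n - x k) powr \<theta>"
      using less.prems mono[of k "Suc k"] mono[of "Suc k" n] mono[of 0 k] kn by (intro germ) auto
    also have "\<dots> \<le> M * (x n - x 0) powr \<theta>"
      using M \<theta> mono[of 0 k] mono[of k n] kn by (intro mult_left_mono powr_mono2) auto
    finally have e2: "norm (\<xi> (x k) (x n) - \<xi> (x k) (x (Suc k)) - \<xi> (x (Suc k)) (x n)) \<le> M * (x n - x 0) powr \<theta>" .
    have split: "(\<Sum>i<n. \<xi> (x i) (x (Suc i))) = (\<Sum>i<k. \<xi> (x i) (x (Suc i))) + \<xi> (x k) (x (Suc k)) +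
        (\<Sum>i<n - Suc k. \<xi> (y i) (y (Suc i)))"
    proof -
      have n: "n = Suc k + (n - Suc k)" using kn by simp
      have "(\<Sum>i<Suc k + (n - Suc k). \<xi> (x i) (x (Suc i))) = (\<Sum>i<Suc k. \<xi> (x i) (x (Suc i))) +
        (\<Sum>i<n - Suc k. \<xi> (x (Suc k + i)) (x (Suc (Suc k + i))))"
        by (rule sum_lessThan_add)
      then show ?thesis using n by (simp add: y_def)
    qed
    have tri: "norm (A + B + D - E) \<le> norm (A - A') + norm (D - D') + norm (E - A' - F) + norm (F - B - D')"
      for A B D E A' D' F :: 'a
    proof -
      have eq: "A + B + D - E = (A - A') + (D - D') - (E - A' - F) - (F - B - D')" by simp
 show ?thesis unfolding eq
        using norm_triangle_ineq[of "A - A'" "D - D'"] norm_triangle_ineq4[of "(A - A') + (D - D')" "E - A' - F"]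
          norm_triangle_ineq4[of "(A - A') + (D - D') - (E - A' - F)" "F - B - D'"]
        by linarith
    qed
    have "norm ((\<Sum>i<n. \<xi> (x i) (x (Suc i))) - \<xi> (x 0) (x n))
       \<le> 2 * (?C * M * ((x n - x 0) / 2) powr \<theta>) + 2 * (M * (x n - x 0) powr \<theta>)"
      unfolding split
      by (rule order_trans[OF tri[where A'="\<xi> (x 0) (x k)" and D'="\<xi> (x (Suc k)) (x n)" and F="\<xi> (x k) (x n)"]])
         (use l r e1 e2 in linarith)
    also have "((x n - x 0) / 2) powr \<theta> = (x n - x 0) powr \<theta> * (1/2) powr \<theta>"
      using x0n by (simp add: powr_divide)
    also have "2 * (?C * M * ((x n - x 0) powr \<theta> * (1/2) powr \<theta>)) + 2 * (M * (x n - x 0) powr \<theta>)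
       = (2 * (?C * (1/2) powr \<theta>) + 2) * (M * (x n - x 0) powr \<theta>)"
      by (simp add: algebra_simps)
    also have "\<dots> = ?C * M * (x n - x 0) powr \<theta>"
      unfolding sew_const_fix[OF \<theta>] by simp
    finally show ?thesis .
  qed
qed

text \<open>The constant \<open>K\<close> is only qualitative: over \<open>n\<close> equal cells its
  contribution is of order \<open>real n powr (1 - \<theta>)\<close> and vanishes in the limit, and
  \<open>partition_germ_bound\<close> supplies what remains. For a difference of two sewn paths this
  yields a constant governed by the difference of the germs, although \<open>K\<close> comes from
  each path separately.\<close>

lemma sewing_bound:
  fixes \<xi> :: "real \<Rightarrow> real \<Rightarrow> 'a::real_normed_vector"
  assumes \<theta>: "\<theta> > 1" and M: "M \<ge> 0"
    and diag: "\<And>a. 0 \<le> a \<Longrightarrow> a \<le> L \<Longrightarrow> \<xi> a a = 0"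
    and germ: "\<And>a b c. 0 \<le> a \<Longrightarrow> a \<le> b \<Longrightarrow> b \<le> c \<Longrightarrow> c \<le> L \<Longrightarrow>
      norm (\<xi> a c - \<xi> a b - \<xi> b c) \<le> M * (c - a) powr \<theta>"
    and Z: "\<And>a b. 0 \<le> a \<Longrightarrow> a \<le> b \<Longrightarrow> b \<le> L \<Longrightarrow> norm (Z b - Z a - \<xi> a b) \<le> K * (b - a) powr \<theta>"
    and ab: "0 \<le> a" "a \<le> b" "b \<le> L"
  shows "norm (Z b - Z a - \<xi> a b) \<le> sew_const \<theta> * M * (b - a) powr \<theta>"
proof -
  let ?l = "b - a"
  have bnd: "norm (Z b - Z a - \<xi> a b) \<le> K * ?l powr \<theta> * real n powr (1 - \<theta>) + sew_const \<theta> * M * ?l powr \<theta>"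
    if n: "n > 0" for n :: nat
  proof -
    define x where "x i = a + ?l * (real i / real n)" for i
    have mx: "mono x" unfolding x_def using ab n
      by (intro monoI add_left_mono mult_left_mono divide_right_mono) auto
    have x0: "x 0 = a" "x n = b" using n by (auto simp: x_def)
    have step: "x (Suc i) - x i = ?l / n" for i using n by (simp add: x_def field_simps)
    have "norm ((\<Sum>i<n. (Z (x (Suc i)) - Z (x i) - \<xi> (x i) (x (Suc i))))) \<le> (\<Sum>i<n. K * (?l / n) powr \<theta>)"
    proof (rule sum_norm_le)
      fix i assume "i \<in> {..<n}"
      then have i: "i < n" by simp
      have "x (Suc i) \<le> x n" "x 0 \<le> x i" "x i \<le> x (Suc i)" using mx i by (auto simp: monoD)
      then show "norm (Z (x (Suc i)) - Z (x i) - \<xi> (x i) (x (Suc i))) \<le> K * (?l / n) powr \<theta>"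
        using Z[of "x i" "x (Suc i)"] x0 ab step[of i] by auto
    qed
    also have "(\<Sum>i<n. K * (?l / n) powr \<theta>) = K * ?l powr \<theta> * real n powr (1 - \<theta>)"
      using n ab by (simp add: powr_divide powr_diff)
    finally have 1: "norm ((\<Sum>i<n. (Z (x (Suc i)) - Z (x i) - \<xi> (x i) (x (Suc i))))) \<le> K * ?l powr \<theta> * real n powr (1 - \<theta>)" .
    have "(\<Sum>i<n. (Z (x (Suc i)) - Z (x i) - \<xi> (x i) (x (Suc i)))) = Z b - Z a - (\<Sum>i<n. \<xi> (x i) (x (Suc i)))"
      unfolding sum_subtractf[of _ "\<lambda>i. \<xi> (x i) (x (Suc i))"]
      using sum_lessThan_telescope[of "\<lambda>i. Z (x i)" n] x0 by simp
    then have eq: "Z b - Z a - \<xi> a b = (\<Sum>i<n. (Z (x (Suc i)) - Z (x i) - \<xi> (x i) (x (Suc i))))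
        + ((\<Sum>i<n. \<xi> (x i) (x (Suc i))) - \<xi> a b)" by simp
    have 2: "norm ((\<Sum>i<n. \<xi> (x i) (x (Suc i))) - \<xi> a b) \<le> sew_const \<theta> * M * ?l powr \<theta>"
      using partition_germ_bound[OF \<theta> M diag germ mx] x0 ab by auto
    show ?thesis unfolding eq by (rule norm_triangle_mono[OF 1 2])
  qed
  have "((\<lambda>n. K * ?l powr \<theta> * real n powr (1 - \<theta>) + sew_const \<theta> * M * ?l powr \<theta>) \<longlongrightarrow>
      K * ?l powr \<theta> * 0 + sew_const \<theta> * M * ?l powr \<theta>) sequentially"
    using \<theta> by (intro tendsto_intros tendsto_neg_powr filterlim_real_sequentially) auto
  then show ?thesis
    using bnd by (intro tendsto_lowerbound[where F=sequentially])
      (auto intro!: eventually_sequentiallyI[of 1])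
qed

text \<open>Riemann sums over uniform grids of mesh \<open>h n\<close>, clipped at \<open>y\<close>.
  The grids are not nested. Two of them are compared through the germ itself, since over
  \<open>{a..b}\<close> the increment of either sum is close to \<open>\<xi> a b\<close> by
  \<open>Sb\<close>.\<close>

lemma sewing_exists:
  fixes \<xi> :: "real \<Rightarrow> real \<Rightarrow> 'a::banach"
  assumes \<theta>: "\<theta> > 1" and M: "M \<ge> 0" and L: "L \<ge> 0"
    and diag: "\<And>a. 0 \<le> a \<Longrightarrow> a \<le> L \<Longrightarrow> \<xi> a a = 0"
    and germ: "\<And>a b c. 0 \<le> a \<Longrightarrow> a \<le> b \<Longrightarrow> b \<le> c \<Longrightarrow> c \<le> L \<Longrightarrow>
      norm (\<xi> a c - \<xi> a b - \<xi> b c) \<le> M * (c - a) powr \<theta>"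
  obtains Z where "Z 0 = 0"
    "\<And>a b. 0 \<le> a \<Longrightarrow> a \<le> b \<Longrightarrow> b \<le> L \<Longrightarrow> norm (Z b - Z a - \<xi> a b) \<le> sew_const \<theta> * M * (b - a) powr \<theta>"
proof -
  let ?C = "sew_const \<theta>"
  define h where "h n = 1 / real (Suc n)" for n
  define N where "N n = nat \<lceil>L * real (Suc n)\<rceil>" for n
  have h0: "h n > 0" for n by (simp add: h_def)
  have Nh: "L \<le> real (N n) * h n" for n
    using real_nat_ceiling_ge[of "L * real (Suc n)"] by (simp add: N_def h_def field_simps)
  \<comment> \<open>Cells beyond \<open>y\<close> collapse to the point \<open>y\<close>, where the
    germ vanishes; this is why the number \<open>N n\<close> of summands can be the same for all
    \<open>y\<close>.\<close>
  define S where "S n y = (\<Sum>i<N n. \<xi> (min y (i * h n)) (min y (Suc i * h n)))" for n y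
  have S0: "S n 0 = 0" for n
    unfolding S_def using L h0[of n] diag by (intro sum.neutral) (auto simp: min_def)
  have Sb: "norm (S n b - S n a - \<xi> a b) \<le> ?C * M * (b - a) powr \<theta> + M * h n powr \<theta>"
    if ab: "0 \<le> a" "a \<le> b" "b \<le> L" for a b n
  proof -
    define x where "x i = max a (min b (i * h n))" for i :: nat
    have mx: "mono x" unfolding x_def using h0[of n]
      by (intro monoI max.mono min.mono mult_right_mono) auto
    have x0: "x 0 = a" "x (N n) = b" using ab Nh[of n] by (auto simp: x_def)
    \<comment> \<open>The cell that contains \<open>a\<close>. It is the only one that the
      restriction to \<open>{a..b}\<close> cuts in two, at the price of one germ defect.\<close>
    define k where "k = nat \<lfloor>a / h n\<rfloor>"
    have "norm (\<Sum>i<N n. \<xi> (min b (i * h n)) (min b (Suc i * h n)) - \<xi> (min a (i * h n)) (min a (Suc i * h n))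
        - \<xi> (x i) (x (Suc i))) \<le> (\<Sum>i<N n. if i = k then M * h n powr \<theta> else 0)"
    proof (rule sum_norm_le)
      fix i assume "i \<in> {..<N n}"
      have ih: "real i * h n \<le> real (Suc i) * h n" "0 \<le> real i * h n" using h0[of n] by (auto intro!: mult_right_mono)
      have sh: "real (Suc i) * h n = real i * h n + h n" by (simp add: algebra_simps)
      consider (1) "Suc i * h n \<le> a" | (2) "a \<le> i * h n" | (3) "i * h n < a" "a < Suc i * h n" by linarith
      then show "norm (\<xi> (min b (i * h n)) (min b (Suc i * h n)) - \<xi> (min a (i * h n)) (min a (Suc i * h n))
        - \<xi> (x i) (x (Suc i))) \<le> (if i = k then M * h n powr \<theta> else 0)"
      proof cases
        case 1
        with ih ab have "min b (i * h n) = i * h n" "min b (Suc i * h n) = Suc i * h n" "min a (i * h n) = i * h n"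
          "min a (Suc i * h n) = Suc i * h n" "x i = a" "x (Suc i) = a"
          unfolding x_def by (auto simp: min_def max_def simp del: of_nat_Suc)
        then show ?thesis using diag[of a] ab M by simp
      next
        case 2
        with ih ab have "min a (i * h n) = a" "min a (Suc i * h n) = a" "x i = min b (i * h n)" "x (Suc i) = min b (Suc i * h n)"
          unfolding x_def by (auto simp: min_def max_def simp del: of_nat_Suc)
        then show ?thesis using diag[of a] ab M by simp
      next
        case 3
        with ih ab have eq: "min b (i * h n) = i * h n" "min a (i * h n) = i * h n" "min a (Suc i * h n) = a"
          "x i = a" "x (Suc i) = min b (Suc i * h n)"
          unfolding x_def by (auto simp: min_def max_def simp del: of_nat_Suc)
        have "real i \<le> a / h n" "a / h n < real i + 1" using 3 h0[of n] by (auto simp: field_simps)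
        then have "\<lfloor>a / h n\<rfloor> = int i" by (intro floor_unique) auto
        then have "i = k" unfolding k_def by simp
        have "norm (\<xi> (i * h n) (min b (Suc i * h n)) - \<xi> (i * h n) a - \<xi> a (min b (Suc i * h n)))
          \<le> M * (min b (Suc i * h n) - i * h n) powr \<theta>"
          by (rule germ) (use 3 ih ab in auto)
        also have "\<dots> \<le> M * h n powr \<theta>"
          using M \<theta> 3 ih ab sh by (intro mult_left_mono powr_mono2) auto
        finally show ?thesis unfolding eq using \<open>i = k\<close> by simp
      qed
    qed
    also have "\<dots> \<le> M * h n powr \<theta>" using M by simp
    finally have 1: "norm (S n b - S n a - (\<Sum>i<N n. \<xi> (x i) (x (Suc i)))) \<le> M * h n powr \<theta>"
      unfolding S_def by (simp add: sum_subtractf)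
    have 2: "norm ((\<Sum>i<N n. \<xi> (x i) (x (Suc i))) - \<xi> a b) \<le> ?C * M * (b - a) powr \<theta>"
      using partition_germ_bound[OF \<theta> M diag germ mx, of L "N n"] x0 ab by auto
    have "S n b - S n a - \<xi> a b = (S n b - S n a - (\<Sum>i<N n. \<xi> (x i) (x (Suc i)))) + ((\<Sum>i<N n. \<xi> (x i) (x (Suc i))) - \<xi> a b)"
      by simp
    then show ?thesis using norm_triangle_mono[OF 1 2] by (simp add: add.commute)
  qed
  \<comment> \<open>The error of \<open>Dab\<close> summed over all cells: their number is at most
    \<open>(L + h n) / h n\<close>, and each contributes a term of order
    \<open>h n powr \<theta>\<close>.\<close>
  define e where "e n = (2 * L + 2) * (2 * ?C * M + 2 * M) * h n powr (\<theta> - 1)" for n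
  have hmono: "h m \<le> h n" if "n \<le> m" for n m using that by (simp add: h_def field_simps)
  have cauchy: "norm (S n y - S m y) \<le> e n" if nm: "n \<le> m" and y: "0 \<le> y" "y \<le> L" for n m y
  proof -
    define D where "D y = S n y - S m y" for y
    have Dab: "norm (D b - D a) \<le> 2 * (?C * M * (b - a) powr \<theta>) + 2 * (M * h n powr \<theta>)"
      if ab: "0 \<le> a" "a \<le> b" "b \<le> L" for a b
    proof -
      have "D b - D a = (S n b - S n a - \<xi> a b) - (S m b - S m a - \<xi> a b)" by (simp add: D_def)
      then have "norm (D b - D a) \<le> norm (S n b - S n a - \<xi> a b) + norm (S m b - S m a - \<xi> a b)"
        by (metis norm_triangle_ineq4)
      moreover have "M * h m powr \<theta> \<le> M * h n powr \<theta>"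
        using M \<theta> hmono[OF nm] h0[of m] by (intro mult_left_mono powr_mono2) auto
      ultimately show ?thesis using Sb[OF ab, of n] Sb[OF ab, of m] by linarith
    qed
    define x where "x i = min y (real i * h n)" for i
    have x0: "x 0 = 0" "x (N n) = y" using y Nh[of n] by (auto simp: x_def)
    have "D y = (\<Sum>i<N n. D (x (Suc i)) - D (x i))"
      using sum_lessThan_telescope[of "\<lambda>i. D (x i)" "N n"] x0 by (simp add: D_def S0)
    also have "norm \<dots> \<le> (\<Sum>i<N n. 2 * (?C * M * h n powr \<theta>) + 2 * (M * h n powr \<theta>))"
    proof (rule sum_norm_le)
      fix i
      have ih: "real i * h n \<le> real (Suc i) * h n" "0 \<le> real i * h n" using h0[of n] by (auto intro!: mult_right_mono)
      have sh: "real (Suc i) * h n = real i * h n + h n" by (simp add: algebra_simps)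
      have "norm (D (x (Suc i)) - D (x i)) \<le> 2 * (?C * M * (x (Suc i) - x i) powr \<theta>) + 2 * (M * h n powr \<theta>)"
        by (rule Dab) (use ih y in \<open>auto simp: x_def min_def\<close>)
      also have "\<dots> \<le> 2 * (?C * M * h n powr \<theta>) + 2 * (M * h n powr \<theta>)"
        using M \<theta> sew_const_pos[OF \<theta>] ih sh h0[of n] unfolding x_def
        by (intro add_right_mono mult_left_mono powr_mono2) auto
      finally show "norm (D (x (Suc i)) - D (x i)) \<le> 2 * (?C * M * h n powr \<theta>) + 2 * (M * h n powr \<theta>)" .
    qed
    also have "\<dots> = (real (N n) * h n) * (2 * ?C * M + 2 * M) * h n powr (\<theta> - 1)"
      using h0[of n] by (simp add: powr_diff field_simps)
    also have "\<dots> \<le> e n"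
    proof -
      have "real (N n) \<le> L * real (Suc n) + 1"
        unfolding N_def using L of_int_ceiling_le_add_one[of "L * real (Suc n)"] by (simp del: of_nat_Suc)
      then have "real (N n) * h n \<le> (L * real (Suc n) + 1) * h n" using h0[of n] by (intro mult_right_mono) auto
      also have "\<dots> = L + h n" by (simp add: h_def field_simps)
      also have "\<dots> \<le> 2 * L + 2" using L by (simp add: h_def field_simps)
      finally show ?thesis unfolding e_def using M sew_const_pos[OF \<theta>] by (intro mult_right_mono) auto
    qed
    finally show ?thesis by (simp add: D_def)
  qed
  have h_lim: "h \<longlonglongrightarrow> 0" unfolding h_def using LIMSEQ_inverse_real_of_nat by (simp add: inverse_eq_divide)
  have hp: "(\<lambda>n. h n powr s) \<longlonglongrightarrow> 0" if "s > 0" for s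
    using that h0 by (intro tendsto_zero_powrI[OF h_lim tendsto_const]) (auto simp: less_imp_le)
  have e_lim: "e \<longlonglongrightarrow> 0" unfolding e_def using hp[of "\<theta> - 1"] \<theta>
    by (auto intro!: tendsto_mult_right_zero)
  have conv: "convergent (\<lambda>n. S n y)" if y: "0 \<le> y" "y \<le> L" for y
  proof (rule Cauchy_convergent, rule CauchyI)
    fix r :: real assume "r > 0"
    then obtain n0 where n0: "\<And>n. n \<ge> n0 \<Longrightarrow> e n < r"
      using order_tendstoD(2)[OF e_lim] by (auto simp: eventually_sequentially)
    have "norm (S m y - S n y) < r" if "m \<ge> n0" "n \<ge> n0" for m n
      using cauchy[of m n y] cauchy[of n m y] n0[of m] n0[of n] that y
      by (cases "m \<le> n") (auto simp: norm_minus_commute not_le dest: less_imp_le)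
    then show "\<exists>M. \<forall>m\<ge>M. \<forall>n\<ge>M. norm (S m y - S n y) < r" by blast
  qed
  define Z where "Z y = lim (\<lambda>n. S n y)" for y
  have Zlim: "(\<lambda>n. S n y) \<longlonglongrightarrow> Z y" if "0 \<le> y" "y \<le> L" for y
    using conv[OF that] unfolding Z_def by (simp add: convergent_LIMSEQ_iff)
  show ?thesis
  proof (rule that)
    show "Z 0 = 0" unfolding Z_def by (simp add: S0)
    fix a b assume ab: "0 \<le> a" "a \<le> b" "b \<le> L"
    have "(\<lambda>n. norm (S n b - S n a - \<xi> a b)) \<longlonglongrightarrow> norm (Z b - Z a - \<xi> a b)"
      using ab by (intro tendsto_intros Zlim) auto
    moreover have "(\<lambda>n. ?C * M * (b - a) powr \<theta> + M * h n powr \<theta>) \<longlonglongrightarrow> ?C * M * (b - a) powr \<theta> + M * 0"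
      using \<theta> by (intro tendsto_intros hp) auto
    ultimately show "norm (Z b - Z a - \<xi> a b) \<le> ?C * M * (b - a) powr \<theta>"
      using Sb[OF ab] by (intro LIMSEQ_le) auto
  qed
qed

section \<open>The heat kernel on the circle\<close>

definition periodize :: "(real \<Rightarrow> real) \<Rightarrow> real \<Rightarrow> real" where
  "periodize F z = (\<Sum>\<^sub>\<infinity>k\<in>(UNIV::int set). F (z - 2 * pi * of_int k))"

text \<open>Since \<open>inverse 0 = 0\<close>, the value at 0 vanishes; the image
  \<open>k = 0\<close> is counted by a separate indicator in the bounds below.\<close>

definition inv_sq :: "int \<Rightarrow> real" where "inv_sq k = inverse ((of_int k)\<^sup>2)"

lemma inv_sq_nonneg: "inv_sq k \<ge> 0" by (simp add: inv_sq_def)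

lemma inv_sq_summable: "inv_sq summable_on UNIV"
proof -
  have s: "summable (\<lambda>n. inverse (real n ^ 2))" using inverse_power_summable[of 2, where 'a=real] by simp
  have n: "(\<lambda>n. inverse ((real n)\<^sup>2)) summable_on UNIV"
    by (rule norm_summable_imp_summable_on) (use s in simp)
  have A: "inv_sq summable_on {0..}"
  proof (subst summable_on_reindex_bij_betw[of int UNIV, symmetric])
    show "bij_betw int UNIV {0..}" by (rule bij_betwI[where g=nat]) auto
    show "(\<lambda>x. inv_sq (int x)) summable_on UNIV" using n by (simp add: inv_sq_def)
  qed
  have "summable (\<lambda>n. inverse (real (Suc n) ^ 2))" using s by (rule summable_Suc_iff[THEN iffD2])
  then have n1: "(\<lambda>n. inverse ((real (Suc n))\<^sup>2)) summable_on UNIV"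
    by (intro norm_summable_imp_summable_on) simp
  have B: "inv_sq summable_on {..<0}"
  proof (subst summable_on_reindex_bij_betw[of "\<lambda>n. - int (Suc n)" UNIV, symmetric])
    show "bij_betw (\<lambda>n. - int (Suc n)) UNIV {..<0}"
      by (rule bij_betwI[where g="\<lambda>k. nat (- k) - 1"]) auto
    have "(\<lambda>x. inv_sq (- int (Suc x))) = (\<lambda>n. inverse ((real (Suc n))\<^sup>2))"
      by (auto simp: inv_sq_def fun_eq_iff power2_eq_square algebra_simps)
    then show "(\<lambda>x. inv_sq (- int (Suc x))) summable_on UNIV" using n1 by simp
  qed
  have "inv_sq summable_on ({0..} \<union> {..<0})" by (rule summable_on_Un_disjoint[OF A B]) auto
  also have "{0..} \<union> {..<0} = (UNIV :: int set)" by auto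
  finally show ?thesis .
qed

text \<open>The exponent 3 leaves room for a summable factor
  and a remaining decay with exponent 2.\<close>

definition cubic_decay :: "real \<Rightarrow> real \<Rightarrow> (real \<Rightarrow> real) \<Rightarrow> bool" where
  "cubic_decay A r F \<longleftrightarrow> (\<forall>y. \<bar>F y\<bar> \<le> A * inverse (1 + y\<^sup>2 / r) ^ 3)"

lemma image_distance:
  fixes z R :: real
  assumes "\<bar>z\<bar> \<le> R" "R < \<bar>of_int k\<bar>"
  shows "(of_int k)\<^sup>2 \<le> (z - 2 * pi * of_int k)\<^sup>2"
proof -
  have pk: "6 * \<bar>real_of_int k\<bar> \<le> 2 * pi * \<bar>of_int k\<bar>" using pi_gt3 by (intro mult_right_mono) auto
  have "2 * pi * \<bar>of_int k\<bar> \<le> \<bar>z\<bar> + \<bar>z - 2 * pi * of_int k\<bar>"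
    using abs_triangle_ineq4[of z "z - 2 * pi * of_int k"] by (simp add: abs_mult)
  then have "\<bar>real_of_int k\<bar> \<le> \<bar>z - 2 * pi * of_int k\<bar>" using pk assms by linarith
  then show ?thesis by (simp add: abs_le_square_iff)
qed

text \<open>A summable majorant that is uniform for \<open>\<bar>z\<bar> \<le> R\<close>. If
  \<open>\<bar>k\<bar> > R\<close>, the image point has distance at least
  \<open>\<bar>k\<bar>\<close> from 0 and the decay gives \<open>r * inv_sq k\<close>; for the
  finitely many other nonzero \<open>k\<close> one has
  \<open>1 \<le> R^2 * inv_sq k\<close>.\<close>

lemma image_bound:
  assumes F: "cubic_decay A r F" and r: "r > 0" and A: "A \<ge> 0" and R: "R \<ge> 1" and z: "\<bar>z\<bar> \<le> R"
  shows "\<bar>F (z - 2 * pi * of_int k)\<bar> \<le> A * ((R\<^sup>2 + r) * inv_sq k + (if k = 0 then 1 else 0))"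
proof -
  let ?y = "z - 2 * pi * of_int k"
  let ?q = "inverse (1 + ?y\<^sup>2 / r)"
  have q: "0 < ?q" "?q \<le> 1" using r by (auto simp: inverse_le_1_iff add_pos_nonneg)
  have "?q ^ 3 \<le> ?q ^ 1" using q by (intro power_decreasing) auto
  then have q3: "?q ^ 3 \<le> ?q" by simp
  have "?q \<le> (R\<^sup>2 + r) * inv_sq k + (if k = 0 then 1 else 0)"
  proof (cases "k = 0")
    case True
    then show ?thesis using q by (simp add: inv_sq_def)
  next
    case False
    have k1: "1 \<le> (real_of_int k)\<^sup>2" "k \<noteq> 0" using False by (simp_all add: int_one_le_iff_zero_less flip: of_int_power)
    show ?thesis
    proof (cases "R < \<bar>of_int k\<bar>")
      case True
      have "(of_int k)\<^sup>2 / r \<le> 1 + ?y\<^sup>2 / r" using image_distance[OF z True] r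
        by (simp add: divide_right_mono add_increasing)
      then have "?q \<le> inverse ((of_int k)\<^sup>2 / r)" using r k1 by (intro le_imp_inverse_le) auto
      also have "\<dots> = r * inv_sq k" by (simp add: inv_sq_def divide_inverse)
      also have "\<dots> \<le> (R\<^sup>2 + r) * inv_sq k" by (intro mult_right_mono) (auto simp: inv_sq_nonneg)
      finally show ?thesis using False by simp
    next
      case F': False
      then have "(real_of_int k)\<^sup>2 \<le> R\<^sup>2" using R by (simp add: abs_le_square_iff[symmetric])
      then have "1 \<le> R\<^sup>2 * inv_sq k" using k1 by (simp add: inv_sq_def field_simps)
      also have "\<dots> \<le> (R\<^sup>2 + r) * inv_sq k" using r by (intro mult_right_mono) (auto simp: inv_sq_nonneg)
      finally show ?thesis using q False by simp
    qed
  qed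
  then have "A * ?q ^ 3 \<le> A * ((R\<^sup>2 + r) * inv_sq k + (if k = 0 then 1 else 0))"
    using q3 A by (intro mult_left_mono) auto
  then show ?thesis using F unfolding cubic_decay_def by (meson order_trans)
qed

lemma image_bound_summable:
  "(\<lambda>k::int. A * (B * inv_sq k + (if k = 0 then 1 else 0))) summable_on UNIV"
proof -
  have "(\<lambda>k::int. if k = 0 then 1 else (0::real)) summable_on UNIV"
    using summable_on_cong_neutral[of "{0::int}" UNIV "\<lambda>k. if k = 0 then 1 else (0::real)" "\<lambda>k. if k = 0 then 1 else (0::real)"] by simp
  then show ?thesis by (intro summable_on_cmult_right summable_on_add inv_sq_summable)
qed

lemma periodize_abs_summable:
  assumes F: "cubic_decay A r F" and r: "r > 0" and A: "A \<ge> 0"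
  shows "(\<lambda>k. norm (F (z - 2 * pi * of_int k))) summable_on UNIV"
proof (rule Infinite_Sum.abs_summable_on_comparison_test')
  show "(\<lambda>k::int. A * (((\<bar>z\<bar> + 1)\<^sup>2 + r) * inv_sq k + (if k = 0 then 1 else 0))) summable_on UNIV"
    by (rule image_bound_summable)
  show "norm (F (z - 2 * pi * of_int k)) \<le> A * (((\<bar>z\<bar> + 1)\<^sup>2 + r) * inv_sq k + (if k = 0 then 1 else 0))" for k
    using image_bound[OF F r A, of "\<bar>z\<bar> + 1" z k] by simp
qed

text \<open>Absolute convergence permits an enumeration of the integers. Written as a series over
  the natural numbers, the sum is open to the M-test and to termwise differentiation.\<close>

lemma periodize_eq_suminf:
  assumes F: "cubic_decay A r F" and r: "r > 0" and A: "A \<ge> 0"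
  shows "periodize F z = (\<Sum>n. F (z - 2 * pi * of_int (int_decode n)))"
proof -
  have s: "(\<lambda>k. F (z - 2 * pi * of_int k)) summable_on UNIV"
    by (rule abs_summable_summable[OF periodize_abs_summable[OF assms]])
  have "(\<lambda>n. F (z - 2 * pi * of_int (int_decode n))) summable_on UNIV"
    using s by (subst summable_on_reindex_bij_betw[OF bij_int_decode])
  then have "((\<lambda>n. F (z - 2 * pi * of_int (int_decode n))) has_sum periodize F z) UNIV"
    unfolding periodize_def by (subst infsum_reindex_bij_betw[OF bij_int_decode, symmetric]) (rule has_sum_infsum)
  from has_sum_imp_sums[OF this] show ?thesis by (simp add: sums_iff)
qed

lemma periodize_uniform:
  assumes F: "cubic_decay A r F" and r: "r > 0" and A: "A \<ge> 0" and R: "R \<ge> 1"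
  shows "uniform_limit {-R..R} (\<lambda>n z. \<Sum>i<n. F (z - 2 * pi * of_int (int_decode i))) (periodize F) sequentially"
proof -
  have "uniform_limit {-R..R} (\<lambda>n z. \<Sum>i<n. F (z - 2 * pi * of_int (int_decode i)))
    (\<lambda>z. \<Sum>n. F (z - 2 * pi * of_int (int_decode n))) sequentially"
  proof (rule Weierstrass_m_test)
    show "norm (F (z - 2 * pi * of_int (int_decode n))) \<le>
       A * ((R\<^sup>2 + r) * inv_sq (int_decode n) + (if int_decode n = 0 then 1 else 0))" if "z \<in> {-R..R}" for n z
      using image_bound[OF F r A R, of z "int_decode n"] that by (auto simp: abs_le_iff)
    have "(\<lambda>n. A * ((R\<^sup>2 + r) * inv_sq (int_decode n) + (if int_decode n = 0 then 1 else 0))) summable_on UNIV"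
      using image_bound_summable[of A "R\<^sup>2 + r"] by (subst summable_on_reindex_bij_betw[OF bij_int_decode])
    then show "summable (\<lambda>n. A * ((R\<^sup>2 + r) * inv_sq (int_decode n) + (if int_decode n = 0 then 1 else 0)))"
      by (rule summable_on_imp_summable)
  qed
  moreover have "(\<lambda>z. \<Sum>n. F (z - 2 * pi * of_int (int_decode n))) = periodize F"
    by (rule ext) (rule periodize_eq_suminf[OF F r A, symmetric])
  ultimately show ?thesis by simp
qed

lemma periodize_continuous:
  assumes F: "cubic_decay A r F" and r: "r > 0" and A: "A \<ge> 0" and c: "continuous_on UNIV F"
  shows "continuous_on UNIV (periodize F)"
proof (rule continuous_at_imp_continuous_on, rule ballI)
  fix z :: real
  define R where "R = \<bar>z\<bar> + 1"
  have "continuous_on {-R..R} (periodize F)"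
    by (rule uniform_limit_theorem[OF _ periodize_uniform[OF F r A]])
       (auto intro!: always_eventually continuous_intros continuous_on_compose2[OF c] simp: R_def)
  then show "isCont (periodize F) z"
    by (rule continuous_on_interior) (auto simp: R_def)
qed

lemma periodize_deriv:
  assumes F: "cubic_decay A r F" and F': "cubic_decay A' r F'" and r: "r > 0" and A: "A \<ge> 0" "A' \<ge> 0"
    and d: "\<And>y. (F has_real_derivative F' y) (at y)"
  shows "(periodize F has_real_derivative periodize F' z) (at z)"
proof -
  define R where "R = \<bar>z\<bar> + 1"
  have "((\<lambda>x. \<Sum>n. F (x - 2 * pi * of_int (int_decode n))) has_field_derivative
      (\<Sum>n. F' (z - 2 * pi * of_int (int_decode n)))) (at z)"
  proof (rule has_field_derivative_series'(2)[of "{-R..R}"])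
    show "((\<lambda>x. F (x - 2 * pi * of_int (int_decode n))) has_field_derivative F' (x - 2 * pi * of_int (int_decode n)))
       (at x within {-R..R})" for n x
      using DERIV_chain2[OF d, of "\<lambda>x. x - 2 * pi * of_int (int_decode n)" 1 x]
        DERIV_diff[OF DERIV_ident DERIV_const[of "2 * pi * of_int (int_decode n)"], of x UNIV]
      by (simp add: has_field_derivative_at_within)
    show "uniformly_convergent_on {-R..R} (\<lambda>n x. \<Sum>i<n. F' (x - 2 * pi * of_int (int_decode i)))"
      using periodize_uniform[OF F' r A(2), of R] unfolding uniformly_convergent_on_def R_def by auto
    show "z \<in> {-R..R}" "z \<in> interior {-R..R}" by (auto simp: R_def)
    have "(\<lambda>n. F (z - 2 * pi * of_int (int_decode n))) summable_on UNIV"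
      using abs_summable_summable[OF periodize_abs_summable[OF F r A(1)]]
      by (subst summable_on_reindex_bij_betw[OF bij_int_decode])
    then show "summable (\<lambda>n. F (z - 2 * pi * of_int (int_decode n)))" by (rule summable_on_imp_summable)
  qed simp
  moreover have "(\<lambda>z. \<Sum>n. F (z - 2 * pi * of_int (int_decode n))) = periodize F"
    by (rule ext) (rule periodize_eq_suminf[OF F r A(1), symmetric])
  ultimately show ?thesis by (simp add: periodize_eq_suminf[OF F' r A(2)])
qed

lemma periodize_shift: "periodize F (z + 2 * pi * of_int j) = periodize F z"
proof -
  have "bij_betw (\<lambda>k. k + j) UNIV (UNIV::int set)"
    by (rule bij_betwI[where g="\<lambda>k. k - j"]) auto
  from infsum_reindex_bij_betw[OF this, of "\<lambda>k. F (z + 2 * pi * of_int j - 2 * pi * of_int k)"]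
  show ?thesis unfolding periodize_def by (simp add: algebra_simps)
qed

text \<open>For \<open>\<bar>z\<bar> \<le> pi\<close> and nonzero \<open>k\<close> the distance of
  the image from 0 is at least \<open>pi * \<bar>k\<bar>\<close>, hence at least both
  \<open>\<bar>z\<bar>\<close> and \<open>\<bar>k\<bar>\<close>. Two of the three factors of decay
  are compared with the image \<open>k = 0\<close>, the third one gives \<open>r * inv_sq k\<close>
  and makes the sum converge.\<close>

lemma periodize_bound_near:
  assumes F: "cubic_decay A r F" and r: "0 < r" "r \<le> T" and A: "A \<ge> 0" and z: "\<bar>z\<bar> \<le> pi"
  shows "\<bar>periodize F z\<bar> \<le> A * (1 + T * (\<Sum>\<^sub>\<infinity>k. inv_sq k)) * inverse (1 + z\<^sup>2 / r) ^ 2"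
proof -
  let ?e = "inverse (1 + z\<^sup>2 / r)"
  have e: "0 < ?e" "?e \<le> 1" using r by (auto simp: inverse_le_1_iff add_pos_nonneg)
  have trm: "\<bar>F (z - 2 * pi * of_int k)\<bar> \<le> (A * ?e ^ 2) * (T * inv_sq k + (if k = 0 then 1 else 0))" for k
  proof -
    let ?y = "z - 2 * pi * of_int k"
    let ?q = "inverse (1 + ?y\<^sup>2 / r)"
    have q: "0 < ?q" using r by (auto simp: add_pos_nonneg)
    have "?q ^ 3 \<le> ?e ^ 2 * (T * inv_sq k + (if k = 0 then 1 else 0))"
    proof (cases "k = 0")
      case True
      then show ?thesis using e by (simp add: inv_sq_def power_decreasing)
    next
      case False
      then have k1: "1 \<le> \<bar>real_of_int k\<bar>" by linarith
      have "2 * pi * \<bar>of_int k\<bar> \<le> \<bar>z\<bar> + \<bar>?y\<bar>"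
        using abs_triangle_ineq4[of z ?y] by (simp add: abs_mult)
      moreover have "pi * 1 \<le> pi * \<bar>of_int k\<bar>" using k1 by (intro mult_left_mono) auto
      ultimately have y: "pi * \<bar>of_int k\<bar> \<le> \<bar>?y\<bar>" using z by linarith
      have zy: "z\<^sup>2 \<le> ?y\<^sup>2" using z y \<open>pi * 1 \<le> pi * \<bar>of_int k\<bar>\<close> by (intro abs_le_square_iff[THEN iffD1]) linarith
      have "1 * \<bar>real_of_int k\<bar> \<le> pi * \<bar>of_int k\<bar>" using pi_gt3 by (intro mult_right_mono) auto
      then have ky: "(real_of_int k)\<^sup>2 \<le> ?y\<^sup>2" using y by (intro abs_le_square_iff[THEN iffD1]) linarith
      have qe: "?q \<le> ?e" using zy r by (intro le_imp_inverse_le) (auto simp: divide_right_mono add_pos_nonneg)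
      have "(of_int k)\<^sup>2 / r \<le> 1 + ?y\<^sup>2 / r" using ky r by (simp add: divide_right_mono add_increasing)
      then have "?q \<le> inverse ((of_int k)\<^sup>2 / r)" using r False by (intro le_imp_inverse_le) auto
      also have "\<dots> = r * inv_sq k" by (simp add: inv_sq_def divide_inverse)
      also have "\<dots> \<le> T * inv_sq k" using r by (intro mult_right_mono) (auto simp: inv_sq_nonneg)
      finally have qT: "?q \<le> T * inv_sq k" .
      have "?q ^ 2 * ?q \<le> ?e ^ 2 * (T * inv_sq k)"
        using q qe qT e by (intro mult_mono power_mono) auto
      then show ?thesis using False by (simp add: power3_eq_cube power2_eq_square)
    qed
    then have "A * ?q ^ 3 \<le> A * (?e ^ 2 * (T * inv_sq k + (if k = 0 then 1 else 0)))"
      using A by (intro mult_left_mono) auto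
    then show ?thesis using F unfolding cubic_decay_def by (metis (no_types, lifting) mult.assoc order_trans)
  qed
  have "\<bar>periodize F z\<bar> \<le> (\<Sum>\<^sub>\<infinity>k. \<bar>F (z - 2 * pi * of_int k)\<bar>)"
    unfolding periodize_def using norm_infsum_bound[OF periodize_abs_summable[OF F r(1) A]] by simp
  also have "\<dots> \<le> (\<Sum>\<^sub>\<infinity>k. (A * ?e ^ 2) * (T * inv_sq k + (if k = 0 then 1 else 0)))"
    using periodize_abs_summable[OF F r(1) A, of z] image_bound_summable trm by (intro infsum_mono) auto
  also have "\<dots> = (A * ?e ^ 2) * (T * (\<Sum>\<^sub>\<infinity>k. inv_sq k) + 1)"
  proof -
    have h: "((\<lambda>k::int. if k = 0 then 1 else (0::real)) has_sum 1) UNIV"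
      using has_sum_finite_neutralI[of "{0::int}" UNIV "\<lambda>k. if k = 0 then 1 else (0::real)"] by simp
    have "((\<lambda>k. (A * ?e ^ 2) * (T * inv_sq k + (if k = 0 then 1 else 0))) has_sum
       (A * ?e ^ 2) * (T * (\<Sum>\<^sub>\<infinity>k. inv_sq k) + 1)) UNIV"
      by (intro has_sum_cmult_right has_sum_add h has_sum_infsum inv_sq_summable)
    then show ?thesis by (rule infsumI)
  qed
  finally show ?thesis by (simp add: mult_ac add.commute)
qed

section \<open>Gaussian bounds for the periodic heat kernel and its space derivatives\<close>

definition heat_kernel1 :: "real \<Rightarrow> real \<Rightarrow> real" where
  "heat_kernel1 t = periodize (\<lambda>x. - x / (2 * t) * line_kernel t x)"

text \<open>The function periodized here is the second space derivative of
  \<open>line_kernel t\<close>, the one in \<open>heat_kernel1\<close> the first.\<close>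

definition heat_kernel2 :: "real \<Rightarrow> real \<Rightarrow> real" where
  "heat_kernel2 t = periodize (\<lambda>x. (x\<^sup>2 / (4 * t\<^sup>2) - 1 / (2 * t)) * line_kernel t x)"

lemma heat_kernel_periodize: "heat_kernel t = periodize (line_kernel t)"
  by (simp add: heat_kernel_def periodize_def fun_eq_iff)

definition gauss_const :: real where "gauss_const = 20 ^ 4 * exp (1 / 4)"

lemma gauss_const_pos: "gauss_const > 0" by (simp add: gauss_const_def)

text \<open>Decay of order four leaves one factor \<open>1 + x^2 / t\<close> for the prefactors of
  the derivatives and three for \<open>cubic_decay\<close>. It comes from the fourth power of
  \<open>(1 + y) / 16 \<le> exp ((1 + y) / 16)\<close>, whose right-hand side becomes
  \<open>exp (1 / 4) * exp (y / 4)\<close>. This explains \<open>gauss_const\<close>, in which 16 is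
  rounded up to 20.\<close>

lemma line_kernel_decay4:
  assumes t: "t > 0"
  shows "\<bar>line_kernel t x\<bar> \<le> gauss_const * t powr - (1 / 2) * inverse (1 + x\<^sup>2 / t) ^ 4"
proof -
  define y where "y = x\<^sup>2 / t"
  have y: "y \<ge> 0" using t by (simp add: y_def)
  have "(1 + y) / 16 \<le> exp ((1 + y) / 16)" using exp_ge_add_one_self[of "(1 + y) / 16"] by linarith
  then have "((1 + y) / 16) ^ 4 \<le> exp ((1 + y) / 16) ^ 4" using y by (intro power_mono) auto
  also have "\<dots> = exp (1 / 4) * exp (y / 4)"
    by (simp add: exp_of_nat_mult[symmetric] exp_add[symmetric] field_simps)
  finally have "(1 + y) ^ 4 \<le> 16 ^ 4 * exp (1 / 4) * exp (y / 4)" by (simp add: power_divide field_simps)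
  also have "\<dots> \<le> gauss_const * exp (y / 4)" unfolding gauss_const_def by (intro mult_right_mono) auto
  finally have "exp (- (y / 4)) \<le> gauss_const * inverse (1 + y) ^ 4"
    using y by (simp add: exp_minus field_simps)
  moreover have "- (x\<^sup>2) / (4 * t) = - (y / 4)" by (simp add: y_def)
  ultimately have e: "exp (- (x\<^sup>2) / (4 * t)) \<le> gauss_const * inverse (1 + y) ^ 4" by (simp only:)
  have "sqrt t \<le> sqrt (4 * pi * t)" using t pi_gt3 by (intro real_sqrt_le_mono) (auto simp: field_simps)
  then have s: "inverse (sqrt (4 * pi * t)) \<le> t powr - (1 / 2)"
    using t by (simp add: powr_minus powr_half_sqrt le_imp_inverse_le)
  have "\<bar>line_kernel t x\<bar> = exp (- t) * exp (- (x\<^sup>2) / (4 * t)) * inverse (sqrt (4 * pi * t))"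
    unfolding line_kernel_def using t by (simp only: divide_inverse abs_mult abs_exp_cancel abs_inverse real_sqrt_abs2 abs_of_nonneg[OF real_sqrt_ge_zero] ) simp
  also have "\<dots> \<le> 1 * (gauss_const * inverse (1 + y) ^ 4) * t powr - (1 / 2)"
    using e s t gauss_const_pos y by (intro mult_mono) (simp_all add: less_imp_le)
  finally show ?thesis unfolding y_def by (simp only: mult_ac mult_1)
qed

lemma inverse_pow_le: "x \<ge> 0 \<Longrightarrow> m \<le> n \<Longrightarrow> inverse (1 + x :: real) ^ n \<le> inverse (1 + x) ^ m"
  by (intro power_decreasing) (auto simp: inverse_le_1_iff)

lemma inverse_pow_Suc: "x \<ge> 0 \<Longrightarrow> (1 + x) * inverse (1 + x :: real) ^ Suc n = inverse (1 + x) ^ n"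
  by simp

lemma line_kernel_decay:
  assumes t: "t > 0"
  shows "cubic_decay (gauss_const * t powr - (1 / 2)) t (line_kernel t)"
    "cubic_decay (gauss_const * t powr - 1) t (\<lambda>x. - x / (2 * t) * line_kernel t x)"
    "cubic_decay (gauss_const * t powr - (3 / 2)) t (\<lambda>x. (x\<^sup>2 / (4 * t\<^sup>2) - 1 / (2 * t)) * line_kernel t x)"
proof -
  have y: "x\<^sup>2 / t \<ge> 0" for x using t by simp
  show "cubic_decay (gauss_const * t powr - (1 / 2)) t (line_kernel t)"
    unfolding cubic_decay_def
  proof
    fix x
    have "gauss_const * t powr - (1 / 2) * inverse (1 + x\<^sup>2 / t) ^ 4 \<le> gauss_const * t powr - (1 / 2) * inverse (1 + x\<^sup>2 / t) ^ 3"
      using gauss_const_pos y by (intro mult_left_mono inverse_pow_le) auto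
    then show "\<bar>line_kernel t x\<bar> \<le> gauss_const * t powr - (1 / 2) * inverse (1 + x\<^sup>2 / t) ^ 3"
      using line_kernel_decay4[OF t, of x] by linarith
  qed
  \<comment> \<open>A prefactor of size \<open>t powr (1 / 2 - c) * (1 + x^2 / t)\<close> uses up
    one of the four powers of decay and changes the weight \<open>t powr - (1 / 2)\<close> into
    \<open>t powr - c\<close>.\<close>
  have gen: "cubic_decay (gauss_const * t powr - c) t (\<lambda>x. m x * line_kernel t x)"
    if m: "\<And>x. \<bar>m x\<bar> \<le> t powr (1 / 2 - c) * (1 + x\<^sup>2 / t)" for m c
    unfolding cubic_decay_def
  proof
    fix x
    have "\<bar>m x * line_kernel t x\<bar> \<le> (t powr (1 / 2 - c) * (1 + x\<^sup>2 / t)) * (gauss_const * t powr - (1 / 2) * inverse (1 + x\<^sup>2 / t) ^ Suc 3)"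
      unfolding abs_mult using m[of x] line_kernel_decay4[OF t, of x] by (intro mult_mono) auto
    also have "\<dots> = gauss_const * (t powr (1 / 2 - c) * t powr - (1 / 2)) * ((1 + x\<^sup>2 / t) * inverse (1 + x\<^sup>2 / t) ^ Suc 3)"
      by (simp only: mult_ac)
    also have "\<dots> = gauss_const * t powr - c * inverse (1 + x\<^sup>2 / t) ^ 3"
      unfolding inverse_pow_Suc[OF y] by (simp add: powr_add[symmetric])
    finally show "\<bar>m x * line_kernel t x\<bar> \<le> gauss_const * t powr - c * inverse (1 + x\<^sup>2 / t) ^ 3" .
  qed
  show "cubic_decay (gauss_const * t powr - 1) t (\<lambda>x. - x / (2 * t) * line_kernel t x)"
  proof (rule gen)
    fix x
    have st: "sqrt t > 0" "sqrt t * sqrt t = t" using t by auto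
    have "\<bar>x\<bar> / sqrt t \<le> 1 + (\<bar>x\<bar> / sqrt t)\<^sup>2"
      using sum_squares_bound[of 1 "\<bar>x\<bar> / sqrt t"] zero_le_power2[of "\<bar>x\<bar> / sqrt t"] by (simp, linarith)
    then have "\<bar>x\<bar> / sqrt t \<le> 1 + x\<^sup>2 / t" using t by (simp add: power_divide)
    then have "1 / sqrt t * (\<bar>x\<bar> / sqrt t) \<le> 1 / sqrt t * (1 + x\<^sup>2 / t)" using t by (intro mult_left_mono) auto
    moreover have "\<bar>- x / (2 * t)\<bar> \<le> 1 / sqrt t * (\<bar>x\<bar> / sqrt t)" using t st by (simp add: abs_mult field_simps)
    moreover have "t powr (1 / 2 - 1) = 1 / sqrt t" using t by (simp add: powr_minus powr_half_sqrt inverse_eq_divide)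
    ultimately show "\<bar>- x / (2 * t)\<bar> \<le> t powr (1 / 2 - 1) * (1 + x\<^sup>2 / t)" by simp
  qed
  show "cubic_decay (gauss_const * t powr - (3 / 2)) t (\<lambda>x. (x\<^sup>2 / (4 * t\<^sup>2) - 1 / (2 * t)) * line_kernel t x)"
  proof (rule gen)
    fix x
    have "\<bar>x\<^sup>2 / (4 * t\<^sup>2) - 1 / (2 * t)\<bar> \<le> x\<^sup>2 / (4 * t\<^sup>2) + 1 / (2 * t)"
      using t by (intro order_trans[OF abs_triangle_ineq4]) simp
    also have "\<dots> \<le> 1 / t * (1 + x\<^sup>2 / t)" using t by (simp add: field_simps power2_eq_square)
    also have "1 / t = t powr (1 / 2 - 3 / 2)" using t by (simp add: powr_minus inverse_eq_divide)
    finally show "\<bar>x\<^sup>2 / (4 * t\<^sup>2) - 1 / (2 * t)\<bar> \<le> t powr (1 / 2 - 3 / 2) * (1 + x\<^sup>2 / t)" .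
  qed
qed

lemma line_kernel_deriv:
  assumes "t > 0"
  shows "(line_kernel t has_real_derivative - x / (2 * t) * line_kernel t x) (at x)"
  unfolding line_kernel_def using assms by (auto intro!: derivative_eq_intros simp: field_simps)

lemma line_kernel_deriv2:
  assumes "t > 0"
  shows "((\<lambda>x. - x / (2 * t) * line_kernel t x) has_real_derivative (x\<^sup>2 / (4 * t\<^sup>2) - 1 / (2 * t)) * line_kernel t x) (at x)"
  using assms by (rule_tac DERIV_cong[OF DERIV_mult[OF _ line_kernel_deriv]])
       (auto intro!: derivative_eq_intros simp: field_simps power2_eq_square)

lemma line_kernel2_continuous:
  assumes "t > 0"
  shows "continuous_on UNIV (\<lambda>x. (x\<^sup>2 / (4 * t\<^sup>2) - 1 / (2 * t)) * line_kernel t x)"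
  using assms unfolding line_kernel_def by (intro continuous_intros) auto

lemma heat_kernel_deriv:
  assumes t: "t > 0"
  shows "(heat_kernel t has_real_derivative heat_kernel1 t z) (at z)"
    "(heat_kernel1 t has_real_derivative heat_kernel2 t z) (at z)"
    "continuous_on UNIV (heat_kernel2 t)"
proof -
  have g: "0 \<le> gauss_const * t powr c" for c using gauss_const_pos by simp
  show "(heat_kernel t has_real_derivative heat_kernel1 t z) (at z)"
    unfolding heat_kernel_periodize heat_kernel1_def
    by (rule periodize_deriv[OF line_kernel_decay(1)[OF t] line_kernel_decay(2)[OF t] t g g line_kernel_deriv[OF t]])
  show "(heat_kernel1 t has_real_derivative heat_kernel2 t z) (at z)"
    unfolding heat_kernel1_def heat_kernel2_def
    by (rule periodize_deriv[OF line_kernel_decay(2)[OF t] line_kernel_decay(3)[OF t] t g g line_kernel_deriv2[OF t]])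
  show "continuous_on UNIV (heat_kernel2 t)"
    unfolding heat_kernel2_def
    by (rule periodize_continuous[OF line_kernel_decay(3)[OF t] t g line_kernel2_continuous[OF t]])
qed

definition kernel_const :: "real \<Rightarrow> real" where
  "kernel_const T = gauss_const * (1 + T * (\<Sum>\<^sub>\<infinity>k. inv_sq k))"

lemma kernel_const_pos: "T \<ge> 0 \<Longrightarrow> kernel_const T > 0"
  unfolding kernel_const_def using gauss_const_pos
  by (intro mult_pos_pos add_pos_nonneg mult_nonneg_nonneg infsum_nonneg) (auto simp: inv_sq_nonneg)

lemma heat_kernel_bounds:
  assumes r: "0 < r" "r \<le> T" and z: "\<bar>z\<bar> \<le> pi"
  shows "\<bar>heat_kernel r z\<bar> \<le> kernel_const T * r powr - (1 / 2) * inverse (1 + z\<^sup>2 / r) ^ 2"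
    "\<bar>heat_kernel1 r z\<bar> \<le> kernel_const T * r powr - 1 * inverse (1 + z\<^sup>2 / r) ^ 2"
    "\<bar>heat_kernel2 r z\<bar> \<le> kernel_const T * r powr - (3 / 2) * inverse (1 + z\<^sup>2 / r) ^ 2"
proof -
  have g: "0 \<le> gauss_const * r powr c" for c using gauss_const_pos by simp
  show "\<bar>heat_kernel r z\<bar> \<le> kernel_const T * r powr - (1 / 2) * inverse (1 + z\<^sup>2 / r) ^ 2"
    using periodize_bound_near[OF line_kernel_decay(1)[OF r(1)] r g z]
    by (simp add: heat_kernel_periodize kernel_const_def mult_ac)
  show "\<bar>heat_kernel1 r z\<bar> \<le> kernel_const T * r powr - 1 * inverse (1 + z\<^sup>2 / r) ^ 2"
    using periodize_bound_near[OF line_kernel_decay(2)[OF r(1)] r g z]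
    by (simp add: heat_kernel1_def kernel_const_def mult_ac)
  show "\<bar>heat_kernel2 r z\<bar> \<le> kernel_const T * r powr - (3 / 2) * inverse (1 + z\<^sup>2 / r) ^ 2"
    using periodize_bound_near[OF line_kernel_decay(3)[OF r(1)] r g z]
    by (simp add: heat_kernel2_def kernel_const_def mult_ac)
qed

section \<open>Convolution with Hoelder paths\<close>

text \<open>The indices \<open>-1, 0, 1\<close> are those of the images that can be closest to a point of \<open>{-2 * pi..2 * pi}\<close>.\<close>

lemma wrapped_integral_bound:
  fixes f :: "real \<Rightarrow> 'a::euclidean_space"
  assumes r: "r > 0" and c: "c \<ge> 0" and f: "f integrable_on {0..2*pi}"
    and b: "\<And>y. y \<in> {0..2*pi} \<Longrightarrow> \<exists>j\<in>{-1, 0, 1::int}. norm (f y) \<le> c * inverse (1 + (x - y - 2 * pi * of_int j)\<^sup>2 / r)"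
  shows "norm (integral {0..2*pi} f) \<le> 3 * pi * c * sqrt r"
proof -
  define q where "q j y = inverse (1 + (x - y - 2 * pi * of_int j)\<^sup>2 / r)" for j :: int and y
  \<comment> \<open>A primitive of \<open>q j\<close>. The range of the arctangent has length
    \<open>pi\<close>, so each of the three images contributes at most \<open>pi * sqrt r\<close>,
    wherever \<open>x\<close> lies.\<close>
  define Q where "Q j y = - (sqrt r * arctan ((x - y - 2 * pi * of_int j) / sqrt r))" for j :: int and y
  have q0: "q j y \<ge> 0" for j y using r by (simp add: q_def add_nonneg_nonneg)
  have dQ: "(Q j has_real_derivative q j y) (at y)" for j y
  proof -
    have "sqrt r * (inverse (1 + ((x - y - 2 * pi * of_int j) / sqrt r)\<^sup>2) * (1 / sqrt r)) = q j y"
      using r by (simp add: q_def power_divide)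
    moreover have "(Q j has_real_derivative sqrt r * (inverse (1 + ((x - y - 2 * pi * of_int j) / sqrt r)\<^sup>2) * (1 / sqrt r))) (at y)"
      unfolding Q_def using r by (auto intro!: derivative_eq_intros simp: mult.assoc)
    ultimately show ?thesis by simp
  qed
  have hq: "(q j has_integral (Q j (2 * pi) - Q j 0)) {0..2*pi}" for j
    by (rule fundamental_theorem_of_calculus)
       (auto simp flip: has_real_derivative_iff_has_vector_derivative intro: has_field_derivative_at_within dQ)
  have Qb: "Q j (2 * pi) - Q j 0 \<le> pi * sqrt r" for j
  proof -
    have "arctan a - arctan b \<le> pi" for a b using arctan_ubound[of a] arctan_lbound[of b] by linarith
    then have "sqrt r * (arctan ((x - 0 - 2 * pi * of_int j) / sqrt r) - arctan ((x - 2 * pi - 2 * pi * of_int j) / sqrt r)) \<le> sqrt r * pi"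
      using r by (intro mult_left_mono) auto
    then show ?thesis by (simp add: Q_def algebra_simps)
  qed
  have h: "((\<lambda>y. c * (q (-1) y + q 0 y + q 1 y)) has_integral
     c * ((Q (-1) (2 * pi) - Q (-1) 0) + (Q 0 (2 * pi) - Q 0 0) + (Q 1 (2 * pi) - Q 1 0))) {0..2*pi}"
    by (intro has_integral_mult_right has_integral_add hq)
  have "norm (integral {0..2*pi} f) \<le> integral {0..2*pi} (\<lambda>y. c * (q (-1) y + q 0 y + q 1 y))"
  proof (rule integral_norm_bound_integral[OF f])
    show "(\<lambda>y. c * (q (-1) y + q 0 y + q 1 y)) integrable_on {0..2*pi}" using h by blast
    fix y assume "y \<in> {0..2*pi}"
    from b[OF this] obtain j :: int where j: "j \<in> {-1, 0, 1}" "norm (f y) \<le> c * q j y" unfolding q_def by blast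
    have "q j y \<le> q (-1) y + q 0 y + q 1 y" using j(1) q0[of "-1" y] q0[of 0 y] q0[of 1 y] by auto
    then have "c * q j y \<le> c * (q (-1) y + q 0 y + q 1 y)" using c by (rule mult_left_mono)
    then show "norm (f y) \<le> c * (q (-1) y + q 0 y + q 1 y)" using j by linarith
  qed
  also have "\<dots> = c * ((Q (-1) (2 * pi) - Q (-1) 0) + (Q 0 (2 * pi) - Q 0 0) + (Q 1 (2 * pi) - Q 1 0))"
    by (rule integral_unique[OF h])
  also have "\<dots> \<le> c * (pi * sqrt r + pi * sqrt r + pi * sqrt r)"
    using c by (intro mult_left_mono add_mono Qb) auto
  finally show ?thesis by (simp add: algebra_simps)
qed

lemma periodic_kernel_shift:
  assumes per: "\<And>z. P (z + 2 * pi) = P z" and j: "j \<in> {-1, 0, 1::int}"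
  shows "P (z - 2 * pi * of_int j) = (P z :: real)"
  using j per[of "z - 2 * pi"] per[of z] by auto

text \<open>The integral of \<open>P (x - \<cdot>)\<close> against \<open>dZ\<close>, after an integration by parts, for \<open>Z 0 = 0\<close>.\<close>

definition stieltjes_conv :: "(real \<Rightarrow> real) \<Rightarrow> (real \<Rightarrow> real) \<Rightarrow> (real \<Rightarrow> 'a::euclidean_space) \<Rightarrow> real \<Rightarrow> 'a" where
  "stieltjes_conv P P' Z x = P x *\<^sub>R Z (2 * pi) + integral {0..2*pi} (\<lambda>y. P' (x - y) *\<^sub>R Z y)"

lemma hoelder_continuous_on:
  fixes Z :: "real \<Rightarrow> 'a::real_normed_vector"
  assumes "\<alpha> > 0" and Z: "\<And>x y. x \<in> S \<Longrightarrow> y \<in> S \<Longrightarrow> norm (Z x - Z y) \<le> E * \<bar>x - y\<bar> powr \<alpha>"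
  shows "continuous_on S Z"
  unfolding continuous_on_def
proof
  fix x assume x: "x \<in> S"
  have "((\<lambda>y. \<bar>y - x\<bar> powr \<alpha>) \<longlongrightarrow> 0) (at x within S)"
    using assms(1) by (intro tendsto_zero_powrI[where b=\<alpha>]) (auto intro!: tendsto_eq_intros)
  then have "((\<lambda>y. E * \<bar>y - x\<bar> powr \<alpha>) \<longlongrightarrow> 0) (at x within S)" by (rule tendsto_mult_right_zero)
  then have "((\<lambda>y. Z y - Z x) \<longlongrightarrow> 0) (at x within S)"
    by (rule Lim_null_comparison[rotated]) (auto simp: eventually_at_filter Z x intro!: always_eventually)
  then show "(Z \<longlongrightarrow> Z x) (at x within S)" by (rule LIM_zero_cancel)
qed

lemma kernel_integral:
  fixes c :: "'a::euclidean_space"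
  assumes P: "\<And>z. (P has_real_derivative P' z) (at z)" and "a \<le> b"
  shows "((\<lambda>y. P' (x - y) *\<^sub>R c) has_integral (P (x - a) - P (x - b)) *\<^sub>R c) {a..b}"
proof -
  have "((\<lambda>y. - P (x - y)) has_real_derivative P' (x - y)) (at y)" for y
    by (rule DERIV_cong[OF DERIV_minus[OF DERIV_chain2[OF P]]]) (auto intro!: derivative_eq_intros)
  then have "((\<lambda>y. P' (x - y)) has_integral (- P (x - b) - (- P (x - a)))) {a..b}"
    using assms(2) by (intro fundamental_theorem_of_calculus)
      (auto simp flip: has_real_derivative_iff_has_vector_derivative intro: has_field_derivative_at_within)
  from has_integral_scaleR_left[OF this, of c] show ?thesis by simp
qed

text \<open>In the variable \<open>w = \<bar>z\<bar> / sqrt r\<close> this reads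
  \<open>w powr \<alpha> \<le> 1 + w^2\<close>. It converts Hoelder regularity in space into a gain
  in time, at the price of one power of kernel decay.\<close>

lemma powr_decay:
  fixes z r \<alpha> :: real
  assumes "r > 0" "0 < \<alpha>" "\<alpha> \<le> 1"
  shows "\<bar>z\<bar> powr \<alpha> * inverse (1 + z\<^sup>2 / r) \<le> r powr (\<alpha> / 2)"
proof -
  define w where "w = \<bar>z\<bar> / sqrt r"
  have w: "w \<ge> 0" "z\<^sup>2 / r = w\<^sup>2" using assms by (auto simp: w_def power_divide)
  have "w powr \<alpha> \<le> 1 + w\<^sup>2"
  proof (cases "w \<le> 1")
    case True then show ?thesis using assms w by (intro order_trans[OF powr_le1]) auto
  next
    case False
    then have "w powr \<alpha> \<le> w powr 2" using assms by (intro powr_mono) auto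
    also have "\<dots> = w\<^sup>2" using False by (simp add: powr_numeral)
    finally show ?thesis by simp
  qed
  then have "w powr \<alpha> * inverse (1 + w\<^sup>2) \<le> 1" by (simp add: field_simps add_pos_nonneg)
  then have "r powr (\<alpha> / 2) * (w powr \<alpha> * inverse (1 + w\<^sup>2)) \<le> r powr (\<alpha> / 2) * 1" by (intro mult_left_mono) auto
  moreover have "r powr (\<alpha> / 2) * w powr \<alpha> = \<bar>z\<bar> powr \<alpha>"
    using assms by (simp add: w_def powr_divide powr_half_sqrt[symmetric] powr_powr)
  ultimately show ?thesis unfolding w(2) by (simp add: mult.assoc[symmetric])
qed

text \<open>\<open>Z\<close> need not be periodic, but its increments extend periodically. Each
  \<open>y\<close> is replaced by its image closest to \<open>x\<close>, so that the circle is cut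
  at the point antipodal to \<open>x\<close> instead of at 0. There the boundary term carries
  \<open>P pi\<close>, which is small, and the integrand involves increments of \<open>Z\<close>
  over the circle distance only. One of the two powers of decay absorbs these increments by
  \<open>powr_decay\<close>, the other is integrated by
  \<open>wrapped_integral_bound\<close>.\<close>

lemma stieltjes_conv_bound:
  fixes Z :: "real \<Rightarrow> 'a::euclidean_space"
  assumes P: "\<And>z. (P has_real_derivative P' z) (at z)" and cP': "continuous_on UNIV P'"
    and per: "\<And>z. P (z + 2 * pi) = P z" "\<And>z. P' (z + 2 * pi) = P' z"
    and r: "r > 0" and c: "c \<ge> 0" and \<alpha>: "0 < \<alpha>" "\<alpha> \<le> 1"
    and bP: "\<bar>P pi\<bar> \<le> c * sqrt r * inverse (1 + pi\<^sup>2 / r) ^ 2"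
    and bP': "\<And>z. \<bar>z\<bar> \<le> pi \<Longrightarrow> \<bar>P' z\<bar> \<le> c * inverse (1 + z\<^sup>2 / r) ^ 2"
    and E: "E \<ge> 0" and Z0: "Z 0 = 0"
    and Z: "\<And>x y. x \<in> {0..2*pi} \<Longrightarrow> y \<in> {0..2*pi} \<Longrightarrow> norm (Z x - Z y) \<le> E * \<bar>x - y\<bar> powr \<alpha>"
    and x: "x \<in> {0..2*pi}"
  shows "norm (stieltjes_conv P P' Z x) \<le> 24 * c * E * sqrt r * r powr (\<alpha> / 2)"
proof -
  have contZ: "continuous_on {0..2*pi} Z" by (rule hoelder_continuous_on[OF \<alpha>(1) Z])
  have I: "(\<lambda>y. P' (x - y) *\<^sub>R Z y) integrable_on {0..2*pi}"
    by (intro integrable_continuous_real continuous_intros contZ continuous_on_compose2[OF cP']) auto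
  define I0 where "I0 = integral {0..2*pi} (\<lambda>y. P' (x - y) *\<^sub>R Z y)"
  have h1: "((\<lambda>y. P' (x - y) *\<^sub>R Z y) has_integral I0) {0..2*pi}"
    unfolding I0_def using I by (rule integrable_integral)
  \<comment> \<open>Over a full period \<open>P'\<close> integrates to 0, hence \<open>Z x\<close>
    may be subtracted from \<open>Z y\<close> in the integral.\<close>
  have h2: "((\<lambda>y. P' (x - y) *\<^sub>R Z x) has_integral 0) {0..2*pi}"
    using kernel_integral[OF P, of 0 "2 * pi" x "Z x"] per(1)[of "x - 2 * pi"] by simp
  have "\<exists>B. (\<lambda>y. P' (x - y) *\<^sub>R B y) integrable_on {0..2*pi} \<and>
    stieltjes_conv P P' Z x = P pi *\<^sub>R Z (2 * pi) + integral {0..2*pi} (\<lambda>y. P' (x - y) *\<^sub>R B y) \<and>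
    (\<forall>y\<in>{0..2*pi}. \<exists>j\<in>{-1, 0, 1::int}. \<bar>x - y - 2 * pi * of_int j\<bar> \<le> pi \<and>
        norm (B y) \<le> 2 * E * \<bar>x - y - 2 * pi * of_int j\<bar> powr \<alpha>)"
  proof (cases "x \<le> pi")
    case True
    \<comment> \<open>For \<open>y\<close> beyond the cut \<open>x + pi\<close> the closest image is
      \<open>y - 2 * pi\<close>, where the extension of \<open>Z\<close> takes the value
      \<open>Z y - Z (2 * pi)\<close>. The integral of this correction turns the boundary factor
      \<open>P x\<close> into \<open>P pi\<close>. The case \<open>x > pi\<close> below is the
      mirror image, with the cut at \<open>x - pi\<close>.\<close>
    define B where "B y = Z y - Z x - (if y \<in> {x + pi..2*pi} then Z (2 * pi) else 0)" for y
    have "((\<lambda>y. if y \<in> {x + pi..2*pi} then P' (x - y) *\<^sub>R Z (2 * pi) else 0) has_integral (P (x - (x + pi)) - P (x - 2 * pi)) *\<^sub>R Z (2 * pi)) {0..2*pi}"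
      using kernel_integral[OF P, of "x + pi" "2 * pi" x "Z (2 * pi)"] True x
      by (subst has_integral_restrict) auto
    moreover have "P (x - (x + pi)) = P pi" "P (x - 2 * pi) = P x" using per(1)[of "- pi"] per(1)[of "x - 2 * pi"] by auto
    ultimately have "((\<lambda>y. if y \<in> {x + pi..2*pi} then P' (x - y) *\<^sub>R Z (2 * pi) else 0) has_integral (P pi - P x) *\<^sub>R Z (2 * pi)) {0..2*pi}"
      by simp
    from has_integral_diff[OF has_integral_diff[OF h1 h2] this]
    have hB: "((\<lambda>y. P' (x - y) *\<^sub>R B y) has_integral (I0 - 0 - (P pi - P x) *\<^sub>R Z (2 * pi))) {0..2*pi}"
      by (rule has_integral_eq[rotated]) (auto simp: B_def algebra_simps)
    have bB: "\<exists>j\<in>{-1, 0, 1::int}. \<bar>x - y - 2 * pi * of_int j\<bar> \<le> pi \<and>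
        norm (B y) \<le> 2 * E * \<bar>x - y - 2 * pi * of_int j\<bar> powr \<alpha>" if y: "y \<in> {0..2*pi}" for y
    proof (cases "y \<ge> x + pi")
      case True
      have "norm (B y) \<le> norm (Z y - Z (2 * pi)) + norm (Z x - Z 0)"
        using norm_triangle_ineq4[of "Z y - Z (2 * pi)" "Z x"] True y by (simp add: B_def Z0 algebra_simps)
      also have "\<dots> \<le> E * \<bar>y - 2 * pi\<bar> powr \<alpha> + E * \<bar>x - 0\<bar> powr \<alpha>" using x y by (intro add_mono Z) auto
      also have "\<dots> \<le> E * \<bar>x - y + 2 * pi\<bar> powr \<alpha> + E * \<bar>x - y + 2 * pi\<bar> powr \<alpha>"
        using x y \<alpha> E by (intro add_mono mult_left_mono powr_mono2) auto
      finally show ?thesis using True x y \<open>x \<le> pi\<close> by (intro bexI[of _ "-1"]) auto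
    next
      case False
      have "0 \<le> E * \<bar>x - y\<bar> powr \<alpha>" using E by simp
      then show ?thesis using False Z[OF y x] x y \<open>x \<le> pi\<close>
        by (intro bexI[of _ 0]) (auto simp: B_def abs_minus_commute)
    qed
    show ?thesis
      by (rule exI[of _ B]) (use hB bB in \<open>auto simp: stieltjes_conv_def I0_def[symmetric] integral_unique scaleR_diff_left\<close>)
  next
    case False
    define B where "B y = Z y - Z x + (if y \<in> {0..x - pi} then Z (2 * pi) else 0)" for y
    have "((\<lambda>y. if y \<in> {0..x - pi} then P' (x - y) *\<^sub>R Z (2 * pi) else 0) has_integral (P (x - 0) - P (x - (x - pi))) *\<^sub>R Z (2 * pi)) {0..2*pi}"
      using kernel_integral[OF P, of 0 "x - pi" x "Z (2 * pi)"] False x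
      by (subst has_integral_restrict) auto
    then have "((\<lambda>y. if y \<in> {0..x - pi} then P' (x - y) *\<^sub>R Z (2 * pi) else 0) has_integral (P x - P pi) *\<^sub>R Z (2 * pi)) {0..2*pi}"
      by simp
    from has_integral_add[OF has_integral_diff[OF h1 h2] this]
    have hB: "((\<lambda>y. P' (x - y) *\<^sub>R B y) has_integral (I0 - 0 + (P x - P pi) *\<^sub>R Z (2 * pi))) {0..2*pi}"
      by (rule has_integral_eq[rotated]) (auto simp: B_def algebra_simps)
    have bB: "\<exists>j\<in>{-1, 0, 1::int}. \<bar>x - y - 2 * pi * of_int j\<bar> \<le> pi \<and>
        norm (B y) \<le> 2 * E * \<bar>x - y - 2 * pi * of_int j\<bar> powr \<alpha>" if y: "y \<in> {0..2*pi}" for y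
    proof (cases "y \<le> x - pi")
      case True
      have "norm (B y) \<le> norm (Z y - Z 0) + norm (Z (2 * pi) - Z x)"
        using norm_triangle_ineq[of "Z y" "Z (2 * pi) - Z x"] True y by (simp add: B_def Z0 algebra_simps)
      also have "\<dots> \<le> E * \<bar>y - 0\<bar> powr \<alpha> + E * \<bar>2 * pi - x\<bar> powr \<alpha>" using x y by (intro add_mono Z) auto
      also have "\<dots> \<le> E * \<bar>x - y - 2 * pi\<bar> powr \<alpha> + E * \<bar>x - y - 2 * pi\<bar> powr \<alpha>"
        using x y \<alpha> E by (intro add_mono mult_left_mono powr_mono2) auto
      finally show ?thesis using True x y False by (intro bexI[of _ 1]) auto
    next
      case F: False
      have "0 \<le> E * \<bar>x - y\<bar> powr \<alpha>" using E by simp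
      then show ?thesis using F Z[OF y x] x y False
        by (intro bexI[of _ 0]) (auto simp: B_def abs_minus_commute)
    qed
    show ?thesis
      by (rule exI[of _ B]) (use hB bB in \<open>auto simp: stieltjes_conv_def I0_def[symmetric] integral_unique scaleR_diff_left\<close>)
  qed
  then obtain B where iB: "(\<lambda>y. P' (x - y) *\<^sub>R B y) integrable_on {0..2*pi}"
    and eq: "stieltjes_conv P P' Z x = P pi *\<^sub>R Z (2 * pi) + integral {0..2*pi} (\<lambda>y. P' (x - y) *\<^sub>R B y)"
    and bB: "\<And>y. y \<in> {0..2*pi} \<Longrightarrow> \<exists>j\<in>{-1, 0, 1::int}. \<bar>x - y - 2 * pi * of_int j\<bar> \<le> pi \<and>
        norm (B y) \<le> 2 * E * \<bar>x - y - 2 * pi * of_int j\<bar> powr \<alpha>" by auto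
  have "norm (integral {0..2*pi} (\<lambda>y. P' (x - y) *\<^sub>R B y)) \<le> 3 * pi * (2 * c * E * r powr (\<alpha> / 2)) * sqrt r"
  proof (rule wrapped_integral_bound[OF r _ iB])
    show "0 \<le> 2 * c * E * r powr (\<alpha> / 2)" using c E by simp
    fix y assume "y \<in> {0..2*pi}"
    from bB[OF this] obtain j where j: "j \<in> {-1, 0, 1::int}" "\<bar>x - y - 2 * pi * of_int j\<bar> \<le> pi"
      "norm (B y) \<le> 2 * E * \<bar>x - y - 2 * pi * of_int j\<bar> powr \<alpha>" by blast
    let ?w = "x - y - 2 * pi * of_int j"
    let ?e = "inverse (1 + ?w\<^sup>2 / r)"
    have e: "?e \<ge> 0" using r by (simp add: add_nonneg_nonneg)
    have "norm (P' (x - y) *\<^sub>R B y) = \<bar>P' ?w\<bar> * norm (B y)"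
      using periodic_kernel_shift[where P=P', OF per(2) j(1)] by simp
    also have "\<dots> \<le> (c * ?e ^ 2) * (2 * E * \<bar>?w\<bar> powr \<alpha>)"
      using j bP'[OF j(2)] c by (intro mult_mono) auto
    also have "\<dots> = (2 * c * E * ?e) * (\<bar>?w\<bar> powr \<alpha> * ?e)" by (simp add: power2_eq_square)
    also have "\<dots> \<le> (2 * c * E * ?e) * r powr (\<alpha> / 2)"
      using c E e by (intro mult_left_mono powr_decay r \<alpha>) auto
    finally show "\<exists>j\<in>{-1, 0, 1::int}. norm (P' (x - y) *\<^sub>R B y) \<le> 2 * c * E * r powr (\<alpha> / 2) * inverse (1 + (x - y - 2 * pi * of_int j)\<^sup>2 / r)"
      using j(1) by (intro bexI[of _ j]) (simp_all add: mult_ac)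
  qed
  moreover have "norm (P pi *\<^sub>R Z (2 * pi)) \<le> 2 * c * E * r powr (\<alpha> / 2) * sqrt r"
  proof -
    let ?e = "inverse (1 + pi\<^sup>2 / r)"
    have e: "?e \<ge> 0" "?e \<le> 1" using r by (auto simp: add_nonneg_nonneg inverse_le_1_iff add_pos_nonneg)
    have "(2 * pi) powr \<alpha> = 2 powr \<alpha> * pi powr \<alpha>" by (simp add: powr_mult)
    also have "2 powr \<alpha> \<le> 2 powr 1" using \<alpha> by (intro powr_mono) auto
    finally have tp: "(2 * pi) powr \<alpha> \<le> 2 * pi powr \<alpha>" by simp
    have "norm (Z (2 * pi) - Z 0) \<le> E * \<bar>2 * pi - 0\<bar> powr \<alpha>" by (rule Z) auto
    also have "\<dots> \<le> E * (2 * pi powr \<alpha>)" using tp E by (intro mult_left_mono) auto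
    finally have zz: "norm (Z (2 * pi)) \<le> E * (2 * pi powr \<alpha>)" by (simp add: Z0)
    have "norm (P pi *\<^sub>R Z (2 * pi)) \<le> (c * sqrt r * ?e ^ 2) * (E * (2 * pi powr \<alpha>))"
      unfolding norm_scaleR using bP zz c r by (intro mult_mono) auto
    also have "\<dots> = (2 * c * E * sqrt r * ?e) * (\<bar>pi\<bar> powr \<alpha> * ?e)" by (simp add: power2_eq_square)
    also have "\<dots> \<le> (2 * c * E * sqrt r * 1) * r powr (\<alpha> / 2)"
      using c E e r by (intro mult_mono powr_decay r \<alpha>) auto
    finally show ?thesis by (simp add: mult_ac)
  qed
  ultimately have "norm (stieltjes_conv P P' Z x) \<le> (6 * pi + 2) * (c * E * sqrt r * r powr (\<alpha> / 2))"
    unfolding eq by (intro order_trans[OF norm_triangle_ineq]) (simp add: algebra_simps)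
  also have "\<dots> \<le> 24 * (c * E * sqrt r * r powr (\<alpha> / 2))"
    using c E r pi_less_4 pi_approx by (intro mult_right_mono) auto
  finally show ?thesis by (simp add: mult_ac)
qed

lemma kernel_conv_deriv:
  fixes Z :: "real \<Rightarrow> 'a::euclidean_space"
  assumes P: "\<And>z. (P has_real_derivative P' z) (at z)" and cP': "continuous_on UNIV P'"
    and Z: "continuous_on {0..2*pi} Z"
  shows "((\<lambda>x. integral {0..2*pi} (\<lambda>y. P (x - y) *\<^sub>R Z y)) has_vector_derivative
     integral {0..2*pi} (\<lambda>y. P' (x - y) *\<^sub>R Z y)) (at x)"
proof -
  have cP: "continuous_on UNIV P" using P by (meson DERIV_isCont continuous_at_imp_continuous_on)
  have "((\<lambda>x. integral (cbox 0 (2*pi)) (\<lambda>y. P (x - y) *\<^sub>R Z y)) has_vector_derivative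
     integral (cbox 0 (2*pi)) (\<lambda>y. P' (x - y) *\<^sub>R Z y)) (at x within UNIV)"
  proof (rule leibniz_rule_vector_derivative)
    fix x y :: real
    have "((\<lambda>x. P (x - y)) has_real_derivative P' (x - y)) (at x)"
      by (rule DERIV_cong[OF DERIV_chain2[OF P]]) (auto intro!: derivative_eq_intros)
    from has_vector_derivative_scaleR[OF this has_vector_derivative_const[of "Z y"]]
    show "((\<lambda>x. P (x - y) *\<^sub>R Z y) has_vector_derivative P' (x - y) *\<^sub>R Z y) (at x within UNIV)"
      by simp
  next
    fix x :: real
    show "(\<lambda>y. P (x - y) *\<^sub>R Z y) integrable_on cbox 0 (2*pi)"
      unfolding cbox_interval
      by (intro integrable_continuous_real continuous_intros Z continuous_on_compose2[OF cP]) auto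
  next
    show "continuous_on (UNIV \<times> cbox 0 (2*pi)) (\<lambda>(x, y). P' (x - y) *\<^sub>R Z y)"
      unfolding case_prod_unfold
      by (intro continuous_intros continuous_on_compose2[OF cP'] continuous_on_compose2[OF Z]) auto
  qed auto
  then show ?thesis by simp
qed

lemma stieltjes_conv_deriv:
  fixes Z :: "real \<Rightarrow> 'a::euclidean_space"
  assumes P: "\<And>z. (P has_real_derivative P' z) (at z)" and P': "\<And>z. (P' has_real_derivative P'' z) (at z)"
    and cP'': "continuous_on UNIV P''" and Z: "continuous_on {0..2*pi} Z"
  shows "(stieltjes_conv P P' Z has_vector_derivative stieltjes_conv P' P'' Z x) (at x)"
proof -
  have "((\<lambda>x. P x *\<^sub>R Z (2 * pi)) has_vector_derivative P' x *\<^sub>R Z (2 * pi)) (at x)"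
    using has_vector_derivative_scaleR[OF P has_vector_derivative_const[of "Z (2 * pi)"]] by simp
  from has_vector_derivative_add[OF this kernel_conv_deriv[OF P' cP'' Z]]
  show ?thesis unfolding stieltjes_conv_def .
qed

lemma lipschitz_from_vector_derivative:
  fixes F :: "real \<Rightarrow> 'a::real_normed_vector"
  assumes d: "\<And>x. (F has_vector_derivative F' x) (at x)"
    and b: "\<And>x. x \<in> {a..b} \<Longrightarrow> norm (F' x) \<le> L" and xy: "x \<in> {a..b}" "y \<in> {a..b}"
  shows "norm (F x - F y) \<le> L * \<bar>x - y\<bar>"
proof -
  have "norm (F x - F y) \<le> L * norm (x - y)"
  proof (rule differentiable_bound[of "{a..b}" F "\<lambda>x h. h *\<^sub>R F' x"])
    show "(F has_derivative (\<lambda>h. h *\<^sub>R F' x)) (at x within {a..b})" for x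
      using d[of x] unfolding has_vector_derivative_def by (rule has_derivative_at_withinI)
    show "onorm (\<lambda>h. h *\<^sub>R F' x) \<le> L" if "x \<in> {a..b}" for x
    proof (rule onorm_le)
      show "norm (h *\<^sub>R F' x) \<le> L * norm h" for h
        using mult_right_mono[OF b[OF that], of "norm h"] by (simp add: mult.commute)
    qed
  qed (use xy in auto)
  then show ?thesis by simp
qed

lemma heat_kernel_periodic:
  "heat_kernel r (z + 2 * pi) = heat_kernel r z" "heat_kernel1 r (z + 2 * pi) = heat_kernel1 r z"
  "heat_kernel2 r (z + 2 * pi) = heat_kernel2 r z"
  unfolding heat_kernel_periodize heat_kernel1_def heat_kernel2_def
  using periodize_shift[of _ z 1] by auto

lemma heat_kernel_continuous:
  assumes "r > 0"
  shows "continuous_on UNIV (heat_kernel r)" "continuous_on UNIV (heat_kernel1 r)"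
  using heat_kernel_deriv[OF assms] by (meson DERIV_isCont continuous_at_imp_continuous_on)+

text \<open>Two instances of \<open>stieltjes_conv_bound\<close>: one with
  \<open>P = heat_kernel r\<close> and \<open>c\<close> of order \<open>r powr - 1\<close>, and, for
  the derivative in \<open>x\<close>, one with \<open>P = heat_kernel1 r\<close> and
  \<open>c\<close> of order \<open>r powr - (3/2)\<close>. Each gains the factor
  \<open>sqrt r * r powr (\<alpha> / 2)\<close>.\<close>

lemma heat_stieltjes_bounds:
  fixes Z :: "real \<Rightarrow> 'a::euclidean_space"
  assumes r: "0 < r" "r \<le> T" and \<alpha>: "0 < \<alpha>" "\<alpha> \<le> 1" and E: "E \<ge> 0" and Z0: "Z 0 = 0"
    and Z: "\<And>x y. x \<in> {0..2*pi} \<Longrightarrow> y \<in> {0..2*pi} \<Longrightarrow> norm (Z x - Z y) \<le> E * \<bar>x - y\<bar> powr \<alpha>"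
  shows "x \<in> {0..2*pi} \<Longrightarrow> norm (stieltjes_conv (heat_kernel r) (heat_kernel1 r) Z x) \<le> 24 * kernel_const T * E * r powr ((\<alpha> - 1) / 2)"
    and "x \<in> {0..2*pi} \<Longrightarrow> y \<in> {0..2*pi} \<Longrightarrow>
      norm (stieltjes_conv (heat_kernel r) (heat_kernel1 r) Z x - stieltjes_conv (heat_kernel r) (heat_kernel1 r) Z y)
        \<le> 24 * kernel_const T * E * r powr ((\<alpha> - 2) / 2) * \<bar>x - y\<bar>"
proof -
  note d = heat_kernel_deriv[OF r(1)]
  note b = heat_kernel_bounds[OF r]
  have K: "kernel_const T \<ge> 0" using kernel_const_pos[of T] r by auto
  have s: "sqrt r = r powr (1 / 2)" using r by (simp add: powr_half_sqrt)
  have e1: "r powr - 1 * sqrt r = r powr - (1 / 2)" "r powr - (3 / 2) * sqrt r = r powr - 1"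
    unfolding s powr_add[symmetric] by simp_all
  have "norm (stieltjes_conv (heat_kernel r) (heat_kernel1 r) Z x) \<le> 24 * (kernel_const T * r powr - 1) * E * sqrt r * r powr (\<alpha> / 2)"
    if x: "x \<in> {0..2*pi}" for x
  proof (rule stieltjes_conv_bound[OF d(1) heat_kernel_continuous(2)[OF r(1)] heat_kernel_periodic(1,2) r(1) _ \<alpha> _ _ E Z0 Z x])
    have "kernel_const T * r powr - 1 * sqrt r = kernel_const T * r powr - (1/2)" using e1 by (simp only: mult.assoc)
    then show "\<bar>heat_kernel r pi\<bar> \<le> kernel_const T * r powr - 1 * sqrt r * inverse (1 + pi\<^sup>2 / r) ^ 2"
      using b(1)[of pi] by simp
  qed (use K b in auto)
  then show "x \<in> {0..2*pi} \<Longrightarrow> norm (stieltjes_conv (heat_kernel r) (heat_kernel1 r) Z x) \<le> 24 * kernel_const T * E * r powr ((\<alpha> - 1) / 2)"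
  proof -
    have "r powr - 1 * sqrt r * r powr (\<alpha> / 2) = r powr ((\<alpha> - 1) / 2)"
      unfolding s powr_add[symmetric] by (rule arg_cong[where f="\<lambda>e. r powr e"]) (simp add: field_simps)
    moreover have "24 * (kernel_const T * r powr - 1) * E * sqrt r * r powr (\<alpha> / 2) =
        24 * kernel_const T * E * (r powr - 1 * sqrt r * r powr (\<alpha> / 2))" by (simp only: mult_ac)
    ultimately have "24 * (kernel_const T * r powr - 1) * E * sqrt r * r powr (\<alpha> / 2) = 24 * kernel_const T * E * r powr ((\<alpha> - 1) / 2)"
      by (simp only:)
    then show "x \<in> {0..2*pi} \<Longrightarrow> norm (stieltjes_conv (heat_kernel r) (heat_kernel1 r) Z x) \<le> 24 * kernel_const T * E * r powr ((\<alpha> - 1) / 2)"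
      using \<open>\<And>x. x \<in> {0..2*pi} \<Longrightarrow> norm (stieltjes_conv (heat_kernel r) (heat_kernel1 r) Z x) \<le> 24 * (kernel_const T * r powr - 1) * E * sqrt r * r powr (\<alpha> / 2)\<close> by simp
  qed
  have 2: "norm (stieltjes_conv (heat_kernel1 r) (heat_kernel2 r) Z x) \<le> 24 * (kernel_const T * r powr - (3/2)) * E * sqrt r * r powr (\<alpha> / 2)"
    if x: "x \<in> {0..2*pi}" for x
  proof (rule stieltjes_conv_bound[OF d(2) d(3) heat_kernel_periodic(2,3) r(1) _ \<alpha> _ _ E Z0 Z x])
    have "kernel_const T * r powr - (3/2) * sqrt r = kernel_const T * r powr - 1" using e1 by (simp only: mult.assoc)
    then show "\<bar>heat_kernel1 r pi\<bar> \<le> kernel_const T * r powr - (3/2) * sqrt r * inverse (1 + pi\<^sup>2 / r) ^ 2"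
      using b(2)[of pi] by simp
  qed (use K b in auto)
  have "r powr - (3/2) * sqrt r * r powr (\<alpha> / 2) = r powr ((\<alpha> - 2) / 2)"
    unfolding s powr_add[symmetric] by (rule arg_cong[where f="\<lambda>e. r powr e"]) (simp add: field_simps)
  moreover have "24 * (kernel_const T * r powr - (3/2)) * E * sqrt r * r powr (\<alpha> / 2) =
      24 * kernel_const T * E * (r powr - (3/2) * sqrt r * r powr (\<alpha> / 2))" by (simp only: mult_ac)
  ultimately have eq: "24 * (kernel_const T * r powr - (3/2)) * E * sqrt r * r powr (\<alpha> / 2) = 24 * kernel_const T * E * r powr ((\<alpha> - 2) / 2)"
    by (simp only:)
  show "x \<in> {0..2*pi} \<Longrightarrow> y \<in> {0..2*pi} \<Longrightarrow>
      norm (stieltjes_conv (heat_kernel r) (heat_kernel1 r) Z x - stieltjes_conv (heat_kernel r) (heat_kernel1 r) Z y)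
        \<le> 24 * kernel_const T * E * r powr ((\<alpha> - 2) / 2) * \<bar>x - y\<bar>"
    by (rule lipschitz_from_vector_derivative[OF stieltjes_conv_deriv[OF d hoelder_continuous_on[OF \<alpha>(1) Z]]])
       (use 2 eq in auto)
qed

text \<open>Passes from the Lebesgue integral to the gauge integral, for which the fundamental
  theorem and differentiation under the integral sign are applied.\<close>

lemma heat_semigroup_eq_integral:
  fixes w :: "real \<Rightarrow> real ^ 'n::finite"
  assumes r: "r > 0" and w: "continuous_on {0..2*pi} w"
  shows "heat_semigroup r w x = integral {0..2*pi} (\<lambda>y. heat_kernel r (x - y) *\<^sub>R w y)"
proof -
  have "(\<lambda>y. heat_kernel r (x - y) *\<^sub>R w y) absolutely_integrable_on cbox 0 (2*pi)"
    unfolding cbox_interval[symmetric]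
    by (intro absolutely_integrable_continuous continuous_intros continuous_on_compose2[OF heat_kernel_continuous(1)[OF r]])
       (use w in auto)
  then show ?thesis unfolding heat_semigroup_def using r
    by (simp add: set_lebesgue_integral_eq_integral)
qed

lemma kernel_sup_bound:
  fixes w :: "real \<Rightarrow> 'a::euclidean_space"
  assumes cP: "continuous_on UNIV P" and per: "\<And>z. P (z + 2 * pi) = P z"
    and r: "r > 0" and c: "c \<ge> 0"
    and bP: "\<And>z. \<bar>z\<bar> \<le> pi \<Longrightarrow> \<bar>P z\<bar> \<le> c * inverse (1 + z\<^sup>2 / r) ^ 2"
    and w: "continuous_on {0..2*pi} w" and E: "\<And>y. y \<in> {0..2*pi} \<Longrightarrow> norm (w y) \<le> E"
    and x: "x \<in> {0..2*pi}"
  shows "norm (integral {0..2*pi} (\<lambda>y. P (x - y) *\<^sub>R w y)) \<le> 3 * pi * (c * E) * sqrt r"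
proof (rule wrapped_integral_bound[OF r])
  have E0: "E \<ge> 0" using E[OF x] norm_ge_zero order_trans by blast
  then show "0 \<le> c * E" using c by simp
  show "(\<lambda>y. P (x - y) *\<^sub>R w y) integrable_on {0..2*pi}"
    by (intro integrable_continuous_real continuous_intros w continuous_on_compose2[OF cP]) auto
  fix y assume y: "y \<in> {0..2*pi}"
  obtain j where j: "j \<in> {-1, 0, 1::int}" "\<bar>x - y - 2 * pi * of_int j\<bar> \<le> pi"
  proof -
    consider "x - y < - pi" | "- pi \<le> x - y" "x - y \<le> pi" | "pi < x - y" by linarith
    then show ?thesis using that[of "-1"] that[of 0] that[of 1] x y by cases auto
  qed
  let ?w = "x - y - 2 * pi * of_int j"
  have "norm (P (x - y) *\<^sub>R w y) = \<bar>P ?w\<bar> * norm (w y)" using periodic_kernel_shift[where P=P, OF per j(1)] by simp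
  also have "\<dots> \<le> (c * inverse (1 + ?w\<^sup>2 / r) ^ 2) * E" using bP[OF j(2)] E[OF y] c by (intro mult_mono) auto
  also have "\<dots> \<le> (c * inverse (1 + ?w\<^sup>2 / r) ^ 1) * E"
    using c E0 r by (intro mult_left_mono mult_right_mono inverse_pow_le) auto
  finally show "\<exists>j\<in>{-1, 0, 1::int}. norm (P (x - y) *\<^sub>R w y) \<le> c * E * inverse (1 + (x - y - 2 * pi * of_int j)\<^sup>2 / r)"
    using j(1) by (intro bexI[of _ j]) (simp_all add: mult_ac)
qed

lemma heat_semigroup_bounds:
  fixes w :: "real \<Rightarrow> real ^ 'n::finite"
  assumes r: "0 < r" "r \<le> T" and w: "continuous_on {0..2*pi} w" and E: "\<And>y. y \<in> {0..2*pi} \<Longrightarrow> norm (w y) \<le> E"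
  shows "x \<in> {0..2*pi} \<Longrightarrow> norm (heat_semigroup r w x) \<le> 12 * kernel_const T * E"
    and "x \<in> {0..2*pi} \<Longrightarrow> y \<in> {0..2*pi} \<Longrightarrow>
       norm (heat_semigroup r w x - heat_semigroup r w y) \<le> 12 * kernel_const T * E * r powr - (1/2) * \<bar>x - y\<bar>"
proof -
  note d = heat_kernel_deriv[OF r(1)]
  note b = heat_kernel_bounds[OF r]
  have K: "kernel_const T \<ge> 0" using kernel_const_pos[of T] r by auto
  have E0: "E \<ge> 0" using E[of 0] norm_ge_zero[of "w 0"] by (simp, linarith)
  have s: "sqrt r = r powr (1 / 2)" using r by (simp add: powr_half_sqrt)
  have e1: "r powr - (1/2) * sqrt r = 1" "r powr - 1 * sqrt r = r powr - (1 / 2)"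
    unfolding s powr_add[symmetric] using r by simp_all
  have pi12: "3 * pi * C \<le> 12 * C" if "C \<ge> 0" for C using that pi_less_4 by (intro mult_right_mono) auto
  show "norm (heat_semigroup r w x) \<le> 12 * kernel_const T * E" if x: "x \<in> {0..2*pi}"
  proof -
    have "norm (heat_semigroup r w x) \<le> 3 * pi * ((kernel_const T * r powr - (1/2)) * E) * sqrt r"
      unfolding heat_semigroup_eq_integral[OF r(1) w]
      by (rule kernel_sup_bound[OF heat_kernel_continuous(1)[OF r(1)] heat_kernel_periodic(1) r(1) _ b(1) w E x]) (use K in auto)
    also have "\<dots> = 3 * pi * (kernel_const T * E * (r powr - (1/2) * sqrt r))" by (simp only: mult_ac)
    also have "\<dots> \<le> 12 * (kernel_const T * E * (r powr - (1/2) * sqrt r))" using K E0 r by (intro pi12) auto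
    finally show ?thesis unfolding e1 by simp
  qed
  have 2: "norm (integral {0..2*pi} (\<lambda>y. heat_kernel1 r (x - y) *\<^sub>R w y)) \<le> 12 * kernel_const T * E * r powr - (1/2)"
    if x: "x \<in> {0..2*pi}" for x
  proof -
    have "norm (integral {0..2*pi} (\<lambda>y. heat_kernel1 r (x - y) *\<^sub>R w y)) \<le> 3 * pi * ((kernel_const T * r powr - 1) * E) * sqrt r"
      by (rule kernel_sup_bound[OF heat_kernel_continuous(2)[OF r(1)] heat_kernel_periodic(2) r(1) _ b(2) w E x]) (use K in auto)
    also have "\<dots> = 3 * pi * (kernel_const T * E * (r powr - 1 * sqrt r))" by (simp only: mult_ac)
    also have "\<dots> \<le> 12 * (kernel_const T * E * (r powr - 1 * sqrt r))" using K E0 r by (intro pi12) auto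
    finally show ?thesis unfolding e1 by simp
  qed
  show "x \<in> {0..2*pi} \<Longrightarrow> y \<in> {0..2*pi} \<Longrightarrow>
       norm (heat_semigroup r w x - heat_semigroup r w y) \<le> 12 * kernel_const T * E * r powr - (1/2) * \<bar>x - y\<bar>"
    unfolding heat_semigroup_eq_integral[OF r(1) w]
    by (rule lipschitz_from_vector_derivative[OF kernel_conv_deriv[OF d(1) heat_kernel_continuous(2)[OF r(1)] w]])
       (use 2 in auto)
qed

text \<open>For the Lipschitz bound, the derivative of \<open>heat_semigroup r h\<close> is a
  Stieltjes convolution with \<open>Z = h - h 0\<close>, whose boundary term vanishes because
  \<open>h (2 * pi) = h 0\<close>. The Hoelder bound is uniform in \<open>r\<close>: points closer
  than \<open>sqrt r\<close> are handled by the Lipschitz bound, while for more distant points the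
  semigroup differs from a constant multiple of \<open>h\<close> by a term of order
  \<open>r powr (\<beta> / 2)\<close>.\<close>

lemma heat_semigroup_hoelder_bounds:
  fixes h :: "real \<Rightarrow> real ^ 'n::finite"
  assumes r: "0 < r" "r \<le> T" and \<beta>: "0 < \<beta>" "\<beta> < 1" and D: "D \<ge> 0" and per: "h (2 * pi) = h 0"
    and h: "\<And>x y. x \<in> {0..2*pi} \<Longrightarrow> y \<in> {0..2*pi} \<Longrightarrow> norm (h x - h y) \<le> D * \<bar>x - y\<bar> powr \<beta>"
    and x: "x \<in> {0..2*pi}" and y: "y \<in> {0..2*pi}"
  shows "norm (heat_semigroup r h x - heat_semigroup r h y) \<le> 24 * kernel_const T * D * r powr ((\<beta> - 1) / 2) * \<bar>x - y\<bar>"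
    and "norm (heat_semigroup r h x - heat_semigroup r h y) \<le> 96 * kernel_const T * D * \<bar>x - y\<bar> powr \<beta>"
proof -
  note d = heat_kernel_deriv[OF r(1)]
  note b = heat_kernel_bounds[OF r]
  have K: "kernel_const T \<ge> 0" using kernel_const_pos[of T] r by auto
  have ch: "continuous_on {0..2*pi} h" by (rule hoelder_continuous_on[OF \<beta>(1) h])
  define Z where "Z y = h y - h 0" for y
  have cZ: "continuous_on {0..2*pi} Z" unfolding Z_def by (intro continuous_intros ch)
  have Zh: "norm (Z x - Z y) \<le> D * \<bar>x - y\<bar> powr \<beta>" if "x \<in> {0..2*pi}" "y \<in> {0..2*pi}" for x y
    using h[OF that] by (simp add: Z_def)
  have conv: "integral {0..2*pi} (\<lambda>y. heat_kernel1 r (x - y) *\<^sub>R h y) = stieltjes_conv (heat_kernel r) (heat_kernel1 r) Z x" for x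
  proof -
    have "((\<lambda>y. heat_kernel1 r (x - y) *\<^sub>R h 0) has_integral 0) {0..2*pi}"
      using kernel_integral[OF d(1), of 0 "2 * pi" x "h 0"] heat_kernel_periodic(1)[of r "x - 2 * pi"] by simp
    moreover have "(\<lambda>y. heat_kernel1 r (x - y) *\<^sub>R Z y) integrable_on {0..2*pi}"
      by (intro integrable_continuous_real continuous_intros cZ continuous_on_compose2[OF heat_kernel_continuous(2)[OF r(1)]]) auto
    ultimately have "((\<lambda>y. heat_kernel1 r (x - y) *\<^sub>R h 0 + heat_kernel1 r (x - y) *\<^sub>R Z y) has_integral
        (0 + integral {0..2*pi} (\<lambda>y. heat_kernel1 r (x - y) *\<^sub>R Z y))) {0..2*pi}"
      by (intro has_integral_add integrable_integral)
    then have "((\<lambda>y. heat_kernel1 r (x - y) *\<^sub>R h y) has_integral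
        (0 + integral {0..2*pi} (\<lambda>y. heat_kernel1 r (x - y) *\<^sub>R Z y))) {0..2*pi}"
      by (rule has_integral_eq[rotated]) (simp add: Z_def algebra_simps)
    then show ?thesis by (simp add: integral_unique stieltjes_conv_def Z_def per)
  qed
  have der: "norm (integral {0..2*pi} (\<lambda>y. heat_kernel1 r (x - y) *\<^sub>R h y)) \<le> 24 * kernel_const T * D * r powr ((\<beta> - 1) / 2)"
    if x: "x \<in> {0..2*pi}" for x
    unfolding conv by (rule heat_stieltjes_bounds(1)[OF r \<beta>(1) less_imp_le[OF \<beta>(2)] D _ Zh x]) (auto simp: Z_def)
  have lip: "norm (heat_semigroup r h x - heat_semigroup r h y) \<le> 24 * kernel_const T * D * r powr ((\<beta> - 1) / 2) * \<bar>x - y\<bar>"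
    unfolding heat_semigroup_eq_integral[OF r(1) ch]
    by (rule lipschitz_from_vector_derivative[OF kernel_conv_deriv[OF d(1) heat_kernel_continuous(2)[OF r(1)] ch]])
       (use der x y in auto)
  then show "norm (heat_semigroup r h x - heat_semigroup r h y) \<le> 24 * kernel_const T * D * r powr ((\<beta> - 1) / 2) * \<bar>x - y\<bar>" .
  \<comment> \<open>The total mass of the kernel, which is not 1 because of the damping factor
    \<open>exp (- r)\<close>. What matters is that it is bounded and, by \<open>cc\<close>, the same
    at \<open>x\<close> and \<open>y\<close>.\<close>
  define c where "c x = integral {0..2*pi} (\<lambda>y. heat_kernel r (x - y) *\<^sub>R (1::real))" for x
  have cb: "\<bar>c x\<bar> \<le> 12 * kernel_const T" if x: "x \<in> {0..2*pi}" for x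
  proof -
    have s: "r powr - (1/2) * sqrt r = 1" using r by (simp add: powr_half_sqrt[symmetric] powr_add[symmetric])
    have "norm (c x) \<le> 3 * pi * ((kernel_const T * r powr - (1/2)) * 1) * sqrt r" unfolding c_def
      by (rule kernel_sup_bound[OF heat_kernel_continuous(1)[OF r(1)] heat_kernel_periodic(1) r(1) _ b(1) _ _ x]) (use K in auto)
    also have "\<dots> = 3 * pi * (kernel_const T * (r powr - (1/2) * sqrt r))" by simp
    also have "\<dots> \<le> 12 * kernel_const T" unfolding s using K pi_less_4 mult_right_mono[of "3 * pi" 12 "kernel_const T"] by simp
    finally show ?thesis by simp
  qed
  have cc: "c x = c y"
  proof -
    have z: "integral {0..2*pi} (\<lambda>y. heat_kernel1 r (x - y) *\<^sub>R (1::real)) = 0" for x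
      using integral_unique[OF kernel_integral[OF d(1), of 0 "2 * pi" x "1::real"]] heat_kernel_periodic(1)[of r "x - 2 * pi"] by simp
    have "norm (c x - c y) \<le> 0 * \<bar>x - y\<bar>" unfolding c_def
      by (rule lipschitz_from_vector_derivative[OF kernel_conv_deriv[OF d(1) heat_kernel_continuous(2)[OF r(1)]]])
         (use x y z in auto)
    then show ?thesis by simp
  qed
  have near: "norm (heat_semigroup r h x - c x *\<^sub>R h x) \<le> 24 * kernel_const T * D * r powr (\<beta> / 2)" if x: "x \<in> {0..2*pi}" for x
  proof -
    have i1: "(\<lambda>y. heat_kernel r (x - y) *\<^sub>R h y) integrable_on {0..2*pi}"
      by (intro integrable_continuous_real continuous_intros ch continuous_on_compose2[OF heat_kernel_continuous(1)[OF r(1)]]) auto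
    have i2: "(\<lambda>y. heat_kernel r (x - y) *\<^sub>R (1::real)) integrable_on {0..2*pi}"
      by (intro integrable_continuous_real continuous_intros continuous_on_compose2[OF heat_kernel_continuous(1)[OF r(1)]]) auto
    have hi: "((\<lambda>y. heat_kernel r (x - y) *\<^sub>R (h y - h x)) has_integral (heat_semigroup r h x - c x *\<^sub>R h x)) {0..2*pi}"
    proof -
      have "((\<lambda>y. heat_kernel r (x - y) *\<^sub>R h y - (heat_kernel r (x - y) *\<^sub>R (1::real)) *\<^sub>R h x) has_integral (heat_semigroup r h x - c x *\<^sub>R h x)) {0..2*pi}"
        unfolding heat_semigroup_eq_integral[OF r(1) ch] c_def
        by (intro has_integral_diff has_integral_scaleR_left integrable_integral i1 i2)
      then show ?thesis by (rule has_integral_eq[rotated]) (simp add: algebra_simps)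
    qed
    have "norm (integral {0..2*pi} (\<lambda>y. heat_kernel r (x - y) *\<^sub>R (h y - h x))) \<le>
       3 * pi * (2 * (kernel_const T * r powr - (1/2)) * D * r powr (\<beta> / 2)) * sqrt r"
    proof (rule wrapped_integral_bound[OF r(1)])
      show "(\<lambda>y. heat_kernel r (x - y) *\<^sub>R (h y - h x)) integrable_on {0..2*pi}" using hi by blast
      show "0 \<le> 2 * (kernel_const T * r powr - (1/2)) * D * r powr (\<beta> / 2)" using K D by simp
      fix y assume y: "y \<in> {0..2*pi}"
      have "\<exists>j\<in>{-1, 0, 1::int}. \<bar>x - y - 2 * pi * of_int j\<bar> \<le> pi \<and> norm (h y - h x) \<le> 2 * D * \<bar>x - y - 2 * pi * of_int j\<bar> powr \<beta>"
      proof -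
        consider "x - y < - pi" | "- pi \<le> x - y" "x - y \<le> pi" | "pi < x - y" by linarith
        then show ?thesis
        proof cases
          case 1
          have "norm (h y - h x) \<le> norm (h y - h (2 * pi)) + norm (h 0 - h x)"
            using norm_triangle_ineq[of "h y - h (2 * pi)" "h 0 - h x"] per by simp
          also have "\<dots> \<le> D * \<bar>y - 2 * pi\<bar> powr \<beta> + D * \<bar>0 - x\<bar> powr \<beta>" using x y by (intro add_mono h) auto
          also have "\<dots> \<le> D * \<bar>x - y + 2 * pi\<bar> powr \<beta> + D * \<bar>x - y + 2 * pi\<bar> powr \<beta>"
            using x y \<beta> D by (intro add_mono mult_left_mono powr_mono2) auto
          finally show ?thesis using 1 x y by (intro bexI[of _ "-1"]) auto
        next
          case 2
          have "0 \<le> D * \<bar>x - y\<bar> powr \<beta>" using D by simp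
          then show ?thesis using 2 h[OF y x] by (intro bexI[of _ 0]) (auto simp: abs_minus_commute)
        next
          case 3
          have "norm (h y - h x) \<le> norm (h y - h 0) + norm (h (2 * pi) - h x)"
            using norm_triangle_ineq[of "h y - h 0" "h (2 * pi) - h x"] per by simp
          also have "\<dots> \<le> D * \<bar>y - 0\<bar> powr \<beta> + D * \<bar>2 * pi - x\<bar> powr \<beta>" using x y by (intro add_mono h) auto
          also have "\<dots> \<le> D * \<bar>x - y - 2 * pi\<bar> powr \<beta> + D * \<bar>x - y - 2 * pi\<bar> powr \<beta>"
            using x y \<beta> D by (intro add_mono mult_left_mono powr_mono2) auto
          finally show ?thesis using 3 x y by (intro bexI[of _ 1]) auto
        qed
      qed
      then obtain j where j: "j \<in> {-1, 0, 1::int}" "\<bar>x - y - 2 * pi * of_int j\<bar> \<le> pi"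
        "norm (h y - h x) \<le> 2 * D * \<bar>x - y - 2 * pi * of_int j\<bar> powr \<beta>" by blast
      let ?w = "x - y - 2 * pi * of_int j"
      let ?e = "inverse (1 + ?w\<^sup>2 / r)"
      have e: "?e \<ge> 0" using r by (simp add: add_nonneg_nonneg)
      have "norm (heat_kernel r (x - y) *\<^sub>R (h y - h x)) = \<bar>heat_kernel r ?w\<bar> * norm (h y - h x)"
        using periodic_kernel_shift[where P="heat_kernel r", OF heat_kernel_periodic(1) j(1)] by simp
      also have "\<dots> \<le> (kernel_const T * r powr - (1/2) * ?e ^ 2) * (2 * D * \<bar>?w\<bar> powr \<beta>)"
        using j b(1)[OF j(2)] K by (intro mult_mono) auto
      also have "\<dots> = (2 * (kernel_const T * r powr - (1/2)) * D * ?e) * (\<bar>?w\<bar> powr \<beta> * ?e)" by (simp add: power2_eq_square)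
      also have "\<dots> \<le> (2 * (kernel_const T * r powr - (1/2)) * D * ?e) * r powr (\<beta> / 2)"
        using K D e \<beta> by (intro mult_left_mono powr_decay r) auto
      finally show "\<exists>j\<in>{-1, 0, 1::int}. norm (heat_kernel r (x - y) *\<^sub>R (h y - h x)) \<le>
          2 * (kernel_const T * r powr - (1/2)) * D * r powr (\<beta> / 2) * inverse (1 + (x - y - 2 * pi * of_int j)\<^sup>2 / r)"
        using j(1) by (intro bexI[of _ j]) (simp_all add: mult_ac)
    qed
    also have "\<dots> = 6 * pi * (kernel_const T * D * r powr (\<beta> / 2)) * (r powr - (1/2) * sqrt r)" by (simp add: mult_ac)
    also have "r powr - (1/2) * sqrt r = 1" using r by (simp add: powr_half_sqrt[symmetric] powr_add[symmetric])
    also have "6 * pi * (kernel_const T * D * r powr (\<beta> / 2)) * 1 \<le> 24 * (kernel_const T * D * r powr (\<beta> / 2))"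
      using K D pi_less_4 mult_right_mono[of "6 * pi" 24 "kernel_const T * D * r powr (\<beta> / 2)"] by simp
    finally show ?thesis using integral_unique[OF hi] by (simp add: mult_ac)
  qed
  show "norm (heat_semigroup r h x - heat_semigroup r h y) \<le> 96 * kernel_const T * D * \<bar>x - y\<bar> powr \<beta>"
  proof (cases "\<bar>x - y\<bar> \<le> sqrt r")
    case True
    show ?thesis
    proof (cases "x = y")
      case False
      have "\<bar>x - y\<bar> = \<bar>x - y\<bar> powr (1 - \<beta>) * \<bar>x - y\<bar> powr \<beta>" using False by (simp add: powr_add[symmetric])
      also have "\<dots> \<le> sqrt r powr (1 - \<beta>) * \<bar>x - y\<bar> powr \<beta>"
        using True \<beta> by (intro mult_right_mono powr_mono2) auto
      also have "sqrt r powr (1 - \<beta>) = r powr ((1 - \<beta>) / 2)" using r by (simp add: powr_half_sqrt[symmetric] powr_powr)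
      finally have "24 * kernel_const T * D * r powr ((\<beta> - 1) / 2) * \<bar>x - y\<bar> \<le>
        24 * kernel_const T * D * r powr ((\<beta> - 1) / 2) * (r powr ((1 - \<beta>) / 2) * \<bar>x - y\<bar> powr \<beta>)"
        using K D by (intro mult_left_mono) auto
      also have "\<dots> = 24 * (kernel_const T * D * \<bar>x - y\<bar> powr \<beta>) * (r powr ((\<beta> - 1) / 2) * r powr ((1 - \<beta>) / 2))" by (simp add: mult_ac)
      also have "r powr ((\<beta> - 1) / 2) * r powr ((1 - \<beta>) / 2) = 1" using r by (simp add: powr_add[symmetric] add_divide_distrib[symmetric])
      also have "24 * (kernel_const T * D * \<bar>x - y\<bar> powr \<beta>) * 1 \<le> 96 * (kernel_const T * D * \<bar>x - y\<bar> powr \<beta>)"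
        using K D by simp
      finally show ?thesis using lip by (simp add: mult_ac)
    qed simp
  next
    case False
    have rb: "r powr (\<beta> / 2) \<le> \<bar>x - y\<bar> powr \<beta>"
    proof -
      have "r powr (\<beta> / 2) = sqrt r powr \<beta>" using r by (simp add: powr_half_sqrt[symmetric] powr_powr)
      also have "\<dots> \<le> \<bar>x - y\<bar> powr \<beta>" using False \<beta> r by (intro powr_mono2) auto
      finally show ?thesis .
    qed
    have eq: "heat_semigroup r h x - heat_semigroup r h y = (heat_semigroup r h x - c x *\<^sub>R h x) - (heat_semigroup r h y - c y *\<^sub>R h y) + c x *\<^sub>R (h x - h y)"
      by (simp add: cc algebra_simps)
    have "norm (heat_semigroup r h x - heat_semigroup r h y) \<le>
       norm (heat_semigroup r h x - c x *\<^sub>R h x) + norm (heat_semigroup r h y - c y *\<^sub>R h y) + norm (c x *\<^sub>R (h x - h y))"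
      unfolding eq by (intro norm_triangle_mono norm_triangle_le_diff) auto
    also have "\<dots> \<le> 24 * kernel_const T * D * r powr (\<beta> / 2) + 24 * kernel_const T * D * r powr (\<beta> / 2) + 12 * kernel_const T * (D * \<bar>x - y\<bar> powr \<beta>)"
      unfolding norm_scaleR using K cb[OF x] h[OF x y] by (intro add_mono near x y mult_mono) auto
    also have "\<dots> \<le> 24 * kernel_const T * D * \<bar>x - y\<bar> powr \<beta> + 24 * kernel_const T * D * \<bar>x - y\<bar> powr \<beta> + 12 * kernel_const T * (D * \<bar>x - y\<bar> powr \<beta>)"
      using K D rb by (intro add_mono mult_left_mono) auto
    also have "\<dots> \<le> 96 * (kernel_const T * D * \<bar>x - y\<bar> powr \<beta>)" using K D by (simp add: algebra_simps)
    finally show ?thesis by (simp add: mult_ac)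
  qed
qed

section \<open>Rough integrals against a smooth weight\<close>

lemma division_interval:
  fixes L :: real
  assumes "\<D> division_of {0..L}" "K \<in> \<D>"
  shows "K = {Inf K..Sup K}" "0 \<le> Inf K" "Inf K \<le> Sup K" "Sup K \<le> L"
proof -
  note d = division_ofD(2-4)[OF assms(1) assms(2)]
  from d(3) obtain a b where ab: "K = cbox a b" "K \<noteq> {}" "K \<subseteq> {0..L}" using d(1,2) by auto
  then have le: "a \<le> b" by auto
  then have K: "K = {a..b}" "Inf K = a" "Sup K = b" using ab by auto
  then show "K = {Inf K..Sup K}" "Inf K \<le> Sup K" using le by auto
  have "a \<in> K" "b \<in> K" using K le by auto
  then show "0 \<le> Inf K" "Sup K \<le> L" using ab K by auto
qed

text \<open>A division is an unordered set of intervals; tagging each interval by its left end point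
  reduces the claim to telescoping over a tagged division.\<close>

lemma division_telescope:
  fixes F :: "real \<Rightarrow> 'a::real_normed_vector"
  assumes \<D>: "\<D> division_of {0..L}" and L: "L \<ge> 0"
  shows "(\<Sum>K\<in>\<D>. F (Sup K) - F (Inf K)) = F L - F 0"
proof -
  define p where "p = (\<lambda>K. (Inf K, K)) ` \<D>"
  note d = division_ofD[OF \<D>]
  note i = division_interval[OF \<D>]
  have "p tagged_division_of {0..L}"
    unfolding tagged_division_of
  proof (intro conjI allI impI)
    show "finite p" using d(1) by (simp add: p_def)
    fix x K assume xK: "(x, K) \<in> p"
    then have K: "K \<in> \<D>" "x = Inf K" by (auto simp: p_def)
    then show "x \<in> K" using i[OF K(1)] by (metis atLeastAtMost_iff order_refl)
    show "K \<subseteq> {0..L}" "\<exists>a b. K = cbox a b" using d K by auto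
  next
    fix x1 K1 x2 K2 assume "(x1, K1) \<in> p \<and> (x2, K2) \<in> p \<and> (x1, K1) \<noteq> (x2, K2)"
    then show "interior K1 \<inter> interior K2 = {}" using d(5) by (auto simp: p_def)
  next
    have "{K. \<exists>x. (x, K) \<in> p} = \<D>" by (auto simp: p_def)
    then show "\<Union> {K. \<exists>x. (x, K) \<in> p} = {0..L}" using d(6) by simp
  qed
  from additive_tagged_division_1[OF L this, of F]
  have "(\<Sum>(x, K)\<in>p. F (Sup K) - F (Inf K)) = F L - F 0" .
  moreover have "(\<Sum>(x, K)\<in>p. F (Sup K) - F (Inf K)) = (\<Sum>K\<in>\<D>. F (Sup K) - F (Inf K))"
    unfolding p_def by (subst sum.reindex) (auto simp: inj_on_def)
  ultimately show ?thesis by simp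
qed

text \<open>The increments of \<open>F\<close> telescope, and the total error is at most
  \<open>K * \<eta> powr (\<sigma> - 1)\<close> times the total length \<open>L\<close>. Since
  \<sigma> > 1 this tends to 0 with the mesh.\<close>

lemma germ_sum_limit:
  fixes F :: "real \<Rightarrow> 'a::real_normed_vector"
  assumes L: "L \<ge> 0" and K: "K \<ge> 0" and \<sigma>: "\<sigma> > 1" and \<epsilon>: "\<epsilon> > 0"
    and s: "\<And>a b. 0 \<le> a \<Longrightarrow> a \<le> b \<Longrightarrow> b \<le> L \<Longrightarrow> norm (s a b - (F b - F a)) \<le> K * (b - a) powr \<sigma>"
  shows "\<exists>\<eta>>0. \<forall>\<D>. \<D> division_of {0..L} \<and> (\<forall>k\<in>\<D>. Sup k - Inf k < \<eta>) \<longrightarrow>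
    norm ((\<Sum>k\<in>\<D>. s (Inf k) (Sup k)) - (F L - F 0)) < \<epsilon>"
proof -
  have "((\<lambda>\<eta>. K * L * \<eta> powr (\<sigma> - 1)) \<longlongrightarrow> 0) (at_right 0)"
    using \<sigma> by (intro tendsto_mult_right_zero tendsto_zero_powrI[where b="\<sigma> - 1"])
      (auto intro!: tendsto_eq_intros simp: eventually_at_filter)
  then have "\<forall>\<^sub>F \<eta> in at_right 0. K * L * \<eta> powr (\<sigma> - 1) < \<epsilon>" using \<epsilon> by (rule order_tendstoD)
  moreover have "\<forall>\<^sub>F \<eta> in at_right (0::real). \<eta> > 0" by (simp add: eventually_at_filter)
  ultimately have "\<forall>\<^sub>F \<eta> in at_right 0. \<eta> > 0 \<and> K * L * \<eta> powr (\<sigma> - 1) < \<epsilon>" by eventually_elim auto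
  then obtain \<eta> where \<eta>: "\<eta> > 0" "K * L * \<eta> powr (\<sigma> - 1) < \<epsilon>"
    using eventually_happens'[of "at_right (0::real)"] by (auto simp: trivial_limit_at_right_real)
  show ?thesis
  proof (intro exI[of _ \<eta>] conjI allI impI)
    fix \<D> assume \<D>: "\<D> division_of {0..L} \<and> (\<forall>k\<in>\<D>. Sup k - Inf k < \<eta>)"
    note i = division_interval[OF conjunct1[OF \<D>]]
    have "norm (\<Sum>k\<in>\<D>. s (Inf k) (Sup k) - (F (Sup k) - F (Inf k))) \<le> (\<Sum>k\<in>\<D>. K * \<eta> powr (\<sigma> - 1) * (Sup k - Inf k))"
    proof (rule sum_norm_le)
      fix k assume k: "k \<in> \<D>"
      let ?l = "Sup k - Inf k"
      have l: "0 \<le> ?l" "?l \<le> \<eta>" using i[OF k] \<D> k by auto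
      have "norm (s (Inf k) (Sup k) - (F (Sup k) - F (Inf k))) \<le> K * ?l powr \<sigma>" by (rule s) (use i[OF k] in auto)
      also have "?l powr \<sigma> = ?l powr (\<sigma> - 1) * ?l" using l by (cases "?l = 0") (auto simp: powr_mult_base[symmetric] powr_diff)
      also have "K * (?l powr (\<sigma> - 1) * ?l) \<le> K * (\<eta> powr (\<sigma> - 1) * ?l)"
        using K l \<sigma> by (intro mult_left_mono mult_right_mono powr_mono2) auto
      finally show "norm (s (Inf k) (Sup k) - (F (Sup k) - F (Inf k))) \<le> K * \<eta> powr (\<sigma> - 1) * ?l" by (simp add: mult.assoc)
    qed
    also have "\<dots> = K * \<eta> powr (\<sigma> - 1) * L"
      unfolding sum_distrib_left[symmetric] using division_telescope[OF conjunct1[OF \<D>] L, of "\<lambda>x. x"] by simp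
    also have "\<dots> < \<epsilon>" using \<eta> by (simp add: mult_ac)
    finally show "norm ((\<Sum>k\<in>\<D>. s (Inf k) (Sup k)) - (F L - F 0)) < \<epsilon>"
      unfolding sum_subtractf[of "\<lambda>k. s (Inf k) (Sup k)"] division_telescope[OF conjunct1[OF \<D>] L, of F] .
  qed (use \<eta> in auto)
qed

lemma fine_division_ex:
  assumes "\<eta> > 0"
  shows "\<exists>\<D>. \<D> division_of {0..L::real} \<and> (\<forall>k\<in>\<D>. Sup k - Inf k < \<eta>)"
proof -
  have "gauge (\<lambda>x::real. ball x (\<eta> / 3))" using assms by (intro gauge_ball) auto
  then obtain p where p: "p tagged_division_of {0..L}" "(\<lambda>x. ball x (\<eta> / 3)) fine p"
    using fine_division_exists_real by blast
  have \<D>: "snd ` p division_of {0..L}" by (rule division_of_tagged_division[OF p(1)])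
  moreover have "Sup k - Inf k < \<eta>" if k: "k \<in> snd ` p" for k
  proof -
    from k obtain x where x: "(x, k) \<in> p" by auto
    then have "k \<subseteq> ball x (\<eta> / 3)" using p(2) by (auto simp: fine_def)
    moreover have "Sup k \<in> k" "Inf k \<in> k" using division_interval[OF \<D> k] by (metis atLeastAtMost_iff order_refl)+
    ultimately have "dist x (Sup k) < \<eta> / 3" "dist x (Inf k) < \<eta> / 3" by auto
    then show ?thesis using assms unfolding dist_real_def by linarith
  qed
  ultimately show ?thesis by blast
qed

text \<open>The definition by \<open>THE\<close> requires uniqueness: one division can be chosen
  fine enough for both candidate limits at once.\<close>

lemma rough_integral_eqI:
  assumes I: "has_rough_integral R Y Y' I"
  shows "rough_integral R Y Y' = I"
  unfolding rough_integral_def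
proof (rule the_equality)
  show "has_rough_integral R Y Y' I" by (rule I)
next
  fix J assume J: "has_rough_integral R Y Y' J"
  show "J = I"
  proof (rule ccontr)
    assume "J \<noteq> I"
    define \<epsilon> where "\<epsilon> = norm (J - I) / 2"
    have \<epsilon>: "\<epsilon> > 0" using \<open>J \<noteq> I\<close> by (simp add: \<epsilon>_def)
    obtain \<eta>1 where \<eta>1: "\<eta>1 > 0" "\<And>P. P division_of {0..2*pi} \<Longrightarrow> (\<forall>K\<in>P. Sup K - Inf K < \<eta>1) \<Longrightarrow>
        norm ((\<Sum>K\<in>P. rough_summand R Y Y' (Inf K) (Sup K)) - I) < \<epsilon>"
      using I \<epsilon> unfolding has_rough_integral_def by meson
    obtain \<eta>2 where \<eta>2: "\<eta>2 > 0" "\<And>P. P division_of {0..2*pi} \<Longrightarrow> (\<forall>K\<in>P. Sup K - Inf K < \<eta>2) \<Longrightarrow>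
        norm ((\<Sum>K\<in>P. rough_summand R Y Y' (Inf K) (Sup K)) - J) < \<epsilon>"
      using J \<epsilon> unfolding has_rough_integral_def by meson
    obtain \<D> where \<D>: "\<D> division_of {0..2*pi}" "\<forall>k\<in>\<D>. Sup k - Inf k < min \<eta>1 \<eta>2"
      using fine_division_ex[of "min \<eta>1 \<eta>2" "2 * pi"] \<eta>1(1) \<eta>2(1) by fastforce
    let ?S = "\<Sum>K\<in>\<D>. rough_summand R Y Y' (Inf K) (Sup K)"
    have "norm (?S - I) < \<epsilon>" "norm (?S - J) < \<epsilon>" using \<eta>1(2)[OF \<D>(1)] \<eta>2(2)[OF \<D>(1)] \<D>(2) by auto
    moreover have "norm (J - I) \<le> norm (?S - I) + norm (?S - J)"
      using norm_triangle_ineq4[of "?S - I" "?S - J"] by simp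
    ultimately show False unfolding \<epsilon>_def by linarith
  qed
qed

text \<open>The weight multiplies the germ by its value at the left end point, so the sums converge
  to a Stieltjes integral of the weight against the sewn path \<open>Z\<close>. Integration by parts
  expresses it through the values of \<open>Z\<close>, which makes the kernel bounds for
  \<open>stieltjes_conv\<close> available.\<close>

lemma weighted_rough_integral:
  fixes R :: "'n::finite path \<times> 'n area"
  assumes P: "\<And>z. (P has_real_derivative P' z) (at z)" and cP': "continuous_on UNIV P'"
    and per: "\<And>z. P (z + 2 * pi) = P z"
    and \<theta>: "\<theta> > 1" and K: "K \<ge> 0" and \<alpha>: "0 < \<alpha>" and E: "E \<ge> 0" and Z0: "Z 0 = 0"
    and germ: "\<And>a b. 0 \<le> a \<Longrightarrow> a \<le> b \<Longrightarrow> b \<le> 2 * pi \<Longrightarrow> norm (Z b - Z a - rough_summand R Y Y' a b) \<le> K * (b - a) powr \<theta>"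
    and Z: "\<And>x y. x \<in> {0..2*pi} \<Longrightarrow> y \<in> {0..2*pi} \<Longrightarrow> norm (Z x - Z y) \<le> E * \<bar>x - y\<bar> powr \<alpha>"
  shows "rough_integral R (\<lambda>y. P (x - y) *\<^sub>R Y y) (\<lambda>y. \<chi> i j k. P (x - y) * Y' y $ i $ j $ k) = stieltjes_conv P P' Z x"
proof (rule rough_integral_eqI)
  have contZ: "continuous_on {0..2*pi} Z" by (rule hoelder_continuous_on[OF \<alpha> Z])
  have cP: "continuous_on UNIV P" using P by (meson DERIV_isCont continuous_at_imp_continuous_on)
  have "bounded ((\<lambda>y. P (x - y)) ` {0..2*pi})" "bounded ((\<lambda>y. P' (x - y)) ` {0..2*pi})"
    by (intro compact_imp_bounded compact_continuous_image continuous_on_compose2[OF cP] continuous_on_compose2[OF cP'] continuous_intros; auto)+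
  from this(1)[unfolded bounded_pos] this(2)[unfolded bounded_pos]
  obtain B1 B2 where B: "B1 > 0" "\<And>y. y \<in> {0..2*pi} \<Longrightarrow> norm (P (x - y)) \<le> B1"
      "B2 > 0" "\<And>y. y \<in> {0..2*pi} \<Longrightarrow> norm (P' (x - y)) \<le> B2"
    by (meson image_eqI)
  have summ: "rough_summand R (\<lambda>y. P (x - y) *\<^sub>R Y y) (\<lambda>y. \<chi> i j k. P (x - y) * Y' y $ i $ j $ k) a b
      = P (x - a) *\<^sub>R rough_summand R Y Y' a b" for a b
    by (simp add: rough_summand_def vec_eq_iff sum_distrib_left distrib_left mult.assoc)
  define G where "G y = integral {0..y} (\<lambda>s. P' (x - s) *\<^sub>R Z s)" for y
  \<comment> \<open>The indefinite Stieltjes integral of the weight against \<open>Z\<close>,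
    integrated by parts. Its increment over \<open>{a..b}\<close> differs from the weighted germ by
    the germ error, of order \<theta>, and by an integral of \<open>P'\<close> against
    \<open>Z b - Z s\<close>, of order \<open>1 + \<alpha>\<close>.\<close>
  define F where "F y = P (x - y) *\<^sub>R Z y + G y" for y
  have int: "(\<lambda>s. P' (x - s) *\<^sub>R Z s) integrable_on {a..b}" if "0 \<le> a" "b \<le> 2 * pi" for a b
    using that by (intro integrable_continuous_real continuous_intros continuous_on_subset[OF contZ] continuous_on_compose2[OF cP']) auto
  \<comment> \<open>Both errors have an order above 1. The smaller order is used for the two of
    them, and the powers of \<open>2 * pi\<close> in \<open>C\<close> make up for the
    difference.\<close>
  define \<sigma> where "\<sigma> = min \<theta> (1 + \<alpha>)"
  define C where "C = B1 * K * (2 * pi) powr (\<theta> - \<sigma>) + B2 * E * (2 * pi) powr (1 + \<alpha> - \<sigma>)"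
  have bound: "norm (P (x - a) *\<^sub>R rough_summand R Y Y' a b - (F b - F a)) \<le> C * (b - a) powr \<sigma>"
    if ab: "0 \<le> a" "a \<le> b" "b \<le> 2 * pi" for a b
  proof -
    have Gab: "G b - G a = integral {a..b} (\<lambda>s. P' (x - s) *\<^sub>R Z s)"
      using Henstock_Kurzweil_Integration.integral_combine[OF ab(1,2) int[OF order_refl ab(3)]] unfolding G_def
      by (simp add: algebra_simps)
    have h1: "((\<lambda>s. P' (x - s) *\<^sub>R Z b) has_integral (P (x - a) - P (x - b)) *\<^sub>R Z b) {a..b}"
      by (rule kernel_integral[OF P ab(2)])
    have h2: "((\<lambda>s. P' (x - s) *\<^sub>R Z s) has_integral (G b - G a)) {a..b}"
      unfolding Gab by (rule integrable_integral[OF int]) (use ab in auto)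
    from has_integral_diff[OF h1 h2]
    have h: "((\<lambda>s. P' (x - s) *\<^sub>R (Z b - Z s)) has_integral ((P (x - a) - P (x - b)) *\<^sub>R Z b - (G b - G a))) (cbox a b)"
      by (simp add: scaleR_diff_right)
    have "norm ((P (x - a) - P (x - b)) *\<^sub>R Z b - (G b - G a)) \<le> (B2 * (E * (b - a) powr \<alpha>)) * measure lborel (cbox a b)"
    proof (rule has_integral_bound[OF _ h])
      show "0 \<le> B2 * (E * (b - a) powr \<alpha>)" using B E by simp
      fix s assume "s \<in> cbox a b"
      then have s: "a \<le> s" "s \<le> b" by auto
      have "norm (Z b - Z s) \<le> E * \<bar>b - s\<bar> powr \<alpha>" using s ab by (intro Z) auto
      also have "\<dots> \<le> E * (b - a) powr \<alpha>" using s E \<alpha> by (intro mult_left_mono powr_mono2) auto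
      finally show "norm (P' (x - s) *\<^sub>R (Z b - Z s)) \<le> B2 * (E * (b - a) powr \<alpha>)"
        unfolding norm_scaleR using B(3) B(4)[of s] s ab by (intro mult_mono) auto
    qed
    also have "\<dots> = B2 * E * (b - a) powr (1 + \<alpha>)"
      using ab by (cases "a = b") (auto simp: powr_add)
    finally have e2: "norm ((P (x - a) - P (x - b)) *\<^sub>R Z b - (G b - G a)) \<le> B2 * E * (b - a) powr (1 + \<alpha>)" .
    have "norm (P (x - a) *\<^sub>R (Z b - Z a - rough_summand R Y Y' a b)) \<le> B1 * (K * (b - a) powr \<theta>)"
      unfolding norm_scaleR using B(1) B(2)[of a] germ[OF ab] ab by (intro mult_mono) auto
    then have e1: "norm (P (x - a) *\<^sub>R (Z b - Z a - rough_summand R Y Y' a b)) \<le> B1 * K * (b - a) powr \<theta>"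
      by (simp add: mult.assoc)
    have eq: "P (x - a) *\<^sub>R rough_summand R Y Y' a b - (F b - F a) =
       ((P (x - a) - P (x - b)) *\<^sub>R Z b - (G b - G a)) - P (x - a) *\<^sub>R (Z b - Z a - rough_summand R Y Y' a b)"
      unfolding F_def by (simp add: algebra_simps)
    have pw: "(b - a) powr c \<le> (2 * pi) powr (c - \<sigma>) * (b - a) powr \<sigma>" if "c \<ge> \<sigma>" for c
    proof -
      have "(b - a) powr c = (b - a) powr (c - \<sigma>) * (b - a) powr \<sigma>" by (simp add: powr_add[symmetric])
      also have "\<dots> \<le> (2 * pi) powr (c - \<sigma>) * (b - a) powr \<sigma>" using that ab by (intro mult_right_mono powr_mono2) auto
      finally show ?thesis .
    qed
    have "norm (P (x - a) *\<^sub>R rough_summand R Y Y' a b - (F b - F a)) \<le> B2 * E * (b - a) powr (1 + \<alpha>) + B1 * K * (b - a) powr \<theta>"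
      unfolding eq using norm_triangle_ineq4[of "(P (x - a) - P (x - b)) *\<^sub>R Z b - (G b - G a)"
        "P (x - a) *\<^sub>R (Z b - Z a - rough_summand R Y Y' a b)"] e1 e2 by linarith
    also have "\<dots> \<le> B2 * E * ((2 * pi) powr (1 + \<alpha> - \<sigma>) * (b - a) powr \<sigma>) + B1 * K * ((2 * pi) powr (\<theta> - \<sigma>) * (b - a) powr \<sigma>)"
      using B E K by (intro add_mono mult_left_mono pw) (auto simp: \<sigma>_def)
    finally show ?thesis by (simp add: C_def algebra_simps)
  qed
  have FF': "F (2 * pi) - F 0 = stieltjes_conv P P' Z x"
    unfolding F_def G_def stieltjes_conv_def using per[of "x - 2 * pi"] by (simp add: Z0)
  have C: "C \<ge> 0" unfolding C_def using B K E by simp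
  have \<sigma>: "\<sigma> > 1" unfolding \<sigma>_def using \<theta> \<alpha> by simp
  show "has_rough_integral R (\<lambda>y. P (x - y) *\<^sub>R Y y) (\<lambda>y. \<chi> i j k. P (x - y) * Y' y $ i $ j $ k) (stieltjes_conv P P' Z x)"
    unfolding has_rough_integral_def summ FF'[symmetric]
    by (intro allI impI germ_sum_limit[OF _ C \<sigma> _ bound]) auto
qed

section \<open>A singular Gronwall inequality\<close>

lemma nn_integral_powr_minus:
  fixes t a :: real
  assumes "a < 1" "t \<ge> 0"
  shows "(\<integral>\<^sup>+s\<in>{0..t}. ennreal (s powr - a) \<partial>lborel) = ennreal (t powr (1 - a) / (1 - a))"
proof -
  have "((\<lambda>s. s powr - a) has_integral (t powr (-a + 1) / (-a + 1))) {0..t}"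
    using has_integral_powr_from_0[of "-a" t] assms by simp
  from nn_integral_has_integral_lebesgue[OF _ this]
  have "(\<integral>\<^sup>+s. ennreal (indicator {0..t} s * s powr - a) \<partial>lborel) = ennreal (t powr (1 - a) / (1 - a))"
    by simp
  moreover have "(\<integral>\<^sup>+s. ennreal (indicator {0..t} s * s powr - a) \<partial>lborel) = (\<integral>\<^sup>+s\<in>{0..t}. ennreal (s powr - a) \<partial>lborel)"
    by (intro nn_integral_cong) (auto simp: indicator_def)
  ultimately show ?thesis by simp
qed

lemma nn_integral_powr_minus_reflect:
  fixes t a :: real
  assumes "a < 1" "t \<ge> 0"
  shows "(\<integral>\<^sup>+s\<in>{0..t}. ennreal ((t - s) powr - a) \<partial>lborel) = ennreal (t powr (1 - a) / (1 - a))"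
proof -
  have "(\<integral>\<^sup>+s\<in>{0..t}. ennreal (s powr - a) \<partial>lborel) =
     (\<integral>\<^sup>+s. ennreal ((t + (-1) * s) powr - a) * indicator {0..t} (t + (-1) * s) \<partial>lborel)"
    using nn_integral_real_affine[of "\<lambda>s. ennreal (s powr - a) * indicator {0..t} s" "-1" t] by simp
  also have "\<dots> = (\<integral>\<^sup>+s\<in>{0..t}. ennreal ((t - s) powr - a) \<partial>lborel)"
    by (intro nn_integral_cong) (auto simp: indicator_def)
  finally show ?thesis using nn_integral_powr_minus[OF assms] by simp
qed

text \<open>At least one of \<open>s\<close> and \<open>t - s\<close> is not below
  \<open>t / 2\<close>, and its negative power is at most that of \<open>t / 2\<close>.\<close>

lemma powr_minus_mult_le:
  fixes s t a b :: real
  assumes "0 < s" "s < t" "a \<ge> 0" "b \<ge> 0"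
  shows "(t - s) powr - a * s powr - b \<le> (t / 2) powr - b * (t - s) powr - a + (t / 2) powr - a * s powr - b"
proof (cases "s \<ge> t / 2")
  case True
  then have "s powr - b \<le> (t / 2) powr - b" using assms by (intro powr_mono2') auto
  then have "s powr - b * (t - s) powr - a \<le> (t / 2) powr - b * (t - s) powr - a" by (intro mult_right_mono) auto
  moreover have "(t / 2) powr - a * s powr - b \<ge> 0" by simp
  ultimately show ?thesis unfolding mult.commute[of "(t - s) powr - a" "s powr - b"] by linarith
next
  case False
  then have "(t - s) powr - a \<le> (t / 2) powr - a" using assms by (intro powr_mono2') auto
  then have "(t - s) powr - a * s powr - b \<le> (t / 2) powr - a * s powr - b" by (intro mult_right_mono) auto
  moreover have "(t / 2) powr - b * (t - s) powr - a \<ge> 0" by simp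
  ultimately show ?thesis by linarith
qed

text \<open>A crude bound for a Beta integral which keeps the exact power of \<open>t\<close>. The
  factors 2 in the constant bound \<open>2 powr b\<close> and \<open>2 powr a\<close>, which arise
  from the powers of \<open>t / 2\<close>.\<close>

lemma beta_integral_le:
  fixes t a b :: real
  assumes ab: "0 \<le> a" "a < 1" "0 \<le> b" "b < 1" and t: "t > 0"
  shows "(\<integral>\<^sup>+s\<in>{0..t}. ennreal ((t - s) powr - a * s powr - b) \<partial>lborel) \<le>
    ennreal ((2 / (1 - a) + 2 / (1 - b)) * t powr (1 - a - b))"
proof -
  have "(\<integral>\<^sup>+s\<in>{0..t}. ennreal ((t - s) powr - a * s powr - b) \<partial>lborel) \<le>
     (\<integral>\<^sup>+s. ennreal ((t / 2) powr - b) * (ennreal ((t - s) powr - a) * indicator {0..t} s) +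
          ennreal ((t / 2) powr - a) * (ennreal (s powr - b) * indicator {0..t} s) \<partial>lborel)"
  proof (intro nn_integral_mono)
    fix s :: real
    show "ennreal ((t - s) powr - a * s powr - b) * indicator {0..t} s \<le>
      ennreal ((t / 2) powr - b) * (ennreal ((t - s) powr - a) * indicator {0..t} s) +
          ennreal ((t / 2) powr - a) * (ennreal (s powr - b) * indicator {0..t} s)"
    proof (cases "0 < s \<and> s < t")
      case True
      then show ?thesis using powr_minus_mult_le[of s t a b] ab t
        by (simp add: ennreal_mult[symmetric] ennreal_plus[symmetric] del: ennreal_plus)
    next
      case False
      then show ?thesis by (auto simp: indicator_def)
    qed
  qed
  also have "\<dots> = ennreal ((t / 2) powr - b) * ennreal (t powr (1 - a) / (1 - a)) +
     ennreal ((t / 2) powr - a) * ennreal (t powr (1 - b) / (1 - b))"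
    using ab t nn_integral_powr_minus_reflect[of a t] nn_integral_powr_minus[of b t]
    by (subst nn_integral_add) (auto simp: nn_integral_cmult)
  also have "\<dots> = ennreal ((t / 2) powr - b * (t powr (1 - a) / (1 - a)) + (t / 2) powr - a * (t powr (1 - b) / (1 - b)))"
    using ab by (simp add: ennreal_mult[symmetric] ennreal_plus[symmetric] del: ennreal_plus)
  also have "\<dots> \<le> ennreal ((2 / (1 - a) + 2 / (1 - b)) * t powr (1 - a - b))"
  proof (rule ennreal_leI)
    have half: "(t / 2) powr - c \<le> 2 * t powr - c" if "0 \<le> c" "c < 1" for c
    proof -
      have "(t / 2) powr - c = t powr - c * 2 powr c" using t
        by (simp add: powr_divide powr_minus field_simps)
      also have "\<dots> \<le> t powr - c * 2 powr 1" using that by (intro mult_left_mono powr_mono) auto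
      finally show ?thesis by simp
    qed
    have "(t / 2) powr - b * (t powr (1 - a) / (1 - a)) \<le> 2 * t powr - b * (t powr (1 - a) / (1 - a))"
      using ab half by (intro mult_right_mono) auto
    moreover have "(t / 2) powr - a * (t powr (1 - b) / (1 - b)) \<le> 2 * t powr - a * (t powr (1 - b) / (1 - b))"
      using ab half by (intro mult_right_mono) auto
    moreover have "t powr - b * t powr (1 - a) = t powr (1 - a - b)" "t powr - a * t powr (1 - b) = t powr (1 - a - b)"
      using t arg_cong[of "1 - b - a" "1 - a - b" "\<lambda>c. t powr c"] by (simp_all add: powr_add[symmetric])
    then have "2 * t powr - b * (t powr (1 - a) / (1 - a)) = 2 / (1 - a) * t powr (1 - a - b)"
      "2 * t powr - a * (t powr (1 - b) / (1 - b)) = 2 / (1 - b) * t powr (1 - a - b)"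
      by (metis (no_types, opaque_lifting) mult.assoc times_divide_eq_left times_divide_eq_right)+
    ultimately show "(t / 2) powr - b * (t powr (1 - a) / (1 - a)) + (t / 2) powr - a * (t powr (1 - b) / (1 - b))
       \<le> (2 / (1 - a) + 2 / (1 - b)) * t powr (1 - a - b)"
      unfolding distrib_right by linarith
  qed
  finally show ?thesis .
qed

text \<open>Trades a part of the integrability of the kernel for a small factor: under an
  exponential weight of rate \<mu> the singularity worsens from \<gamma> to
  \<open>\<gamma> + \<eta>\<close>, but a factor \<open>\<mu> powr - \<eta>\<close> appears.\<close>

lemma exp_minus_le_powr:
  fixes x \<eta> :: real
  assumes "x > 0" "0 \<le> \<eta>" "\<eta> \<le> 1"
  shows "exp (- x) \<le> x powr - \<eta>"
proof -
  have "x powr \<eta> \<le> exp x"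
  proof (cases "x \<le> 1")
    case True
    then have "x powr \<eta> \<le> 1" using assms by (intro powr_le1) auto
    then show ?thesis using assms by (meson one_le_exp_iff less_imp_le order_trans)
  next
    case False
    then have "x powr \<eta> \<le> x powr 1" using assms by (intro powr_mono) auto
    also have "\<dots> \<le> exp x" using assms exp_ge_add_one_self[of x] by (simp, linarith)
    finally show ?thesis .
  qed
  then show ?thesis using assms by (simp add: exp_minus powr_minus le_imp_inverse_le)
qed

text \<open>Comparison: the excess of \<open>N\<close> over the supersolution \<open>H\<close> is a subsolution of the homogeneous
  inequality, hence vanishes because the kernel is a contraction in an exponentially weighted norm.\<close>

lemma singular_comparison:
  fixes N H h :: "real \<Rightarrow> ennreal" and C \<gamma> T :: real
  assumes [measurable]: "N \<in> borel_measurable borel" "H \<in> borel_measurable borel"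
    and \<gamma>: "0 \<le> \<gamma>" "\<gamma> < 1" and C: "C \<ge> 0" and T: "T \<ge> 0"
    and fin: "(\<integral>\<^sup>+t\<in>{0..T}. N t \<partial>lborel) < \<infinity>"
    and Hfin: "\<And>t. H t < \<infinity>"
    and sub: "AE t in lborel. t \<in> {0..T} \<longrightarrow>
       N t \<le> h t + (\<integral>\<^sup>+s\<in>{0..t}. ennreal (C * (t - s) powr - \<gamma>) * N s \<partial>lborel)"
    and super: "\<And>t. 0 < t \<Longrightarrow> t \<le> T \<Longrightarrow>
       h t + (\<integral>\<^sup>+s\<in>{0..t}. ennreal (C * (t - s) powr - \<gamma>) * H s \<partial>lborel) \<le> H t"
  shows "AE t in lborel. t \<in> {0..T} \<longrightarrow> N t \<le> H t"
proof -
  define k where "k r = ennreal (C * r powr - \<gamma>)" for r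
  have [measurable]: "k \<in> borel_measurable borel" unfolding k_def by measurable
  \<comment> \<open>Subtraction in \<open>ennreal\<close> is truncated at 0, so \<open>D\<close> is
    the positive part of the excess.\<close>
  define D where "D t = N t - H t" for t
  have [measurable]: "D \<in> borel_measurable borel" unfolding D_def by measurable
  have DN: "D t \<le> N t" for t unfolding D_def by (simp add: ennreal_minus_le_iff)
  have NHD: "N t \<le> H t + D t" for t unfolding D_def
    using diff_add_cancel_ennreal[of "H t" "N t"] add_increasing2[of "N t - H t" "N t" "H t"]
    by (cases "N t \<le> H t") (simp_all add: not_le less_imp_le add.commute[of "H t"])
  have Dsub: "AE t in lborel. t \<in> {0..T} \<longrightarrow> D t \<le> (\<integral>\<^sup>+s\<in>{0..t}. k (t - s) * D s \<partial>lborel)"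
    using sub AE_lborel_singleton[of 0]
  proof eventually_elim
    case (elim t)
    show ?case
    proof
      assume t: "t \<in> {0..T}"
      then have tp: "0 < t" "t \<le> T" using elim by auto
      have "N t \<le> h t + (\<integral>\<^sup>+s\<in>{0..t}. k (t - s) * N s \<partial>lborel)" using elim t unfolding k_def by simp
      also have "(\<integral>\<^sup>+s\<in>{0..t}. k (t - s) * N s \<partial>lborel) \<le>
          (\<integral>\<^sup>+s. k (t - s) * H s * indicator {0..t} s + k (t - s) * D s * indicator {0..t} s \<partial>lborel)"
        using NHD by (intro nn_integral_mono) (auto simp: indicator_def distrib_left[symmetric] intro!: mult_left_mono)
      also have "\<dots> = (\<integral>\<^sup>+s\<in>{0..t}. k (t - s) * H s \<partial>lborel) + (\<integral>\<^sup>+s\<in>{0..t}. k (t - s) * D s \<partial>lborel)"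
        by (rule nn_integral_add) measurable
      finally have "N t \<le> (h t + (\<integral>\<^sup>+s\<in>{0..t}. k (t - s) * H s \<partial>lborel)) + (\<integral>\<^sup>+s\<in>{0..t}. k (t - s) * D s \<partial>lborel)"
        by (simp add: add.assoc add_left_mono)
      also have "\<dots> \<le> H t + (\<integral>\<^sup>+s\<in>{0..t}. k (t - s) * D s \<partial>lborel)"
        using super[OF tp] unfolding k_def by (intro add_right_mono)
      finally show "D t \<le> (\<integral>\<^sup>+s\<in>{0..t}. k (t - s) * D s \<partial>lborel)"
        unfolding D_def using Hfin[of t] by (auto simp: ennreal_minus_le_iff)
    qed
  qed
  \<comment> \<open>Half of the room left by \<gamma> < 1, so that \<open>\<gamma> + \<eta>\<close>
    is still an integrable exponent.\<close>
  define \<eta> where "\<eta> = (1 - \<gamma>) / 2"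
  have \<eta>: "0 < \<eta>" "\<eta> \<le> 1" "\<gamma> + \<eta> < 1" using \<gamma> by (auto simp: \<eta>_def field_simps)
  define G where "G = C * (T powr (1 - (\<gamma> + \<eta>)) / (1 - (\<gamma> + \<eta>)))"
  have G0: "G \<ge> 0" unfolding G_def using C \<eta> by auto
  \<comment> \<open>Chosen such that \<open>\<mu> powr \<eta> = 2 * G + 1\<close>, which makes the
    weighted mass of the kernel at most \<open>1 / 2\<close>.\<close>
  define \<mu> where "\<mu> = (2 * G + 1) powr (1 / \<eta>)"
  have \<mu>0: "\<mu> > 0" unfolding \<mu>_def using G0 by simp
  have \<mu>G: "\<mu> powr - \<eta> * G \<le> 1 / 2"
  proof -
    have "\<mu> powr - \<eta> = inverse (2 * G + 1)" unfolding \<mu>_def powr_powr using \<eta> G0 by (simp add: powr_minus)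
    then have "\<mu> powr - \<eta> * (2 * G + 1) = 1" using G0 by simp
    moreover have "2 * (\<mu> powr - \<eta> * G) \<le> \<mu> powr - \<eta> * (2 * G + 1)" by (simp add: algebra_simps)
    ultimately show ?thesis by linarith
  qed
  have kint: "(\<integral>\<^sup>+r\<in>{0..T}. ennreal (exp (- \<mu> * r)) * k r \<partial>lborel) \<le> ennreal (1 / 2)"
  proof -
    have "(\<integral>\<^sup>+r\<in>{0..T}. ennreal (exp (- \<mu> * r)) * k r \<partial>lborel) \<le>
        (\<integral>\<^sup>+r. ennreal (\<mu> powr - \<eta> * C) * (ennreal (r powr - (\<gamma> + \<eta>)) * indicator {0..T} r) \<partial>lborel)"
    proof (intro nn_integral_mono)
      fix r :: real
      show "ennreal (exp (- \<mu> * r)) * k r * indicator {0..T} r \<le>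
        ennreal (\<mu> powr - \<eta> * C) * (ennreal (r powr - (\<gamma> + \<eta>)) * indicator {0..T} r)"
      proof (cases "0 < r \<and> r \<le> T")
        case True
        have "exp (- \<mu> * r) \<le> (\<mu> * r) powr - \<eta>"
          using exp_minus_le_powr[of "\<mu> * r" \<eta>] True \<mu>0 \<eta> by simp
        then have "exp (- \<mu> * r) * (C * r powr - \<gamma>) \<le> (\<mu> * r) powr - \<eta> * (C * r powr - \<gamma>)"
          using C by (intro mult_right_mono) auto
        also have "\<dots> = \<mu> powr - \<eta> * C * r powr - (\<gamma> + \<eta>)"
          using True \<mu>0 by (simp add: powr_mult powr_add[symmetric] mult_ac add.commute)
        finally show ?thesis using True C
          by (simp add: k_def ennreal_mult[symmetric] ennreal_leI)
      next
        case False
        then show ?thesis by (auto simp: indicator_def k_def)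
      qed
    qed
    also have "\<dots> = ennreal (\<mu> powr - \<eta> * C) * ennreal (T powr (1 - (\<gamma> + \<eta>)) / (1 - (\<gamma> + \<eta>)))"
      using nn_integral_powr_minus[of "\<gamma> + \<eta>" T] \<eta> T by (subst nn_integral_cmult) auto
    also have "\<dots> = ennreal (\<mu> powr - \<eta> * G)"
      unfolding G_def using C \<eta> by (simp add: ennreal_mult[symmetric] mult.assoc)
    also have "\<dots> \<le> ennreal (1 / 2)" using \<mu>G by (rule ennreal_leI)
    finally show ?thesis .
  qed
  define \<Phi> where "\<Phi> = (\<integral>\<^sup>+t\<in>{0..T}. ennreal (exp (- \<mu> * t)) * D t \<partial>lborel)"
  have "\<Phi> \<le> (\<integral>\<^sup>+t\<in>{0..T}. N t \<partial>lborel)"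
    unfolding \<Phi>_def
  proof (intro nn_integral_mono)
    fix t
    have "ennreal (exp (- \<mu> * t)) * D t \<le> 1 * N t" if "t \<ge> 0"
      using that \<mu>0 DN by (intro mult_mono) auto
    then show "ennreal (exp (- \<mu> * t)) * D t * indicator {0..T} t \<le> N t * indicator {0..T} t"
      by (auto simp: indicator_def)
  qed
  then have \<Phi>fin: "\<Phi> < \<infinity>" using fin by auto
  \<comment> \<open>The order of integration is exchanged and \<open>t = s + r\<close> is
    substituted; the exponential weight then factorizes and the integral of the weighted kernel
    separates from that of \<open>D\<close>.\<close>
  have "\<Phi> \<le> (\<integral>\<^sup>+t\<in>{0..T}. ennreal (exp (- \<mu> * t)) * (\<integral>\<^sup>+s\<in>{0..t}. k (t - s) * D s \<partial>lborel) \<partial>lborel)"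
    unfolding \<Phi>_def
  proof (rule nn_integral_mono_AE, use Dsub in eventually_elim)
    case (elim t)
    then show ?case by (auto simp: indicator_def intro!: mult_left_mono)
  qed
  also have "\<dots> = (\<integral>\<^sup>+t. \<integral>\<^sup>+s. (ennreal (exp (- \<mu> * t)) * indicator {0..T} t) * (k (t - s) * D s * indicator {0..t} s) \<partial>lborel \<partial>lborel)"
    by (subst nn_integral_cmult) (auto simp: mult_ac intro!: nn_integral_cong)
  also have "\<dots> = (\<integral>\<^sup>+s. \<integral>\<^sup>+t. (ennreal (exp (- \<mu> * t)) * indicator {0..T} t) * (k (t - s) * D s * indicator {0..t} s) \<partial>lborel \<partial>lborel)"
  proof (rule lborel_pair.Fubini')
    have "(\<lambda>(s, t). (ennreal (exp (- \<mu> * t)) * indicator {0..T} t) * (k (t - s) * D s * indicator {0..t} s)) =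
      (\<lambda>(s, t). (ennreal (exp (- \<mu> * t)) * indicator {0..T} t) * (k (t - s) * D s * (if 0 \<le> s \<and> s \<le> t then 1 else 0)))"
      by (auto simp: fun_eq_iff indicator_def)
    moreover have "\<dots> \<in> borel_measurable (lborel \<Otimes>\<^sub>M lborel)" by measurable
    ultimately show "(\<lambda>(s, t). (ennreal (exp (- \<mu> * t)) * indicator {0..T} t) * (k (t - s) * D s * indicator {0..t} s))
       \<in> borel_measurable (lborel \<Otimes>\<^sub>M lborel)" by simp
  qed
  also have "\<dots> \<le> (\<integral>\<^sup>+s. (ennreal (exp (- \<mu> * s)) * D s * indicator {0..T} s) * ennreal (1 / 2) \<partial>lborel)"
  proof (rule nn_integral_mono)
    fix s :: real
    have "(\<integral>\<^sup>+t. (ennreal (exp (- \<mu> * t)) * indicator {0..T} t) * (k (t - s) * D s * indicator {0..t} s) \<partial>lborel) =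
      (\<integral>\<^sup>+r. (ennreal (exp (- \<mu> * (s + 1 * r))) * indicator {0..T} (s + 1 * r)) * (k (s + 1 * r - s) * D s * indicator {0..(s + 1 * r)} s) \<partial>lborel)"
    proof -
      have "(\<lambda>t. (ennreal (exp (- \<mu> * t)) * indicator {0..T} t) * (k (t - s) * D s * indicator {0..t} s)) =
        (\<lambda>t. (ennreal (exp (- \<mu> * t)) * indicator {0..T} t) * (k (t - s) * D s * (if 0 \<le> s \<and> s \<le> t then 1 else 0)))"
        by (auto simp: fun_eq_iff indicator_def)
      moreover have "\<dots> \<in> borel_measurable borel" by measurable
      ultimately have "(\<lambda>t. (ennreal (exp (- \<mu> * t)) * indicator {0..T} t) * (k (t - s) * D s * indicator {0..t} s)) \<in> borel_measurable borel"
        by simp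
      then show ?thesis using nn_integral_real_affine[of "\<lambda>t. (ennreal (exp (- \<mu> * t)) * indicator {0..T} t) * (k (t - s) * D s * indicator {0..t} s)" 1 s]
        by simp
    qed
    also have "\<dots> \<le> (\<integral>\<^sup>+r. (ennreal (exp (- \<mu> * s)) * D s * indicator {0..T} s) * (ennreal (exp (- \<mu> * r)) * k r * indicator {0..T} r) \<partial>lborel)"
    proof (rule nn_integral_mono)
      fix r :: real
      have "ennreal (exp (- \<mu> * (s + r))) = ennreal (exp (- \<mu> * s)) * ennreal (exp (- \<mu> * r))"
        by (simp add: ennreal_mult[symmetric] exp_add[symmetric] algebra_simps)
      then show "(ennreal (exp (- \<mu> * (s + 1 * r))) * indicator {0..T} (s + 1 * r)) * (k (s + 1 * r - s) * D s * indicator {0..(s + 1 * r)} s)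
        \<le> (ennreal (exp (- \<mu> * s)) * D s * indicator {0..T} s) * (ennreal (exp (- \<mu> * r)) * k r * indicator {0..T} r)"
        by (auto simp: indicator_def mult_ac)
    qed
    also have "\<dots> = (ennreal (exp (- \<mu> * s)) * D s * indicator {0..T} s) * (\<integral>\<^sup>+r\<in>{0..T}. ennreal (exp (- \<mu> * r)) * k r \<partial>lborel)"
      by (rule nn_integral_cmult) measurable
    also have "\<dots> \<le> (ennreal (exp (- \<mu> * s)) * D s * indicator {0..T} s) * ennreal (1 / 2)"
      by (rule mult_left_mono[OF kint]) simp
    finally show "(\<integral>\<^sup>+t. (ennreal (exp (- \<mu> * t)) * indicator {0..T} t) * (k (t - s) * D s * indicator {0..t} s) \<partial>lborel)
      \<le> (ennreal (exp (- \<mu> * s)) * D s * indicator {0..T} s) * ennreal (1 / 2)" .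
  qed
  also have "\<dots> = \<Phi> * ennreal (1 / 2)"
    unfolding \<Phi>_def by (rule nn_integral_multc) measurable
  finally have "\<Phi> \<le> \<Phi> * ennreal (1 / 2)" .
  \<comment> \<open>The inequality leaves 0 and \<infinity>; the latter is excluded by the
    integrability of \<open>N\<close>.\<close>
  then have "\<Phi> = 0"
    using \<Phi>fin by (cases \<Phi>) (auto simp: ennreal_mult[symmetric] simp del: ennreal_half)
  then have "AE t in lborel. ennreal (exp (- \<mu> * t)) * D t * indicator {0..T} t = 0"
    unfolding \<Phi>_def by (subst (asm) nn_integral_0_iff_AE) auto
  then show ?thesis
  proof eventually_elim
    case (elim t)
    then have "t \<in> {0..T} \<Longrightarrow> D t = 0" by (auto simp: indicator_def ennreal_eq_0_iff not_le)
    then show ?case using NHD[of t] by auto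
  qed
qed

text \<open>Follows from \<open>singular_comparison\<close> with an explicit supersolution. The
  constant is uniform in \<open>N\<close>, \<open>a\<close> and \<open>T'\<close>, as the continuity
  argument in time requires, where the length of the interval varies.\<close>

lemma singular_gronwall:
  fixes C \<gamma> \<kappa> T :: real
  assumes \<gamma>: "0 \<le> \<gamma>" "\<gamma> < 1" and \<kappa>: "0 \<le> \<kappa>" "\<kappa> < 1" and C: "C \<ge> 0" and T: "T \<ge> 0"
  shows "\<exists>K\<ge>0. \<forall>N a T'. N \<in> borel_measurable borel \<longrightarrow> a \<ge> 0 \<longrightarrow> 0 \<le> T' \<longrightarrow> T' \<le> T \<longrightarrow>
    (\<integral>\<^sup>+t\<in>{0..T'}. N t \<partial>lborel) < \<infinity> \<longrightarrow>
    (AE t in lborel. t \<in> {0..T'} \<longrightarrow> N t \<le> ennreal (a * t powr - \<kappa>) +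
         (\<integral>\<^sup>+s\<in>{0..t}. ennreal (C * (t - s) powr - \<gamma>) * N s \<partial>lborel)) \<longrightarrow>
    (AE t in lborel. t \<in> {0..T'} \<longrightarrow> N t \<le> ennreal (K * a * t powr - \<kappa>))"
proof -
  define \<eta> where "\<eta> = (1 - \<gamma>) / 2"
  have \<eta>: "0 < \<eta>" "\<eta> \<le> 1" "\<gamma> + \<eta> < 1" using \<gamma> by (auto simp: \<eta>_def field_simps)
  define G where "G = C * ((2 / (1 - (\<gamma> + \<eta>)) + 2 / (1 - \<kappa>)) * T powr (1 - (\<gamma> + \<eta>)))"
  have G0: "G \<ge> 0" unfolding G_def using C \<eta> \<kappa> by auto
  define \<mu> where "\<mu> = (2 * G + 1) powr (1 / \<eta>)"
  have \<mu>0: "\<mu> > 0" unfolding \<mu>_def using G0 by simp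
  have \<mu>G: "\<mu> powr - \<eta> * G \<le> 1 / 2"
  proof -
    have "\<mu> powr - \<eta> = inverse (2 * G + 1)" unfolding \<mu>_def powr_powr using \<eta> G0 by (simp add: powr_minus)
    then have "\<mu> powr - \<eta> * (2 * G + 1) = 1" using G0 by simp
    moreover have "2 * (\<mu> powr - \<eta> * G) \<le> \<mu> powr - \<eta> * (2 * G + 1)" by (simp add: algebra_simps)
    ultimately show ?thesis by linarith
  qed
  have main: "AE t in lborel. t \<in> {0..T'} \<longrightarrow> N t \<le> ennreal (2 * exp (\<mu> * T) * a * t powr - \<kappa>)"
    if [measurable]: "N \<in> borel_measurable borel" and a: "a \<ge> 0" and T': "0 \<le> T'" "T' \<le> T" and
    fin: "(\<integral>\<^sup>+t\<in>{0..T'}. N t \<partial>lborel) < \<infinity>" and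
    sub: "AE t in lborel. t \<in> {0..T'} \<longrightarrow> N t \<le> ennreal (a * t powr - \<kappa>) +
         (\<integral>\<^sup>+s\<in>{0..t}. ennreal (C * (t - s) powr - \<gamma>) * N s \<partial>lborel)" for N a T'
  proof -
    \<comment> \<open>The profile \<open>t powr - \<kappa>\<close> times an exponential. By
      \<open>\<mu>G\<close> and the Beta integral the convolution term is at most half of
      \<open>H\<close>; the factor 2 leaves the other half for the term with
      \<open>a\<close>.\<close>
    define H where "H t = ennreal (2 * a * (exp (\<mu> * t) * t powr - \<kappa>))" for t
    have [measurable]: "H \<in> borel_measurable borel" unfolding H_def by measurable
    have "AE t in lborel. t \<in> {0..T'} \<longrightarrow> N t \<le> H t"
    proof (rule singular_comparison[OF _ _ \<gamma> C T'(1) fin _ sub])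
      show "N \<in> borel_measurable borel" "H \<in> borel_measurable borel" by measurable
      show "H t < \<infinity>" for t by (simp add: H_def)
      fix t assume t: "0 < t" "t \<le> T'"
      have "(\<integral>\<^sup>+s\<in>{0..t}. ennreal (C * (t - s) powr - \<gamma>) * H s \<partial>lborel) \<le>
        (\<integral>\<^sup>+s. ennreal (2 * a * exp (\<mu> * t) * \<mu> powr - \<eta> * C) *
           (ennreal ((t - s) powr - (\<gamma> + \<eta>) * s powr - \<kappa>) * indicator {0..t} s) \<partial>lborel)"
      proof (rule nn_integral_mono)
        fix s
        show "ennreal (C * (t - s) powr - \<gamma>) * H s * indicator {0..t} s \<le> ennreal (2 * a * exp (\<mu> * t) * \<mu> powr - \<eta> * C) *
           (ennreal ((t - s) powr - (\<gamma> + \<eta>) * s powr - \<kappa>) * indicator {0..t} s)"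
        proof (cases "0 < s \<and> s < t")
          case True
          have "exp (\<mu> * s) = exp (\<mu> * t) * exp (- (\<mu> * (t - s)))"
            by (simp add: exp_add[symmetric] algebra_simps)
          also have "\<dots> \<le> exp (\<mu> * t) * (\<mu> * (t - s)) powr - \<eta>"
            using True \<mu>0 \<eta> by (intro mult_left_mono exp_minus_le_powr) auto
          finally have e: "exp (\<mu> * s) \<le> exp (\<mu> * t) * (\<mu> * (t - s)) powr - \<eta>" .
          have "C * (t - s) powr - \<gamma> * (2 * a * (exp (\<mu> * s) * s powr - \<kappa>)) \<le>
            C * (t - s) powr - \<gamma> * (2 * a * ((exp (\<mu> * t) * (\<mu> * (t - s)) powr - \<eta>) * s powr - \<kappa>))"
            using C a e by (intro mult_left_mono mult_right_mono) auto
          also have "\<dots> = 2 * a * exp (\<mu> * t) * \<mu> powr - \<eta> * C * ((t - s) powr - (\<gamma> + \<eta>) * s powr - \<kappa>)"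
          proof -
            have "(t - s) powr - (\<gamma> + \<eta>) = (t - s) powr - \<gamma> * (t - s) powr - \<eta>" by (simp add: powr_add[symmetric])
            then show ?thesis using True \<mu>0 by (simp add: powr_mult mult_ac)
          qed
          finally show ?thesis using True C a
            by (simp add: H_def ennreal_mult[symmetric] ennreal_leI)
        next
          case False
          then show ?thesis by (auto simp: indicator_def H_def)
        qed
      qed
      also have "\<dots> = ennreal (2 * a * exp (\<mu> * t) * \<mu> powr - \<eta> * C) * (\<integral>\<^sup>+s\<in>{0..t}. ennreal ((t - s) powr - (\<gamma> + \<eta>) * s powr - \<kappa>) \<partial>lborel)"
        by (rule nn_integral_cmult) measurable
      also have "\<dots> \<le> ennreal (2 * a * exp (\<mu> * t) * \<mu> powr - \<eta> * C) * ennreal ((2 / (1 - (\<gamma> + \<eta>)) + 2 / (1 - \<kappa>)) * t powr (1 - (\<gamma> + \<eta>) - \<kappa>))"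
        using \<gamma> \<eta> \<kappa> t by (intro mult_left_mono beta_integral_le) auto
      also have "\<dots> = ennreal (2 * a * exp (\<mu> * t) * \<mu> powr - \<eta> * C * ((2 / (1 - (\<gamma> + \<eta>)) + 2 / (1 - \<kappa>)) * t powr (1 - (\<gamma> + \<eta>) - \<kappa>)))"
        using a C \<eta> \<kappa> by (subst ennreal_mult) auto
      also have "\<dots> \<le> ennreal (a * (exp (\<mu> * t) * t powr - \<kappa>))"
      proof (rule ennreal_leI)
        have "t powr (1 - (\<gamma> + \<eta>) - \<kappa>) = t powr (1 - (\<gamma> + \<eta>)) * t powr - \<kappa>" by (simp add: powr_add[symmetric])
        also have "\<dots> \<le> T powr (1 - (\<gamma> + \<eta>)) * t powr - \<kappa>"
          using t T' \<eta> by (intro mult_right_mono powr_mono2) auto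
        finally have "2 * a * exp (\<mu> * t) * \<mu> powr - \<eta> * C * ((2 / (1 - (\<gamma> + \<eta>)) + 2 / (1 - \<kappa>)) * t powr (1 - (\<gamma> + \<eta>) - \<kappa>)) \<le>
          2 * a * exp (\<mu> * t) * \<mu> powr - \<eta> * C * ((2 / (1 - (\<gamma> + \<eta>)) + 2 / (1 - \<kappa>)) * (T powr (1 - (\<gamma> + \<eta>)) * t powr - \<kappa>))"
          using a C \<eta> \<kappa> by (intro mult_left_mono) auto
        also have "\<dots> = 2 * a * (exp (\<mu> * t) * t powr - \<kappa>) * (\<mu> powr - \<eta> * G)" unfolding G_def by (simp add: mult_ac)
        also have "\<dots> \<le> 2 * a * (exp (\<mu> * t) * t powr - \<kappa>) * (1 / 2)" using a by (intro mult_left_mono \<mu>G) auto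
        finally show "2 * a * exp (\<mu> * t) * \<mu> powr - \<eta> * C * ((2 / (1 - (\<gamma> + \<eta>)) + 2 / (1 - \<kappa>)) * t powr (1 - (\<gamma> + \<eta>) - \<kappa>)) \<le> a * (exp (\<mu> * t) * t powr - \<kappa>)"
          by simp
      qed
      finally have "(\<integral>\<^sup>+s\<in>{0..t}. ennreal (C * (t - s) powr - \<gamma>) * H s \<partial>lborel) \<le> ennreal (a * (exp (\<mu> * t) * t powr - \<kappa>))" .
      moreover have "ennreal (a * t powr - \<kappa>) \<le> ennreal (a * (exp (\<mu> * t) * t powr - \<kappa>))"
      proof (rule ennreal_leI)
        have "1 * t powr - \<kappa> \<le> exp (\<mu> * t) * t powr - \<kappa>" using t \<mu>0 by (intro mult_right_mono) auto
        then show "a * t powr - \<kappa> \<le> a * (exp (\<mu> * t) * t powr - \<kappa>)" using a by (intro mult_left_mono) auto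
      qed
      ultimately have "ennreal (a * t powr - \<kappa>) + (\<integral>\<^sup>+s\<in>{0..t}. ennreal (C * (t - s) powr - \<gamma>) * H s \<partial>lborel)
        \<le> ennreal (a * (exp (\<mu> * t) * t powr - \<kappa>)) + ennreal (a * (exp (\<mu> * t) * t powr - \<kappa>))" by (rule add_mono[rotated])
      also have "\<dots> = H t" unfolding H_def using a by (simp add: ennreal_plus[symmetric] del: ennreal_plus)
      finally show "ennreal (a * t powr - \<kappa>) + (\<integral>\<^sup>+s\<in>{0..t}. ennreal (C * (t - s) powr - \<gamma>) * H s \<partial>lborel) \<le> H t" .
    qed
    then show ?thesis
    proof eventually_elim
      case (elim t)
      show ?case
      proof
        assume t: "t \<in> {0..T'}"
        have "N t \<le> H t" using elim t by simp
        also have "H t \<le> ennreal (2 * exp (\<mu> * T) * a * t powr - \<kappa>)" unfolding H_def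
        proof (rule ennreal_leI)
          have "exp (\<mu> * t) \<le> exp (\<mu> * T)" using t T' \<mu>0 by simp
          then have "2 * a * (exp (\<mu> * t) * t powr - \<kappa>) \<le> 2 * a * (exp (\<mu> * T) * t powr - \<kappa>)"
            using a by (intro mult_left_mono mult_right_mono) auto
          then show "2 * a * (exp (\<mu> * t) * t powr - \<kappa>) \<le> 2 * exp (\<mu> * T) * a * t powr - \<kappa>" by (simp add: mult_ac)
        qed
        finally show "N t \<le> ennreal (2 * exp (\<mu> * T) * a * t powr - \<kappa>)" .
      qed
    qed
  qed
  show ?thesis by (rule exI[of _ "2 * exp (\<mu> * T)"]) (use main in auto)
qed

section \<open>Stability of the rough integral\<close>

lemma frechet_derivative_bounded_linear_compose:
  assumes L: "bounded_linear L" and h: "h differentiable (at x)"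
  shows "(\<lambda>x. L (h x)) differentiable (at x)"
    "frechet_derivative (\<lambda>x. L (h x)) (at x) v = L (frechet_derivative h (at x) v)"
proof -
  have d: "((\<lambda>x. L (h x)) has_derivative (\<lambda>v. L (frechet_derivative h (at x) v))) (at x)"
    using bounded_linear.has_derivative[OF L] h by (simp add: frechet_derivative_works)
  then show "(\<lambda>x. L (h x)) differentiable (at x)" by (auto simp: differentiable_def)
  show "frechet_derivative (\<lambda>x. L (h x)) (at x) v = L (frechet_derivative h (at x) v)"
    using frechet_derivative_at[OF d] by metis
qed

lemma Ck_bounded_linear_compose:
  assumes L: "bounded_linear L" and "Ck k h"
  shows "Ck k (\<lambda>x. L (h x))"
  using assms(2)
proof (induction k arbitrary: h)
  case 0
  then show ?case using bounded_linear.continuous_on[OF L] by simp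
next
  case (Suc k)
  have d: "h differentiable (at x)" "Ck k (\<lambda>x. frechet_derivative h (at x) v)" for x v using Suc.prems by auto
  have "(\<lambda>x. frechet_derivative (\<lambda>x. L (h x)) (at x) v) = (\<lambda>x. L (frechet_derivative h (at x) v))" for v
    by (rule ext) (rule frechet_derivative_bounded_linear_compose(2)[OF L d(1)])
  then show ?case using frechet_derivative_bounded_linear_compose(1)[OF L d(1)] Suc.IH[OF d(2)] by simp
qed

definition partial :: "'n \<Rightarrow> (real ^ 'n \<Rightarrow> real) \<Rightarrow> real ^ 'n \<Rightarrow> real" where
  "partial k h x = frechet_derivative h (at x) (axis k 1)"

lemma Ck_partial: "Ck (Suc m) h \<Longrightarrow> Ck m (partial k h)"
  by (simp add: partial_def[abs_def])

lemma frechet_derivative_partial: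
  fixes h :: "real ^ 'n::finite \<Rightarrow> real"
  assumes "h differentiable (at x)"
  shows "frechet_derivative h (at x) v = (\<Sum>k\<in>UNIV. v $ k * partial k h x)"
proof -
  have lin: "linear (frechet_derivative h (at x))" using assms by (rule linear_frechet_derivative)
  have "v = (\<Sum>k\<in>UNIV. v $ k *\<^sub>R axis k 1)" using basis_expansion[of v] by (simp add: scalar_mult_eq_scaleR)
  then have "frechet_derivative h (at x) v = frechet_derivative h (at x) (\<Sum>k\<in>UNIV. v $ k *\<^sub>R axis k 1)" by simp
  also have "\<dots> = (\<Sum>k\<in>UNIV. v $ k * partial k h x)"
    by (simp add: linear_sum[OF lin] linear_scale[OF lin] partial_def)
  finally show ?thesis .
qed

lemma deriv_along_segment:
  fixes h :: "real ^ 'n::finite \<Rightarrow> real"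
  assumes "\<And>x. h differentiable (at x)"
  shows "((\<lambda>\<theta>. h (a + \<theta> *\<^sub>R v)) has_real_derivative (\<Sum>k\<in>UNIV. v $ k * partial k h (a + \<theta> *\<^sub>R v))) (at \<theta>)"
proof -
  have 1: "((\<lambda>\<theta>. a + \<theta> *\<^sub>R v) has_derivative (\<lambda>t. t *\<^sub>R v)) (at \<theta>)"
    by (auto intro!: derivative_eq_intros)
  have 2: "(h has_derivative frechet_derivative h (at (a + \<theta> *\<^sub>R v))) (at (a + \<theta> *\<^sub>R v))"
    using assms by (simp add: frechet_derivative_works)
  have "((\<lambda>\<theta>. h (a + \<theta> *\<^sub>R v)) has_derivative (\<lambda>t. frechet_derivative h (at (a + \<theta> *\<^sub>R v)) (t *\<^sub>R v))) (at \<theta>)"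
    using has_derivative_compose[OF 1 2] .
  moreover have "frechet_derivative h (at (a + \<theta> *\<^sub>R v)) (t *\<^sub>R v) = (\<Sum>k\<in>UNIV. v $ k * partial k h (a + \<theta> *\<^sub>R v)) * t" for t
    unfolding frechet_derivative_partial[OF assms] by (simp add: sum_distrib_left mult_ac)
  ultimately show ?thesis by (simp add: has_field_derivative_def)
qed

lemma mvt_bound:
  fixes G :: "real \<Rightarrow> real"
  assumes "\<And>\<theta>. (G has_real_derivative G' \<theta>) (at \<theta>)" and "\<And>\<theta>. 0 \<le> \<theta> \<Longrightarrow> \<theta> \<le> 1 \<Longrightarrow> \<bar>G' \<theta>\<bar> \<le> B"
  shows "\<bar>G 1 - G 0\<bar> \<le> B"
proof -
  obtain z where "0 < z" "z < 1" "G 1 - G 0 = (1 - 0) * G' z"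
    using MVT2[of 0 1 G G'] assms(1) by auto
  then show ?thesis using assms(2)[of z] by simp
qed

lemma norm_segment_le:
  fixes a v :: "'a::real_normed_vector"
  assumes "norm a \<le> B" "norm (a + v) \<le> B" "0 \<le> \<theta>" "\<theta> \<le> 1"
  shows "norm (a + \<theta> *\<^sub>R v) \<le> B"
proof -
  have "a + \<theta> *\<^sub>R v = (1 - \<theta>) *\<^sub>R a + \<theta> *\<^sub>R (a + v)" by (simp add: algebra_simps)
  also have "norm \<dots> \<le> (1 - \<theta>) * norm a + \<theta> * norm (a + v)"
    using assms by (intro order_trans[OF norm_triangle_ineq]) simp
  also have "\<dots> \<le> (1 - \<theta>) * B + \<theta> * B" using assms by (intro add_mono mult_left_mono) auto
  finally show ?thesis by (simp add: algebra_simps)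
qed

lemma C1_bound_lipschitz:
  fixes h :: "real ^ 'n::finite \<Rightarrow> real"
  assumes h: "Ck 1 h"
  shows "\<exists>C\<ge>0. \<forall>a b. norm a \<le> B \<longrightarrow> norm b \<le> B \<longrightarrow> \<bar>h a\<bar> \<le> C \<and> \<bar>h a - h b\<bar> \<le> C * norm (a - b)"
proof -
  have d: "h differentiable (at x)" for x using h by simp
  have ch: "continuous_on UNIV h" using d by (simp add: continuous_at_imp_continuous_on differentiable_imp_continuous_within)
  have cp: "continuous_on UNIV (partial k h)" for k using h by (simp add: partial_def[abs_def])
  have "\<exists>C>0. \<forall>a. norm a \<le> B \<longrightarrow> \<bar>H a\<bar> \<le> C" if "continuous_on UNIV H" for H :: "real ^ 'n \<Rightarrow> real"
  proof -
    have "bounded (H ` cball 0 B)"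
      by (intro compact_imp_bounded compact_continuous_image continuous_on_subset[OF that]) auto
    then show ?thesis unfolding bounded_pos by auto
  qed note bd = this
  obtain C0 where C0: "C0 > 0" "\<And>a. norm a \<le> B \<Longrightarrow> \<bar>h a\<bar> \<le> C0" using bd[OF ch] by blast
  have "\<forall>k. \<exists>C>0. \<forall>a. norm a \<le> B \<longrightarrow> \<bar>partial k h a\<bar> \<le> C" using bd[OF cp] by blast
  then obtain Cp where Cp: "\<And>k. Cp k > 0" "\<And>k a. norm a \<le> B \<Longrightarrow> \<bar>partial k h a\<bar> \<le> Cp k" by metis
  define C where "C = C0 + (\<Sum>k\<in>UNIV. Cp k)"
  have S0: "(\<Sum>k\<in>UNIV. Cp k) \<ge> 0" using Cp(1) by (intro sum_nonneg) (simp add: less_imp_le)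
  have "\<bar>h a - h b\<bar> \<le> C * norm (a - b)" if ab: "norm a \<le> B" "norm b \<le> B" for a b
  proof -
    have "\<bar>h (b + 1 *\<^sub>R (a - b)) - h (b + 0 *\<^sub>R (a - b))\<bar> \<le> (\<Sum>k\<in>UNIV. Cp k) * norm (a - b)"
    proof (rule mvt_bound[OF deriv_along_segment[OF d]])
      fix \<theta> :: real assume \<theta>: "0 \<le> \<theta>" "\<theta> \<le> 1"
      have "norm (b + \<theta> *\<^sub>R (a - b)) \<le> B" by (rule norm_segment_le) (use ab \<theta> in auto)
      then have "\<bar>\<Sum>k\<in>UNIV. (a - b) $ k * partial k h (b + \<theta> *\<^sub>R (a - b))\<bar> \<le> (\<Sum>k\<in>UNIV. norm (a - b) * Cp k)"
        using Cp(2) by (intro order_trans[OF sum_abs] sum_mono) (auto simp: abs_mult simp del: vector_minus_component intro!: mult_mono component_le_norm_cart)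
      then show "\<bar>\<Sum>k\<in>UNIV. (a - b) $ k * partial k h (b + \<theta> *\<^sub>R (a - b))\<bar> \<le> (\<Sum>k\<in>UNIV. Cp k) * norm (a - b)"
        by (simp only: sum_distrib_left[symmetric] mult.commute[of "sum Cp UNIV"])
    qed
    also have "\<dots> \<le> C * norm (a - b)" using C0 unfolding C_def by (intro mult_right_mono) auto
    finally show ?thesis by simp
  qed
  moreover have "\<bar>h a\<bar> \<le> C" if "norm a \<le> B" for a using C0(2)[OF that] S0 unfolding C_def by linarith
  ultimately show ?thesis using C0 S0 by (intro exI[of _ C]) (auto simp: C_def)
qed

text \<open>The mean value theorem is applied to \<open>h (a + \<theta> *\<^sub>R v) - h (a' +
  \<theta> *\<^sub>R v')\<close> as one function of \<theta>, which keeps the two increments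
  together. The distance \<open>norm (a - a')\<close> meets the increment of the unprimed pair only;
  the mixed product \<open>norm v * norm (v - v')\<close> is absorbed by means of
  \<open>norm v \<le> 2 * B\<close>.\<close>

lemma C2_increment_difference:
  fixes h :: "real ^ 'n::finite \<Rightarrow> real"
  assumes h: "Ck 2 h" and B: "B \<ge> 0"
  shows "\<exists>C\<ge>0. \<forall>a b a' b'. norm a \<le> B \<longrightarrow> norm b \<le> B \<longrightarrow> norm a' \<le> B \<longrightarrow> norm b' \<le> B \<longrightarrow>
     \<bar>(h b - h a) - (h b' - h a')\<bar> \<le> C * (norm (a - a') * norm (b - a) + norm ((b - a) - (b' - a')))"
proof -
  have d: "h differentiable (at x)" for x using h by (simp add: numeral_2_eq_2)
  have "\<forall>k. \<exists>C\<ge>0. \<forall>a b. norm a \<le> B \<longrightarrow> norm b \<le> B \<longrightarrow> \<bar>partial k h a\<bar> \<le> C \<and> \<bar>partial k h a - partial k h b\<bar> \<le> C * norm (a - b)"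
  proof
    fix k
    have "Ck 1 (partial k h)" using h by (intro Ck_partial) (simp add: numeral_2_eq_2)
    then show "\<exists>C\<ge>0. \<forall>a b. norm a \<le> B \<longrightarrow> norm b \<le> B \<longrightarrow> \<bar>partial k h a\<bar> \<le> C \<and> \<bar>partial k h a - partial k h b\<bar> \<le> C * norm (a - b)"
      by (rule C1_bound_lipschitz)
  qed
  then obtain Cp where Cp: "\<And>k. Cp k \<ge> 0" "\<And>k a. norm a \<le> B \<Longrightarrow> \<bar>partial k h a\<bar> \<le> Cp k"
    "\<And>k a b. norm a \<le> B \<Longrightarrow> norm b \<le> B \<Longrightarrow> \<bar>partial k h a - partial k h b\<bar> \<le> Cp k * norm (a - b)" by metis
  define C where "C = (\<Sum>k\<in>UNIV. Cp k) * (2 * B + 1)"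
  have S0: "(\<Sum>k\<in>UNIV. Cp k) \<ge> 0" using Cp(1) by (intro sum_nonneg) simp
  show ?thesis
  proof (intro exI[of _ C] conjI allI impI)
    show "C \<ge> 0" using S0 B by (simp add: C_def)
    fix a b a' b' :: "real ^ 'n" assume n: "norm a \<le> B" "norm b \<le> B" "norm a' \<le> B" "norm b' \<le> B"
    define v v' where "v = b - a" and "v' = b' - a'"
    have nv: "norm v \<le> 2 * B" unfolding v_def using n by (intro order_trans[OF norm_triangle_ineq4]) simp
    let ?G = "\<lambda>\<theta>. h (a + \<theta> *\<^sub>R v) - h (a' + \<theta> *\<^sub>R v')"
    let ?e = "norm (a - a') * norm v + norm (v - v')"
    have "\<bar>?G 1 - ?G 0\<bar> \<le> C * ?e"
    proof (rule mvt_bound[OF DERIV_diff[OF deriv_along_segment[OF d] deriv_along_segment[OF d]]])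
      fix \<theta> :: real assume \<theta>: "0 \<le> \<theta>" "\<theta> \<le> 1"
      let ?x = "a + \<theta> *\<^sub>R v" and ?x' = "a' + \<theta> *\<^sub>R v'"
      have x: "norm ?x \<le> B" "norm ?x' \<le> B" by (rule norm_segment_le; use n \<theta> in \<open>auto simp: v_def v'_def\<close>)+
      have "norm (?x - ?x') = norm ((a - a') + \<theta> *\<^sub>R (v - v'))" by (simp add: algebra_simps)
      also have "\<dots> \<le> norm (a - a') + \<theta> * norm (v - v')" using \<theta> by (intro order_trans[OF norm_triangle_ineq]) simp
      also have "\<dots> \<le> norm (a - a') + norm (v - v')" using \<theta> by (simp add: mult_left_le_one_le)
      finally have xx: "norm (?x - ?x') \<le> norm (a - a') + norm (v - v')" .
      have each: "\<bar>v $ k * partial k h ?x - v' $ k * partial k h ?x'\<bar> \<le> Cp k * ((2 * B + 1) * ?e)" for k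
      proof -
        have "\<bar>v $ k * partial k h ?x - v' $ k * partial k h ?x'\<bar> =
           \<bar>v $ k * (partial k h ?x - partial k h ?x') + (v - v') $ k * partial k h ?x'\<bar>" by (simp add: algebra_simps)
        also have "\<dots> \<le> \<bar>v $ k\<bar> * \<bar>partial k h ?x - partial k h ?x'\<bar> + \<bar>(v - v') $ k\<bar> * \<bar>partial k h ?x'\<bar>"
          by (intro order_trans[OF abs_triangle_ineq]) (simp only: abs_mult)
        also have "\<dots> \<le> norm v * (Cp k * (norm (a - a') + norm (v - v'))) + norm (v - v') * Cp k"
        proof (intro add_mono mult_mono component_le_norm_cart)
          have "\<bar>partial k h ?x - partial k h ?x'\<bar> \<le> Cp k * norm (?x - ?x')" by (rule Cp(3)[OF x])
          also have "\<dots> \<le> Cp k * (norm (a - a') + norm (v - v'))" by (rule mult_left_mono[OF xx Cp(1)])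
          finally show "\<bar>partial k h ?x - partial k h ?x'\<bar> \<le> Cp k * (norm (a - a') + norm (v - v'))" .
        qed (use Cp x in auto)
        also have "\<dots> = Cp k * (norm (a - a') * norm v + norm v * norm (v - v') + norm (v - v'))" by (simp add: algebra_simps)
        also have "\<dots> \<le> Cp k * ((2 * B + 1) * ?e)"
        proof (rule mult_left_mono[OF _ Cp(1)])
          have "norm v * norm (v - v') \<le> 2 * B * norm (v - v')" using nv by (intro mult_right_mono) auto
          moreover have "0 \<le> 2 * B * (norm (a - a') * norm v)" using B by simp
          ultimately show "norm (a - a') * norm v + norm v * norm (v - v') + norm (v - v') \<le> (2 * B + 1) * ?e"
            by (simp add: algebra_simps)
        qed
        finally show ?thesis .
      qed
      have "\<bar>(\<Sum>k\<in>UNIV. v $ k * partial k h ?x) - (\<Sum>k\<in>UNIV. v' $ k * partial k h ?x')\<bar> \<le> (\<Sum>k\<in>UNIV. Cp k * ((2 * B + 1) * ?e))"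
        unfolding sum_subtractf[symmetric] by (intro order_trans[OF sum_abs] sum_mono each)
      then show "\<bar>(\<Sum>k\<in>UNIV. v $ k * partial k h ?x) - (\<Sum>k\<in>UNIV. v' $ k * partial k h ?x')\<bar> \<le> C * ?e"
        by (simp add: C_def sum_distrib_right[symmetric] mult.assoc)
    qed
    then show "\<bar>(h b - h a) - (h b' - h a')\<bar> \<le> C * (norm (a - a') * norm (b - a) + norm ((b - a) - (b' - a')))"
      by (simp add: v_def v'_def algebra_simps)
  qed
qed

definition taylor_rem :: "(real ^ 'n::finite \<Rightarrow> real) \<Rightarrow> real ^ 'n \<Rightarrow> real ^ 'n \<Rightarrow> real" where
  "taylor_rem h a b = h b - h a - (\<Sum>k\<in>UNIV. (b - a) $ k * partial k h a)"

text \<open>One constant for everything that the germ estimates ask of \<open>h\<close> on a ball.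
  In the difference estimates \<open>norm (a - a')\<close> is paired with the unprimed increment
  \<open>b - a\<close>, so that later the Lipschitz seminorm of the unprimed state alone multiplies
  \<open>d\<close>.\<close>

definition C3_bounds :: "real \<Rightarrow> real \<Rightarrow> (real ^ 'n::finite \<Rightarrow> real) \<Rightarrow> bool" where
  "C3_bounds C B h \<longleftrightarrow> C \<ge> 0 \<and>
    (\<forall>a b. norm a \<le> B \<longrightarrow> norm b \<le> B \<longrightarrow> \<bar>h a\<bar> \<le> C \<and> \<bar>h a - h b\<bar> \<le> C * norm (a - b) \<and>
       (\<forall>k. \<bar>partial k h a\<bar> \<le> C \<and> \<bar>partial k h a - partial k h b\<bar> \<le> C * norm (a - b))) \<and>
    (\<forall>a b a' b'. norm a \<le> B \<longrightarrow> norm b \<le> B \<longrightarrow> norm a' \<le> B \<longrightarrow> norm b' \<le> B \<longrightarrow>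
       (\<forall>k. \<bar>(partial k h b - partial k h a) - (partial k h b' - partial k h a')\<bar>
           \<le> C * (norm (a - a') * norm (b - a) + norm ((b - a) - (b' - a')))) \<and>
       \<bar>taylor_rem h a b - taylor_rem h a' b'\<bar> \<le>
           C * (norm (a - a') * (norm (b - a))\<^sup>2 + norm ((b - a) - (b' - a')) * (norm (b - a) + norm (b' - a'))))"

lemma C3_bounds_mono: "C3_bounds C B h \<Longrightarrow> C \<le> C' \<Longrightarrow> C3_bounds C' B h"
proof -
  assume h: "C3_bounds C B h" and CC: "C \<le> C'"
  have m: "x \<le> C * y \<Longrightarrow> 0 \<le> y \<Longrightarrow> x \<le> C' * y" for x y :: real
    using mult_right_mono[OF CC, of y] by linarith
  have C: "C \<ge> 0" using h by (simp add: C3_bounds_def)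
  show ?thesis unfolding C3_bounds_def
  proof (intro conjI allI impI)
    show "C' \<ge> 0" using C CC by simp
  next
    fix a b :: "real ^ 'a" and k assume n: "norm a \<le> B" "norm b \<le> B"
    note hh = h[unfolded C3_bounds_def, THEN conjunct2, THEN conjunct1, rule_format, OF n]
    show "\<bar>h a\<bar> \<le> C'" "\<bar>partial k h a\<bar> \<le> C'" using hh CC by (meson order_trans)+
    show "\<bar>h a - h b\<bar> \<le> C' * norm (a - b)" "\<bar>partial k h a - partial k h b\<bar> \<le> C' * norm (a - b)"
      by (rule m; use hh in auto)+
  next
    fix a b a' b' :: "real ^ 'a" and k assume n: "norm a \<le> B" "norm b \<le> B" "norm a' \<le> B" "norm b' \<le> B"
    note hh = h[unfolded C3_bounds_def, THEN conjunct2, THEN conjunct2, rule_format, OF n]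
    show "\<bar>(partial k h b - partial k h a) - (partial k h b' - partial k h a')\<bar>
           \<le> C' * (norm (a - a') * norm (b - a) + norm ((b - a) - (b' - a')))"
      "\<bar>taylor_rem h a b - taylor_rem h a' b'\<bar> \<le>
           C' * (norm (a - a') * (norm (b - a))\<^sup>2 + norm ((b - a) - (b' - a')) * (norm (b - a) + norm (b' - a')))"
      by (rule m; use hh in auto)+
  qed
qed

lemma C3_bounds_exists:
  fixes h :: "real ^ 'n::finite \<Rightarrow> real"
  assumes h: "Ck 3 h" and B: "B \<ge> 0"
  shows "\<exists>C. C3_bounds C B h"
proof -
  have d: "h differentiable (at x)" for x using h by (simp add: numeral_3_eq_3)
  have C1h: "Ck 1 h"
  proof -
    have "continuous_on UNIV (\<lambda>x. frechet_derivative h (at x) v)" for v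
    proof -
      have "Ck 2 (\<lambda>x. frechet_derivative h (at x) v)" using h by (simp add: numeral_3_eq_3 numeral_2_eq_2)
      then have "\<forall>x. (\<lambda>x. frechet_derivative h (at x) v) differentiable (at x)" by (simp add: numeral_2_eq_2)
      then show ?thesis by (simp add: continuous_at_imp_continuous_on differentiable_imp_continuous_within)
    qed
    then show ?thesis using d by simp
  qed
  have p2: "Ck 2 (partial k h)" for k using h by (intro Ck_partial) (simp add: numeral_3_eq_3 numeral_2_eq_2)
  have p1: "Ck 1 (partial k h)" for k
  proof -
    have dd: "\<forall>x. partial k h differentiable (at x)" using p2[of k] by (simp add: numeral_2_eq_2)
    have "continuous_on UNIV (\<lambda>x. frechet_derivative (partial k h) (at x) v)" for v
    proof -
      have "\<forall>x. (\<lambda>x. frechet_derivative (partial k h) (at x) v) differentiable (at x)" using p2[of k] by (simp add: numeral_2_eq_2)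
      then show ?thesis by (simp add: continuous_at_imp_continuous_on differentiable_imp_continuous_within)
    qed
    then show ?thesis using dd by simp
  qed
  obtain C0 where C0: "C0 \<ge> 0" "\<And>a b. norm a \<le> B \<Longrightarrow> norm b \<le> B \<Longrightarrow> \<bar>h a\<bar> \<le> C0 \<and> \<bar>h a - h b\<bar> \<le> C0 * norm (a - b)"
    using C1_bound_lipschitz[OF C1h] by blast
  have "\<forall>k. \<exists>C\<ge>0. \<forall>a b. norm a \<le> B \<longrightarrow> norm b \<le> B \<longrightarrow> \<bar>partial k h a\<bar> \<le> C \<and> \<bar>partial k h a - partial k h b\<bar> \<le> C * norm (a - b)"
    using C1_bound_lipschitz[OF p1] by blast
  then obtain C1 where C1: "\<And>k. C1 k \<ge> 0" "\<And>k a b. norm a \<le> B \<Longrightarrow> norm b \<le> B \<Longrightarrow>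
    \<bar>partial k h a\<bar> \<le> C1 k \<and> \<bar>partial k h a - partial k h b\<bar> \<le> C1 k * norm (a - b)" by metis
  have "\<forall>k. \<exists>C\<ge>0. \<forall>a b a' b'. norm a \<le> B \<longrightarrow> norm b \<le> B \<longrightarrow> norm a' \<le> B \<longrightarrow> norm b' \<le> B \<longrightarrow>
     \<bar>(partial k h b - partial k h a) - (partial k h b' - partial k h a')\<bar> \<le> C * (norm (a - a') * norm (b - a) + norm ((b - a) - (b' - a')))"
    using C2_increment_difference[OF p2 B] by blast
  then obtain C2 where C2: "\<And>k. C2 k \<ge> 0" "\<And>k a b a' b'. norm a \<le> B \<Longrightarrow> norm b \<le> B \<Longrightarrow> norm a' \<le> B \<Longrightarrow> norm b' \<le> B \<Longrightarrow>
     \<bar>(partial k h b - partial k h a) - (partial k h b' - partial k h a')\<bar> \<le> C2 k * (norm (a - a') * norm (b - a) + norm ((b - a) - (b' - a')))"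
    by metis
  define C where "C = C0 + (\<Sum>k\<in>UNIV. C1 k + C2 k)"
  have le: "C1 k + C2 k \<le> (\<Sum>k\<in>UNIV. C1 k + C2 k)" for k using C1(1) C2(1) by (intro member_le_sum) (auto simp: add_nonneg_nonneg)
  have S0: "(\<Sum>k\<in>UNIV. C1 k + C2 k) \<ge> 0" using C1(1) C2(1) by (intro sum_nonneg) (simp add: add_nonneg_nonneg)
  have CC: "C0 \<le> C" "C1 k \<le> C" "C2 k \<le> C" "(\<Sum>k\<in>UNIV. C1 k + C2 k) \<le> C" for k
    using le[of k] C0(1) S0 C1(1)[of k] C2(1)[of k] by (auto simp: C_def)
  have m: "x \<le> c * y \<Longrightarrow> c \<le> C \<Longrightarrow> 0 \<le> y \<Longrightarrow> x \<le> C * y" for x y c :: real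
    using mult_right_mono[of c C y] by linarith
  have taylor: "\<bar>taylor_rem h a b - taylor_rem h a' b'\<bar> \<le>
           C * (norm (a - a') * (norm (b - a))\<^sup>2 + norm ((b - a) - (b' - a')) * (norm (b - a) + norm (b' - a')))"
    if n: "norm a \<le> B" "norm b \<le> B" "norm a' \<le> B" "norm b' \<le> B" for a b a' b'
  proof -
    define v v' where "v = b - a" and "v' = b' - a'"
    \<comment> \<open>The values at 1 and 0 differ by the difference of the two Taylor remainders.
      The derivative in \<theta> contains increments of the partial derivatives, which
      \<open>C2(2)\<close> compares.\<close>
    let ?G = "\<lambda>\<theta>. (h (a + \<theta> *\<^sub>R v) - \<theta> * (\<Sum>k\<in>UNIV. v $ k * partial k h a)) - (h (a' + \<theta> *\<^sub>R v') - \<theta> * (\<Sum>k\<in>UNIV. v' $ k * partial k h a'))"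
    let ?e = "norm (a - a') * (norm v)\<^sup>2 + norm (v - v') * (norm v + norm v')"
    have dG: "(?G has_real_derivative ((\<Sum>k\<in>UNIV. v $ k * partial k h (a + \<theta> *\<^sub>R v)) - (\<Sum>k\<in>UNIV. v $ k * partial k h a)) -
        ((\<Sum>k\<in>UNIV. v' $ k * partial k h (a' + \<theta> *\<^sub>R v')) - (\<Sum>k\<in>UNIV. v' $ k * partial k h a'))) (at \<theta>)" for \<theta>
      by (intro DERIV_diff deriv_along_segment d) (auto intro!: derivative_eq_intros)
    have "\<bar>?G 1 - ?G 0\<bar> \<le> (\<Sum>k\<in>UNIV. C1 k + C2 k) * ?e"
    proof (rule mvt_bound[OF dG])
      fix \<theta> :: real assume \<theta>: "0 \<le> \<theta>" "\<theta> \<le> 1"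
      let ?x = "a + \<theta> *\<^sub>R v" and ?x' = "a' + \<theta> *\<^sub>R v'"
      have x: "norm ?x \<le> B" "norm ?x' \<le> B" by (rule norm_segment_le; use n \<theta> in \<open>auto simp: v_def v'_def\<close>)+
      have each: "\<bar>v $ k * (partial k h ?x - partial k h a) - v' $ k * (partial k h ?x' - partial k h a')\<bar> \<le> (C1 k + C2 k) * ?e" for k
      proof -
        let ?D = "partial k h ?x - partial k h a" and ?D' = "partial k h ?x' - partial k h a'"
        have D1: "\<bar>?D - ?D'\<bar> \<le> C2 k * (norm (a - a') * norm v + norm (v - v'))"
        proof -
          have "\<bar>?D - ?D'\<bar> \<le> C2 k * (norm (a - a') * norm (?x - a) + norm ((?x - a) - (?x' - a')))" by (rule C2(2)) (use n x in auto)
          also have "\<dots> = C2 k * (norm (a - a') * (\<theta> * norm v) + \<theta> * norm (v - v'))"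
            using \<theta> by (simp add: scaleR_diff_right[symmetric])
          also have "\<dots> \<le> C2 k * (norm (a - a') * norm v + norm (v - v'))"
            using \<theta> by (intro mult_left_mono[OF _ C2(1)] add_mono mult_left_mono) (auto simp: mult_left_le_one_le)
          finally show ?thesis .
        qed
        have D2: "\<bar>?D'\<bar> \<le> C1 k * norm v'"
        proof -
          have "\<bar>?D'\<bar> \<le> C1 k * norm (?x' - a')" using C1(2)[OF x(2) n(3)] by blast
          also have "\<dots> \<le> C1 k * norm v'" using \<theta> by (intro mult_left_mono[OF _ C1(1)]) (auto simp: mult_left_le_one_le)
          finally show ?thesis .
        qed
        have "\<bar>v $ k * ?D - v' $ k * ?D'\<bar> = \<bar>v $ k * (?D - ?D') + (v - v') $ k * ?D'\<bar>" by (simp add: algebra_simps)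
        also have "\<dots> \<le> \<bar>v $ k\<bar> * \<bar>?D - ?D'\<bar> + \<bar>(v - v') $ k\<bar> * \<bar>?D'\<bar>"
          by (intro order_trans[OF abs_triangle_ineq]) (simp only: abs_mult)
        also have "\<dots> \<le> norm v * (C2 k * (norm (a - a') * norm v + norm (v - v'))) + norm (v - v') * (C1 k * norm v')"
          using D1 D2 by (intro add_mono mult_mono component_le_norm_cart) auto
        also have "\<dots> \<le> (C1 k + C2 k) * ?e"
        proof -
          have "0 \<le> C1 k * (norm (a - a') * (norm v)\<^sup>2 + norm (v - v') * norm v)" "0 \<le> C2 k * (norm (v - v') * norm v')"
            using C1(1) C2(1) by (auto intro!: mult_nonneg_nonneg add_nonneg_nonneg)
          then show ?thesis by (simp add: algebra_simps power2_eq_square)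
        qed
        finally show ?thesis .
      qed
      have eq: "((\<Sum>k\<in>UNIV. v $ k * partial k h ?x) - (\<Sum>k\<in>UNIV. v $ k * partial k h a)) -
        ((\<Sum>k\<in>UNIV. v' $ k * partial k h ?x') - (\<Sum>k\<in>UNIV. v' $ k * partial k h a'))
        = (\<Sum>k\<in>UNIV. v $ k * (partial k h ?x - partial k h a) - v' $ k * (partial k h ?x' - partial k h a'))"
        by (simp add: sum_subtractf right_diff_distrib)
      show "\<bar>((\<Sum>k\<in>UNIV. v $ k * partial k h ?x) - (\<Sum>k\<in>UNIV. v $ k * partial k h a)) -
        ((\<Sum>k\<in>UNIV. v' $ k * partial k h ?x') - (\<Sum>k\<in>UNIV. v' $ k * partial k h a'))\<bar> \<le> (\<Sum>k\<in>UNIV. C1 k + C2 k) * ?e"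
        unfolding eq sum_distrib_right by (intro order_trans[OF sum_abs] sum_mono each)
    qed
    also have "\<dots> \<le> C * ?e" using CC(4) by (intro mult_right_mono) auto
    finally show ?thesis by (simp add: taylor_rem_def v_def v'_def algebra_simps)
  qed
  have "C3_bounds C B h"
    unfolding C3_bounds_def
  proof (intro conjI allI impI)
    show "C \<ge> 0" using C0 CC by linarith
  next
    fix a b :: "real ^ 'n" and k assume n: "norm a \<le> B" "norm b \<le> B"
    show "\<bar>h a\<bar> \<le> C" "\<bar>partial k h a\<bar> \<le> C" using C0(2)[OF n] C1(2)[OF n, of k] CC(1) CC(2)[of k] by linarith+
    show "\<bar>h a - h b\<bar> \<le> C * norm (a - b)" by (rule m[of _ C0]) (use C0(2)[OF n] CC in auto)
    show "\<bar>partial k h a - partial k h b\<bar> \<le> C * norm (a - b)" by (rule m[of _ "C1 k"]) (use C1(2)[OF n, of k] CC in auto)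
  next
    fix a b a' b' :: "real ^ 'n" and k assume n: "norm a \<le> B" "norm b \<le> B" "norm a' \<le> B" "norm b' \<le> B"
    show "\<bar>(partial k h b - partial k h a) - (partial k h b' - partial k h a')\<bar>
           \<le> C * (norm (a - a') * norm (b - a) + norm ((b - a) - (b' - a')))"
      by (rule m[OF C2(2)[OF n] CC(3)]) auto
  qed (rule taylor)
  then show ?thesis by blast
qed

section \<open>Germs of rough path states and their differences\<close>

text \<open>\<open>N\<close> is kept apart from the other bounds because it blows up at time 0, so that all estimates
  must be linear in it; this is why \<open>v\<close> is measured in the sup norm wherever that suffices.\<close>

definition rp_state :: "real \<Rightarrow> real \<Rightarrow> real \<Rightarrow> 'n::finite path \<Rightarrow> 'n area \<Rightarrow> 'n path \<Rightarrow> bool" where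
  "rp_state \<alpha> M N X A v \<longleftrightarrow> M \<ge> 0 \<and> N \<ge> 0 \<and>
    (\<forall>x\<in>{0..2*pi}. norm (X x) \<le> M \<and> norm (v x) \<le> M) \<and>
    (\<forall>x\<in>{0..2*pi}. \<forall>y\<in>{0..2*pi}. norm (X y - X x) \<le> M * \<bar>y - x\<bar> powr \<alpha> \<and>
       norm (A x y) \<le> M * \<bar>y - x\<bar> powr (2 * \<alpha>) \<and> norm (v y - v x) \<le> N * \<bar>y - x\<bar>) \<and>
    (\<forall>x\<in>{0..2*pi}. \<forall>y\<in>{0..2*pi}. \<forall>z\<in>{0..2*pi}. \<forall>i j.
       A x z $ i $ j - A y z $ i $ j - A x y $ i $ j = (X y - X x) $ i * (X z - X y) $ j)"

text \<open>\<open>W\<close> is for \<open>v - v'\<close> what \<open>N\<close> is for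
  \<open>v\<close>: it is singular at time 0 and must therefore enter the estimates linearly and
  never multiplied by \<open>N\<close>. Only \<open>d\<close>, which stays bounded in time, may be
  multiplied by \<open>N\<close>.\<close>

definition rp_close :: "real \<Rightarrow> real \<Rightarrow> real \<Rightarrow> 'n::finite path \<Rightarrow> 'n area \<Rightarrow> 'n path \<Rightarrow>
    'n path \<Rightarrow> 'n area \<Rightarrow> 'n path \<Rightarrow> bool" where
  "rp_close \<alpha> d W X A v X' A' v' \<longleftrightarrow> d \<ge> 0 \<and> W \<ge> 0 \<and>
    (\<forall>x\<in>{0..2*pi}. norm (X x - X' x) \<le> d \<and> norm (v x - v' x) \<le> d) \<and>
    (\<forall>x\<in>{0..2*pi}. \<forall>y\<in>{0..2*pi}. norm ((X y - X x) - (X' y - X' x)) \<le> d * \<bar>y - x\<bar> powr \<alpha> \<and>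
       norm (A x y - A' x y) \<le> d * \<bar>y - x\<bar> powr (2 * \<alpha>) \<and>
       norm ((v y - v x) - (v' y - v' x)) \<le> W * \<bar>y - x\<bar>)"

definition scalar_germ :: "(real ^ 'n::finite \<Rightarrow> real) \<Rightarrow> 'n \<Rightarrow> 'n path \<Rightarrow> 'n area \<Rightarrow> 'n path \<Rightarrow> real \<Rightarrow> real \<Rightarrow> real" where
  "scalar_germ h j X A v a b = h (X a + v a) * (X b - X a) $ j + (\<Sum>k\<in>UNIV. partial k h (X a + v a) * A a b $ k $ j)"

text \<open>The numbers 7 and 49 in the constants bound \<open>2 * pi\<close> and its square.\<close>

definition germ_const :: "real \<Rightarrow> real \<Rightarrow> real \<Rightarrow> real" where
  "germ_const C M n = (let K2 = 2 * M\<^sup>2 + 28 * M in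
     C * (2 * K2 + 188 * M + 98 + 21 * n) * M + C * (K2 + 7 * n) + n * (C * ((2 * M + 148) * M + M + 49)))"

definition germ_size_const :: "real \<Rightarrow> real \<Rightarrow> real \<Rightarrow> real" where
  "germ_size_const C M n = C * (2 * M + 1) * (1 + 7 * n)"

lemma rp_state_norm:
  assumes "rp_state \<alpha> M N X A v" "x \<in> {0..2*pi}"
  shows "norm (X x + v x) \<le> 2 * M"
proof -
  have "norm (X x) \<le> M" "norm (v x) \<le> M" using assms by (simp_all add: rp_state_def)
  then show ?thesis using norm_triangle_ineq[of "X x" "v x"] by linarith
qed

lemma component2_le:
  fixes A :: "real ^ 'm ^ 'n"
  shows "norm A \<le> B \<Longrightarrow> \<bar>A $ k $ j\<bar> \<le> B"
  using component_le_norm_cart[of "A $ k" j] Finite_Cartesian_Product.norm_nth_le[of A k] by linarith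

text \<open>Since \<open>2 * \<alpha> < 1\<close>, a length in \<open>{0..2*pi}\<close> is at most 7
  times its power \<open>2 * \<alpha>\<close>. Lipschitz increments of \<open>v\<close> thus count
  as terms of order \<open>2 * \<alpha>\<close>, like the area.\<close>

lemma interval_powr_facts:
  fixes l \<alpha> :: real
  assumes "0 \<le> l" "l \<le> 2 * pi" "0 < \<alpha>" "\<alpha> < 1 / 2"
  shows "l powr \<alpha> \<le> 7" "l \<le> 7 * (l powr \<alpha>)\<^sup>2" "l powr (2 * \<alpha>) = (l powr \<alpha>)\<^sup>2" "l powr (3 * \<alpha>) = (l powr \<alpha>) ^ 3"
proof -
  have p7: "l powr c \<le> 7" if c: "0 \<le> c" "c \<le> 1" for c
  proof -
    have "l powr c \<le> 7 powr c" using assms c pi_less_4 pi_approx by (intro powr_mono2) auto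
    also have "\<dots> \<le> 7 powr 1" using c by (intro powr_mono) auto
    finally show ?thesis by simp
  qed
  show "l powr \<alpha> \<le> 7" using p7 assms by auto
  show e2: "l powr (2 * \<alpha>) = (l powr \<alpha>)\<^sup>2" by (simp add: power2_eq_square powr_add[symmetric])
  show "l powr (3 * \<alpha>) = (l powr \<alpha>) ^ 3" by (simp add: power3_eq_cube powr_add[symmetric])
  have "l = l powr (1 - 2 * \<alpha>) * l powr (2 * \<alpha>)" using assms by (cases "l = 0") (auto simp: powr_add[symmetric])
  also have "\<dots> \<le> 7 * l powr (2 * \<alpha>)" using assms by (intro mult_right_mono p7) auto
  finally show "l \<le> 7 * (l powr \<alpha>)\<^sup>2" using e2 by simp
qed

text \<open>By Chen's relation the defect of one germ consists of \<open>R * (X c - X b) $ j\<close>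
  and the terms \<open>\<Delta> k * A b c $ k $ j\<close>. Here \<open>R\<close> is what remains of
  the increment of \<open>h (u _)\<close> after subtracting its first order part in
  \<open>X\<close>; it has order \<open>2 * \<alpha>\<close>, and \<open>\<Delta> k\<close>, an
  increment of a partial derivative, has order \<alpha>. All products thus have order
  \<open>3 * \<alpha>\<close>. The difficulty is linearity: increments of \<open>v\<close> and of
  \<open>v - v'\<close> are bounded both by Lipschitz seminorms and by sup norms, and in a product
  of two of them a Lipschitz seminorm is used for one factor only.\<close>

lemma scalar_germ_difference:
  fixes h :: "real ^ 'n::finite \<Rightarrow> real" and j :: 'n
  assumes h: "C3_bounds C (2 * M) h" and \<alpha>: "0 < \<alpha>" "\<alpha> < 1 / 2"
    and s: "rp_state \<alpha> M N X A v" and s': "rp_state \<alpha> M N' X' A' v'" and cl: "rp_close \<alpha> d W X A v X' A' v'"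
    and d: "d \<le> 2 * M" and abc: "0 \<le> a" "a \<le> b" "b \<le> c" "c \<le> 2 * pi"
  defines "\<Xi> \<equiv> \<lambda>a b. scalar_germ h j X A v a b - scalar_germ h j X' A' v' a b"
  shows "\<bar>\<Xi> a c - \<Xi> a b - \<Xi> b c\<bar> \<le> germ_const C M CARD('n) * (d * (1 + N) + W) * (c - a) powr (3 * \<alpha>)"
proof -
  define p where "p = (c - a) powr \<alpha>"
  have l: "0 \<le> c - a" "c - a \<le> 2 * pi" using abc by auto
  note pf = interval_powr_facts[OF l \<alpha>, folded p_def]
  have p0: "p \<ge> 0" by (simp add: p_def)
  have I: "a \<in> {0..2*pi}" "b \<in> {0..2*pi}" "c \<in> {0..2*pi}" using abc by auto
  have M0: "M \<ge> 0" and N0: "N \<ge> 0" and d0: "d \<ge> 0" and W0: "W \<ge> 0" and C0: "C \<ge> 0"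
    using s cl h by (auto simp: rp_state_def rp_close_def C3_bounds_def)
  define E where "E = d * (1 + N) + W"
  have dN0: "0 \<le> d * N" using d0 N0 by simp
  have E: "d \<le> E" "d * N \<le> E" "W \<le> E" "d * (1 + N) \<le> E" "0 \<le> E" "d + d * N + W = E"
    using d0 W0 dN0 by (auto simp: E_def algebra_simps)
  have ab: "\<bar>b - a\<bar> powr \<alpha> \<le> p" "\<bar>c - b\<bar> powr \<alpha> \<le> p" unfolding p_def using abc \<alpha> by (auto intro!: powr_mono2)
  have ab2: "\<bar>b - a\<bar> powr (2 * \<alpha>) \<le> p\<^sup>2" "\<bar>c - b\<bar> powr (2 * \<alpha>) \<le> p\<^sup>2"
    unfolding pf(3)[symmetric] using abc \<alpha> by (auto intro!: powr_mono2)
  have abl: "\<bar>b - a\<bar> \<le> 7 * p\<^sup>2" using pf(2) abc by simp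
  define u u' where "u x = X x + v x" and "u' x = X' x + v' x" for x
  have ub: "norm (u x) \<le> 2 * M" "norm (u' x) \<le> 2 * M" if "x \<in> {0..2*pi}" for x
    unfolding u_def u'_def using rp_state_norm[OF s that] rp_state_norm[OF s' that] by auto
  have uu: "norm (u x - u' x) \<le> 2 * d" if "x \<in> {0..2*pi}" for x
  proof -
    have "u x - u' x = (X x - X' x) + (v x - v' x)" by (simp add: u_def u'_def)
    moreover have "norm (X x - X' x) \<le> d" "norm (v x - v' x) \<le> d" using cl that by (auto simp: rp_close_def)
    ultimately show ?thesis using norm_triangle_ineq[of "X x - X' x" "v x - v' x"] by simp
  qed
  have Xab: "norm (X b - X a) \<le> M * p"
  proof -
    have "norm (X b - X a) \<le> M * \<bar>b - a\<bar> powr \<alpha>" using s I by (simp add: rp_state_def)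
    then show ?thesis using mult_left_mono[OF ab(1) M0] by linarith
  qed
  have X'bc: "norm (X' c - X' b) \<le> M * p"
  proof -
    have "norm (X' c - X' b) \<le> M * \<bar>c - b\<bar> powr \<alpha>" using s' I by (simp add: rp_state_def)
    then show ?thesis using mult_left_mono[OF ab(2) M0] by linarith
  qed
  have A'bc: "norm (A' b c) \<le> M * p\<^sup>2"
  proof -
    have "norm (A' b c) \<le> M * \<bar>c - b\<bar> powr (2 * \<alpha>)" using s' I by (simp add: rp_state_def)
    then show ?thesis using mult_left_mono[OF ab2(2) M0] by linarith
  qed
  have vab: "norm (v b - v a) \<le> 7 * N * p\<^sup>2"
  proof -
    have "norm (v b - v a) \<le> N * \<bar>b - a\<bar>" using s I by (simp add: rp_state_def)
    then show ?thesis using mult_left_mono[OF abl N0] by simp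
  qed
  \<comment> \<open>A second bound, by the sup norm and without smallness. Multiplied with
    \<open>vab\<close> it keeps the square of the increment linear in \<open>N\<close>;
    \<open>w1\<close> and \<open>w2\<close> play the same game for the difference.\<close>
  have vab': "norm (v b - v a) \<le> 2 * M"
  proof -
    have "norm (v b) \<le> M" "norm (v a) \<le> M" using s I by (auto simp: rp_state_def)
    then show ?thesis using norm_triangle_ineq4[of "v b" "v a"] by simp
  qed
  have dX: "norm ((X b - X a) - (X' b - X' a)) \<le> d * p"
  proof -
    have "norm ((X b - X a) - (X' b - X' a)) \<le> d * \<bar>b - a\<bar> powr \<alpha>" using cl I by (simp add: rp_close_def)
    then show ?thesis using mult_left_mono[OF ab(1) d0] by linarith
  qed
  have dXbc: "norm ((X c - X b) - (X' c - X' b)) \<le> d * p"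
  proof -
    have "norm ((X c - X b) - (X' c - X' b)) \<le> d * \<bar>c - b\<bar> powr \<alpha>" using cl I by (simp add: rp_close_def)
    then show ?thesis using mult_left_mono[OF ab(2) d0] by linarith
  qed
  have dAbc: "norm (A b c - A' b c) \<le> d * p\<^sup>2"
  proof -
    have "norm (A b c - A' b c) \<le> d * \<bar>c - b\<bar> powr (2 * \<alpha>)" using cl I by (simp add: rp_close_def)
    then show ?thesis using mult_left_mono[OF ab2(2) d0] by linarith
  qed
  define w where "w = norm ((v b - v a) - (v' b - v' a))"
  have w0: "w \<ge> 0" by (simp add: w_def)
  have w1: "w \<le> 7 * W * p\<^sup>2"
  proof -
    have "w \<le> W * \<bar>b - a\<bar>" unfolding w_def using cl I by (simp add: rp_close_def)
    then show ?thesis using mult_left_mono[OF abl W0] by simp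
  qed
  have w2: "w \<le> 2 * d"
  proof -
    have "norm (v b - v' b) \<le> d" "norm (v a - v' a) \<le> d" using cl I by (auto simp: rp_close_def)
    moreover have eq: "(v b - v a) - (v' b - v' a) = (v b - v' b) - (v a - v' a)" by simp
    ultimately show ?thesis using norm_triangle_ineq4[of "v b - v' b" "v a - v' a"] unfolding w_def eq by linarith
  qed
  define D D' e where "D = norm (u b - u a)" and "D' = norm (u' b - u' a)" and "e = norm ((u b - u a) - (u' b - u' a))"
  have D0: "D \<ge> 0" "D' \<ge> 0" "e \<ge> 0" by (auto simp: D_def D'_def e_def)
  have Dle: "D \<le> norm (X b - X a) + norm (v b - v a)"
    unfolding D_def u_def using norm_triangle_ineq[of "X b - X a" "v b - v a"] by (simp add: algebra_simps)
  have p2: "p\<^sup>2 \<le> 7 * p" using mult_right_mono[OF pf(1) p0] by (simp add: power2_eq_square)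
  have D1: "D \<le> p * (M + 49 * N)"
    using Dle Xab vab mult_left_mono[OF p2, of "7 * N"] N0 by (simp add: algebra_simps)
  have D2: "D \<le> 9 * M" using Dle Xab vab' mult_left_mono[OF pf(1) M0] by linarith
  define K2 where "K2 = 2 * M\<^sup>2 + 28 * M"
  have K20: "K2 \<ge> 0" using M0 by (simp add: K2_def)
  have Dsq: "D\<^sup>2 \<le> K2 * (1 + N) * p\<^sup>2"
  proof -
    have "D\<^sup>2 \<le> (norm (X b - X a) + norm (v b - v a))\<^sup>2" using Dle D0 by (intro power_mono) auto
    also have "\<dots> \<le> 2 * (norm (X b - X a))\<^sup>2 + 2 * (norm (v b - v a))\<^sup>2"
      using sum_squares_bound[of "norm (X b - X a)" "norm (v b - v a)"] by (simp add: power2_sum)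
    also have "(norm (X b - X a))\<^sup>2 \<le> (M * p)\<^sup>2" using Xab by (intro power_mono) auto
    also have "(norm (v b - v a))\<^sup>2 \<le> 2 * M * (7 * N * p\<^sup>2)"
      unfolding power2_eq_square[of "norm (v b - v a)"] using vab vab' M0 by (intro mult_mono) auto
    finally have "D\<^sup>2 \<le> (2 * M\<^sup>2 + 28 * M * N) * p\<^sup>2" by (simp add: power_mult_distrib algebra_simps)
    also have "\<dots> \<le> K2 * (1 + N) * p\<^sup>2"
      unfolding K2_def using M0 N0 by (intro mult_right_mono) (auto simp: algebra_simps)
    finally show ?thesis .
  qed
  have ele: "e \<le> d * p + w"
    using dX norm_triangle_ineq[of "(X b - X a) - (X' b - X' a)" "(v b - v a) - (v' b - v' a)"]
    unfolding e_def w_def u_def u'_def by (simp add: algebra_simps)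
  have e1: "e \<le> p * (d + 49 * W)"
    using ele w1 mult_left_mono[OF p2, of "7 * W"] W0 by (simp add: algebra_simps)
  have eD: "e * D \<le> (64 * M + 49) * E * p\<^sup>2"
  proof -
    have "e * D \<le> (d * p + w) * D" using ele D0(1) by (rule mult_right_mono)
    also have "\<dots> = d * p * D + w * D" by (simp add: algebra_simps)
    also have "\<dots> \<le> d * p * (p * (M + 49 * N)) + 7 * W * p\<^sup>2 * (9 * M)"
      using D1 D2 w1 d0 p0 D0 w0 W0 by (intro add_mono mult_left_mono mult_mono) auto
    also have "\<dots> = (M * d + 49 * (d * N) + 63 * M * W) * p\<^sup>2" by (simp add: algebra_simps power2_eq_square)
    also have "\<dots> \<le> (M * E + 49 * E + 63 * M * E) * p\<^sup>2"
      using E M0 by (intro mult_right_mono add_mono mult_left_mono) auto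
    finally show ?thesis by (simp add: algebra_simps)
  qed
  \<comment> \<open>Linearity once more: \<open>d \<le> 2 * M\<close> turns the square of
    \<open>d\<close> into a multiple of \<open>d\<close>, and the square of \<open>w\<close> is
    bounded by the product of \<open>w1\<close> and \<open>w2\<close>.\<close>
  have esq: "e\<^sup>2 \<le> 60 * M * E * p\<^sup>2"
  proof -
    have "e\<^sup>2 \<le> (d * p + w)\<^sup>2" using ele D0 by (intro power_mono) auto
    also have "\<dots> \<le> 2 * (d * p)\<^sup>2 + 2 * w\<^sup>2" using sum_squares_bound[of "d * p" w] by (simp add: power2_sum)
    also have "(d * p)\<^sup>2 \<le> 2 * M * d * p\<^sup>2"
      unfolding power_mult_distrib using mult_right_mono[OF d d0] by (intro mult_right_mono) (auto simp: power2_eq_square)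
    also have "w\<^sup>2 \<le> 4 * M * (7 * W * p\<^sup>2)"
      unfolding power2_eq_square[of w] using w1 w2 d w0 M0 by (intro mult_mono) auto
    finally have "e\<^sup>2 \<le> (4 * M * d + 56 * M * W) * p\<^sup>2" by (simp add: algebra_simps)
    also have "\<dots> \<le> (4 * M * E + 56 * M * E) * p\<^sup>2"
      using E M0 by (intro mult_right_mono add_mono mult_left_mono) auto
    finally show ?thesis by (simp add: algebra_simps)
  qed
  \<comment> \<open>The triangle inequality expresses the primed increment by the unprimed one, so
    that the result is free of \<open>N'\<close>.\<close>
  have DD: "D' \<le> D + e"
    using norm_triangle_ineq4[of "u b - u a" "(u b - u a) - (u' b - u' a)"] by (simp add: D_def D'_def e_def)
  have eDD: "e * (D + D') \<le> (188 * M + 98) * E * p\<^sup>2"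
  proof -
    have "e * (D + D') \<le> e * (D + (D + e))" using DD D0 by (intro mult_left_mono) auto
    also have "\<dots> = 2 * (e * D) + e\<^sup>2" by (simp add: algebra_simps power2_eq_square)
    finally show ?thesis using eD esq by (simp add: algebra_simps)
  qed
  note h1 = h[unfolded C3_bounds_def, THEN conjunct2, THEN conjunct1, rule_format]
  note h2 = h[unfolded C3_bounds_def, THEN conjunct2, THEN conjunct2, rule_format]
  have tay: "\<bar>taylor_rem h (u a) (u b) - taylor_rem h (u' a) (u' b)\<bar> \<le> C * (2 * K2 + 188 * M + 98) * E * p\<^sup>2"
  proof -
    have "\<bar>taylor_rem h (u a) (u b) - taylor_rem h (u' a) (u' b)\<bar> \<le> C * (norm (u a - u' a) * D\<^sup>2 + e * (D + D'))"
      unfolding D_def D'_def e_def using h2[OF ub(1)[OF I(1)] ub(1)[OF I(2)] ub(2)[OF I(1)] ub(2)[OF I(2)]] by blast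
    also have "\<dots> \<le> C * (2 * d * (K2 * (1 + N) * p\<^sup>2) + (188 * M + 98) * E * p\<^sup>2)"
      using uu[OF I(1)] Dsq d0 by (intro mult_left_mono[OF _ C0] add_mono[OF mult_mono eDD]) auto
    also have "\<dots> = C * (2 * K2 * (d * (1 + N)) + (188 * M + 98) * E) * p\<^sup>2" by (simp add: algebra_simps)
    also have "\<dots> \<le> C * (2 * K2 * E + (188 * M + 98) * E) * p\<^sup>2"
      using E K20 by (intro mult_right_mono mult_left_mono[OF _ C0] add_mono mult_left_mono) auto
    finally show ?thesis by (simp add: algebra_simps)
  qed
  define R R' where "R = taylor_rem h (u a) (u b) + (\<Sum>k\<in>UNIV. (v b - v a) $ k * partial k h (u a))"
    and "R' = taylor_rem h (u' a) (u' b) + (\<Sum>k\<in>UNIV. (v' b - v' a) $ k * partial k h (u' a))"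
  let ?n = "real CARD('n)"
  have pk: "\<bar>partial k h (u a) - partial k h (u' a)\<bar> \<le> C * (2 * d)" "\<bar>partial k h (u a)\<bar> \<le> C" "\<bar>partial k h (u' a)\<bar> \<le> C" for k
    using h1[OF ub(1)[OF I(1)] ub(2)[OF I(1)]] h1[OF ub(2)[OF I(1)] ub(2)[OF I(1)]] mult_left_mono[OF uu[OF I(1)] C0]
    by (meson order_trans)+
  have RR: "\<bar>R - R'\<bar> \<le> C * (2 * K2 + 188 * M + 98 + 21 * ?n) * E * p\<^sup>2"
  proof -
    have "\<bar>(v b - v a) $ k * partial k h (u a) - (v' b - v' a) $ k * partial k h (u' a)\<bar> \<le> 21 * C * E * p\<^sup>2" for k
    proof -
      have "\<bar>(v b - v a) $ k * partial k h (u a) - (v' b - v' a) $ k * partial k h (u' a)\<bar> =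
        \<bar>(v b - v a) $ k * (partial k h (u a) - partial k h (u' a)) + ((v b - v a) - (v' b - v' a)) $ k * partial k h (u' a)\<bar>"
        by (simp add: algebra_simps)
      also have "\<dots> \<le> \<bar>(v b - v a) $ k\<bar> * \<bar>partial k h (u a) - partial k h (u' a)\<bar> + \<bar>((v b - v a) - (v' b - v' a)) $ k\<bar> * \<bar>partial k h (u' a)\<bar>"
        by (intro order_trans[OF abs_triangle_ineq]) (simp only: abs_mult)
      also have "\<dots> \<le> (7 * N * p\<^sup>2) * (C * (2 * d)) + (7 * W * p\<^sup>2) * C"
        using order_trans[OF component_le_norm_cart vab] order_trans[OF component_le_norm_cart w1[unfolded w_def]] pk N0 W0
        by (intro add_mono mult_mono) auto
      also have "\<dots> = (14 * (d * N) + 7 * W) * C * p\<^sup>2" by (simp add: algebra_simps)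
      also have "\<dots> \<le> (14 * E + 7 * E) * C * p\<^sup>2" using E C0 by (intro mult_right_mono add_mono) auto
      finally show ?thesis by (simp add: algebra_simps)
    qed
    then have "\<bar>\<Sum>k\<in>UNIV. (v b - v a) $ k * partial k h (u a) - (v' b - v' a) $ k * partial k h (u' a)\<bar> \<le> (\<Sum>k\<in>(UNIV::'n set). 21 * C * E * p\<^sup>2)"
      by (intro order_trans[OF sum_abs] sum_mono)
    then have "\<bar>\<Sum>k\<in>UNIV. (v b - v a) $ k * partial k h (u a) - (v' b - v' a) $ k * partial k h (u' a)\<bar> \<le> ?n * (21 * C * E * p\<^sup>2)"
      by simp
    moreover have "R - R' = (taylor_rem h (u a) (u b) - taylor_rem h (u' a) (u' b)) +
       (\<Sum>k\<in>UNIV. (v b - v a) $ k * partial k h (u a) - (v' b - v' a) $ k * partial k h (u' a))"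
      by (simp add: R_def R'_def sum_subtractf)
    ultimately have "\<bar>R - R'\<bar> \<le> C * (2 * K2 + 188 * M + 98) * E * p\<^sup>2 + ?n * (21 * C * E * p\<^sup>2)"
      using tay abs_triangle_ineq[of "taylor_rem h (u a) (u b) - taylor_rem h (u' a) (u' b)"
        "\<Sum>k\<in>UNIV. (v b - v a) $ k * partial k h (u a) - (v' b - v' a) $ k * partial k h (u' a)"] by linarith
    then show ?thesis by (simp add: algebra_simps)
  qed
  have Rb: "\<bar>R\<bar> \<le> C * (K2 + 7 * ?n) * (1 + N) * p\<^sup>2"
  proof -
    have "\<bar>taylor_rem h (u a) (u b) - taylor_rem h (u a) (u a)\<bar> \<le>
      C * (norm (u a - u a) * (norm (u b - u a))\<^sup>2 + norm ((u b - u a) - (u a - u a)) * (norm (u b - u a) + norm (u a - u a)))"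
      using h2[OF ub(1)[OF I(1)] ub(1)[OF I(2)] ub(1)[OF I(1)] ub(1)[OF I(1)]] by blast
    then have "\<bar>taylor_rem h (u a) (u b)\<bar> \<le> C * D\<^sup>2" by (simp add: taylor_rem_def D_def power2_eq_square)
    also have "\<dots> \<le> C * (K2 * (1 + N) * p\<^sup>2)" using Dsq C0 by (rule mult_left_mono)
    finally have t: "\<bar>taylor_rem h (u a) (u b)\<bar> \<le> C * (K2 * (1 + N) * p\<^sup>2)" .
    have "\<bar>(v b - v a) $ k * partial k h (u a)\<bar> \<le> (7 * N * p\<^sup>2) * C" for k
      unfolding abs_mult using order_trans[OF component_le_norm_cart vab] pk(2) N0 by (intro mult_mono) auto
    then have "\<bar>\<Sum>k\<in>UNIV. (v b - v a) $ k * partial k h (u a)\<bar> \<le> (\<Sum>k\<in>(UNIV::'n set). (7 * N * p\<^sup>2) * C)"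
      by (intro order_trans[OF sum_abs] sum_mono)
    also have "\<dots> = ?n * 7 * C * N * p\<^sup>2" by simp
    also have "\<dots> \<le> ?n * 7 * C * (1 + N) * p\<^sup>2" using C0 by (intro mult_right_mono mult_left_mono) auto
    finally have "\<bar>R\<bar> \<le> C * (K2 * (1 + N) * p\<^sup>2) + ?n * 7 * C * (1 + N) * p\<^sup>2"
      unfolding R_def using t by linarith
    then show ?thesis by (simp add: algebra_simps)
  qed
  define \<Delta> \<Delta>' where "\<Delta> k = partial k h (u b) - partial k h (u a)" and "\<Delta>' k = partial k h (u' b) - partial k h (u' a)" for k
  have \<Delta>\<Delta>: "\<bar>\<Delta> k - \<Delta>' k\<bar> \<le> C * (2 * M + 148) * E * p" for k
  proof -
    have "\<bar>\<Delta> k - \<Delta>' k\<bar> \<le> C * (norm (u a - u' a) * D + e)"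
      unfolding \<Delta>_def \<Delta>'_def D_def e_def using h2[OF ub(1)[OF I(1)] ub(1)[OF I(2)] ub(2)[OF I(1)] ub(2)[OF I(2)]] by blast
    also have "\<dots> \<le> C * (2 * d * (p * (M + 49 * N)) + p * (d + 49 * W))"
      using uu[OF I(1)] D1 e1 d0 D0 by (intro mult_left_mono[OF _ C0] add_mono mult_mono) auto
    also have "\<dots> = C * (2 * M * d + 98 * (d * N) + d + 49 * W) * p" by (simp add: algebra_simps)
    also have "\<dots> \<le> C * (2 * M * E + 98 * E + E + 49 * E) * p"
      using E M0 p0 by (intro mult_right_mono mult_left_mono[OF _ C0] add_mono mult_left_mono) auto
    finally show ?thesis by (simp add: algebra_simps)
  qed
  have \<Delta>b: "\<bar>\<Delta> k\<bar> \<le> C * (M + 49) * (1 + N) * p" for k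
  proof -
    have "\<bar>\<Delta> k\<bar> \<le> C * D" unfolding \<Delta>_def D_def using h1[OF ub(1)[OF I(2)] ub(1)[OF I(1)]] by blast
    also have "\<dots> \<le> C * (p * (M + 49 * N))" using D1 C0 by (rule mult_left_mono)
    also have "\<dots> \<le> C * (p * ((M + 49) * (1 + N)))"
      using M0 N0 p0 by (intro mult_left_mono[OF _ C0] mult_left_mono) (auto simp: algebra_simps)
    finally show ?thesis by (simp add: algebra_simps)
  qed
  \<comment> \<open>Chen's relation replaces \<open>A a c\<close> by \<open>A a b\<close>,
    \<open>A b c\<close> and a product of increments of \<open>X\<close>. This product supplies
    exactly the first order part that is missing from \<open>h (u b) - h (u a)\<close>.\<close>
  have delta: "scalar_germ h j X A v a c - scalar_germ h j X A v a b - scalar_germ h j X A v b c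
      = - (taylor_rem h (u a) (u b) + (\<Sum>k\<in>UNIV. (v b - v a) $ k * partial k h (u a))) * (X c - X b) $ j
        - (\<Sum>k\<in>UNIV. (partial k h (u b) - partial k h (u a)) * A b c $ k $ j)"
    if chen: "\<forall>x\<in>{0..2*pi}. \<forall>y\<in>{0..2*pi}. \<forall>z\<in>{0..2*pi}. \<forall>i j.
       A x z $ i $ j - A y z $ i $ j - A x y $ i $ j = (X y - X x) $ i * (X z - X y) $ j" and
     u: "\<And>x. u x = X x + v x" for X A v u
  proof -
    have "A a c $ k $ j = A b c $ k $ j + A a b $ k $ j + (X b - X a) $ k * (X c - X b) $ j" for k
      using chen[rule_format, OF I, of k j] by linarith
    note chen_k = this
    have e1: "(\<Sum>k\<in>UNIV. partial k h (u a) * A a c $ k $ j) = (\<Sum>k\<in>UNIV. partial k h (u a) * A b c $ k $ j) +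
      (\<Sum>k\<in>UNIV. partial k h (u a) * A a b $ k $ j) + (\<Sum>k\<in>UNIV. (X b - X a) $ k * partial k h (u a)) * (X c - X b) $ j"
      unfolding sum_distrib_right sum.distrib[symmetric]
      by (intro sum.cong refl) (simp only: chen_k distrib_left mult_ac)
    have e2: "taylor_rem h (u a) (u b) + (\<Sum>k\<in>UNIV. (v b - v a) $ k * partial k h (u a)) =
      h (u b) - h (u a) - (\<Sum>k\<in>UNIV. (X b - X a) $ k * partial k h (u a))"
      unfolding taylor_rem_def by (simp add: u algebra_simps sum.distrib sum_subtractf)
    have e3: "(\<Sum>k\<in>UNIV. (partial k h (u b) - partial k h (u a)) * A b c $ k $ j) =
      (\<Sum>k\<in>UNIV. partial k h (u b) * A b c $ k $ j) - (\<Sum>k\<in>UNIV. partial k h (u a) * A b c $ k $ j)"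
      by (simp add: sum_subtractf left_diff_distrib)
    have e4: "(X c - X a) $ j = (X b - X a) $ j + (X c - X b) $ j" by simp
    have alg: "ha * (x + y) + (s1 + s2 + s3 * y) - (ha * x + s2) - (hb * y + s4) = - (hb - ha - s3) * y - (s4 - s1)"
      for ha hb x y s1 s2 s3 s4 :: real by (simp add: algebra_simps)
    show ?thesis unfolding scalar_germ_def u[symmetric] e1 e2 e3 e4 by (rule alg)
  qed
  have d1: "scalar_germ h j X A v a c - scalar_germ h j X A v a b - scalar_germ h j X A v b c
      = - R * (X c - X b) $ j - (\<Sum>k\<in>UNIV. \<Delta> k * A b c $ k $ j)"
    unfolding R_def \<Delta>_def by (rule delta) (use s in \<open>auto simp: rp_state_def u_def\<close>)
  have d2: "scalar_germ h j X' A' v' a c - scalar_germ h j X' A' v' a b - scalar_germ h j X' A' v' b c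
      = - R' * (X' c - X' b) $ j - (\<Sum>k\<in>UNIV. \<Delta>' k * A' b c $ k $ j)"
    unfolding R'_def \<Delta>'_def by (rule delta) (use s' in \<open>auto simp: rp_state_def u'_def\<close>)
  \<comment> \<open>The products are split so that \<open>R\<close> and \<open>\<Delta> k\<close>,
    which carry the factor \<open>1 + N\<close>, meet increments of size \<open>d\<close>, while
    \<open>R - R'\<close> and \<open>\<Delta> k - \<Delta>' k\<close>, which are of size
    \<open>E\<close>, meet primed increments of size \<open>M\<close>.\<close>
  have "\<Xi> a c - \<Xi> a b - \<Xi> b c = - ((R - R') * (X' c - X' b) $ j + R * ((X c - X b) - (X' c - X' b)) $ j)
      - (\<Sum>k\<in>UNIV. (\<Delta> k - \<Delta>' k) * A' b c $ k $ j + \<Delta> k * (A b c - A' b c) $ k $ j)"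
  proof -
    have "(\<Sum>k\<in>UNIV. (\<Delta> k - \<Delta>' k) * A' b c $ k $ j + \<Delta> k * (A b c - A' b c) $ k $ j) =
      (\<Sum>k\<in>UNIV. \<Delta> k * A b c $ k $ j) - (\<Sum>k\<in>UNIV. \<Delta>' k * A' b c $ k $ j)"
      unfolding sum_subtractf[symmetric] by (intro sum.cong) (auto simp: algebra_simps)
    moreover have "(R - R') * (X' c - X' b) $ j + R * ((X c - X b) - (X' c - X' b)) $ j = R * (X c - X b) $ j - R' * (X' c - X' b) $ j"
      by (simp add: algebra_simps)
    ultimately show ?thesis using d1 d2 unfolding \<Xi>_def by simp
  qed
  moreover have "\<bar>(R - R') * (X' c - X' b) $ j + R * ((X c - X b) - (X' c - X' b)) $ j\<bar> \<le>
     (C * (2 * K2 + 188 * M + 98 + 21 * ?n) * M + C * (K2 + 7 * ?n)) * E * p ^ 3"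
  proof -
    have "\<bar>(R - R') * (X' c - X' b) $ j + R * ((X c - X b) - (X' c - X' b)) $ j\<bar> \<le>
       \<bar>R - R'\<bar> * \<bar>(X' c - X' b) $ j\<bar> + \<bar>R\<bar> * \<bar>((X c - X b) - (X' c - X' b)) $ j\<bar>"
      by (intro order_trans[OF abs_triangle_ineq]) (simp only: abs_mult)
    also have "\<dots> \<le> (C * (2 * K2 + 188 * M + 98 + 21 * ?n) * E * p\<^sup>2) * (M * p) + (C * (K2 + 7 * ?n) * (1 + N) * p\<^sup>2) * (d * p)"
      using RR Rb order_trans[OF component_le_norm_cart X'bc] order_trans[OF component_le_norm_cart dXbc]
      by (intro add_mono mult_mono) (auto intro: order_trans[OF abs_ge_zero])
    also have "\<dots> = (C * (2 * K2 + 188 * M + 98 + 21 * ?n) * M * E + C * (K2 + 7 * ?n) * (d * (1 + N))) * p ^ 3"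
      by (simp add: algebra_simps power2_eq_square power3_eq_cube)
    also have "\<dots> \<le> (C * (2 * K2 + 188 * M + 98 + 21 * ?n) * M * E + C * (K2 + 7 * ?n) * E) * p ^ 3"
      using E(4) C0 K20 p0 by (intro mult_right_mono add_left_mono mult_left_mono) auto
    finally show ?thesis by (simp add: algebra_simps)
  qed
  moreover have "\<bar>\<Sum>k\<in>UNIV. (\<Delta> k - \<Delta>' k) * A' b c $ k $ j + \<Delta> k * (A b c - A' b c) $ k $ j\<bar> \<le>
     ?n * (C * ((2 * M + 148) * M + M + 49)) * E * p ^ 3"
  proof -
    have "\<bar>(\<Delta> k - \<Delta>' k) * A' b c $ k $ j + \<Delta> k * (A b c - A' b c) $ k $ j\<bar> \<le> C * ((2 * M + 148) * M + M + 49) * E * p ^ 3" for k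
    proof -
      have "\<bar>(\<Delta> k - \<Delta>' k) * A' b c $ k $ j + \<Delta> k * (A b c - A' b c) $ k $ j\<bar> \<le>
        \<bar>\<Delta> k - \<Delta>' k\<bar> * \<bar>A' b c $ k $ j\<bar> + \<bar>\<Delta> k\<bar> * \<bar>(A b c - A' b c) $ k $ j\<bar>"
        by (intro order_trans[OF abs_triangle_ineq]) (simp only: abs_mult)
      also have "\<dots> \<le> (C * (2 * M + 148) * E * p) * (M * p\<^sup>2) + (C * (M + 49) * (1 + N) * p) * (d * p\<^sup>2)"
        using \<Delta>\<Delta>[of k] \<Delta>b[of k] component2_le[OF A'bc, of k j]
          component2_le[OF dAbc, of k j]
        by (intro add_mono mult_mono) (auto intro: order_trans[OF abs_ge_zero])
      also have "\<dots> = (C * (2 * M + 148) * M * E + C * (M + 49) * (d * (1 + N))) * p ^ 3"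
        by (simp add: algebra_simps power2_eq_square power3_eq_cube)
      also have "\<dots> \<le> (C * (2 * M + 148) * M * E + C * (M + 49) * E) * p ^ 3"
        using E(4) C0 M0 p0 by (intro mult_right_mono add_left_mono mult_left_mono) auto
      finally show ?thesis by (simp add: algebra_simps)
    qed
    then have "\<bar>\<Sum>k\<in>UNIV. (\<Delta> k - \<Delta>' k) * A' b c $ k $ j + \<Delta> k * (A b c - A' b c) $ k $ j\<bar> \<le> (\<Sum>k\<in>(UNIV::'n set). C * ((2 * M + 148) * M + M + 49) * E * p ^ 3)"
      by (intro order_trans[OF sum_abs] sum_mono)
    then show ?thesis by (simp add: mult.assoc)
  qed
  ultimately have "\<bar>\<Xi> a c - \<Xi> a b - \<Xi> b c\<bar> \<le> (C * (2 * K2 + 188 * M + 98 + 21 * ?n) * M + C * (K2 + 7 * ?n)) * E * p ^ 3 +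
     ?n * (C * ((2 * M + 148) * M + M + 49)) * E * p ^ 3" by linarith
  also have "\<dots> = germ_const C M ?n * E * p ^ 3" unfolding germ_const_def Let_def K2_def by (simp add: algebra_simps)
  finally show ?thesis unfolding E_def pf(4) .
qed

text \<open>At order \<alpha> the bound involves \<open>d\<close> but neither \<open>N\<close> nor
  \<open>W\<close>, because the germ contains the value of \<open>v\<close> at \<open>a\<close> and
  none of its increments.\<close>

lemma scalar_germ_size:
  fixes h :: "real ^ 'n::finite \<Rightarrow> real" and j :: 'n
  assumes h: "C3_bounds C (2 * M) h" and \<alpha>: "0 < \<alpha>" "\<alpha> < 1 / 2"
    and s: "rp_state \<alpha> M N X A v" and s': "rp_state \<alpha> M N' X' A' v'" and cl: "rp_close \<alpha> d W X A v X' A' v'"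
    and ab: "0 \<le> a" "a \<le> b" "b \<le> 2 * pi"
  shows "\<bar>scalar_germ h j X A v a b - scalar_germ h j X' A' v' a b\<bar> \<le> germ_size_const C M CARD('n) * d * (b - a) powr \<alpha>"
proof -
  define p where "p = (b - a) powr \<alpha>"
  have l: "0 \<le> b - a" "b - a \<le> 2 * pi" using ab by auto
  note pf = interval_powr_facts[OF l \<alpha>, folded p_def]
  have p0: "p \<ge> 0" by (simp add: p_def)
  have I: "a \<in> {0..2*pi}" "b \<in> {0..2*pi}" using ab by auto
  have M0: "M \<ge> 0" and d0: "d \<ge> 0" and C0: "C \<ge> 0"
    using s cl h by (auto simp: rp_state_def rp_close_def C3_bounds_def)
  let ?u = "X a + v a" and ?u' = "X' a + v' a"
  have ub: "norm ?u \<le> 2 * M" "norm ?u' \<le> 2 * M"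
    using rp_state_norm[OF s I(1)] rp_state_norm[OF s' I(1)] by auto
  have uu: "norm (?u - ?u') \<le> 2 * d"
  proof -
    have "?u - ?u' = (X a - X' a) + (v a - v' a)" by simp
    moreover have "norm (X a - X' a) \<le> d" "norm (v a - v' a) \<le> d" using cl I by (auto simp: rp_close_def)
    ultimately show ?thesis using norm_triangle_ineq[of "X a - X' a" "v a - v' a"] by (simp only:)
  qed
  note h1 = h[unfolded C3_bounds_def, THEN conjunct2, THEN conjunct1, rule_format]
  have hh: "\<bar>h ?u - h ?u'\<bar> \<le> C * (2 * d)" "\<bar>h ?u'\<bar> \<le> C"
    using h1[OF ub] h1[OF ub(2) ub(2)] mult_left_mono[OF uu C0] by (meson order_trans)+
  have pk: "\<bar>partial k h ?u - partial k h ?u'\<bar> \<le> C * (2 * d)" "\<bar>partial k h ?u'\<bar> \<le> C" for k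
    using h1[OF ub] h1[OF ub(2) ub(2)] mult_left_mono[OF uu C0] by (meson order_trans)+
  have Xb: "norm (X b - X a) \<le> M * p" "norm (A a b) \<le> M * p\<^sup>2"
    using s[unfolded rp_state_def, THEN conjunct2, THEN conjunct2, THEN conjunct2, THEN conjunct1, rule_format, OF I] ab
    unfolding pf(3)[symmetric] by (simp_all add: p_def)
  have dX: "norm ((X b - X a) - (X' b - X' a)) \<le> d * p" "norm (A a b - A' a b) \<le> d * p\<^sup>2"
    using cl[unfolded rp_close_def, THEN conjunct2, THEN conjunct2, THEN conjunct2, rule_format, OF I] ab
    unfolding pf(3)[symmetric] by (simp_all add: p_def)
  have p2: "p\<^sup>2 \<le> 7 * p" using mult_right_mono[OF pf(1) p0] by (simp add: power2_eq_square)
  have "scalar_germ h j X A v a b - scalar_germ h j X' A' v' a b =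
     ((h ?u - h ?u') * (X b - X a) $ j + h ?u' * ((X b - X a) - (X' b - X' a)) $ j) +
     (\<Sum>k\<in>UNIV. (partial k h ?u - partial k h ?u') * A a b $ k $ j + partial k h ?u' * (A a b - A' a b) $ k $ j)"
  proof -
    have "(\<Sum>k\<in>UNIV. (partial k h ?u - partial k h ?u') * A a b $ k $ j + partial k h ?u' * (A a b - A' a b) $ k $ j)
      = (\<Sum>k\<in>UNIV. partial k h ?u * A a b $ k $ j) - (\<Sum>k\<in>UNIV. partial k h ?u' * A' a b $ k $ j)"
      unfolding sum_subtractf[symmetric] by (intro sum.cong) (auto simp: algebra_simps)
    then show ?thesis unfolding scalar_germ_def by (simp add: algebra_simps)
  qed
  moreover have "\<bar>(h ?u - h ?u') * (X b - X a) $ j + h ?u' * ((X b - X a) - (X' b - X' a)) $ j\<bar> \<le> (C * (2 * d)) * (M * p) + C * (d * p)"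
  proof -
    have "\<bar>(h ?u - h ?u') * (X b - X a) $ j + h ?u' * ((X b - X a) - (X' b - X' a)) $ j\<bar> \<le>
      \<bar>h ?u - h ?u'\<bar> * \<bar>(X b - X a) $ j\<bar> + \<bar>h ?u'\<bar> * \<bar>((X b - X a) - (X' b - X' a)) $ j\<bar>"
      by (intro order_trans[OF abs_triangle_ineq]) (simp only: abs_mult)
    also have "\<dots> \<le> (C * (2 * d)) * (M * p) + C * (d * p)"
      using hh C0 d0 order_trans[OF component_le_norm_cart Xb(1)] order_trans[OF component_le_norm_cart dX(1)]
      by (intro add_mono mult_mono) auto
    finally show ?thesis .
  qed
  moreover have "\<bar>\<Sum>k\<in>UNIV. (partial k h ?u - partial k h ?u') * A a b $ k $ j + partial k h ?u' * (A a b - A' a b) $ k $ j\<bar> \<le>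
     real CARD('n) * (7 * ((C * (2 * d)) * (M * p) + C * (d * p)))"
  proof -
    have "\<bar>(partial k h ?u - partial k h ?u') * A a b $ k $ j + partial k h ?u' * (A a b - A' a b) $ k $ j\<bar> \<le> 7 * ((C * (2 * d)) * (M * p) + C * (d * p))" for k
    proof -
      have "\<bar>(partial k h ?u - partial k h ?u') * A a b $ k $ j + partial k h ?u' * (A a b - A' a b) $ k $ j\<bar> \<le>
        \<bar>partial k h ?u - partial k h ?u'\<bar> * \<bar>A a b $ k $ j\<bar> + \<bar>partial k h ?u'\<bar> * \<bar>(A a b - A' a b) $ k $ j\<bar>"
        by (intro order_trans[OF abs_triangle_ineq]) (simp only: abs_mult)
      also have "\<dots> \<le> (C * (2 * d)) * (M * p\<^sup>2) + C * (d * p\<^sup>2)"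
        using pk[of k] C0 d0 component2_le[OF Xb(2), of k j]
          component2_le[OF dX(2), of k j]
        by (intro add_mono mult_mono) auto
      also have "\<dots> \<le> (C * (2 * d)) * (M * (7 * p)) + C * (d * (7 * p))"
        using p2 C0 d0 M0 by (intro add_mono mult_left_mono) auto
      finally show ?thesis by (simp add: algebra_simps)
    qed
    then have "\<bar>\<Sum>k\<in>UNIV. (partial k h ?u - partial k h ?u') * A a b $ k $ j + partial k h ?u' * (A a b - A' a b) $ k $ j\<bar> \<le>
      (\<Sum>k\<in>(UNIV::'n set). 7 * ((C * (2 * d)) * (M * p) + C * (d * p)))" by (intro order_trans[OF sum_abs] sum_mono)
    then show ?thesis by simp
  qed
  ultimately have "\<bar>scalar_germ h j X A v a b - scalar_germ h j X' A' v' a b\<bar> \<le> ((C * (2 * d)) * (M * p) + C * (d * p)) +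
      real CARD('n) * (7 * ((C * (2 * d)) * (M * p) + C * (d * p)))" by linarith
  also have "\<dots> = germ_size_const C M CARD('n) * d * p" unfolding germ_size_const_def by (simp add: algebra_simps)
  finally show ?thesis unfolding p_def .
qed

section \<open>Indefinite rough integrals\<close>

definition vector_germ :: "(real ^ 'n::finite \<Rightarrow> real ^ 'n ^ 'n) \<Rightarrow> 'n path \<Rightarrow> 'n area \<Rightarrow> 'n path \<Rightarrow> real \<Rightarrow> real \<Rightarrow> real ^ 'n" where
  "vector_germ g X A v = rough_summand (X, A) (\<lambda>y. g (X y + v y))
     (\<lambda>y. \<chi> i j k. frechet_derivative g (at (X y + v y)) (axis k 1) $ i $ j)"

lemma bounded_linear_matrix_entry: "bounded_linear (\<lambda>B :: real ^ 'm ^ 'n. B $ i $ j)"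
  by (rule bounded_linear_compose[OF bounded_linear_vec_nth bounded_linear_vec_nth])

lemma vector_germ_component:
  fixes g :: "real ^ 'n::finite \<Rightarrow> real ^ 'n ^ 'n"
  assumes "\<And>x. g differentiable (at x)"
  shows "vector_germ g X A v a b $ i = (\<Sum>j\<in>UNIV. scalar_germ (\<lambda>x. g x $ i $ j) j X A v a b)"
  using frechet_derivative_bounded_linear_compose(2)[OF bounded_linear_matrix_entry assms]
  by (simp add: vector_germ_def rough_summand_def scalar_germ_def incr_def partial_def sum.distrib)

definition C3_matrix_bounds :: "real \<Rightarrow> real \<Rightarrow> (real ^ 'n::finite \<Rightarrow> real ^ 'n ^ 'n) \<Rightarrow> bool" where
  "C3_matrix_bounds C B g \<longleftrightarrow> (\<forall>x. g differentiable (at x)) \<and> (\<forall>i j. C3_bounds C B (\<lambda>x. g x $ i $ j))"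

lemma smooth_C3_matrix_bounds:
  fixes g :: "real ^ 'n::finite \<Rightarrow> real ^ 'n ^ 'n"
  assumes g: "smooth g" and B: "B \<ge> 0"
  shows "\<exists>C. C3_matrix_bounds C B g"
proof -
  have "Ck 3 g" "Ck 1 g" using g by (auto simp only: smooth_def)
  then have "\<forall>i j. \<exists>C. C3_bounds C B (\<lambda>x. g x $ i $ j)"
    using C3_bounds_exists[OF Ck_bounded_linear_compose[OF bounded_linear_matrix_entry] B] by blast
  then obtain C where C: "\<And>i j. C3_bounds (C i j) B (\<lambda>x. g x $ i $ j)" by metis
  then have C0: "C i j \<ge> 0" for i j by (auto simp: C3_bounds_def)
  have "C i j \<le> (\<Sum>i\<in>UNIV. \<Sum>j\<in>UNIV. C i j)" for i j
  proof -
    have "C i j \<le> (\<Sum>j\<in>UNIV. C i j)" using C0 by (intro member_le_sum) auto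
    also have "\<dots> \<le> (\<Sum>i\<in>UNIV. \<Sum>j\<in>UNIV. C i j)" using C0 by (intro member_le_sum[where f="\<lambda>i. \<Sum>j\<in>UNIV. C i j"] sum_nonneg) auto
    finally show ?thesis .
  qed
  then have "C3_bounds (\<Sum>i\<in>UNIV. \<Sum>j\<in>UNIV. C i j) B (\<lambda>x. g x $ i $ j)" for i j
    by (rule C3_bounds_mono[OF C])
  then show ?thesis using \<open>Ck 1 g\<close> unfolding C3_matrix_bounds_def by auto
qed

lemma norm_vec_le_double_sum:
  fixes v :: "real ^ 'n::finite"
  assumes "\<And>i. v $ i = (\<Sum>j\<in>(UNIV::'n set). s i j)" "\<And>i j. \<bar>s i j\<bar> \<le> c"
  shows "norm v \<le> (real CARD('n))\<^sup>2 * c"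
proof -
  have "norm v \<le> (\<Sum>i\<in>UNIV. \<bar>v $ i\<bar>)" by (rule norm_le_l1_cart)
  also have "\<dots> \<le> (\<Sum>i\<in>(UNIV::'n set). \<Sum>j\<in>(UNIV::'n set). c)"
    unfolding assms(1) by (intro sum_mono order_trans[OF sum_abs] assms(2))
  finally show ?thesis by (simp add: power2_eq_square mult.assoc)
qed

lemma vector_germ_difference:
  fixes g :: "real ^ 'n::finite \<Rightarrow> real ^ 'n ^ 'n"
  assumes g: "C3_matrix_bounds C (2 * M) g" and \<alpha>: "0 < \<alpha>" "\<alpha> < 1 / 2"
    and s: "rp_state \<alpha> M N X A v" and s': "rp_state \<alpha> M N' X' A' v'" and cl: "rp_close \<alpha> d W X A v X' A' v'"
    and d: "d \<le> 2 * M"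
  defines "\<Xi> \<equiv> \<lambda>a b. vector_germ g X A v a b - vector_germ g X' A' v' a b"
  shows "0 \<le> a \<Longrightarrow> a \<le> b \<Longrightarrow> b \<le> c \<Longrightarrow> c \<le> 2 * pi \<Longrightarrow> norm (\<Xi> a c - \<Xi> a b - \<Xi> b c) \<le>
      (real CARD('n))\<^sup>2 * (germ_const C M CARD('n) * (d * (1 + N) + W)) * (c - a) powr (3 * \<alpha>)"
    and "0 \<le> a \<Longrightarrow> a \<le> b \<Longrightarrow> b \<le> 2 * pi \<Longrightarrow> norm (\<Xi> a b) \<le>
      (real CARD('n))\<^sup>2 * (germ_size_const C M CARD('n) * d) * (b - a) powr \<alpha>"
proof -
  have dg: "\<And>x. g differentiable (at x)" and h: "\<And>i j. C3_bounds C (2 * M) (\<lambda>x. g x $ i $ j)"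
    using g by (auto simp: C3_matrix_bounds_def)
  show "norm (\<Xi> a c - \<Xi> a b - \<Xi> b c) \<le> (real CARD('n))\<^sup>2 * (germ_const C M CARD('n) * (d * (1 + N) + W)) * (c - a) powr (3 * \<alpha>)"
    if abc: "0 \<le> a" "a \<le> b" "b \<le> c" "c \<le> 2 * pi"
    unfolding mult.assoc
  proof (rule norm_vec_le_double_sum)
    fix i
    let ?s = "\<lambda>j a b. scalar_germ (\<lambda>x. g x $ i $ j) j X A v a b - scalar_germ (\<lambda>x. g x $ i $ j) j X' A' v' a b"
    show "(\<Xi> a c - \<Xi> a b - \<Xi> b c) $ i = (\<Sum>j\<in>UNIV. ?s j a c - ?s j a b - ?s j b c)"
      by (simp add: \<Xi>_def vector_germ_component[OF dg] sum_subtractf)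
    show "\<bar>?s j a c - ?s j a b - ?s j b c\<bar> \<le> germ_const C M CARD('n) * ((d * (1 + N) + W) * (c - a) powr (3 * \<alpha>))" for j
      using scalar_germ_difference[OF h \<alpha> s s' cl d abc] by (simp add: mult.assoc)
  qed
  show "norm (\<Xi> a b) \<le> (real CARD('n))\<^sup>2 * (germ_size_const C M CARD('n) * d) * (b - a) powr \<alpha>"
    if ab: "0 \<le> a" "a \<le> b" "b \<le> 2 * pi"
    unfolding mult.assoc
  proof (rule norm_vec_le_double_sum)
    fix i
    let ?s = "\<lambda>j a b. scalar_germ (\<lambda>x. g x $ i $ j) j X A v a b - scalar_germ (\<lambda>x. g x $ i $ j) j X' A' v' a b"
    show "\<Xi> a b $ i = (\<Sum>j\<in>UNIV. ?s j a b)"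
      by (simp add: \<Xi>_def vector_germ_component[OF dg] sum_subtractf)
    show "\<bar>?s j a b\<bar> \<le> germ_size_const C M CARD('n) * (d * (b - a) powr \<alpha>)" for j
      using scalar_germ_size[OF h \<alpha> s s' cl ab] by (simp add: mult.assoc)
  qed
qed

lemma germ_const_nonneg: "C \<ge> 0 \<Longrightarrow> M \<ge> 0 \<Longrightarrow> germ_const C M (real n) \<ge> 0" "C \<ge> 0 \<Longrightarrow> M \<ge> 0 \<Longrightarrow> germ_size_const C M (real n) \<ge> 0"
  by (auto simp: germ_const_def germ_size_const_def Let_def intro!: add_nonneg_nonneg mult_nonneg_nonneg)

text \<open>The first term is the size of the germ. The second is the sewing error of order
  \<open>3 * \<alpha>\<close>, where 49, the square of 7, bounds the surplus power
  \<open>2 * \<alpha>\<close> of the length; \<open>n^2\<close> counts the matrix entries.\<close>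

definition path_const :: "real \<Rightarrow> real \<Rightarrow> real \<Rightarrow> real \<Rightarrow> real" where
  "path_const \<alpha> C M n = n\<^sup>2 * (germ_size_const C M n + 49 * sew_const (3 * \<alpha>) * germ_const C M n)"

text \<open>A path is recognized as an indefinite rough integral by its germ. Some constant
  \<open>K\<close> is enough, since \<open>sewing_bound\<close> replaces it by an explicit
  one.\<close>

definition rough_path_integral :: "real \<Rightarrow> (real ^ 'n::finite \<Rightarrow> real ^ 'n ^ 'n) \<Rightarrow> 'n path \<Rightarrow> 'n area \<Rightarrow> 'n path \<Rightarrow> 'n path \<Rightarrow> bool" where
  "rough_path_integral \<alpha> g X A v Z \<longleftrightarrow> Z 0 = 0 \<and>
     (\<exists>K\<ge>0. \<forall>a b. 0 \<le> a \<longrightarrow> a \<le> b \<longrightarrow> b \<le> 2 * pi \<longrightarrow> norm (Z b - Z a - vector_germ g X A v a b) \<le> K * (b - a) powr (3 * \<alpha>))"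

lemma rp_state_zero: "M \<ge> 0 \<Longrightarrow> rp_state \<alpha> M 0 (\<lambda>_. 0) (\<lambda>_ _. 0) (\<lambda>_. 0)"
  by (simp add: rp_state_def)

lemma rp_close_zero: "rp_state \<alpha> M N X A v \<Longrightarrow> rp_close \<alpha> M N X A v (\<lambda>_. 0) (\<lambda>_ _. 0) (\<lambda>_. 0)"
  by (simp add: rp_state_def rp_close_def)

lemma vector_germ_zero: "vector_germ g (\<lambda>_. 0) (\<lambda>_ _. 0) v a b = 0"
  by (simp add: vector_germ_def rough_summand_def incr_def vec_eq_iff)

text \<open>The difference of the paths is sewn from the difference of the germs, so
  \<open>sewing_bound\<close> removes the unknown constant \<open>K + K'\<close>. The germ
  difference itself is of order \<alpha> by the second part of
  \<open>vector_germ_difference\<close>.\<close>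

lemma rough_path_integral_difference:
  fixes g :: "real ^ 'n::finite \<Rightarrow> real ^ 'n ^ 'n"
  assumes g: "C3_matrix_bounds C (2 * M) g" and \<alpha>: "1 / 3 < \<alpha>" "\<alpha> < 1 / 2"
    and s: "rp_state \<alpha> M N X A v" and s': "rp_state \<alpha> M N' X' A' v'" and cl: "rp_close \<alpha> d W X A v X' A' v'"
    and d: "d \<le> 2 * M" and Z: "rough_path_integral \<alpha> g X A v Z" and Z': "rough_path_integral \<alpha> g X' A' v' Z'"
    and xy: "x \<in> {0..2*pi}" "y \<in> {0..2*pi}"
  shows "norm ((Z x - Z' x) - (Z y - Z' y)) \<le> path_const \<alpha> C M CARD('n) * (d * (1 + N) + W) * \<bar>x - y\<bar> powr \<alpha>"
proof -
  have \<alpha>': "0 < \<alpha>" "\<alpha> < 1 / 2" and \<theta>: "3 * \<alpha> > 1" using \<alpha> by auto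
  define \<Xi> where "\<Xi> a b = vector_germ g X A v a b - vector_germ g X' A' v' a b" for a b
  let ?n = "real CARD('n)"
  have C0: "C \<ge> 0" using g by (auto simp: C3_matrix_bounds_def C3_bounds_def)
  have M0: "M \<ge> 0" and N0: "N \<ge> 0" and d0: "d \<ge> 0" and W0: "W \<ge> 0"
    using s cl by (auto simp: rp_state_def rp_close_def)
  define E where "E = d * (1 + N) + W"
  have E: "0 \<le> E" "d \<le> E" unfolding E_def using d0 N0 W0 mult_nonneg_nonneg[OF d0 N0] by (auto simp: algebra_simps)
  note gd = vector_germ_difference[OF g \<alpha>' s s' cl d, folded \<Xi>_def E_def]
  obtain K where K: "K \<ge> 0" "\<And>a b. 0 \<le> a \<Longrightarrow> a \<le> b \<Longrightarrow> b \<le> 2 * pi \<Longrightarrow> norm (Z b - Z a - vector_germ g X A v a b) \<le> K * (b - a) powr (3 * \<alpha>)"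
    using Z unfolding rough_path_integral_def by auto
  obtain K' where K': "K' \<ge> 0" "\<And>a b. 0 \<le> a \<Longrightarrow> a \<le> b \<Longrightarrow> b \<le> 2 * pi \<Longrightarrow> norm (Z' b - Z' a - vector_germ g X' A' v' a b) \<le> K' * (b - a) powr (3 * \<alpha>)"
    using Z' unfolding rough_path_integral_def by auto
  have Mg: "0 \<le> ?n\<^sup>2 * (germ_const C M ?n * E)" using germ_const_nonneg C0 M0 E by (intro mult_nonneg_nonneg) auto
  define S where "S x = Z x - Z' x" for x
  have ordered: "norm (S b - S a) \<le> path_const \<alpha> C M ?n * E * (b - a) powr \<alpha>" if ab: "0 \<le> a" "a \<le> b" "b \<le> 2 * pi" for a b
  proof -
    have "norm (S b - S a - \<Xi> a b) \<le> sew_const (3 * \<alpha>) * (?n\<^sup>2 * (germ_const C M ?n * E)) * (b - a) powr (3 * \<alpha>)"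
    proof (rule sewing_bound[OF \<theta> Mg _ _ _ ab])
      show "\<Xi> a a = 0" if "0 \<le> a" "a \<le> 2 * pi" for a
        using gd(2)[of a a] that by simp
      show "norm (\<Xi> a c - \<Xi> a b - \<Xi> b c) \<le> ?n\<^sup>2 * (germ_const C M ?n * E) * (c - a) powr (3 * \<alpha>)"
        if "0 \<le> a" "a \<le> b" "b \<le> c" "c \<le> 2 * pi" for a b c by (rule gd(1)[OF that])
      show "norm (S b - S a - \<Xi> a b) \<le> (K + K') * (b - a) powr (3 * \<alpha>)" if ab: "0 \<le> a" "a \<le> b" "b \<le> 2 * pi" for a b
      proof -
        have eq: "S b - S a - \<Xi> a b = (Z b - Z a - vector_germ g X A v a b) - (Z' b - Z' a - vector_germ g X' A' v' a b)"
          by (simp add: S_def \<Xi>_def)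
        show ?thesis unfolding eq distrib_right using K(2)[OF ab] K'(2)[OF ab]
            norm_triangle_ineq4[of "Z b - Z a - vector_germ g X A v a b" "Z' b - Z' a - vector_germ g X' A' v' a b"] by linarith
      qed
    qed
    also have "\<dots> \<le> sew_const (3 * \<alpha>) * (?n\<^sup>2 * (germ_const C M ?n * E)) * (49 * (b - a) powr \<alpha>)"
    proof (rule mult_left_mono)
      let ?p = "(b - a) powr \<alpha>"
      have p: "0 \<le> ?p" "?p \<le> 7" "(b - a) powr (3 * \<alpha>) = ?p ^ 3" using interval_powr_facts[of "b - a" \<alpha>] ab \<alpha>' by auto
      have "?p\<^sup>2 * ?p \<le> 7\<^sup>2 * ?p" using p by (intro mult_right_mono power_mono) auto
      then show "(b - a) powr (3 * \<alpha>) \<le> 49 * ?p" unfolding p(3) by (simp add: power3_eq_cube power2_eq_square)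
      show "0 \<le> sew_const (3 * \<alpha>) * (?n\<^sup>2 * (germ_const C M ?n * E))" using sew_const_pos[OF \<theta>] Mg by simp
    qed
    finally have 1: "norm (S b - S a - \<Xi> a b) \<le> sew_const (3 * \<alpha>) * (?n\<^sup>2 * (germ_const C M ?n * E)) * (49 * (b - a) powr \<alpha>)" .
    have "norm (\<Xi> a b) \<le> ?n\<^sup>2 * (germ_size_const C M ?n * d) * (b - a) powr \<alpha>" by (rule gd(2)[OF ab])
    also have "\<dots> \<le> ?n\<^sup>2 * (germ_size_const C M ?n * E) * (b - a) powr \<alpha>"
      using E germ_const_nonneg(2)[OF C0 M0, of "CARD('n)"] by (intro mult_right_mono mult_left_mono) auto
    finally have "norm (S b - S a) \<le> sew_const (3 * \<alpha>) * (?n\<^sup>2 * (germ_const C M ?n * E)) * (49 * (b - a) powr \<alpha>) +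
        ?n\<^sup>2 * (germ_size_const C M ?n * E) * (b - a) powr \<alpha>"
      using norm_triangle_ineq[of "S b - S a - \<Xi> a b" "\<Xi> a b"] 1 by simp
    also have "\<dots> = path_const \<alpha> C M ?n * E * (b - a) powr \<alpha>" unfolding path_const_def by (simp add: algebra_simps)
    finally show ?thesis .
  qed
  show ?thesis
    using ordered[of x y] ordered[of y x] xy unfolding S_def E_def
    by (cases "x \<le> y") (auto simp: norm_minus_commute abs_minus_commute)
qed

text \<open>The germ of the zero state vanishes, so the difference estimates against it, with
  \<open>d = M\<close> and \<open>W = N\<close>, provide both the defect bound needed for sewing and
  the Hoelder bound of the result.\<close>

lemma rough_path_integral_exists:
  fixes g :: "real ^ 'n::finite \<Rightarrow> real ^ 'n ^ 'n"
  assumes g: "C3_matrix_bounds C (2 * M) g" and \<alpha>: "1 / 3 < \<alpha>" "\<alpha> < 1 / 2" and s: "rp_state \<alpha> M N X A v"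
  obtains Z where "rough_path_integral \<alpha> g X A v Z"
    "\<And>x y. x \<in> {0..2*pi} \<Longrightarrow> y \<in> {0..2*pi} \<Longrightarrow>
       norm (Z x - Z y) \<le> path_const \<alpha> C M CARD('n) * (M * (1 + N) + N) * \<bar>x - y\<bar> powr \<alpha>"
proof -
  have \<alpha>': "0 < \<alpha>" "\<alpha> < 1 / 2" and \<theta>: "3 * \<alpha> > 1" using \<alpha> by auto
  have C0: "C \<ge> 0" using g by (auto simp: C3_matrix_bounds_def C3_bounds_def)
  have M0: "M \<ge> 0" and N0: "N \<ge> 0" using s by (auto simp: rp_state_def)
  have M2: "M \<le> 2 * M" using M0 by simp
  note gd = vector_germ_difference[OF g \<alpha>' s rp_state_zero[OF M0] rp_close_zero[OF s] M2, unfolded vector_germ_zero diff_0_right]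
  define G where "G = (real CARD('n))\<^sup>2 * (germ_const C M CARD('n) * (M * (1 + N) + N))"
  have G0: "G \<ge> 0" unfolding G_def using germ_const_nonneg C0 M0 N0 by (intro mult_nonneg_nonneg) auto
  have diag: "vector_germ g X A v a a = 0" if "0 \<le> a" "a \<le> 2 * pi" for a using gd(2)[of a a] that by simp
  obtain Z where Z: "Z 0 = 0" "\<And>a b. 0 \<le> a \<Longrightarrow> a \<le> b \<Longrightarrow> b \<le> 2 * pi \<Longrightarrow>
     norm (Z b - Z a - vector_germ g X A v a b) \<le> sew_const (3 * \<alpha>) * G * (b - a) powr (3 * \<alpha>)"
    using sewing_exists[OF \<theta> G0, of "2 * pi" "vector_germ g X A v"] diag gd(1)[folded G_def] by auto
  have rp: "rough_path_integral \<alpha> g X A v Z"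
    unfolding rough_path_integral_def using Z sew_const_pos[OF \<theta>] G0
    by (intro conjI exI[of _ "sew_const (3 * \<alpha>) * G"]) auto
  have rp0: "rough_path_integral \<alpha> g (\<lambda>_. 0) (\<lambda>_ _. 0) (\<lambda>_. 0) (\<lambda>_. 0)"
    unfolding rough_path_integral_def by (auto simp: vector_germ_zero intro!: exI[of _ 0])
  show ?thesis
    by (rule that[OF rp], use rough_path_integral_difference[OF g \<alpha> s rp_state_zero[OF M0] rp_close_zero[OF s] M2 rp rp0] in simp)
qed

section \<open>Spatial estimates for the integrand of the mild equation\<close>

definition drift ::
  "(real ^ 'n \<Rightarrow> real ^ 'n) \<Rightarrow> (real ^ 'n \<Rightarrow> real ^ 'n ^ 'n) \<Rightarrow> 'n path \<Rightarrow> 'n area \<Rightarrow> 'n path \<Rightarrow> real \<Rightarrow> real \<Rightarrow> real ^ 'n::finite" where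
  "drift f g X A v r x = heat_semigroup r (reaction f g (\<lambda>y. X y + v y) v) x +
     rough_integral (X, A) (integrand g r x (\<lambda>y. X y + v y)) (integrand' g r x (\<lambda>y. X y + v y))"

lemma rough_integral_heat:
  fixes g :: "real ^ 'n::finite \<Rightarrow> real ^ 'n ^ 'n"
  assumes r: "r > 0" and \<alpha>: "1 / 3 < \<alpha>" "\<alpha> < 1 / 2" and Z: "rough_path_integral \<alpha> g X A v Z"
    and E: "E \<ge> 0" "\<And>x y. x \<in> {0..2*pi} \<Longrightarrow> y \<in> {0..2*pi} \<Longrightarrow> norm (Z x - Z y) \<le> E * \<bar>x - y\<bar> powr \<alpha>"
  shows "rough_integral (X, A) (integrand g r x (\<lambda>y. X y + v y)) (integrand' g r x (\<lambda>y. X y + v y)) =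
    stieltjes_conv (heat_kernel r) (heat_kernel1 r) Z x"
proof -
  obtain K where K: "K \<ge> 0" "\<And>a b. 0 \<le> a \<Longrightarrow> a \<le> b \<Longrightarrow> b \<le> 2 * pi \<Longrightarrow> norm (Z b - Z a - vector_germ g X A v a b) \<le> K * (b - a) powr (3 * \<alpha>)"
    using Z unfolding rough_path_integral_def by auto
  have "rough_integral (X, A) (\<lambda>y. heat_kernel r (x - y) *\<^sub>R g (X y + v y))
     (\<lambda>y. \<chi> i j k. heat_kernel r (x - y) * (\<chi> i j k. frechet_derivative g (at (X y + v y)) (axis k 1) $ i $ j) $ i $ j $ k) =
     stieltjes_conv (heat_kernel r) (heat_kernel1 r) Z x"
    by (rule weighted_rough_integral[OF heat_kernel_deriv(1)[OF r] heat_kernel_continuous(2)[OF r] heat_kernel_periodic(1) _ K(1) _ E(1) _ K(2)[unfolded vector_germ_def] E(2)])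
       (use \<alpha> Z in \<open>auto simp: rough_path_integral_def\<close>)
  then show ?thesis unfolding integrand_def[abs_def] integrand'_def[abs_def] by simp
qed

lemma stieltjes_conv_diff:
  fixes Z Z' :: "real \<Rightarrow> 'a::euclidean_space"
  assumes "continuous_on UNIV P'" "continuous_on {0..2*pi} Z" "continuous_on {0..2*pi} Z'"
  shows "stieltjes_conv P P' Z x - stieltjes_conv P P' Z' x = stieltjes_conv P P' (\<lambda>y. Z y - Z' y) x"
proof -
  have "(\<lambda>y. P' (x - y) *\<^sub>R Z y) integrable_on {0..2*pi}" "(\<lambda>y. P' (x - y) *\<^sub>R Z' y) integrable_on {0..2*pi}"
    by (intro integrable_continuous_real continuous_intros assms continuous_on_compose2[OF assms(1)]; auto)+
  from integral_diff[OF this] show ?thesis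
    by (simp add: stieltjes_conv_def scaleR_diff_right)
qed

lemma heat_semigroup_diff:
  fixes w w' :: "real \<Rightarrow> real ^ 'n::finite"
  assumes r: "r > 0" and "continuous_on {0..2*pi} w" "continuous_on {0..2*pi} w'"
  shows "heat_semigroup r w x - heat_semigroup r w' x = heat_semigroup r (\<lambda>y. w y - w' y) x"
proof -
  note c = heat_kernel_continuous(1)[OF r]
  have "(\<lambda>y. heat_kernel r (x - y) *\<^sub>R w y) integrable_on {0..2*pi}" "(\<lambda>y. heat_kernel r (x - y) *\<^sub>R w' y) integrable_on {0..2*pi}"
    by (intro integrable_continuous_real continuous_intros assms continuous_on_compose2[OF c]; auto)+
  from integral_diff[OF this] show ?thesis
    using assms by (simp add: heat_semigroup_eq_integral continuous_on_diff scaleR_diff_right)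
qed

text \<open>Recovers a bound on the derivative from the Lipschitz bound in \<open>rp_state\<close>,
  for use in the reaction term. Limits are taken within \<open>{a..b}\<close>, because the Lipschitz
  bound is given on this interval and \<open>x\<close> may be an end point.\<close>

lemma vector_derivative_norm_le:
  fixes F :: "real \<Rightarrow> 'a::real_normed_vector"
  assumes F: "(F has_vector_derivative D) (at x)" and x: "x \<in> {a..b}" and ab: "a < b"
    and L: "\<And>y. y \<in> {a..b} \<Longrightarrow> norm (F y - F x) \<le> L * \<bar>y - x\<bar>"
  shows "norm D \<le> L"
proof -
  have "(F has_derivative (\<lambda>h. h *\<^sub>R D)) (at x within {a..b})"
    using F unfolding has_vector_derivative_def by (rule has_derivative_at_withinI)
  then have lim: "((\<lambda>y. (1 / norm (y - x)) *\<^sub>R (F y - (F x + (y - x) *\<^sub>R D))) \<longlongrightarrow> 0) (at x within {a..b})"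
    by (simp add: has_derivative_within)
  then have lim': "((\<lambda>y. L + norm ((1 / norm (y - x)) *\<^sub>R (F y - (F x + (y - x) *\<^sub>R D)))) \<longlongrightarrow> L + 0) (at x within {a..b})"
    by (intro tendsto_add tendsto_const tendsto_norm_zero[OF lim])
  have "x islimpt {a..b}" using ab x by (intro connected_imp_perfect) auto
  then have nt: "at x within {a..b} \<noteq> bot" by (simp add: trivial_limit_within)
  have "\<forall>\<^sub>F y in at x within {a..b}. norm D \<le> L + norm ((1 / norm (y - x)) *\<^sub>R (F y - (F x + (y - x) *\<^sub>R D)))"
    unfolding eventually_at_filter
  proof (intro always_eventually allI impI)
    fix y assume y: "y \<noteq> x" "y \<in> {a..b}"
    let ?k = "1 / norm (y - x)"
    have k: "?k > 0" using y by simp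
    have "norm D = norm (?k *\<^sub>R ((y - x) *\<^sub>R D))" using y by simp
    also have "?k *\<^sub>R ((y - x) *\<^sub>R D) = ?k *\<^sub>R (F y - F x) - ?k *\<^sub>R (F y - (F x + (y - x) *\<^sub>R D))"
      by (simp add: algebra_simps)
    also have "norm \<dots> \<le> norm (?k *\<^sub>R (F y - F x)) + norm (?k *\<^sub>R (F y - (F x + (y - x) *\<^sub>R D)))"
      by (rule norm_triangle_ineq4)
    also have "norm (?k *\<^sub>R (F y - F x)) \<le> L"
      using L[OF y(2)] y by (simp add: divide_le_eq)
    finally show "norm D \<le> L + norm (?k *\<^sub>R (F y - (F x + (y - x) *\<^sub>R D)))" by simp
  qed
  from tendsto_lowerbound[OF lim' this nt] show ?thesis by simp
qed

lemma C1_differentiable_deriv_x: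
  fixes v :: "real \<Rightarrow> 'a::real_normed_vector"
  assumes "v C1_differentiable_on UNIV"
  shows "(v has_vector_derivative deriv_x v x) (at x)" "continuous_on UNIV (deriv_x v)"
proof -
  obtain D where D: "\<And>x. (v has_vector_derivative D x) (at x)" "continuous_on UNIV D"
    using assms unfolding C1_differentiable_on_def by auto
  have "deriv_x v = D" unfolding deriv_x_def by (rule ext) (rule vector_derivative_at[OF D(1)])
  then show "(v has_vector_derivative deriv_x v x) (at x)" "continuous_on UNIV (deriv_x v)" using D by auto
qed

lemma norm_matrix_vector_le:
  fixes B :: "real ^ 'n ^ 'n::finite"
  assumes "\<And>i j. \<bar>B $ i $ j\<bar> \<le> c" and "norm x \<le> L" and c: "c \<ge> 0"
  shows "norm (B *v x) \<le> (real CARD('n))\<^sup>2 * (c * L)"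
proof (rule norm_vec_le_double_sum)
  show "(B *v x) $ i = (\<Sum>j\<in>UNIV. B $ i $ j * x $ j)" for i by (simp add: matrix_vector_mult_def)
  show "\<bar>B $ i $ j * x $ j\<bar> \<le> c * L" for i j
    unfolding abs_mult using assms(1)[of i j] order_trans[OF component_le_norm_cart assms(2)] c by (intro mult_mono) auto
qed

lemma smooth_lipschitz:
  fixes f :: "real ^ 'n::finite \<Rightarrow> real ^ 'n"
  assumes "smooth f"
  shows "continuous_on UNIV f" "\<exists>C\<ge>0. \<forall>a b. norm a \<le> B \<longrightarrow> norm b \<le> B \<longrightarrow> norm (f a - f b) \<le> C * norm (a - b)"
proof -
  have "Ck 0 f" "Ck 1 f" using assms by (auto simp only: smooth_def)
  then show "continuous_on UNIV f" by simp
  have "\<forall>i. \<exists>C\<ge>0. \<forall>a b. norm a \<le> B \<longrightarrow> norm b \<le> B \<longrightarrow> \<bar>f a $ i\<bar> \<le> C \<and> \<bar>f a $ i - f b $ i\<bar> \<le> C * norm (a - b)"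
    using C1_bound_lipschitz[OF Ck_bounded_linear_compose[OF bounded_linear_vec_nth \<open>Ck 1 f\<close>]] by blast
  then obtain C where C: "\<And>i. C i \<ge> 0" "\<And>i a b. norm a \<le> B \<Longrightarrow> norm b \<le> B \<Longrightarrow> \<bar>f a $ i - f b $ i\<bar> \<le> C i * norm (a - b)"
    by metis
  have "norm (f a - f b) \<le> (\<Sum>i\<in>UNIV. C i) * norm (a - b)" if "norm a \<le> B" "norm b \<le> B" for a b
  proof -
    have "norm (f a - f b) \<le> (\<Sum>i\<in>UNIV. \<bar>(f a - f b) $ i\<bar>)" by (rule norm_le_l1_cart)
    also have "\<dots> \<le> (\<Sum>i\<in>UNIV. C i * norm (a - b))" using C(2)[OF that] by (intro sum_mono) simp
    finally show ?thesis by (simp add: sum_distrib_right)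
  qed
  then show "\<exists>C\<ge>0. \<forall>a b. norm a \<le> B \<longrightarrow> norm b \<le> B \<longrightarrow> norm (f a - f b) \<le> C * norm (a - b)"
    using C(1) by (intro exI[of _ "\<Sum>i\<in>UNIV. C i"]) (auto intro: sum_nonneg)
qed

text \<open>The rough part is \<open>heat_stieltjes_bounds\<close> for the difference of the two
  sewn paths and determines the powers of \<open>r\<close>. The reaction terms are bounded
  functions, on which the semigroup is less singular, so their contribution is absorbed with a power
  of \<open>T\<close>. The bound contains \<open>N\<close> but not \<open>N'\<close>, and
  \<open>K\<close> depends on the states only through \<open>M\<close>.\<close>

lemma spatial_difference:
  fixes f :: "real ^ 'n::finite \<Rightarrow> real ^ 'n" and g :: "real ^ 'n \<Rightarrow> real ^ 'n ^ 'n"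
  assumes f: "smooth f" and g: "smooth g" and \<alpha>: "1 / 3 < \<alpha>" "\<alpha> < 1 / 2" and M0: "M \<ge> 0" and T0: "T \<ge> 0"
  shows "\<exists>K\<ge>0. \<forall>X A v N X' A' v' N' d W r x y.
    rp_state \<alpha> M N X A v \<longrightarrow> rp_state \<alpha> M N' X' A' v' \<longrightarrow> rp_close \<alpha> d W X A v X' A' v' \<longrightarrow> d \<le> 2 * M \<longrightarrow>
    v C1_differentiable_on UNIV \<longrightarrow> v' C1_differentiable_on UNIV \<longrightarrow> 0 < r \<longrightarrow> r \<le> T \<longrightarrow>
    x \<in> {0..2*pi} \<longrightarrow> y \<in> {0..2*pi} \<longrightarrow>
    norm (drift f g X A v r x - drift f g X' A' v' r x) \<le> K * (d * (1 + N) + W) * r powr ((\<alpha> - 1) / 2) \<and>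
    norm ((drift f g X A v r x - drift f g X' A' v' r x) - (drift f g X A v r y - drift f g X' A' v' r y))
      \<le> K * (d * (1 + N) + W) * r powr ((\<alpha> - 2) / 2) * \<bar>x - y\<bar>"
proof -
  let ?n = "real CARD('n)"
  have B: "2 * M \<ge> 0" using M0 by simp
  obtain C where C: "C3_matrix_bounds C (2 * M) g" using smooth_C3_matrix_bounds[OF g B] by blast
  have C0: "C \<ge> 0" using C by (auto simp: C3_matrix_bounds_def C3_bounds_def)
  obtain Cf where Cf: "Cf \<ge> 0" "\<And>a b. norm a \<le> 2 * M \<Longrightarrow> norm b \<le> 2 * M \<Longrightarrow> norm (f a - f b) \<le> Cf * norm (a - b)"
    using smooth_lipschitz(2)[OF f] by blast
  have cf: "continuous_on UNIV f" by (rule smooth_lipschitz(1)[OF f])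
  have cg: "continuous_on UNIV g" using g unfolding smooth_def by (metis Ck.simps(1))
  have \<alpha>': "0 < \<alpha>" "\<alpha> \<le> 1" using \<alpha> by auto
  \<comment> \<open>Read off from \<open>\<rho>b\<close>: since the two paths differ by at most
    \<open>2 * d\<close>, the terms with \<open>g\<close> contribute \<open>3 * C\<close> per matrix
    entry, the change of \<open>f\<close> contributes \<open>2 * Cf\<close>, and the linear term
    contributes 2.\<close>
  define Kr where "Kr = ?n\<^sup>2 * (3 * C) + 2 * Cf + 2"
  have Kr0: "Kr \<ge> 0" using C0 Cf by (simp add: Kr_def)
  define H where "H = kernel_const T"
  have H0: "H \<ge> 0" using kernel_const_pos[OF T0] by (simp add: H_def)
  define Kp where "Kp = path_const \<alpha> C M ?n"
  have Kp0: "Kp \<ge> 0" unfolding Kp_def path_const_def using germ_const_nonneg[OF C0 M0, of "CARD('n)"] sew_const_pos[of "3 * \<alpha>"] \<alpha>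
    by (intro mult_nonneg_nonneg add_nonneg_nonneg) auto
  define K where "K = 12 * H * Kr * T powr ((1 - \<alpha>) / 2) + 24 * H * Kp"
  have K0: "K \<ge> 0" unfolding K_def using H0 Kr0 Kp0 by (intro add_nonneg_nonneg mult_nonneg_nonneg) auto
  show ?thesis
  proof (intro exI[of _ K] conjI[OF K0] allI impI)
    fix X :: "'n path" and A v N and X' :: "'n path" and A' v' N' d W r x y
    assume s: "rp_state \<alpha> M N X A v" and s': "rp_state \<alpha> M N' X' A' v'" and cl: "rp_close \<alpha> d W X A v X' A' v'"
      and d: "d \<le> 2 * M" and v: "v C1_differentiable_on UNIV" and v': "v' C1_differentiable_on UNIV"
      and r: "0 < r" "r \<le> T" and xy: "x \<in> {0..2*pi}" "y \<in> {0..2*pi}"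
    have N0: "N \<ge> 0" and d0: "d \<ge> 0" and W0: "W \<ge> 0" using s cl by (auto simp: rp_state_def rp_close_def)
    define E where "E = d * (1 + N) + W"
    have dN: "0 \<le> d * N" using d0 N0 by simp
    have E: "0 \<le> E" "d \<le> E" "W \<le> E" "d * N \<le> E" unfolding E_def using d0 dN W0 by (auto simp: algebra_simps)
    obtain Z where Z: "rough_path_integral \<alpha> g X A v Z"
      "\<And>x y. x \<in> {0..2*pi} \<Longrightarrow> y \<in> {0..2*pi} \<Longrightarrow> norm (Z x - Z y) \<le> path_const \<alpha> C M CARD('n) * (M * (1 + N) + N) * \<bar>x - y\<bar> powr \<alpha>"
      using rough_path_integral_exists[OF C \<alpha> s] by blast
    obtain Z' where Z': "rough_path_integral \<alpha> g X' A' v' Z'"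
      "\<And>x y. x \<in> {0..2*pi} \<Longrightarrow> y \<in> {0..2*pi} \<Longrightarrow> norm (Z' x - Z' y) \<le> path_const \<alpha> C M CARD('n) * (M * (1 + N') + N') * \<bar>x - y\<bar> powr \<alpha>"
      using rough_path_integral_exists[OF C \<alpha> s'] by blast
    have N'0: "N' \<ge> 0" using s' by (simp add: rp_state_def)
    have e1: "path_const \<alpha> C M CARD('n) * (M * (1 + N) + N) \<ge> 0" "path_const \<alpha> C M CARD('n) * (M * (1 + N') + N') \<ge> 0"
      using Kp0 M0 N0 N'0 by (auto simp: Kp_def[symmetric])
    define S where "S y = Z y - Z' y" for y
    have cZ: "continuous_on {0..2*pi} Z" "continuous_on {0..2*pi} Z'"
      by (rule hoelder_continuous_on[OF \<alpha>'(1) Z(2)] hoelder_continuous_on[OF \<alpha>'(1) Z'(2)]; assumption)+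
    have S0: "S 0 = 0" using Z Z' by (simp add: S_def rough_path_integral_def)
    have Sh: "norm (S x - S y) \<le> Kp * E * \<bar>x - y\<bar> powr \<alpha>" if "x \<in> {0..2*pi}" "y \<in> {0..2*pi}" for x y
      using rough_path_integral_difference[OF C \<alpha> s s' cl d Z(1) Z'(1) that] by (simp add: S_def Kp_def E_def)
    define \<rho> \<rho>' where "\<rho> = reaction f g (\<lambda>y. X y + v y) v" and "\<rho>' = reaction f g (\<lambda>y. X' y + v' y) v'"
    have cX: "continuous_on {0..2*pi} X" if "rp_state \<alpha> M N X A v" for N X A v
      by (rule hoelder_continuous_on[OF \<alpha>'(1), of _ _ M]) (use that in \<open>auto simp: rp_state_def\<close>)
    have c\<rho>: "continuous_on {0..2*pi} (reaction f g (\<lambda>y. X y + v y) v)" if "rp_state \<alpha> M N X A v" "v C1_differentiable_on UNIV" for N X A v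
    proof -
      have cv: "continuous_on {0..2*pi} v" using C1_differentiable_imp_continuous_on[OF that(2)] continuous_on_subset by blast
      have cd: "continuous_on {0..2*pi} (deriv_x v)" using C1_differentiable_deriv_x(2)[OF that(2)] continuous_on_subset by blast
      have cu: "continuous_on {0..2*pi} (\<lambda>y. X y + v y)" by (intro continuous_intros cX[OF that(1)] cv)
      show ?thesis unfolding reaction_def[abs_def] matrix_vector_mult_def
        by (intro continuous_intros cu cd continuous_on_compose2[OF cf cu] continuous_on_compose2[OF cg cu]) auto
    qed
    have c1: "continuous_on {0..2*pi} \<rho>" "continuous_on {0..2*pi} \<rho>'" unfolding \<rho>_def \<rho>'_def using c\<rho> s s' v v' by auto
    have \<rho>b: "norm (\<rho> y - \<rho>' y) \<le> Kr * E" if y: "y \<in> {0..2*pi}" for y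
    proof -
      let ?u = "X y + v y" and ?u' = "X' y + v' y"
      have ub: "norm ?u \<le> 2 * M" "norm ?u' \<le> 2 * M" using rp_state_norm[OF s y] rp_state_norm[OF s' y] by auto
      have uu: "norm (?u - ?u') \<le> 2 * d"
      proof -
        have eq: "?u - ?u' = (X y - X' y) + (v y - v' y)" by simp
        have "norm (X y - X' y) \<le> d" "norm (v y - v' y) \<le> d" using cl y by (auto simp: rp_close_def)
        then show ?thesis unfolding eq using norm_triangle_ineq[of "X y - X' y" "v y - v' y"] by linarith
      qed
      have gg: "\<bar>(g ?u - g ?u') $ i $ j\<bar> \<le> C * (2 * d)" "\<bar>g ?u' $ i $ j\<bar> \<le> C" for i j
      proof -
        have h: "C3_bounds C (2 * M) (\<lambda>x. g x $ i $ j)" using C by (simp add: C3_matrix_bounds_def)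
        note h1 = h[unfolded C3_bounds_def, THEN conjunct2, THEN conjunct1, rule_format]
        show "\<bar>(g ?u - g ?u') $ i $ j\<bar> \<le> C * (2 * d)" using h1[OF ub] mult_left_mono[OF uu C0] by simp
        show "\<bar>g ?u' $ i $ j\<bar> \<le> C" using h1[OF ub(2) ub(2)] by simp
      qed
      have Dv: "norm (deriv_x v y) \<le> N"
        by (rule vector_derivative_norm_le[OF C1_differentiable_deriv_x(1)[OF v] y]) (use s y in \<open>auto simp: rp_state_def\<close>)
      have Dw: "norm (deriv_x v y - deriv_x v' y) \<le> W"
      proof (rule vector_derivative_norm_le[OF has_vector_derivative_diff[OF C1_differentiable_deriv_x(1)[OF v] C1_differentiable_deriv_x(1)[OF v']] y])
        show "norm (v z - v' z - (v y - v' y)) \<le> W * \<bar>z - y\<bar>" if "z \<in> {0..2*pi}" for z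
        proof -
          have "norm ((v z - v y) - (v' z - v' y)) \<le> W * \<bar>z - y\<bar>" using cl y that by (simp add: rp_close_def)
          moreover have "(v z - v y) - (v' z - v' y) = v z - v' z - (v y - v' y)" by simp
          ultimately show ?thesis by (simp only:)
        qed
      qed simp
      \<comment> \<open>The difference of the matrices, of size \<open>d\<close>, meets the unprimed
        derivative, bounded by \<open>N\<close>; the difference of the derivatives, bounded by
        \<open>W\<close>, meets a bounded matrix. This is the spatial reason for the form
        \<open>d * (1 + N) + W\<close>.\<close>
      have eq: "\<rho> y - \<rho>' y = (g ?u - g ?u') *v deriv_x v y + g ?u' *v (deriv_x v y - deriv_x v' y) + (f ?u - f ?u') + (?u - ?u')"
        unfolding \<rho>_def \<rho>'_def reaction_def by (simp add: matrix_vector_mult_diff_rdistrib matrix_vector_mult_diff_distrib)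
      have "norm (\<rho> y - \<rho>' y) \<le> norm ((g ?u - g ?u') *v deriv_x v y) + norm (g ?u' *v (deriv_x v y - deriv_x v' y)) + norm (f ?u - f ?u') + norm (?u - ?u')"
        unfolding eq by (intro norm_triangle_mono order_refl)
      also have "\<dots> \<le> ?n\<^sup>2 * (C * (2 * d) * N) + ?n\<^sup>2 * (C * W) + Cf * (2 * d) + 2 * d"
      proof (intro add_mono uu)
        show "norm ((g ?u - g ?u') *v deriv_x v y) \<le> ?n\<^sup>2 * (C * (2 * d) * N)"
          by (rule norm_matrix_vector_le[OF gg(1) Dv]) (use C0 d0 in simp)
        show "norm (g ?u' *v (deriv_x v y - deriv_x v' y)) \<le> ?n\<^sup>2 * (C * W)"
          by (rule norm_matrix_vector_le[OF gg(2) Dw C0])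
        show "norm (f ?u - f ?u') \<le> Cf * (2 * d)" using Cf(2)[OF ub] mult_left_mono[OF uu Cf(1)] by linarith
      qed
      also have "\<dots> = ?n\<^sup>2 * (C * (2 * (d * N) + W)) + Cf * (2 * d) + 2 * d" by (simp add: algebra_simps)
      also have "\<dots> \<le> ?n\<^sup>2 * (C * (2 * E + E)) + Cf * (2 * E) + 2 * E"
        using E C0 Cf by (intro add_mono mult_left_mono) auto
      also have "\<dots> = Kr * E" by (simp add: Kr_def algebra_simps)
      finally show ?thesis .
    qed
    have dd: "drift f g X A v r x - drift f g X' A' v' r x = heat_semigroup r (\<lambda>y. \<rho> y - \<rho>' y) x + stieltjes_conv (heat_kernel r) (heat_kernel1 r) S x" for x
    proof -
      have "drift f g X A v r x = heat_semigroup r \<rho> x + stieltjes_conv (heat_kernel r) (heat_kernel1 r) Z x"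
        using rough_integral_heat[OF r(1) \<alpha> Z(1) e1(1) Z(2), of x] by (simp add: drift_def \<rho>_def)
      moreover have "drift f g X' A' v' r x = heat_semigroup r \<rho>' x + stieltjes_conv (heat_kernel r) (heat_kernel1 r) Z' x"
        using rough_integral_heat[OF r(1) \<alpha> Z'(1) e1(2) Z'(2), of x] by (simp add: drift_def \<rho>'_def)
      ultimately show ?thesis
        using heat_semigroup_diff[OF r(1) c1, of x] stieltjes_conv_diff[OF heat_kernel_continuous(2)[OF r(1)] cZ, of "heat_kernel r" x]
        by (simp add: S_def[abs_def] algebra_simps)
    qed
    have c2: "continuous_on {0..2*pi} (\<lambda>y. \<rho> y - \<rho>' y)" by (intro continuous_intros c1)
    have hb: "norm (heat_semigroup r (\<lambda>y. \<rho> y - \<rho>' y) x) \<le> 12 * H * (Kr * E)"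
      "norm (heat_semigroup r (\<lambda>y. \<rho> y - \<rho>' y) x - heat_semigroup r (\<lambda>y. \<rho> y - \<rho>' y) y) \<le> 12 * H * (Kr * E) * r powr - (1/2) * \<bar>x - y\<bar>"
      unfolding H_def using heat_semigroup_bounds[OF r c2 \<rho>b] xy by blast+
    have KpE: "Kp * E \<ge> 0" using Kp0 E by simp
    have sb: "norm (stieltjes_conv (heat_kernel r) (heat_kernel1 r) S x) \<le> 24 * H * (Kp * E) * r powr ((\<alpha> - 1) / 2)"
      "norm (stieltjes_conv (heat_kernel r) (heat_kernel1 r) S x - stieltjes_conv (heat_kernel r) (heat_kernel1 r) S y)
        \<le> 24 * H * (Kp * E) * r powr ((\<alpha> - 2) / 2) * \<bar>x - y\<bar>"
      unfolding H_def using heat_stieltjes_bounds[OF r \<alpha>' KpE S0 Sh] xy by blast+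
    \<comment> \<open>Serves to write the milder singularities of the reaction part, namely none and
      \<open>r powr - (1/2)\<close>, as multiples of those of the rough part.\<close>
    have rT: "r powr ((1 - \<alpha>) / 2) \<le> T powr ((1 - \<alpha>) / 2)" using r \<alpha> by (intro powr_mono2) auto
    have r1: "1 \<le> T powr ((1 - \<alpha>) / 2) * r powr ((\<alpha> - 1) / 2)"
    proof -
      have "1 = r powr ((1 - \<alpha>) / 2) * r powr ((\<alpha> - 1) / 2)" using r by (simp add: powr_add[symmetric] add_divide_distrib[symmetric])
      also have "\<dots> \<le> T powr ((1 - \<alpha>) / 2) * r powr ((\<alpha> - 1) / 2)" using rT by (intro mult_right_mono) auto
      finally show ?thesis .
    qed
    have r2: "r powr - (1/2) \<le> T powr ((1 - \<alpha>) / 2) * r powr ((\<alpha> - 2) / 2)"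
    proof -
      have "r powr - (1/2) = r powr ((1 - \<alpha>) / 2) * r powr ((\<alpha> - 2) / 2)" unfolding powr_add[symmetric]
        by (rule arg_cong[where f="\<lambda>e. r powr e"]) (simp add: field_simps)
      also have "\<dots> \<le> T powr ((1 - \<alpha>) / 2) * r powr ((\<alpha> - 2) / 2)" using rT by (intro mult_right_mono) auto
      finally show ?thesis .
    qed
    have HE: "0 \<le> 12 * H * (Kr * E)" using H0 Kr0 E by simp
    have "norm (drift f g X A v r x - drift f g X' A' v' r x) \<le> K * (d * (1 + N) + W) * r powr ((\<alpha> - 1) / 2)"
    proof -
      have "norm (drift f g X A v r x - drift f g X' A' v' r x) \<le> 12 * H * (Kr * E) * 1 + 24 * H * (Kp * E) * r powr ((\<alpha> - 1) / 2)"
        unfolding dd using hb(1) sb(1) by (intro norm_triangle_mono) auto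
      also have "\<dots> \<le> 12 * H * (Kr * E) * (T powr ((1 - \<alpha>) / 2) * r powr ((\<alpha> - 1) / 2)) + 24 * H * (Kp * E) * r powr ((\<alpha> - 1) / 2)"
        using r1 HE by (intro add_right_mono mult_left_mono)
      also have "\<dots> = K * E * r powr ((\<alpha> - 1) / 2)" by (simp add: K_def algebra_simps)
      finally show ?thesis by (simp only: E_def)
    qed
    moreover have "norm ((drift f g X A v r x - drift f g X' A' v' r x) - (drift f g X A v r y - drift f g X' A' v' r y))
      \<le> K * (d * (1 + N) + W) * r powr ((\<alpha> - 2) / 2) * \<bar>x - y\<bar>"
    proof -
      let ?h = "heat_semigroup r (\<lambda>y. \<rho> y - \<rho>' y)" and ?s = "stieltjes_conv (heat_kernel r) (heat_kernel1 r) S"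
      have "norm ((?h x + ?s x) - (?h y + ?s y)) \<le> 12 * H * (Kr * E) * r powr - (1/2) * \<bar>x - y\<bar> + 24 * H * (Kp * E) * r powr ((\<alpha> - 2) / 2) * \<bar>x - y\<bar>"
        using hb(2) sb(2) norm_triangle_ineq[of "?h x - ?h y" "?s x - ?s y"] by (simp add: add_diff_add)
      also have "\<dots> \<le> 12 * H * (Kr * E) * (T powr ((1 - \<alpha>) / 2) * r powr ((\<alpha> - 2) / 2)) * \<bar>x - y\<bar> + 24 * H * (Kp * E) * r powr ((\<alpha> - 2) / 2) * \<bar>x - y\<bar>"
        using r2 HE by (intro add_right_mono mult_right_mono mult_left_mono) auto
      also have "\<dots> = K * E * r powr ((\<alpha> - 2) / 2) * \<bar>x - y\<bar>" by (simp add: K_def algebra_simps)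
      finally show ?thesis unfolding dd by (simp only: E_def)
    qed
    ultimately show "norm (drift f g X A v r x - drift f g X' A' v' r x) \<le> K * (d * (1 + N) + W) * r powr ((\<alpha> - 1) / 2) \<and>
      norm ((drift f g X A v r x - drift f g X' A' v' r x) - (drift f g X A v r y - drift f g X' A' v' r y))
        \<le> K * (d * (1 + N) + W) * r powr ((\<alpha> - 2) / 2) * \<bar>x - y\<bar>" ..
  qed
qed

section \<open>Norms along a mild solution\<close>

lemma two_param_norm_le_iff:
  assumes "K \<ge> 0"
  shows "two_param_norm \<gamma> A \<le> ennreal K \<longleftrightarrow>
    (\<forall>x\<in>{0..2*pi}. \<forall>y\<in>{0..2*pi}. x \<noteq> y \<longrightarrow> norm (A x y) \<le> K * \<bar>x - y\<bar> powr \<gamma>)"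
proof -
  have "two_param_norm \<gamma> A \<le> ennreal K \<longleftrightarrow> (\<forall>x\<in>{0..2*pi}. \<forall>y\<in>{0..2*pi}. x \<noteq> y \<longrightarrow>
      ennreal (norm (A x y) / \<bar>x - y\<bar> powr \<gamma>) \<le> ennreal K)"
    unfolding two_param_norm_def by (auto simp: SUP_le_iff)
  also have "\<dots> \<longleftrightarrow> (\<forall>x\<in>{0..2*pi}. \<forall>y\<in>{0..2*pi}. x \<noteq> y \<longrightarrow> norm (A x y) \<le> K * \<bar>x - y\<bar> powr \<gamma>)"
    using assms by (intro ball_cong refl imp_cong) (simp add: ennreal_le_iff pos_divide_le_eq)
  finally show ?thesis .
qed

lemma sup_norm_le_iff:
  assumes "K \<ge> 0"
  shows "sup_norm w \<le> ennreal K \<longleftrightarrow> (\<forall>x\<in>{0..2*pi}. norm (w x) \<le> K)"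
  unfolding sup_norm_def using assms by (simp add: SUP_le_iff ennreal_le_iff)

lemma ennreal_le_two_param_norm:
  assumes "x \<in> {0..2*pi}" "y \<in> {0..2*pi}" "two_param_norm \<gamma> A < \<infinity>" "x = y \<Longrightarrow> A x y = 0"
  shows "norm (A x y) \<le> enn2real (two_param_norm \<gamma> A) * \<bar>x - y\<bar> powr \<gamma>"
proof (cases "x = y")
  case False
  have "two_param_norm \<gamma> A \<le> ennreal (enn2real (two_param_norm \<gamma> A))" using assms(3) by simp
  then show ?thesis using False assms(1,2) by (simp add: two_param_norm_le_iff)
qed (use assms in simp)

lemma sup_norm_ge: "x \<in> {0..2*pi} \<Longrightarrow> ennreal (norm (w x)) \<le> sup_norm w"
  unfolding sup_norm_def by (rule SUP_upper)

lemma sup_norm_real: "x \<in> {0..2*pi} \<Longrightarrow> sup_norm w < \<infinity> \<Longrightarrow> norm (w x) \<le> enn2real (sup_norm w)"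
  using sup_norm_ge[of x w] by (cases "sup_norm w") auto

lemma two_param_norm_triangle:
  "two_param_norm \<gamma> (\<lambda>x y. A x y + B x y) \<le> two_param_norm \<gamma> A + two_param_norm \<gamma> B"
  unfolding two_param_norm_def
proof (rule SUP_least, clarify)
  fix x y :: real assume xy: "x \<in> {0..2*pi}" "y \<in> {0..2*pi}" "x \<noteq> y"
  let ?I = "{(x, y). x \<in> {0..2*pi} \<and> y \<in> {0..2*pi} \<and> x \<noteq> y}"
  have "ennreal (norm (A x y + B x y) / \<bar>x - y\<bar> powr \<gamma>) \<le> ennreal (norm (A x y) / \<bar>x - y\<bar> powr \<gamma> + norm (B x y) / \<bar>x - y\<bar> powr \<gamma>)"
    by (intro ennreal_leI) (simp add: add_divide_distrib[symmetric] divide_right_mono norm_triangle_ineq)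
  also have "\<dots> = ennreal (norm (A x y) / \<bar>x - y\<bar> powr \<gamma>) + ennreal (norm (B x y) / \<bar>x - y\<bar> powr \<gamma>)" by simp
  also have "\<dots> \<le> (SUP (x, y)\<in>?I. ennreal (norm (A x y) / \<bar>x - y\<bar> powr \<gamma>)) + (SUP (x, y)\<in>?I. ennreal (norm (B x y) / \<bar>x - y\<bar> powr \<gamma>))"
    using xy by (intro add_mono) (auto intro!: SUP_upper2[of "(x, y)"])
  finally show "ennreal (norm (A x y + B x y) / \<bar>x - y\<bar> powr \<gamma>) \<le>
    (SUP (x, y)\<in>?I. ennreal (norm (A x y) / \<bar>x - y\<bar> powr \<gamma>)) + (SUP (x, y)\<in>?I. ennreal (norm (B x y) / \<bar>x - y\<bar> powr \<gamma>))" .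
qed

lemma two_param_norm_uminus: "two_param_norm \<gamma> (\<lambda>x y. - A x y) = two_param_norm \<gamma> A"
  by (simp add: two_param_norm_def)

lemma sup_norm_triangle: "sup_norm (\<lambda>x. w x + z x) \<le> sup_norm w + sup_norm z"
  unfolding sup_norm_def
proof (rule SUP_least)
  fix x :: real assume x: "x \<in> {0..2*pi}"
  have "ennreal (norm (w x + z x)) \<le> ennreal (norm (w x) + norm (z x))" by (intro ennreal_leI norm_triangle_ineq)
  also have "\<dots> = ennreal (norm (w x)) + ennreal (norm (z x))" by simp
  also have "\<dots> \<le> (SUP x\<in>{0..2*pi}. ennreal (norm (w x))) + (SUP x\<in>{0..2*pi}. ennreal (norm (z x)))"
    using x by (intro add_mono SUP_upper)
  finally show "ennreal (norm (w x + z x)) \<le> (SUP x\<in>{0..2*pi}. ennreal (norm (w x))) + (SUP x\<in>{0..2*pi}. ennreal (norm (z x)))" .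
qed

lemma hoelder_norm_triangle: "hoelder_norm \<gamma> (\<lambda>x. w x + z x) \<le> hoelder_norm \<gamma> w + hoelder_norm \<gamma> z"
proof -
  have "incr (\<lambda>x. w x + z x) = (\<lambda>x y. incr w x y + incr z x y)" by (simp add: incr_def fun_eq_iff)
  then have "hoelder_norm \<gamma> (\<lambda>x. w x + z x) \<le> (two_param_norm \<gamma> (incr w) + two_param_norm \<gamma> (incr z)) + (sup_norm w + sup_norm z)"
    unfolding hoelder_norm_def using two_param_norm_triangle[of \<gamma> "incr w" "incr z"]
    by (intro add_mono sup_norm_triangle) simp
  then show ?thesis by (simp add: hoelder_norm_def ac_simps)
qed

lemma hoelder_norm_bounds:
  assumes "hoelder_norm \<gamma> w \<le> ennreal K" "K \<ge> 0" "x \<in> {0..2*pi}" "y \<in> {0..2*pi}"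
  shows "norm (w x) \<le> K" "norm (w y - w x) \<le> K * \<bar>y - x\<bar> powr \<gamma>"
proof -
  have "two_param_norm \<gamma> (incr w) \<le> hoelder_norm \<gamma> w" "sup_norm w \<le> hoelder_norm \<gamma> w"
    by (simp_all add: hoelder_norm_def)
  then have n: "two_param_norm \<gamma> (incr w) \<le> ennreal K" "sup_norm w \<le> ennreal K"
    using assms(1) by (blast intro: order_trans)+
  show "norm (w x) \<le> K" using n(2) assms by (simp add: sup_norm_le_iff)
  show "norm (w y - w x) \<le> K * \<bar>y - x\<bar> powr \<gamma>"
  proof (cases "y = x")
    case False
    then show ?thesis using n(1) assms by (simp add: two_param_norm_le_iff incr_def abs_minus_commute)
  qed simp
qed

lemma hoelder_norm_leI:
  assumes "K1 \<ge> 0" "K2 \<ge> 0" "\<And>x. x \<in> {0..2*pi} \<Longrightarrow> norm (w x) \<le> K1"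
    "\<And>x y. x \<in> {0..2*pi} \<Longrightarrow> y \<in> {0..2*pi} \<Longrightarrow> norm (w y - w x) \<le> K2 * \<bar>y - x\<bar> powr \<gamma>"
  shows "hoelder_norm \<gamma> w \<le> ennreal (K2 + K1)"
proof -
  have "two_param_norm \<gamma> (incr w) \<le> ennreal K2" "sup_norm w \<le> ennreal K1"
    using assms by (auto simp: two_param_norm_le_iff sup_norm_le_iff incr_def abs_minus_commute)
  then show ?thesis unfolding hoelder_norm_def using assms by (simp add: add_mono)
qed

text \<open>A supremum of continuous functions is lower semicontinuous. This holds for uncountable
  families as well, such as the pairs of points in a seminorm.\<close>

lemma SUP_continuous_measurable:
  fixes F :: "'i \<Rightarrow> real \<Rightarrow> real"
  assumes "\<And>i. i \<in> I \<Longrightarrow> continuous_on UNIV (F i)"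
  shows "(\<lambda>t. SUP i\<in>I. ennreal (F i t)) \<in> borel_measurable borel"
proof (rule borel_measurableI_greater)
  fix y :: ennreal
  have "{t \<in> space borel. y < (SUP i\<in>I. ennreal (F i t))} = (\<Union>i\<in>I. {t. y < ennreal (F i t)})"
    by (auto simp: less_SUP_iff)
  moreover have "open (\<Union>i\<in>I. {t. y < ennreal (F i t)})"
    using assms by (intro open_UN ballI open_Collect_less continuous_on_const continuous_on_ennreal)
  ultimately show "{t \<in> space borel. y < (SUP i\<in>I. ennreal (F i t))} \<in> sets borel" by simp
qed

text \<open>Extends a path constantly beyond \<open>{0..T}\<close>, which makes its norms Borel
  functions on the whole line, as the Gronwall inequality requires.\<close>

definition clamp_time :: "real \<Rightarrow> real \<Rightarrow> real" where "clamp_time T t = max 0 (min T t)"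

lemma clamp_time: "T \<ge> 0 \<Longrightarrow> clamp_time T t \<in> {0..T}" "t \<in> {0..T} \<Longrightarrow> clamp_time T t = t"
  by (auto simp: clamp_time_def)

lemma lipschitz_norm_measurable:
  fixes v :: "real \<Rightarrow> real \<Rightarrow> 'a::real_normed_vector"
  assumes T: "T \<ge> 0" and v: "\<And>x. x \<in> {0..2*pi} \<Longrightarrow> continuous_on {0..T} (\<lambda>t. v t x)"
  shows "(\<lambda>t. two_param_norm \<gamma> (incr (v (clamp_time T t)))) \<in> borel_measurable borel"
    "(\<lambda>t. sup_norm (v (clamp_time T t))) \<in> borel_measurable borel"
proof -
  have c: "continuous_on UNIV (\<lambda>t. v (clamp_time T t) x)" if "x \<in> {0..2*pi}" for x
    by (rule continuous_on_compose2[OF v[OF that]]) (use T in \<open>auto simp: clamp_time_def intro!: continuous_intros\<close>)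
  show "(\<lambda>t. sup_norm (v (clamp_time T t))) \<in> borel_measurable borel"
    unfolding sup_norm_def by (intro SUP_continuous_measurable continuous_intros c)
  let ?I = "{(x, y). x \<in> {0..2*pi} \<and> y \<in> {0..2*pi} \<and> x \<noteq> y}"
  have "(\<lambda>t. SUP i\<in>?I. ennreal (norm (incr (v (clamp_time T t)) (fst i) (snd i)) / \<bar>fst i - snd i\<bar> powr \<gamma>)) \<in> borel_measurable borel"
    unfolding incr_def by (intro SUP_continuous_measurable continuous_intros c) auto
  then show "(\<lambda>t. two_param_norm \<gamma> (incr (v (clamp_time T t)))) \<in> borel_measurable borel"
    unfolding two_param_norm_def by (simp add: case_prod_unfold)
qed

lemma ennreal_locally_bounded_compact:
  fixes p :: "'a::metric_space \<Rightarrow> ennreal"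
  assumes J: "compact J" and loc: "\<And>t. t \<in> J \<Longrightarrow> \<exists>B<\<infinity>. \<forall>\<^sub>F s in at t within J. p s \<le> B"
    and fin: "\<And>t. t \<in> J \<Longrightarrow> p t < \<infinity>"
  shows "\<exists>B\<ge>0. \<forall>t\<in>J. p t \<le> ennreal B"
proof -
  have "\<forall>t\<in>J. \<exists>e>0. \<exists>B<\<infinity>. \<forall>s\<in>J. dist s t < e \<longrightarrow> p s \<le> B"
  proof
    fix t assume t: "t \<in> J"
    from loc[OF t] obtain B where B: "B < \<infinity>" "\<forall>\<^sub>F s in at t within J. p s \<le> B" by auto
    then obtain e where e: "e > 0" "\<And>s. s \<in> J \<Longrightarrow> s \<noteq> t \<Longrightarrow> dist s t < e \<Longrightarrow> p s \<le> B"
      unfolding eventually_at by blast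
    have "\<forall>s\<in>J. dist s t < e \<longrightarrow> p s \<le> max B (p t)" using e by (metis max.cobounded2 max.coboundedI1)
    then show "\<exists>e>0. \<exists>B<\<infinity>. \<forall>s\<in>J. dist s t < e \<longrightarrow> p s \<le> B" using e(1) B(1) fin[OF t] by (metis max_less_iff_conj)
  qed
  then obtain e B where eB: "\<And>t. t \<in> J \<Longrightarrow> e t > 0" "\<And>t. t \<in> J \<Longrightarrow> B t < \<infinity>"
    "\<And>t s. t \<in> J \<Longrightarrow> s \<in> J \<Longrightarrow> dist s t < e t \<Longrightarrow> p s \<le> B t" by metis
  have "J \<subseteq> (\<Union>t\<in>J. ball t (e t))" using eB(1) by force
  then obtain D where D: "D \<subseteq> J" "finite D" "J \<subseteq> (\<Union>t\<in>D. ball t (e t))"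
    using compactE_image[OF J, of J "\<lambda>t. ball t (e t)"] by auto
  have "(\<Sum>t\<in>D. B t) < \<infinity>" using D eB(2) by (auto simp: less_top[symmetric])
  then obtain b where b: "b \<ge> 0" "(\<Sum>t\<in>D. B t) = ennreal b" by (cases "\<Sum>t\<in>D. B t") auto
  have "p s \<le> ennreal b" if s: "s \<in> J" for s
  proof -
    obtain t where t: "t \<in> D" "dist s t < e t" using D(3) s by (auto simp: dist_commute)
    then have "p s \<le> B t" using eB(3) D(1) s by auto
    also have "\<dots> \<le> (\<Sum>t\<in>D. B t)" using D(2) t(1) by (intro member_le_sum) auto
    finally show ?thesis using b by simp
  qed
  then show ?thesis using b by blast
qed

text \<open>\<open>p\<close> stands for any of the norms dominated by the distance \<open>d\<close>.
  Near \<open>t\<close> it exceeds its value at \<open>t\<close> by at most 1, and compactness of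
  \<open>{0..T}\<close> does the rest.\<close>

lemma time_continuous_bounded:
  assumes F: "time_continuous {0..T} S d F"
    and p: "\<And>s t. s \<in> {0..T} \<Longrightarrow> t \<in> {0..T} \<Longrightarrow> p (F s) \<le> d (F s) (F t) + p (F t)"
    and fin: "\<And>w. w \<in> S \<Longrightarrow> p w < \<infinity>"
  shows "\<exists>B\<ge>0. \<forall>t\<in>{0..T}. p (F t) \<le> ennreal B"
proof (rule ennreal_locally_bounded_compact)
  fix t assume t: "t \<in> {0..T}"
  then have FS: "F t \<in> S" and lim: "((\<lambda>s. d (F s) (F t)) \<longlongrightarrow> 0) (at t within {0..T})" using F by (auto simp: time_continuous_def)
  show pf: "p (F t) < \<infinity>" by (rule fin[OF FS])
  have "\<forall>\<^sub>F s in at t within {0..T}. d (F s) (F t) < 1" using lim by (rule order_tendstoD) simp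
  moreover have "\<forall>\<^sub>F s in at t within {0..T}. s \<in> {0..T}" by (simp add: eventually_at_filter)
  ultimately have "\<forall>\<^sub>F s in at t within {0..T}. p (F s) \<le> 1 + p (F t)"
  proof eventually_elim
    case (elim s)
    then show ?case using p[OF elim(2) t] add_right_mono[of "d (F s) (F t)" 1 "p (F t)"] by (meson less_imp_le order_trans)
  qed
  then show "\<exists>B<\<infinity>. \<forall>\<^sub>F s in at t within {0..T}. p (F s) \<le> B"
    using pf by (intro exI[of _ "1 + p (F t)"]) (auto simp: less_top[symmetric])
qed simp

lemma time_continuous_pointwise:
  assumes v: "time_continuous {0..T} S (\<lambda>w w'. sup_norm (\<lambda>x. w x - w' x)) v" and x: "x \<in> {0..2*pi}"
  shows "continuous_on {0..T} (\<lambda>t. v t x)"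
  unfolding continuous_on_def
proof
  fix t assume t: "t \<in> {0..T}"
  have lim: "((\<lambda>s. sup_norm (\<lambda>x. v s x - v t x)) \<longlongrightarrow> 0) (at t within {0..T})" using v t by (auto simp: time_continuous_def)
  have "((\<lambda>s. ennreal (norm (v s x - v t x))) \<longlongrightarrow> 0) (at t within {0..T})"
    by (rule tendsto_sandwich[OF _ _ tendsto_const lim])
       (auto intro!: always_eventually sup_norm_ge[OF x, of "\<lambda>x. v _ x - v t x"])
  then have "((\<lambda>s. norm (v s x - v t x)) \<longlongrightarrow> 0) (at t within {0..T})"
    using tendsto_ennreal_iff[of "\<lambda>s. norm (v s x - v t x)" _ 0] by simp
  then show "((\<lambda>t. v t x) \<longlongrightarrow> v t x) (at t within {0..T})"
    by (simp add: tendsto_norm_zero_iff LIM_zero_iff)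
qed

text \<open>Transfers the integrability in \<open>L1_C1\<close> to the Lipschitz seminorm. The
  latter is used in the estimates because its measurability in time follows from pointwise
  continuity in time, without any derivative.\<close>

lemma C1_lipschitz_norm:
  assumes v: "v \<in> C1_space"
  shows "two_param_norm 1 (incr v) \<le> C1_norm v"
proof (cases "sup_norm (deriv_x v) < \<infinity>")
  case True
  have c1: "v C1_differentiable_on UNIV" using v by (simp add: C1_space_def)
  let ?L = "enn2real (sup_norm (deriv_x v))"
  have "norm (v x - v y) \<le> ?L * \<bar>x - y\<bar>" if "x \<in> {0..2*pi}" "y \<in> {0..2*pi}" for x y
    by (rule lipschitz_from_vector_derivative[OF C1_differentiable_deriv_x(1)[OF c1]])
       (use that True sup_norm_real in auto)
  then have "two_param_norm 1 (incr v) \<le> ennreal ?L"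
    by (subst two_param_norm_le_iff) (auto simp: incr_def norm_minus_commute)
  also have "\<dots> = sup_norm (deriv_x v)" using True by simp
  also have "\<dots> \<le> C1_norm v" by (simp add: C1_norm_def)
  finally show ?thesis .
next
  case False
  then show ?thesis by (simp add: C1_norm_def less_top[symmetric])
qed

text \<open>Passes from the completed measure to \<open>lborel\<close>, joins the two time integrals
  into one with integrand \<open>drift\<close>, and extracts the finiteness of the time integral of
  the Lipschitz seminorm, without which the Gronwall inequality could not start.\<close>

lemma mild_solution_facts:
  fixes u :: "real \<Rightarrow> 'n::finite path"
  assumes m: "mild_solution f g \<alpha> u0 \<Psi> T u" and T: "T \<ge> 0"
  defines "v \<equiv> \<lambda>t x. u t x - fst (\<Psi> t) x"
  shows "time_continuous {0..T} C_space (\<lambda>w w'. sup_norm (\<lambda>x. w x - w' x)) v"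
    and "\<And>x. x \<in> {0..2*pi} \<Longrightarrow> continuous_on {0..T} (\<lambda>t. v t x)"
    and "AE t in lborel. t \<in> {0..T} \<longrightarrow> v t \<in> C1_space \<and> two_param_norm 1 (incr (v t)) < \<infinity>"
    and "(\<integral>\<^sup>+t\<in>{0..T}. two_param_norm 1 (incr (v (clamp_time T t))) \<partial>lborel) < \<infinity>"
    and "\<And>t x. t \<in> {0<..T} \<Longrightarrow> x \<in> {0..2*pi} \<Longrightarrow>
       set_integrable lebesgue {0..t} (\<lambda>s. drift f g (fst (\<Psi> s)) (snd (\<Psi> s)) (v s) (t - s) x)"
    and "\<And>t x. t \<in> {0<..T} \<Longrightarrow> x \<in> {0..2*pi} \<Longrightarrow> v t x = heat_semigroup t (\<lambda>y. u0 y - fst (\<Psi> 0) y) x +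
       (LINT s:{0..t}|lebesgue. drift f g (fst (\<Psi> s)) (snd (\<Psi> s)) (v s) (t - s) x)"
proof -
  note M = m[unfolded mild_solution_def Let_def, folded v_def]
  show tc: "time_continuous {0..T} C_space (\<lambda>w w'. sup_norm (\<lambda>x. w x - w' x)) v"
    using M by (simp add: v_def)
  show cont: "\<And>x. x \<in> {0..2*pi} \<Longrightarrow> continuous_on {0..T} (\<lambda>t. v t x)" by (rule time_continuous_pointwise[OF tc])
  have L1: "L1_C1 T v" using M by (simp add: v_def)
  have C1: "AE t in lborel. t \<in> {0..T} \<longrightarrow> v t \<in> C1_space"
    using L1 by (simp add: L1_C1_def AE_completion_iff)
  have "(\<integral>\<^sup>+t\<in>{0..T}. two_param_norm 1 (incr (v (clamp_time T t))) \<partial>lborel) \<le> (\<integral>\<^sup>+t\<in>{0..T}. C1_norm (v t) \<partial>lborel)"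
  proof (rule nn_integral_mono_AE, use C1 in eventually_elim)
    case (elim t)
    then show ?case using C1_lipschitz_norm[of "v t"] by (auto simp: indicator_def clamp_time(2) split: if_splits)
  qed
  also have "\<dots> < \<infinity>" using L1 by (simp add: L1_C1_def nn_integral_completion)
  finally show fin: "(\<integral>\<^sup>+t\<in>{0..T}. two_param_norm 1 (incr (v (clamp_time T t))) \<partial>lborel) < \<infinity>" .
  have [measurable]: "(\<lambda>t. two_param_norm 1 (incr (v (clamp_time T t)))) \<in> borel_measurable borel"
    by (rule lipschitz_norm_measurable[OF T cont])
  have "AE t in lborel. two_param_norm 1 (incr (v (clamp_time T t))) * indicator {0..T} t \<noteq> \<infinity>"
    by (rule nn_integral_PInf_AE) (use fin in auto)
  then show "AE t in lborel. t \<in> {0..T} \<longrightarrow> v t \<in> C1_space \<and> two_param_norm 1 (incr (v t)) < \<infinity>"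
    using C1
  proof eventually_elim
    case (elim t)
    then show ?case by (auto simp: clamp_time(2) less_top[symmetric])
  qed
  fix t x :: real assume t: "t \<in> {0<..T}" and x: "x \<in> {0..2*pi}"
  have us: "(\<lambda>y. fst (\<Psi> s) y + v s y) = u s" for s by (simp add: v_def)
  have i1: "set_integrable lebesgue {0..t} (\<lambda>s. heat_semigroup (t - s) (reaction f g (u s) (v s)) x)"
    and i2: "set_integrable lebesgue {0..t} (\<lambda>s. rough_integral (\<Psi> s) (integrand g (t - s) x (u s)) (integrand' g (t - s) x (u s)))"
    and eq: "v t x = heat_semigroup t (\<lambda>y. u0 y - fst (\<Psi> 0) y) x +
            (LINT s:{0..t}|lebesgue. heat_semigroup (t - s) (reaction f g (u s) (v s)) x) +
            (LINT s:{0..t}|lebesgue. rough_integral (\<Psi> s) (integrand g (t - s) x (u s)) (integrand' g (t - s) x (u s)))"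
    using M t x by (auto simp: v_def)
  have dr: "drift f g (fst (\<Psi> s)) (snd (\<Psi> s)) (v s) (t - s) x =
     heat_semigroup (t - s) (reaction f g (u s) (v s)) x + rough_integral (\<Psi> s) (integrand g (t - s) x (u s)) (integrand' g (t - s) x (u s))" for s
    unfolding drift_def us by simp
  show "set_integrable lebesgue {0..t} (\<lambda>s. drift f g (fst (\<Psi> s)) (snd (\<Psi> s)) (v s) (t - s) x)"
    unfolding dr by (intro set_integral_add i1 i2)
  show "v t x = heat_semigroup t (\<lambda>y. u0 y - fst (\<Psi> 0) y) x +
       (LINT s:{0..t}|lebesgue. drift f g (fst (\<Psi> s)) (snd (\<Psi> s)) (v s) (t - s) x)"
    unfolding dr eq set_integral_add(2)[OF i1 i2] by (simp add: add.assoc)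
qed

text \<open>The zero state is the point of comparison. Its rough integral vanishes, but its drift is
  the semigroup applied to the constant \<open>f 0\<close>; this is the origin of the additional
  constant \<open>c\<close>.\<close>

lemma spatial_bounds:
  fixes f :: "real ^ 'n::finite \<Rightarrow> real ^ 'n" and g :: "real ^ 'n \<Rightarrow> real ^ 'n ^ 'n"
  assumes f: "smooth f" and g: "smooth g" and \<alpha>: "1 / 3 < \<alpha>" "\<alpha> < 1 / 2" and M0: "M \<ge> 0" and T0: "T \<ge> 0"
  shows "\<exists>K\<ge>0. \<forall>X A v N r x y. rp_state \<alpha> M N X A v \<longrightarrow> v C1_differentiable_on UNIV \<longrightarrow> 0 < r \<longrightarrow> r \<le> T \<longrightarrow>
    x \<in> {0..2*pi} \<longrightarrow> y \<in> {0..2*pi} \<longrightarrow>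
    norm (drift f g X A v r x) \<le> K * (1 + N) * r powr ((\<alpha> - 1) / 2) \<and>
    norm (drift f g X A v r x - drift f g X A v r y) \<le> K * (1 + N) * r powr ((\<alpha> - 2) / 2) * \<bar>x - y\<bar>"
proof -
  obtain K where K: "K \<ge> 0" "\<And>X A v N X' A' v' N' d W r x y.
    rp_state \<alpha> M N X A v \<Longrightarrow> rp_state \<alpha> M N' X' A' v' \<Longrightarrow> rp_close \<alpha> d W X A v X' A' v' \<Longrightarrow> d \<le> 2 * M \<Longrightarrow>
    v C1_differentiable_on UNIV \<Longrightarrow> v' C1_differentiable_on UNIV \<Longrightarrow> 0 < r \<Longrightarrow> r \<le> T \<Longrightarrow>
    x \<in> {0..2*pi} \<Longrightarrow> y \<in> {0..2*pi} \<Longrightarrow>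
    norm (drift f g X A v r x - drift f g X' A' v' r x) \<le> K * (d * (1 + N) + W) * r powr ((\<alpha> - 1) / 2) \<and>
    norm ((drift f g X A v r x - drift f g X' A' v' r x) - (drift f g X A v r y - drift f g X' A' v' r y))
      \<le> K * (d * (1 + N) + W) * r powr ((\<alpha> - 2) / 2) * \<bar>x - y\<bar>"
    using spatial_difference[OF f g \<alpha> M0 T0] by blast
  define H where "H = kernel_const T"
  have H0: "H \<ge> 0" using kernel_const_pos[OF T0] by (simp add: H_def)
  define c where "c = 12 * H * norm (f 0) * T powr ((1 - \<alpha>) / 2)"
  have c0: "c \<ge> 0" unfolding c_def using H0 by simp
  have zero: "norm (drift f g (\<lambda>_. 0) (\<lambda>_ _. 0) (\<lambda>_. 0) r x) \<le> c * r powr ((\<alpha> - 1) / 2)"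
    "norm (drift f g (\<lambda>_. 0) (\<lambda>_ _. 0) (\<lambda>_. 0) r x - drift f g (\<lambda>_. 0) (\<lambda>_ _. 0) (\<lambda>_. 0) r y) \<le> c * r powr ((\<alpha> - 2) / 2) * \<bar>x - y\<bar>"
    if r: "0 < r" "r \<le> T" and xy: "x \<in> {0..2*pi}" "y \<in> {0..2*pi}" for r x y
  proof -
    have "has_rough_integral (\<lambda>_. 0, \<lambda>_ _. 0 :: real ^ 'n ^ 'n) Y Y' 0" for Y Y'
      by (auto simp: has_rough_integral_def rough_summand_def incr_def zero_vec_def[symmetric] intro!: exI[of _ 1])
    then have ri: "rough_integral (\<lambda>_. 0, \<lambda>_ _. 0 :: real ^ 'n ^ 'n) Y Y' = 0" for Y Y' by (rule rough_integral_eqI)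
    have dx: "deriv_x (\<lambda>_. 0 :: real ^ 'n) y = 0" for y
      unfolding deriv_x_def by (rule vector_derivative_at) simp
    have dr: "drift f g (\<lambda>_. 0) (\<lambda>_ _. 0) (\<lambda>_. 0) r x = heat_semigroup r (\<lambda>_. f 0) x" for x
      unfolding drift_def ri by (simp add: reaction_def[abs_def] dx)
    have rT: "r powr ((1 - \<alpha>) / 2) \<le> T powr ((1 - \<alpha>) / 2)" using r \<alpha> by (intro powr_mono2) auto
    have r1: "1 \<le> T powr ((1 - \<alpha>) / 2) * r powr ((\<alpha> - 1) / 2)"
    proof -
      have "1 = r powr ((1 - \<alpha>) / 2) * r powr ((\<alpha> - 1) / 2)" using r by (simp add: powr_add[symmetric] add_divide_distrib[symmetric])
      also have "\<dots> \<le> T powr ((1 - \<alpha>) / 2) * r powr ((\<alpha> - 1) / 2)" using rT by (intro mult_right_mono) auto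
      finally show ?thesis .
    qed
    have r2: "r powr - (1/2) \<le> T powr ((1 - \<alpha>) / 2) * r powr ((\<alpha> - 2) / 2)"
    proof -
      have "r powr - (1/2) = r powr ((1 - \<alpha>) / 2) * r powr ((\<alpha> - 2) / 2)" unfolding powr_add[symmetric]
        by (rule arg_cong[where f="\<lambda>e. r powr e"]) (simp add: field_simps)
      also have "\<dots> \<le> T powr ((1 - \<alpha>) / 2) * r powr ((\<alpha> - 2) / 2)" using rT by (intro mult_right_mono) auto
      finally show ?thesis .
    qed
    have hb: "norm (heat_semigroup r (\<lambda>_. f 0) x) \<le> 12 * H * norm (f 0)"
      "norm (heat_semigroup r (\<lambda>_. f 0) x - heat_semigroup r (\<lambda>_. f 0) y) \<le> 12 * H * norm (f 0) * r powr - (1/2) * \<bar>x - y\<bar>"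
      unfolding H_def using heat_semigroup_bounds[OF r, of "\<lambda>_. f 0" "norm (f 0)"] xy by auto
    have b0: "0 \<le> 12 * H * norm (f 0)" using H0 by simp
    show "norm (drift f g (\<lambda>_. 0) (\<lambda>_ _. 0) (\<lambda>_. 0) r x) \<le> c * r powr ((\<alpha> - 1) / 2)"
      unfolding dr c_def using hb(1) mult_left_mono[OF r1 b0] by (simp add: mult.assoc)
    show "norm (drift f g (\<lambda>_. 0) (\<lambda>_ _. 0) (\<lambda>_. 0) r x - drift f g (\<lambda>_. 0) (\<lambda>_ _. 0) (\<lambda>_. 0) r y) \<le> c * r powr ((\<alpha> - 2) / 2) * \<bar>x - y\<bar>"
      unfolding dr c_def using hb(2) mult_right_mono[OF mult_left_mono[OF r2 b0], of "\<bar>x - y\<bar>"] by (simp add: mult.assoc)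
  qed
  define K' where "K' = K * (M + 1) + c"
  have K'0: "K' \<ge> 0" unfolding K'_def using K(1) M0 c0 by simp
  show ?thesis
  proof (intro exI[of _ K'] conjI[OF K'0] allI impI)
    fix X :: "'n path" and A v N r x y
    assume s: "rp_state \<alpha> M N X A v" and v: "v C1_differentiable_on UNIV" and r: "0 < r" "r \<le> T"
      and xy: "x \<in> {0..2*pi}" "y \<in> {0..2*pi}"
    have N0: "N \<ge> 0" using s by (simp add: rp_state_def)
    have v0: "(\<lambda>_. 0 :: real ^ 'n) C1_differentiable_on UNIV" by simp
    have M2: "M \<le> 2 * M" using M0 by simp
    note k = K(2)[OF s rp_state_zero[OF M0] rp_close_zero[OF s] M2 v v0 r xy]
    have c1: "K * (M * (1 + N) + N) + c \<le> K' * (1 + N)"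
    proof -
      have "0 \<le> K" "0 \<le> c * N" using K(1) c0 N0 by auto
      then show ?thesis unfolding K'_def by (simp add: algebra_simps)
    qed
    let ?D = "drift f g X A v r" and ?Z = "drift f g (\<lambda>_. 0) (\<lambda>_ _. 0) (\<lambda>_. 0) r"
    have "norm (?D x) \<le> (K * (M * (1 + N) + N) + c) * r powr ((\<alpha> - 1) / 2)"
    proof -
      have "norm (?D x) \<le> norm (?D x - ?Z x) + norm (?Z x)" using norm_triangle_ineq[of "?D x - ?Z x" "?Z x"] by simp
      then show ?thesis unfolding distrib_right[of _ c] using conjunct1[OF k] zero(1)[OF r xy] by linarith
    qed
    also have "\<dots> \<le> K' * (1 + N) * r powr ((\<alpha> - 1) / 2)" using c1 by (intro mult_right_mono) auto
    finally have 1: "norm (?D x) \<le> K' * (1 + N) * r powr ((\<alpha> - 1) / 2)" .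
    have "norm (?D x - ?D y) \<le> (K * (M * (1 + N) + N) + c) * (r powr ((\<alpha> - 2) / 2) * \<bar>x - y\<bar>)"
    proof -
      have "norm (?D x - ?D y) \<le> norm ((?D x - ?Z x) - (?D y - ?Z y)) + norm (?Z x - ?Z y)"
        using norm_triangle_ineq[of "(?D x - ?Z x) - (?D y - ?Z y)" "?Z x - ?Z y"] by simp
      then show ?thesis unfolding distrib_right[of _ c] mult.assoc
        using conjunct2[OF k, unfolded mult.assoc] zero(2)[OF r xy, unfolded mult.assoc] by linarith
    qed
    also have "\<dots> \<le> K' * (1 + N) * (r powr ((\<alpha> - 2) / 2) * \<bar>x - y\<bar>)" using c1 by (intro mult_right_mono) auto
    finally show "norm (?D x) \<le> K' * (1 + N) * r powr ((\<alpha> - 1) / 2) \<and>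
      norm (?D x - ?D y) \<le> K' * (1 + N) * r powr ((\<alpha> - 2) / 2) * \<bar>x - y\<bar>" using 1 by (simp add: mult.assoc)
  qed
qed

section \<open>Norm estimates from the Duhamel formula\<close>

lemma set_lint_norm_bound:
  fixes G :: "real \<Rightarrow> 'a::{banach, second_countable_topology}"
  assumes int: "set_integrable lebesgue {0..t} G"
    and bd: "AE s in lborel. s \<in> {0..<t} \<longrightarrow> ennreal (norm (G s)) \<le> B s"
  shows "ennreal (norm (LINT s:{0..t}|lebesgue. G s)) \<le> (\<integral>\<^sup>+s\<in>{0..t}. B s \<partial>lborel)"
proof -
  have "ennreal (norm (LINT s:{0..t}|lebesgue. G s)) \<le> (\<integral>\<^sup>+s. ennreal (norm (indicator {0..t} s *\<^sub>R G s)) \<partial>lebesgue)"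
    using int unfolding set_lebesgue_integral_def set_integrable_def by (rule integral_norm_bound_ennreal)
  also have "\<dots> = (\<integral>\<^sup>+s. ennreal (norm (indicator {0..t} s *\<^sub>R G s)) \<partial>lborel)" by (rule nn_integral_completion)
  also have "\<dots> \<le> (\<integral>\<^sup>+s\<in>{0..t}. B s \<partial>lborel)"
  proof (rule nn_integral_mono_AE, use bd AE_lborel_singleton[of t] in eventually_elim)
    case (elim s)
    then show ?case by (auto simp: indicator_def)
  qed
  finally show ?thesis .
qed

lemma ennreal_divide_le_of_le_mult:
  assumes "c > 0" "ennreal n \<le> ennreal c * R"
  shows "ennreal (n / c) \<le> R"
proof (cases R)
  case (real r)
  then have "ennreal n \<le> ennreal (c * r)" using assms by (simp add: ennreal_mult)
  then have "n \<le> c * r" using real assms(1) by (subst (asm) ennreal_le_iff) auto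
  then show ?thesis using real assms(1) by (simp add: ennreal_leI pos_divide_le_eq mult.commute)
qed simp

lemma interpolate_powr:
  fixes n b0 b1 l \<beta> :: real
  assumes "0 \<le> n" "n \<le> b0" "n \<le> b1 * l" "0 \<le> b1" "0 \<le> l" "0 < \<beta>" "\<beta> < 1"
  shows "n \<le> b0 powr (1 - \<beta>) * b1 powr \<beta> * l powr \<beta>"
proof -
  have "n = n powr (1 - \<beta>) * n powr \<beta>" using assms by (cases "n = 0") (auto simp: powr_add[symmetric])
  also have "\<dots> \<le> b0 powr (1 - \<beta>) * (b1 * l) powr \<beta>" using assms by (intro mult_mono powr_mono2) auto
  finally show ?thesis using assms by (simp add: powr_mult)
qed

text \<open>Serves single solutions, with \<open>E\<close> equal to 1 plus the Lipschitz seminorm,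
  and differences, with \<open>E\<close> a multiple of the Gronwall quantity \<open>Q\<close>. As
  \<open>E\<close> may be infinite on a null set it takes values in \<open>ennreal\<close>, and at
  almost every \<open>s\<close> a real number \<open>e\<close> below it controls the drift. The
  \<beta>-Hoelder bound of the drift interpolates between its sup and Lipschitz bounds, and so does
  the exponent of its singularity.\<close>

lemma duhamel_norms:
  fixes w :: "'n::finite path"
  assumes t: "0 < t" "t \<le> T" and \<beta>: "0 < \<beta>" "\<beta> < 1" and K: "K \<ge> 0" and D0: "D0 \<ge> 0" and per: "h (2 * pi) = h 0"
    and h: "\<And>x. x \<in> {0..2*pi} \<Longrightarrow> norm (h x) \<le> D0"
      "\<And>x y. x \<in> {0..2*pi} \<Longrightarrow> y \<in> {0..2*pi} \<Longrightarrow> norm (h x - h y) \<le> D0 * \<bar>x - y\<bar> powr \<beta>"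
    and [measurable]: "E \<in> borel_measurable borel"
    and int: "\<And>x. x \<in> {0..2*pi} \<Longrightarrow> set_integrable lebesgue {0..t} (\<lambda>s. D s x)"
    and w: "\<And>x. x \<in> {0..2*pi} \<Longrightarrow> w x = heat_semigroup t h x + (LINT s:{0..t}|lebesgue. D s x)"
    and bd: "AE s in lborel. s \<in> {0..<t} \<longrightarrow> (\<exists>e\<ge>0. ennreal e \<le> E s \<and>
       (\<forall>x\<in>{0..2*pi}. norm (D s x) \<le> K * e * (t - s) powr - a) \<and>
       (\<forall>x\<in>{0..2*pi}. \<forall>y\<in>{0..2*pi}. norm (D s x - D s y) \<le> K * e * (t - s) powr - \<gamma> * \<bar>x - y\<bar>))"
  shows "sup_norm w \<le> ennreal (12 * kernel_const T * D0) + (\<integral>\<^sup>+s\<in>{0..t}. ennreal (K * (t - s) powr - a) * E s \<partial>lborel)"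
    and "two_param_norm 1 (incr w) \<le> ennreal (24 * kernel_const T * D0 * t powr - ((1 - \<beta>) / 2)) +
        (\<integral>\<^sup>+s\<in>{0..t}. ennreal (K * (t - s) powr - \<gamma>) * E s \<partial>lborel)"
    and "two_param_norm \<beta> (incr w) \<le> ennreal (96 * kernel_const T * D0) +
        (\<integral>\<^sup>+s\<in>{0..t}. ennreal (2 * K * (t - s) powr - ((1 - \<beta>) * a + \<beta> * \<gamma>)) * E s \<partial>lborel)"
proof -
  have ch: "continuous_on {0..2*pi} h" by (rule hoelder_continuous_on[OF \<beta>(1) h(2)])
  have H0: "kernel_const T \<ge> 0" using kernel_const_pos[of T] t by simp
  show "sup_norm w \<le> ennreal (12 * kernel_const T * D0) + (\<integral>\<^sup>+s\<in>{0..t}. ennreal (K * (t - s) powr - a) * E s \<partial>lborel)"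
    unfolding sup_norm_def
  proof (rule SUP_least)
    fix x :: real assume x: "x \<in> {0..2*pi}"
    have "ennreal (norm (LINT s:{0..t}|lebesgue. D s x)) \<le> (\<integral>\<^sup>+s\<in>{0..t}. ennreal (K * (t - s) powr - a) * E s \<partial>lborel)"
    proof (rule set_lint_norm_bound[OF int[OF x]], use bd in eventually_elim)
      case (elim s)
      show ?case
      proof
        assume "s \<in> {0..<t}"
        with elim obtain e where e: "e \<ge> 0" "ennreal e \<le> E s" "norm (D s x) \<le> K * e * (t - s) powr - a" using x by blast
        have "ennreal (norm (D s x)) \<le> ennreal (K * (t - s) powr - a) * ennreal e"
          using e K by (subst ennreal_mult[symmetric]) (auto intro!: ennreal_leI simp: mult_ac)
        also have "\<dots> \<le> ennreal (K * (t - s) powr - a) * E s" using e by (intro mult_left_mono) auto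
        finally show "ennreal (norm (D s x)) \<le> ennreal (K * (t - s) powr - a) * E s" .
      qed
    qed
    moreover have "ennreal (norm (heat_semigroup t h x)) \<le> ennreal (12 * kernel_const T * D0)"
      using heat_semigroup_bounds(1)[OF t ch h(1) x] by (intro ennreal_leI) auto
    moreover have "ennreal (norm (w x)) \<le> ennreal (norm (heat_semigroup t h x)) + ennreal (norm (LINT s:{0..t}|lebesgue. D s x))"
      unfolding w[OF x] by (subst ennreal_plus[symmetric]) (auto intro!: ennreal_leI norm_triangle_ineq simp del: ennreal_plus)
    ultimately show "ennreal (norm (w x)) \<le> ennreal (12 * kernel_const T * D0) + (\<integral>\<^sup>+s\<in>{0..t}. ennreal (K * (t - s) powr - a) * E s \<partial>lborel)"
      by (meson add_mono order_trans)
  qed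
  \<comment> \<open>The Lipschitz and Hoelder parts differ only in the exponent \<open>c\<close>,
    the semigroup bound \<open>k\<close> and the kernel \<open>q\<close>.\<close>
  have gen: "two_param_norm c (incr w) \<le> ennreal k + (\<integral>\<^sup>+s\<in>{0..t}. ennreal (q s) * E s \<partial>lborel)"
    if k: "k \<ge> 0" and [measurable]: "q \<in> borel_measurable borel" and q: "\<And>s. q s \<ge> 0"
      and sg: "\<And>x y. x \<in> {0..2*pi} \<Longrightarrow> y \<in> {0..2*pi} \<Longrightarrow> norm (heat_semigroup t h x - heat_semigroup t h y) \<le> k * \<bar>x - y\<bar> powr c"
      and dq: "\<And>s e x y. s \<in> {0..<t} \<Longrightarrow> e \<ge> 0 \<Longrightarrow> \<forall>x\<in>{0..2*pi}. norm (D s x) \<le> K * e * (t - s) powr - a \<Longrightarrow>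
        \<forall>x\<in>{0..2*pi}. \<forall>y\<in>{0..2*pi}. norm (D s x - D s y) \<le> K * e * (t - s) powr - \<gamma> * \<bar>x - y\<bar> \<Longrightarrow>
        x \<in> {0..2*pi} \<Longrightarrow> y \<in> {0..2*pi} \<Longrightarrow> norm (D s x - D s y) \<le> \<bar>x - y\<bar> powr c * (q s * e)"
    for c k q
    unfolding two_param_norm_def
  proof (rule SUP_least, clarify)
    fix x y :: real assume xy: "x \<in> {0..2*pi}" "y \<in> {0..2*pi}" "x \<noteq> y"
    let ?l = "\<bar>x - y\<bar> powr c"
    have l: "?l > 0" using xy by simp
    have di: "set_integrable lebesgue {0..t} (\<lambda>s. D s y - D s x)" by (intro set_integral_diff int xy)
    have "ennreal (norm (LINT s:{0..t}|lebesgue. D s y - D s x)) \<le> (\<integral>\<^sup>+s\<in>{0..t}. ennreal ?l * (ennreal (q s) * E s) \<partial>lborel)"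
    proof (rule set_lint_norm_bound[OF di], use bd in eventually_elim)
      case (elim s)
      show ?case
      proof
        assume s: "s \<in> {0..<t}"
        with elim obtain e where e: "e \<ge> 0" "ennreal e \<le> E s" "\<forall>x\<in>{0..2*pi}. norm (D s x) \<le> K * e * (t - s) powr - a"
          "\<forall>x\<in>{0..2*pi}. \<forall>y\<in>{0..2*pi}. norm (D s x - D s y) \<le> K * e * (t - s) powr - \<gamma> * \<bar>x - y\<bar>" by blast
        have "norm (D s y - D s x) \<le> ?l * (q s * e)" using dq[OF s e(1,3,4) xy(1,2)] by (simp add: norm_minus_commute)
        then have "ennreal (norm (D s y - D s x)) \<le> ennreal ?l * (ennreal (q s) * ennreal e)"
          using e(1) q l by (simp add: ennreal_mult[symmetric] ennreal_leI)
        also have "\<dots> \<le> ennreal ?l * (ennreal (q s) * E s)" using e by (intro mult_left_mono) auto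
        finally show "ennreal (norm (D s y - D s x)) \<le> ennreal ?l * (ennreal (q s) * E s)" .
      qed
    qed
    also have "\<dots> = ennreal ?l * (\<integral>\<^sup>+s\<in>{0..t}. ennreal (q s) * E s \<partial>lborel)"
      by (subst nn_integral_cmult[symmetric]) (auto simp: mult.assoc)
    finally have 1: "ennreal (norm (LINT s:{0..t}|lebesgue. D s y - D s x)) \<le> ennreal ?l * (\<integral>\<^sup>+s\<in>{0..t}. ennreal (q s) * E s \<partial>lborel)" .
    have 2: "ennreal (norm (heat_semigroup t h y - heat_semigroup t h x)) \<le> ennreal ?l * ennreal k"
      using sg[OF xy(1,2)] k by (subst ennreal_mult[symmetric]) (auto intro!: ennreal_leI simp: mult.commute norm_minus_commute)
    have eq: "incr w x y = (heat_semigroup t h y - heat_semigroup t h x) + (LINT s:{0..t}|lebesgue. D s y - D s x)"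
      unfolding incr_def w[OF xy(1)] w[OF xy(2)] using set_integral_diff(2)[OF int[OF xy(2)] int[OF xy(1)]] by simp
    have "ennreal (norm (incr w x y)) \<le> ennreal (norm (heat_semigroup t h y - heat_semigroup t h x)) + ennreal (norm (LINT s:{0..t}|lebesgue. D s y - D s x))"
      unfolding eq by (subst ennreal_plus[symmetric]) (auto intro!: ennreal_leI norm_triangle_ineq simp del: ennreal_plus)
    also have "\<dots> \<le> ennreal ?l * ennreal k + ennreal ?l * (\<integral>\<^sup>+s\<in>{0..t}. ennreal (q s) * E s \<partial>lborel)" by (rule add_mono[OF 2 1])
    finally have "ennreal (norm (incr w x y)) \<le> ennreal ?l * (ennreal k + (\<integral>\<^sup>+s\<in>{0..t}. ennreal (q s) * E s \<partial>lborel))"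
      by (simp add: distrib_left)
    then show "ennreal (norm (incr w x y) / ?l) \<le> ennreal k + (\<integral>\<^sup>+s\<in>{0..t}. ennreal (q s) * E s \<partial>lborel)"
      by (rule ennreal_divide_le_of_le_mult[OF l])
  qed
  note sg = heat_semigroup_hoelder_bounds[OF t \<beta> D0 per h(2)]
  show "two_param_norm 1 (incr w) \<le> ennreal (24 * kernel_const T * D0 * t powr - ((1 - \<beta>) / 2)) +
        (\<integral>\<^sup>+s\<in>{0..t}. ennreal (K * (t - s) powr - \<gamma>) * E s \<partial>lborel)"
  proof (rule gen)
    have e: "- ((1 - \<beta>) / 2) = (\<beta> - 1) / 2" by (simp add: field_simps)
    show "norm (heat_semigroup t h x - heat_semigroup t h y) \<le> 24 * kernel_const T * D0 * t powr - ((1 - \<beta>) / 2) * \<bar>x - y\<bar> powr 1"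
      if "x \<in> {0..2*pi}" "y \<in> {0..2*pi}" for x y
      unfolding e using sg(1) that by simp
    show "norm (D s x - D s y) \<le> \<bar>x - y\<bar> powr 1 * (K * (t - s) powr - \<gamma> * e)"
      if "\<forall>x\<in>{0..2*pi}. \<forall>y\<in>{0..2*pi}. norm (D s x - D s y) \<le> K * e * (t - s) powr - \<gamma> * \<bar>x - y\<bar>" "x \<in> {0..2*pi}" "y \<in> {0..2*pi}" for s e x y
      using that by (simp add: mult_ac)
  qed (use H0 D0 K in auto)
  show "two_param_norm \<beta> (incr w) \<le> ennreal (96 * kernel_const T * D0) +
        (\<integral>\<^sup>+s\<in>{0..t}. ennreal (2 * K * (t - s) powr - ((1 - \<beta>) * a + \<beta> * \<gamma>)) * E s \<partial>lborel)"
  proof (rule gen)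
    show "norm (heat_semigroup t h x - heat_semigroup t h y) \<le> 96 * kernel_const T * D0 * \<bar>x - y\<bar> powr \<beta>"
      if "x \<in> {0..2*pi}" "y \<in> {0..2*pi}" for x y
      using sg(2) that by simp
    fix s e x y assume s: "s \<in> {0..<t}" and e: "e \<ge> 0" and d1: "\<forall>x\<in>{0..2*pi}. norm (D s x) \<le> K * e * (t - s) powr - a"
      and d2: "\<forall>x\<in>{0..2*pi}. \<forall>y\<in>{0..2*pi}. norm (D s x - D s y) \<le> K * e * (t - s) powr - \<gamma> * \<bar>x - y\<bar>"
      and xy: "x \<in> {0..2*pi}" "y \<in> {0..2*pi}"
    let ?r = "t - s"
    have Ke: "K * e \<ge> 0" using K e by simp
    \<comment> \<open>The oscillation is at most twice the sup norm; this is the source of the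
      factor 2 in the Hoelder kernel.\<close>
    have "norm (D s x - D s y) \<le> 2 * (K * e * ?r powr - a)"
      using d1 xy norm_triangle_ineq4[of "D s x" "D s y"] by (smt (verit))
    then have "norm (D s x - D s y) \<le> (2 * (K * e * ?r powr - a)) powr (1 - \<beta>) * (K * e * ?r powr - \<gamma>) powr \<beta> * \<bar>x - y\<bar> powr \<beta>"
      using d2 xy Ke \<beta> by (intro interpolate_powr) auto
    also have "\<dots> = 2 powr (1 - \<beta>) * ((K * e) powr (1 - \<beta>) * (K * e) powr \<beta>) * ?r powr - ((1 - \<beta>) * a + \<beta> * \<gamma>) * \<bar>x - y\<bar> powr \<beta>"
    proof -
      have "?r powr - ((1 - \<beta>) * a + \<beta> * \<gamma>) = (?r powr - a) powr (1 - \<beta>) * (?r powr - \<gamma>) powr \<beta>"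
        unfolding powr_powr powr_add[symmetric] by (simp add: algebra_simps)
      then show ?thesis using Ke by (simp add: powr_mult mult_ac)
    qed
    also have "(K * e) powr (1 - \<beta>) * (K * e) powr \<beta> = K * e" using Ke by (cases "K * e = 0") (auto simp: powr_add[symmetric])
    also have "2 powr (1 - \<beta>) * (K * e) * ?r powr - ((1 - \<beta>) * a + \<beta> * \<gamma>) * \<bar>x - y\<bar> powr \<beta> \<le>
        2 * (K * e) * ?r powr - ((1 - \<beta>) * a + \<beta> * \<gamma>) * \<bar>x - y\<bar> powr \<beta>"
    proof -
      have "2 powr (1 - \<beta>) \<le> (2::real) powr 1" using \<beta> by (intro powr_mono) auto
      then show ?thesis using Ke by (intro mult_right_mono) auto
    qed
    finally show "norm (D s x - D s y) \<le> \<bar>x - y\<bar> powr \<beta> * (2 * K * ?r powr - ((1 - \<beta>) * a + \<beta> * \<gamma>) * e)" by (simp add: mult_ac)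
  qed (use H0 D0 K in auto)
qed

text \<open>What the estimates use of a mild solution, in terms of the path without its rough part.
  \<open>h\<close> is the initial datum in the equation. It is kept apart from \<open>v 0\<close>,
  because the equation is only given at positive times.\<close>

definition duhamel_solution ::
  "(real ^ 'n \<Rightarrow> real ^ 'n) \<Rightarrow> (real ^ 'n \<Rightarrow> real ^ 'n ^ 'n) \<Rightarrow> 'n path \<Rightarrow> (real \<Rightarrow> 'n path \<times> 'n area) \<Rightarrow> real \<Rightarrow> (real \<Rightarrow> 'n::finite path) \<Rightarrow> bool" where
  "duhamel_solution f g h \<Psi> T v \<longleftrightarrow>
    (\<forall>x\<in>{0..2*pi}. continuous_on {0..T} (\<lambda>t. v t x)) \<and>
    (AE t in lborel. t \<in> {0..T} \<longrightarrow> v t \<in> C1_space \<and> two_param_norm 1 (incr (v t)) < \<infinity>) \<and>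
    (\<integral>\<^sup>+t\<in>{0..T}. two_param_norm 1 (incr (v (clamp_time T t))) \<partial>lborel) < \<infinity> \<and>
    (\<forall>t\<in>{0<..T}. \<forall>x\<in>{0..2*pi}.
       set_integrable lebesgue {0..t} (\<lambda>s. drift f g (fst (\<Psi> s)) (snd (\<Psi> s)) (v s) (t - s) x) \<and>
       v t x = heat_semigroup t h x + (LINT s:{0..t}|lebesgue. drift f g (fst (\<Psi> s)) (snd (\<Psi> s)) (v s) (t - s) x))"

lemma mild_solution_duhamel:
  assumes "mild_solution f g \<alpha> u0 \<Psi> T u" "T \<ge> 0"
  shows "duhamel_solution f g (\<lambda>y. u0 y - fst (\<Psi> 0) y) \<Psi> T (\<lambda>t x. u t x - fst (\<Psi> t) x)"
  using mild_solution_facts[OF assms] unfolding duhamel_solution_def by simp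

lemma duhamel_solution_mono:
  assumes s: "duhamel_solution f g h \<Psi> T v" and T': "0 \<le> T'" "T' \<le> T"
  shows "duhamel_solution f g h \<Psi> T' v"
  unfolding duhamel_solution_def
proof (intro conjI)
  show "\<forall>x\<in>{0..2*pi}. continuous_on {0..T'} (\<lambda>t. v t x)"
    using s T' unfolding duhamel_solution_def by (auto intro: continuous_on_subset)
  have "AE t in lborel. t \<in> {0..T} \<longrightarrow> v t \<in> C1_space \<and> two_param_norm 1 (incr (v t)) < \<infinity>"
    using s by (simp add: duhamel_solution_def)
  then show "AE t in lborel. t \<in> {0..T'} \<longrightarrow> v t \<in> C1_space \<and> two_param_norm 1 (incr (v t)) < \<infinity>"
    by eventually_elim (use T' in auto)
  have "(\<integral>\<^sup>+t\<in>{0..T'}. two_param_norm 1 (incr (v (clamp_time T' t))) \<partial>lborel) \<le>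
      (\<integral>\<^sup>+t\<in>{0..T}. two_param_norm 1 (incr (v (clamp_time T t))) \<partial>lborel)"
    using T' by (intro nn_integral_mono) (auto simp: indicator_def clamp_time(2))
  also have "\<dots> < \<infinity>" using s by (simp add: duhamel_solution_def)
  finally show "(\<integral>\<^sup>+t\<in>{0..T'}. two_param_norm 1 (incr (v (clamp_time T' t))) \<partial>lborel) < \<infinity>" .
qed (use s T' in \<open>auto simp: duhamel_solution_def\<close>)

lemma rp_state_of_norms:
  assumes "(X, A) \<in> rough_paths \<alpha>" "hoelder_norm \<alpha> X \<le> ennreal M" "two_param_norm (2 * \<alpha>) A \<le> ennreal M"
    "sup_norm v \<le> ennreal M" "two_param_norm 1 (incr v) < \<infinity>" "M \<ge> 0"
  shows "rp_state \<alpha> M (enn2real (two_param_norm 1 (incr v))) X A v"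
  unfolding rp_state_def
proof (intro conjI ballI allI)
  fix x y z :: real and i j
  assume x: "x \<in> {0..2*pi}"
  show "norm (X x) \<le> M" "norm (v x) \<le> M"
    using hoelder_norm_bounds(1)[OF assms(2,6) x x] assms(4,6) x by (auto simp: sup_norm_le_iff)
  assume y: "y \<in> {0..2*pi}"
  show "norm (X y - X x) \<le> M * \<bar>y - x\<bar> powr \<alpha>" by (rule hoelder_norm_bounds(2)[OF assms(2,6) x y])
  show "norm (v y - v x) \<le> enn2real (two_param_norm 1 (incr v)) * \<bar>y - x\<bar>"
    using ennreal_le_two_param_norm[OF x y assms(5)] by (simp add: incr_def abs_minus_commute)
  show "norm (A x y) \<le> M * \<bar>y - x\<bar> powr (2 * \<alpha>)"
  proof (cases "x = y")
    case True
    then show ?thesis using assms(1) x by (simp add: rough_paths_def)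
  next
    case False
    then show ?thesis using assms(3,6) x y by (simp add: two_param_norm_le_iff abs_minus_commute)
  qed
  assume z: "z \<in> {0..2*pi}"
  show "A x z $ i $ j - A y z $ i $ j - A x y $ i $ j = (X y - X x) $ i * (X z - X y) $ j"
    using assms(1) x y z unfolding rough_paths_def by (auto simp: incr_def)
qed (use assms in auto)

lemma rp_close_of_norms:
  assumes "hoelder_norm \<alpha> (\<lambda>x. X x - X' x) \<le> ennreal d" "two_param_norm (2 * \<alpha>) (\<lambda>x y. A x y - A' x y) \<le> ennreal d"
    "sup_norm (\<lambda>x. v x - v' x) \<le> ennreal d" "two_param_norm 1 (incr (\<lambda>x. v x - v' x)) < \<infinity>" "d \<ge> 0"
    and "(X, A) \<in> rough_paths \<alpha>" "(X', A') \<in> rough_paths \<alpha>"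
  shows "rp_close \<alpha> d (enn2real (two_param_norm 1 (incr (\<lambda>x. v x - v' x)))) X A v X' A' v'"
  unfolding rp_close_def
proof (intro conjI ballI)
  fix x y :: real
  assume x: "x \<in> {0..2*pi}"
  show "norm (X x - X' x) \<le> d" "norm (v x - v' x) \<le> d"
    using hoelder_norm_bounds(1)[OF assms(1,5) x x] assms(3,5) x by (auto simp: sup_norm_le_iff)
  assume y: "y \<in> {0..2*pi}"
  show "norm ((X y - X x) - (X' y - X' x)) \<le> d * \<bar>y - x\<bar> powr \<alpha>"
    using hoelder_norm_bounds(2)[OF assms(1,5) x y] by (simp add: algebra_simps)
  show "norm ((v y - v x) - (v' y - v' x)) \<le> enn2real (two_param_norm 1 (incr (\<lambda>x. v x - v' x))) * \<bar>y - x\<bar>"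
    using ennreal_le_two_param_norm[OF x y assms(4)] by (simp add: incr_def abs_minus_commute algebra_simps)
  show "norm (A x y - A' x y) \<le> d * \<bar>y - x\<bar> powr (2 * \<alpha>)"
  proof (cases "x = y")
    case True
    then show ?thesis using assms(6,7) x by (simp add: rough_paths_def)
  next
    case False
    then show ?thesis using assms(2,5) x y by (simp add: two_param_norm_le_iff abs_minus_commute)
  qed
qed (use assms in auto)

section \<open>Stability of mild solutions\<close>

definition data_bounded :: "real \<Rightarrow> real \<Rightarrow> real \<Rightarrow> (real \<Rightarrow> 'n::finite path \<times> 'n area) \<Rightarrow> (real \<Rightarrow> 'n path) \<Rightarrow> bool" where
  "data_bounded \<alpha> M T \<Psi> v \<longleftrightarrow> (\<forall>t\<in>{0..T}. \<Psi> t \<in> rough_paths \<alpha> \<and> hoelder_norm \<alpha> (fst (\<Psi> t)) \<le> ennreal M \<and>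
     two_param_norm (2 * \<alpha>) (snd (\<Psi> t)) \<le> ennreal M \<and> sup_norm (v t) \<le> ennreal M)"

lemma drift_bounds:
  fixes f :: "real ^ 'n::finite \<Rightarrow> real ^ 'n" and g :: "real ^ 'n \<Rightarrow> real ^ 'n ^ 'n"
  assumes f: "smooth f" and g: "smooth g" and \<alpha>: "1 / 3 < \<alpha>" "\<alpha> < 1 / 2" and M0: "M \<ge> 0" and T0: "T \<ge> 0"
  shows "\<exists>K\<ge>0. \<forall>\<Psi> v h T' t. 0 < t \<longrightarrow> t \<le> T' \<longrightarrow> T' \<le> T \<longrightarrow> duhamel_solution f g h \<Psi> T' v \<longrightarrow> data_bounded \<alpha> M T' \<Psi> v \<longrightarrow>
    (AE s in lborel. s \<in> {0..<t} \<longrightarrow> (\<exists>e\<ge>0. ennreal e \<le> 1 + two_param_norm 1 (incr (v (clamp_time T' s))) \<and>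
       (\<forall>x\<in>{0..2*pi}. norm (drift f g (fst (\<Psi> s)) (snd (\<Psi> s)) (v s) (t - s) x) \<le> K * e * (t - s) powr - ((1 - \<alpha>) / 2)) \<and>
       (\<forall>x\<in>{0..2*pi}. \<forall>y\<in>{0..2*pi}. norm (drift f g (fst (\<Psi> s)) (snd (\<Psi> s)) (v s) (t - s) x - drift f g (fst (\<Psi> s)) (snd (\<Psi> s)) (v s) (t - s) y)
          \<le> K * e * (t - s) powr - ((2 - \<alpha>) / 2) * \<bar>x - y\<bar>)))"
proof -
  obtain K where K: "K \<ge> 0" "\<And>X A v N r x y. rp_state \<alpha> M N X A v \<Longrightarrow> v C1_differentiable_on UNIV \<Longrightarrow> 0 < r \<Longrightarrow> r \<le> T \<Longrightarrow>
    x \<in> {0..2*pi} \<Longrightarrow> y \<in> {0..2*pi} \<Longrightarrow>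
    norm (drift f g X A v r x) \<le> K * (1 + N) * r powr ((\<alpha> - 1) / 2) \<and>
    norm (drift f g X A v r x - drift f g X A v r y) \<le> K * (1 + N) * r powr ((\<alpha> - 2) / 2) * \<bar>x - y\<bar>"
    using spatial_bounds[OF f g \<alpha> M0 T0] by blast
  have ex: "(\<alpha> - 1) / 2 = - ((1 - \<alpha>) / 2)" "(\<alpha> - 2) / 2 = - ((2 - \<alpha>) / 2)" by (auto simp: field_simps)
  show ?thesis
  proof (intro exI[of _ K] conjI[OF K(1)] allI impI)
    fix \<Psi> :: "real \<Rightarrow> 'n path \<times> 'n area" and v h T' t
    assume t: "0 < t" "t \<le> T'" "T' \<le> T" and sf: "duhamel_solution f g h \<Psi> T' v" and gd: "data_bounded \<alpha> M T' \<Psi> v"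
    have "AE s in lborel. s \<in> {0..T'} \<longrightarrow> v s \<in> C1_space \<and> two_param_norm 1 (incr (v s)) < \<infinity>" using sf by (simp add: duhamel_solution_def)
    then show "AE s in lborel. s \<in> {0..<t} \<longrightarrow> (\<exists>e\<ge>0. ennreal e \<le> 1 + two_param_norm 1 (incr (v (clamp_time T' s))) \<and>
       (\<forall>x\<in>{0..2*pi}. norm (drift f g (fst (\<Psi> s)) (snd (\<Psi> s)) (v s) (t - s) x) \<le> K * e * (t - s) powr - ((1 - \<alpha>) / 2)) \<and>
       (\<forall>x\<in>{0..2*pi}. \<forall>y\<in>{0..2*pi}. norm (drift f g (fst (\<Psi> s)) (snd (\<Psi> s)) (v s) (t - s) x - drift f g (fst (\<Psi> s)) (snd (\<Psi> s)) (v s) (t - s) y)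
          \<le> K * e * (t - s) powr - ((2 - \<alpha>) / 2) * \<bar>x - y\<bar>))"
    proof eventually_elim
      case (elim s)
      show ?case
      proof
        assume s: "s \<in> {0..<t}"
        then have sT: "s \<in> {0..T'}" using t by auto
        have v: "v s C1_differentiable_on UNIV" and fin: "two_param_norm 1 (incr (v s)) < \<infinity>" using elim sT by (auto simp: C1_space_def)
        let ?N = "enn2real (two_param_norm 1 (incr (v s)))"
        have "(fst (\<Psi> s), snd (\<Psi> s)) \<in> rough_paths \<alpha>" using gd sT by (simp add: data_bounded_def)
        then have st: "rp_state \<alpha> M ?N (fst (\<Psi> s)) (snd (\<Psi> s)) (v s)"
          using gd sT fin M0 by (intro rp_state_of_norms) (auto simp: data_bounded_def)
        have r: "0 < t - s" "t - s \<le> T" using s t by auto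
        have N: "ennreal (1 + ?N) \<le> 1 + two_param_norm 1 (incr (v (clamp_time T' s)))"
          using fin sT by (simp add: clamp_time(2))
        show "\<exists>e\<ge>0. ennreal e \<le> 1 + two_param_norm 1 (incr (v (clamp_time T' s))) \<and>
         (\<forall>x\<in>{0..2*pi}. norm (drift f g (fst (\<Psi> s)) (snd (\<Psi> s)) (v s) (t - s) x) \<le> K * e * (t - s) powr - ((1 - \<alpha>) / 2)) \<and>
         (\<forall>x\<in>{0..2*pi}. \<forall>y\<in>{0..2*pi}. norm (drift f g (fst (\<Psi> s)) (snd (\<Psi> s)) (v s) (t - s) x - drift f g (fst (\<Psi> s)) (snd (\<Psi> s)) (v s) (t - s) y)
          \<le> K * e * (t - s) powr - ((2 - \<alpha>) / 2) * \<bar>x - y\<bar>)"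
          using K(2)[OF st v r] N unfolding ex by (intro exI[of _ "1 + ?N"]) auto
      qed
    qed
  qed
qed

lemma solution_measurable:
  assumes "duhamel_solution f g h \<Psi> T v" "T \<ge> 0"
  shows "(\<lambda>t. two_param_norm 1 (incr (v (clamp_time T t)))) \<in> borel_measurable borel"
  using assms by (intro lipschitz_norm_measurable) (auto simp: duhamel_solution_def)

text \<open>The condition \<open>a + b \<le> 1\<close> makes the remaining power of \<open>t\<close>
  nonnegative, so that the bound is uniform down to time 0. The expression \<open>max 0 c\<close>
  accounts for the truncation of negative numbers by \<open>ennreal\<close>.\<close>

lemma kernel_nn_integral:
  fixes K t a b :: real
  assumes "K \<ge> 0" "0 \<le> a" "a < 1" "0 \<le> b" "b < 1" "0 < t" "t \<le> T" "a + b \<le> 1"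
  shows "(\<integral>\<^sup>+s\<in>{0..t}. ennreal (K * (t - s) powr - a) * ennreal (c * s powr - b) \<partial>lborel) \<le>
     ennreal (K * max 0 c * ((2 / (1 - a) + 2 / (1 - b)) * T powr (1 - a - b)))"
proof -
  have "(\<integral>\<^sup>+s\<in>{0..t}. ennreal (K * (t - s) powr - a) * ennreal (c * s powr - b) \<partial>lborel) \<le>
    (\<integral>\<^sup>+s. ennreal (K * max 0 c) * (ennreal ((t - s) powr - a * s powr - b) * indicator {0..t} s) \<partial>lborel)"
  proof (rule nn_integral_mono)
    fix s
    have "ennreal (K * (t - s) powr - a) * ennreal (c * s powr - b) \<le> ennreal (K * (t - s) powr - a) * ennreal (max 0 c * s powr - b)"
      by (intro mult_left_mono ennreal_leI mult_right_mono) auto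
    also have "\<dots> = ennreal (K * max 0 c) * ennreal ((t - s) powr - a * s powr - b)"
      using assms by (simp add: ennreal_mult[symmetric] mult_ac)
    finally show "ennreal (K * (t - s) powr - a) * ennreal (c * s powr - b) * indicator {0..t} s \<le>
      ennreal (K * max 0 c) * (ennreal ((t - s) powr - a * s powr - b) * indicator {0..t} s)"
      by (auto simp: indicator_def)
  qed
  also have "\<dots> = ennreal (K * max 0 c) * (\<integral>\<^sup>+s\<in>{0..t}. ennreal ((t - s) powr - a * s powr - b) \<partial>lborel)"
    by (rule nn_integral_cmult) measurable
  also have "\<dots> \<le> ennreal (K * max 0 c) * ennreal ((2 / (1 - a) + 2 / (1 - b)) * t powr (1 - a - b))"
    using assms by (intro mult_left_mono beta_integral_le) auto
  also have "\<dots> = ennreal (K * max 0 c * ((2 / (1 - a) + 2 / (1 - b)) * t powr (1 - a - b)))"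
    using assms by (intro ennreal_mult[symmetric]) auto
  also have "\<dots> \<le> ennreal (K * max 0 c * ((2 / (1 - a) + 2 / (1 - b)) * T powr (1 - a - b)))"
    using assms by (intro ennreal_leI mult_left_mono powr_mono2) auto
  finally show ?thesis .
qed

text \<open>The semigroup smooths the \<beta>-Hoelder datum at the rate
  \<open>t powr - \<kappa>\<close>, the drift is controlled by \<open>1 + N\<close>, and the
  singular Gronwall inequality preserves the profile \<open>t powr - \<kappa>\<close>.\<close>

lemma solution_lipschitz_decay:
  fixes f :: "real ^ 'n::finite \<Rightarrow> real ^ 'n" and g :: "real ^ 'n \<Rightarrow> real ^ 'n ^ 'n"
  assumes f: "smooth f" and g: "smooth g" and \<alpha>: "1 / 3 < \<alpha>" "\<alpha> < \<beta>" "\<beta> < 1 / 2" and M0: "M \<ge> 0" and T0: "T > 0"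
    and sf: "duhamel_solution f g h \<Psi> T v" and gd: "data_bounded \<alpha> M T \<Psi> v"
    and h: "hoelder_norm \<beta> h \<le> ennreal M" "h (2 * pi) = h 0"
  shows "\<exists>C\<ge>0. AE t in lborel. t \<in> {0..T} \<longrightarrow> two_param_norm 1 (incr (v t)) \<le> ennreal (C * t powr - ((1 - \<beta>) / 2))"
proof -
  define \<kappa> where "\<kappa> = (1 - \<beta>) / 2"
  define \<gamma> where "\<gamma> = (2 - \<alpha>) / 2"
  have \<gamma>: "0 \<le> \<gamma>" "\<gamma> < 1" and \<kappa>: "0 \<le> \<kappa>" "\<kappa> < 1" and \<beta>: "0 < \<beta>" "\<beta> < 1" and \<alpha>2: "\<alpha> < 1 / 2"
    using \<alpha> by (auto simp: \<gamma>_def \<kappa>_def)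
  have T: "T \<ge> 0" using T0 by simp
  obtain K where K: "K \<ge> 0" "\<And>t. 0 < t \<Longrightarrow> t \<le> T \<Longrightarrow>
    (AE s in lborel. s \<in> {0..<t} \<longrightarrow> (\<exists>e\<ge>0. ennreal e \<le> 1 + two_param_norm 1 (incr (v (clamp_time T s))) \<and>
       (\<forall>x\<in>{0..2*pi}. norm (drift f g (fst (\<Psi> s)) (snd (\<Psi> s)) (v s) (t - s) x) \<le> K * e * (t - s) powr - ((1 - \<alpha>) / 2)) \<and>
       (\<forall>x\<in>{0..2*pi}. \<forall>y\<in>{0..2*pi}. norm (drift f g (fst (\<Psi> s)) (snd (\<Psi> s)) (v s) (t - s) x - drift f g (fst (\<Psi> s)) (snd (\<Psi> s)) (v s) (t - s) y)
          \<le> K * e * (t - s) powr - ((2 - \<alpha>) / 2) * \<bar>x - y\<bar>)))"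
    using drift_bounds[OF f g \<alpha>(1) \<alpha>2 M0 T] sf gd by blast
  define N where "N t = two_param_norm 1 (incr (v (clamp_time T t)))" for t
  have [measurable]: "N \<in> borel_measurable borel" unfolding N_def by (rule solution_measurable[OF sf T])
  have mN: "(\<lambda>s. 1 + N s) \<in> borel_measurable borel" by measurable
  define H where "H = kernel_const T"
  have H0: "H \<ge> 0" using kernel_const_pos[OF T] by (simp add: H_def)
  \<comment> \<open>The first term comes from the datum. The second is the contribution of the 1 in
    \<open>1 + N\<close>, a multiple of \<open>t powr (1 - \<gamma>)\<close>, rewritten as a
    multiple of \<open>t powr - \<kappa>\<close>.\<close>
  define a where "a = 24 * H * M + K * (T powr (1 - \<gamma> + \<kappa>) / (1 - \<gamma>))"
  have a0: "a \<ge> 0" unfolding a_def using H0 M0 K(1) \<gamma> by simp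
  have ineq: "N t \<le> ennreal (a * t powr - \<kappa>) + (\<integral>\<^sup>+s\<in>{0..t}. ennreal (K * (t - s) powr - \<gamma>) * N s \<partial>lborel)" if t: "0 < t" "t \<le> T" for t
  proof -
    have "two_param_norm 1 (incr (v t)) \<le> ennreal (24 * kernel_const T * M * t powr - ((1 - \<beta>) / 2)) +
        (\<integral>\<^sup>+s\<in>{0..t}. ennreal (K * (t - s) powr - \<gamma>) * (1 + N s) \<partial>lborel)"
      by (rule duhamel_norms(2)[OF t \<beta> K(1) M0 h(2), where D="\<lambda>s x. drift f g (fst (\<Psi> s)) (snd (\<Psi> s)) (v s) (t - s) x" and a="(1 - \<alpha>) / 2"])
         (use mN[unfolded N_def] sf t K(2)[OF t] hoelder_norm_bounds[OF h(1) M0] in \<open>auto simp: duhamel_solution_def N_def \<gamma>_def\<close>)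
    also have "(\<integral>\<^sup>+s\<in>{0..t}. ennreal (K * (t - s) powr - \<gamma>) * (1 + N s) \<partial>lborel) =
       (\<integral>\<^sup>+s. ennreal K * (ennreal ((t - s) powr - \<gamma>) * indicator {0..t} s) + ennreal (K * (t - s) powr - \<gamma>) * N s * indicator {0..t} s \<partial>lborel)"
      using K(1) by (intro nn_integral_cong) (auto simp: indicator_def distrib_left ennreal_mult)
    also have "\<dots> = ennreal K * (\<integral>\<^sup>+s\<in>{0..t}. ennreal ((t - s) powr - \<gamma>) \<partial>lborel) + (\<integral>\<^sup>+s\<in>{0..t}. ennreal (K * (t - s) powr - \<gamma>) * N s \<partial>lborel)"
      by (subst nn_integral_add) (auto simp: nn_integral_cmult)
    also have "(\<integral>\<^sup>+s\<in>{0..t}. ennreal ((t - s) powr - \<gamma>) \<partial>lborel) = ennreal (t powr (1 - \<gamma>) / (1 - \<gamma>))"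
      by (rule nn_integral_powr_minus_reflect) (use \<gamma> t in auto)
    also have "ennreal K * ennreal (t powr (1 - \<gamma>) / (1 - \<gamma>)) \<le> ennreal (K * (T powr (1 - \<gamma> + \<kappa>) / (1 - \<gamma>)) * t powr - \<kappa>)"
    proof -
      have "t powr (1 - \<gamma>) = t powr (1 - \<gamma> + \<kappa>) * t powr - \<kappa>" by (simp add: powr_add[symmetric])
      also have "\<dots> \<le> T powr (1 - \<gamma> + \<kappa>) * t powr - \<kappa>" using t \<gamma> \<kappa> by (intro mult_right_mono powr_mono2) auto
      finally have "K * (t powr (1 - \<gamma>) / (1 - \<gamma>)) \<le> K * (T powr (1 - \<gamma> + \<kappa>) * t powr - \<kappa> / (1 - \<gamma>))"
        using K(1) \<gamma> by (intro mult_left_mono divide_right_mono) auto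
      then show ?thesis using K(1) \<gamma> by (simp add: ennreal_mult[symmetric] ennreal_leI)
    qed
    finally have "two_param_norm 1 (incr (v t)) \<le> ennreal (24 * kernel_const T * M * t powr - ((1 - \<beta>) / 2)) +
       (ennreal (K * (T powr (1 - \<gamma> + \<kappa>) / (1 - \<gamma>)) * t powr - \<kappa>) + (\<integral>\<^sup>+s\<in>{0..t}. ennreal (K * (t - s) powr - \<gamma>) * N s \<partial>lborel))"
      by (simp add: add_mono)
    also have "\<dots> = ennreal (a * t powr - \<kappa>) + (\<integral>\<^sup>+s\<in>{0..t}. ennreal (K * (t - s) powr - \<gamma>) * N s \<partial>lborel)"
      unfolding a_def H_def[symmetric] \<kappa>_def[symmetric] distrib_right add.assoc[symmetric]
      using H0 M0 K(1) \<gamma> by (subst ennreal_plus) auto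
    finally show ?thesis using t by (simp add: N_def clamp_time(2))
  qed
  obtain G where G: "G \<ge> 0" "\<And>N a. N \<in> borel_measurable borel \<Longrightarrow> a \<ge> 0 \<Longrightarrow>
    (\<integral>\<^sup>+t\<in>{0..T}. N t \<partial>lborel) < \<infinity> \<Longrightarrow>
    (AE t in lborel. t \<in> {0..T} \<longrightarrow> N t \<le> ennreal (a * t powr - \<kappa>) +
         (\<integral>\<^sup>+s\<in>{0..t}. ennreal (K * (t - s) powr - \<gamma>) * N s \<partial>lborel)) \<Longrightarrow>
    (AE t in lborel. t \<in> {0..T} \<longrightarrow> N t \<le> ennreal (G * a * t powr - \<kappa>))"
    using singular_gronwall[OF \<gamma> \<kappa> K(1) T] T by blast
  have "AE t in lborel. t \<in> {0..T} \<longrightarrow> N t \<le> ennreal (G * a * t powr - \<kappa>)"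
  proof (rule G(2)[OF _ a0])
    show "N \<in> borel_measurable borel" by measurable
    show "(\<integral>\<^sup>+t\<in>{0..T}. N t \<partial>lborel) < \<infinity>" using sf unfolding N_def duhamel_solution_def by blast
    show "AE t in lborel. t \<in> {0..T} \<longrightarrow> N t \<le> ennreal (a * t powr - \<kappa>) +
         (\<integral>\<^sup>+s\<in>{0..t}. ennreal (K * (t - s) powr - \<gamma>) * N s \<partial>lborel)"
      using AE_lborel_singleton[of 0] by eventually_elim (use ineq in auto)
  qed
  then have "AE t in lborel. t \<in> {0..T} \<longrightarrow> two_param_norm 1 (incr (v t)) \<le> ennreal (G * a * t powr - ((1 - \<beta>) / 2))"
    by eventually_elim (auto simp: N_def clamp_time(2) \<kappa>_def)
  then show ?thesis using G(1) a0 by (intro exI[of _ "G * a"]) auto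
qed

text \<open>Decay of the Lipschitz seminorm is assumed for \<open>v\<close> only; for
  \<open>v'\<close> finiteness almost everywhere is enough, as \<open>N'\<close> is absent from the
  bound in \<open>spatial_difference\<close>. In \<open>C2\<close> the summands
  \<open>T powr \<kappa>\<close> and \<open>C1\<close> account for the two terms of
  \<open>1 + N\<close>, and the summand 1 accounts for \<open>W\<close>.\<close>

lemma difference_drift_bounds:
  fixes f :: "real ^ 'n::finite \<Rightarrow> real ^ 'n" and g :: "real ^ 'n \<Rightarrow> real ^ 'n ^ 'n"
  assumes f: "smooth f" and g: "smooth g" and \<alpha>: "1 / 3 < \<alpha>" "\<alpha> < 1 / 2" and M: "M \<ge> 1" and T0: "T > 0"
    and C1: "C1 \<ge> 0" and \<kappa>: "\<kappa> \<ge> 0"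
  defines "C2 \<equiv> 1 + T powr \<kappa> + C1"
  shows "\<exists>K\<ge>0. \<forall>\<Psi> v h \<Psi>' v' h' T' t \<eta>. 0 < t \<longrightarrow> t \<le> T' \<longrightarrow> T' \<le> T \<longrightarrow> 0 \<le> \<eta> \<longrightarrow> \<eta> \<le> 1 \<longrightarrow>
    duhamel_solution f g h \<Psi> T' v \<longrightarrow> data_bounded \<alpha> M T' \<Psi> v \<longrightarrow>
    duhamel_solution f g h' \<Psi>' T' v' \<longrightarrow> data_bounded \<alpha> M T' \<Psi>' v' \<longrightarrow>
    (AE t in lborel. t \<in> {0..T'} \<longrightarrow> two_param_norm 1 (incr (v t)) \<le> ennreal (C1 * t powr - \<kappa>)) \<longrightarrow>
    (\<forall>t\<in>{0..T'}. hoelder_norm \<alpha> (\<lambda>x. fst (\<Psi> t) x - fst (\<Psi>' t) x) \<le> ennreal \<eta> \<and>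
        two_param_norm (2 * \<alpha>) (\<lambda>x y. snd (\<Psi> t) x y - snd (\<Psi>' t) x y) \<le> ennreal \<eta> \<and>
        sup_norm (\<lambda>x. v t x - v' t x) \<le> 1) \<longrightarrow>
    (AE s in lborel. s \<in> {0..<t} \<longrightarrow> (\<exists>e\<ge>0. ennreal e \<le> ennreal C2 *
         (ennreal (s powr - \<kappa>) * (ennreal \<eta> + sup_norm (\<lambda>x. v (clamp_time T' s) x - v' (clamp_time T' s) x)) +
           two_param_norm 1 (incr (\<lambda>x. v (clamp_time T' s) x - v' (clamp_time T' s) x))) \<and>
       (\<forall>x\<in>{0..2*pi}. norm (drift f g (fst (\<Psi> s)) (snd (\<Psi> s)) (v s) (t - s) x - drift f g (fst (\<Psi>' s)) (snd (\<Psi>' s)) (v' s) (t - s) x)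
           \<le> K * e * (t - s) powr - ((1 - \<alpha>) / 2)) \<and>
       (\<forall>x\<in>{0..2*pi}. \<forall>y\<in>{0..2*pi}.
          norm ((drift f g (fst (\<Psi> s)) (snd (\<Psi> s)) (v s) (t - s) x - drift f g (fst (\<Psi>' s)) (snd (\<Psi>' s)) (v' s) (t - s) x) -
             (drift f g (fst (\<Psi> s)) (snd (\<Psi> s)) (v s) (t - s) y - drift f g (fst (\<Psi>' s)) (snd (\<Psi>' s)) (v' s) (t - s) y))
          \<le> K * e * (t - s) powr - ((2 - \<alpha>) / 2) * \<bar>x - y\<bar>)))"
proof -
  have M0: "M \<ge> 0" and T: "T \<ge> 0" using M T0 by auto
  obtain K where K: "K \<ge> 0" "\<And>X A v N X' A' v' N' d W r x y.
    rp_state \<alpha> M N X A v \<Longrightarrow> rp_state \<alpha> M N' X' A' v' \<Longrightarrow> rp_close \<alpha> d W X A v X' A' v' \<Longrightarrow> d \<le> 2 * M \<Longrightarrow>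
    v C1_differentiable_on UNIV \<Longrightarrow> v' C1_differentiable_on UNIV \<Longrightarrow> 0 < r \<Longrightarrow> r \<le> T \<Longrightarrow>
    x \<in> {0..2*pi} \<Longrightarrow> y \<in> {0..2*pi} \<Longrightarrow>
    norm (drift f g X A v r x - drift f g X' A' v' r x) \<le> K * (d * (1 + N) + W) * r powr ((\<alpha> - 1) / 2) \<and>
    norm ((drift f g X A v r x - drift f g X' A' v' r x) - (drift f g X A v r y - drift f g X' A' v' r y))
      \<le> K * (d * (1 + N) + W) * r powr ((\<alpha> - 2) / 2) * \<bar>x - y\<bar>"
    using spatial_difference[OF f g \<alpha> M0 T] by blast
  have ex: "(\<alpha> - 1) / 2 = - ((1 - \<alpha>) / 2)" "(\<alpha> - 2) / 2 = - ((2 - \<alpha>) / 2)" by (auto simp: field_simps)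
  show ?thesis
  proof (intro exI[of _ K] conjI[OF K(1)] allI impI)
    fix \<Psi> \<Psi>' :: "real \<Rightarrow> 'n path \<times> 'n area" and v h v' h' T' t \<eta>
    assume t: "0 < t" "t \<le> T'" "T' \<le> T" and \<eta>: "0 \<le> \<eta>" "\<eta> \<le> 1"
      and sf: "duhamel_solution f g h \<Psi> T' v" and gd: "data_bounded \<alpha> M T' \<Psi> v"
      and sf': "duhamel_solution f g h' \<Psi>' T' v'" and gd': "data_bounded \<alpha> M T' \<Psi>' v'"
      and dec: "AE t in lborel. t \<in> {0..T'} \<longrightarrow> two_param_norm 1 (incr (v t)) \<le> ennreal (C1 * t powr - \<kappa>)"
      and cl: "\<forall>t\<in>{0..T'}. hoelder_norm \<alpha> (\<lambda>x. fst (\<Psi> t) x - fst (\<Psi>' t) x) \<le> ennreal \<eta> \<and>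
        two_param_norm (2 * \<alpha>) (\<lambda>x y. snd (\<Psi> t) x y - snd (\<Psi>' t) x y) \<le> ennreal \<eta> \<and>
        sup_norm (\<lambda>x. v t x - v' t x) \<le> 1"
    have a1: "AE s in lborel. s \<in> {0..T'} \<longrightarrow> v s \<in> C1_space \<and> two_param_norm 1 (incr (v s)) < \<infinity>" using sf by (simp add: duhamel_solution_def)
    have a2: "AE s in lborel. s \<in> {0..T'} \<longrightarrow> v' s \<in> C1_space \<and> two_param_norm 1 (incr (v' s)) < \<infinity>" using sf' by (simp add: duhamel_solution_def)
    let ?D = "\<lambda>s x. drift f g (fst (\<Psi> s)) (snd (\<Psi> s)) (v s) (t - s) x - drift f g (fst (\<Psi>' s)) (snd (\<Psi>' s)) (v' s) (t - s) x"
    show "AE s in lborel. s \<in> {0..<t} \<longrightarrow> (\<exists>e\<ge>0. ennreal e \<le> ennreal C2 *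
         (ennreal (s powr - \<kappa>) * (ennreal \<eta> + sup_norm (\<lambda>x. v (clamp_time T' s) x - v' (clamp_time T' s) x)) +
           two_param_norm 1 (incr (\<lambda>x. v (clamp_time T' s) x - v' (clamp_time T' s) x))) \<and>
       (\<forall>x\<in>{0..2*pi}. norm (?D s x) \<le> K * e * (t - s) powr - ((1 - \<alpha>) / 2)) \<and>
       (\<forall>x\<in>{0..2*pi}. \<forall>y\<in>{0..2*pi}. norm (?D s x - ?D s y) \<le> K * e * (t - s) powr - ((2 - \<alpha>) / 2) * \<bar>x - y\<bar>))"
      using a1 a2 dec AE_lborel_singleton[of 0]
    proof eventually_elim
      case (elim s)
      show ?case
      proof
        assume s: "s \<in> {0..<t}"
        then have sT: "s \<in> {0..T'}" and s0: "s > 0" using t elim by auto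
        have v: "v s C1_differentiable_on UNIV" and fin: "two_param_norm 1 (incr (v s)) < \<infinity>"
          and v': "v' s C1_differentiable_on UNIV" and fin': "two_param_norm 1 (incr (v' s)) < \<infinity>"
          using elim sT by (auto simp: C1_space_def)
        let ?w = "\<lambda>x. v s x - v' s x"
        have "two_param_norm 1 (incr ?w) \<le> two_param_norm 1 (incr (v s)) + two_param_norm 1 (\<lambda>x y. - incr (v' s) x y)"
          using two_param_norm_triangle[of 1 "incr (v s)" "\<lambda>x y. - incr (v' s) x y"] by (simp add: incr_def[abs_def] algebra_simps)
        also have "\<dots> < \<infinity>" unfolding two_param_norm_uminus using fin fin' by simp
        finally have finw: "two_param_norm 1 (incr ?w) < \<infinity>" .
        have mle: "sup_norm ?w \<le> 1" using cl sT by blast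
        then have mfin: "sup_norm ?w < \<infinity>" using order.strict_trans1[of "sup_norm ?w" 1 \<infinity>] by simp
        define N W m where "N = enn2real (two_param_norm 1 (incr (v s)))" and "W = enn2real (two_param_norm 1 (incr ?w))"
          and "m = enn2real (sup_norm ?w)"
        have m: "sup_norm ?w = ennreal m" "0 \<le> m" "m \<le> 1" and W: "two_param_norm 1 (incr ?w) = ennreal W" "0 \<le> W"
          and N: "two_param_norm 1 (incr (v s)) = ennreal N" "0 \<le> N"
          using mle mfin finw fin by (auto simp: m_def W_def N_def ennreal_enn2real enn2real_leI)
        have rp: "(fst (\<Psi> s), snd (\<Psi> s)) \<in> rough_paths \<alpha>" "(fst (\<Psi>' s), snd (\<Psi>' s)) \<in> rough_paths \<alpha>"
          using gd gd' sT by (simp_all add: data_bounded_def)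
        have st: "rp_state \<alpha> M N (fst (\<Psi> s)) (snd (\<Psi> s)) (v s)"
          unfolding N_def using gd sT fin M0 rp by (intro rp_state_of_norms) (auto simp: data_bounded_def)
        have st': "rp_state \<alpha> M (enn2real (two_param_norm 1 (incr (v' s)))) (fst (\<Psi>' s)) (snd (\<Psi>' s)) (v' s)"
          using gd' sT fin' M0 rp by (intro rp_state_of_norms) (auto simp: data_bounded_def)
        have \<eta>m: "ennreal \<eta> \<le> ennreal (\<eta> + m)" "ennreal m \<le> ennreal (\<eta> + m)" using \<eta> m by (auto intro!: ennreal_leI)
        have rc: "rp_close \<alpha> (\<eta> + m) W (fst (\<Psi> s)) (snd (\<Psi> s)) (v s) (fst (\<Psi>' s)) (snd (\<Psi>' s)) (v' s)"
          unfolding W_def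
        proof (rule rp_close_of_norms[OF _ _ _ finw _ rp])
          show "hoelder_norm \<alpha> (\<lambda>x. fst (\<Psi> s) x - fst (\<Psi>' s) x) \<le> ennreal (\<eta> + m)"
            "two_param_norm (2 * \<alpha>) (\<lambda>x y. snd (\<Psi> s) x y - snd (\<Psi>' s) x y) \<le> ennreal (\<eta> + m)"
            using cl sT order_trans[OF _ \<eta>m(1)] by blast+
          show "sup_norm ?w \<le> ennreal (\<eta> + m)" unfolding m(1) by (rule \<eta>m(2))
        qed (use \<eta> m in auto)
        \<comment> \<open>Here the restrictions \<open>\<eta> \<le> 1\<close> and
          \<open>m \<le> 1\<close> are used. The first is a matter of choosing the data close, the
          second is provided later by the continuity argument.\<close>
        have d: "\<eta> + m \<le> 2 * M" using \<eta> m M by simp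
        have r: "0 < t - s" "t - s \<le> T" using s t by auto
        define e where "e = (\<eta> + m) * (1 + N) + W"
        have e0: "e \<ge> 0" using \<eta> m N W by (simp add: e_def)
        have Nb: "N \<le> C1 * s powr - \<kappa>"
          using elim(3) sT N C1 by (simp add: ennreal_le_iff)
        have one: "1 \<le> T powr \<kappa> * s powr - \<kappa>"
        proof -
          have "1 = s powr \<kappa> * s powr - \<kappa>" using s0 by (simp add: powr_add[symmetric])
          also have "\<dots> \<le> T powr \<kappa> * s powr - \<kappa>" using s0 s t \<kappa> by (intro mult_right_mono powr_mono2) auto
          finally show ?thesis .
        qed
        have "e \<le> C2 * (s powr - \<kappa> * (\<eta> + m) + W)"
        proof -
          have "1 + N \<le> (T powr \<kappa> + C1) * s powr - \<kappa>" using one Nb by (simp add: distrib_right)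
          also have "\<dots> \<le> C2 * s powr - \<kappa>" unfolding C2_def by (intro mult_right_mono) auto
          finally have "(\<eta> + m) * (1 + N) \<le> (\<eta> + m) * (C2 * s powr - \<kappa>)" using \<eta> m by (intro mult_left_mono) auto
          moreover have "1 * W \<le> C2 * W" using W C1 unfolding C2_def by (intro mult_right_mono) auto
          ultimately show ?thesis unfolding e_def by (simp add: algebra_simps)
        qed
        then have "ennreal e \<le> ennreal (C2 * (s powr - \<kappa> * (\<eta> + m) + W))" by (rule ennreal_leI)
        also have "\<dots> = ennreal C2 * (ennreal (s powr - \<kappa>) * (ennreal \<eta> + sup_norm ?w) + two_param_norm 1 (incr ?w))"
          unfolding m W(1) using \<eta> m W C1 by (simp add: ennreal_mult C2_def)
        finally have eE: "ennreal e \<le> ennreal C2 *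
         (ennreal (s powr - \<kappa>) * (ennreal \<eta> + sup_norm (\<lambda>x. v (clamp_time T' s) x - v' (clamp_time T' s) x)) +
           two_param_norm 1 (incr (\<lambda>x. v (clamp_time T' s) x - v' (clamp_time T' s) x)))"
          using sT by (simp add: clamp_time(2))
        show "\<exists>e\<ge>0. ennreal e \<le> ennreal C2 *
         (ennreal (s powr - \<kappa>) * (ennreal \<eta> + sup_norm (\<lambda>x. v (clamp_time T' s) x - v' (clamp_time T' s) x)) +
           two_param_norm 1 (incr (\<lambda>x. v (clamp_time T' s) x - v' (clamp_time T' s) x))) \<and>
         (\<forall>x\<in>{0..2*pi}. norm (?D s x) \<le> K * e * (t - s) powr - ((1 - \<alpha>) / 2)) \<and>
         (\<forall>x\<in>{0..2*pi}. \<forall>y\<in>{0..2*pi}. norm (?D s x - ?D s y) \<le> K * e * (t - s) powr - ((2 - \<alpha>) / 2) * \<bar>x - y\<bar>)"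
          using K(2)[OF st st' rc d v v' r] e0 eE unfolding ex e_def[symmetric] by (intro exI[of _ e] conjI) auto
      qed
    qed
  qed
qed

text \<open>The sup norm of \<open>v - v'\<close> is multiplied by \<open>N\<close>, which behaves
  like \<open>t powr - \<kappa>\<close>. It therefore enters \<open>Q\<close> with this weight, and
  a single scalar inequality for \<open>Q\<close> closes. Its solution is inserted into
  \<open>duhamel_norms\<close> to bound the sup and \<beta>-Hoelder norms at every positive time.
  The constant is uniform in \<open>T'\<close>, in \<eta> and in the perturbed data.\<close>

lemma difference_estimate:
  fixes f :: "real ^ 'n::finite \<Rightarrow> real ^ 'n" and g :: "real ^ 'n \<Rightarrow> real ^ 'n ^ 'n"
  assumes f: "smooth f" and g: "smooth g" and \<alpha>: "1 / 3 < \<alpha>" "\<alpha> < \<beta>" "\<beta> < 1 / 2" and M: "M \<ge> 1" and T0: "T > 0" and C1: "C1 \<ge> 0"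
  shows "\<exists>C\<ge>0. \<forall>\<Psi> v h \<Psi>' v' h' T' \<eta>. 0 < T' \<longrightarrow> T' \<le> T \<longrightarrow> 0 \<le> \<eta> \<longrightarrow> \<eta> \<le> 1 \<longrightarrow>
    duhamel_solution f g h \<Psi> T' v \<longrightarrow> data_bounded \<alpha> M T' \<Psi> v \<longrightarrow>
    duhamel_solution f g h' \<Psi>' T' v' \<longrightarrow> data_bounded \<alpha> M T' \<Psi>' v' \<longrightarrow>
    (AE t in lborel. t \<in> {0..T'} \<longrightarrow> two_param_norm 1 (incr (v t)) \<le> ennreal (C1 * t powr - ((1 - \<beta>) / 2))) \<longrightarrow>
    (\<forall>t\<in>{0..T'}. hoelder_norm \<alpha> (\<lambda>x. fst (\<Psi> t) x - fst (\<Psi>' t) x) \<le> ennreal \<eta> \<and>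
        two_param_norm (2 * \<alpha>) (\<lambda>x y. snd (\<Psi> t) x y - snd (\<Psi>' t) x y) \<le> ennreal \<eta> \<and>
        sup_norm (\<lambda>x. v t x - v' t x) \<le> 1) \<longrightarrow>
    continuous_on {0..2*pi} h \<longrightarrow> continuous_on {0..2*pi} h' \<longrightarrow> h (2 * pi) = h 0 \<longrightarrow> h' (2 * pi) = h' 0 \<longrightarrow>
    hoelder_norm \<beta> (\<lambda>x. h x - h' x) \<le> ennreal \<eta> \<longrightarrow>
    (\<forall>t\<in>{0<..T'}. sup_norm (\<lambda>x. v t x - v' t x) \<le> ennreal (C * \<eta>) \<and>
        two_param_norm \<beta> (incr (\<lambda>x. v t x - v' t x)) \<le> ennreal (C * \<eta>))"
proof -
  define \<kappa> where "\<kappa> = (1 - \<beta>) / 2"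
  define \<gamma> where "\<gamma> = (2 - \<alpha>) / 2"
  define a0 where "a0 = (1 - \<alpha>) / 2"
  \<comment> \<open>The exponent of the \<beta>-Hoelder seminorm of the drift, by interpolation. It
    satisfies \<open>a1 + \<kappa> = \<gamma>\<close>, hence the Hoelder bound has no singularity at
    time 0.\<close>
  define a1 where "a1 = (1 - \<beta>) * a0 + \<beta> * \<gamma>"
  have a1_eq: "a1 = (1 - \<alpha> + \<beta>) / 2" unfolding a1_def a0_def \<gamma>_def by (simp add: field_simps)
  have \<gamma>: "0 \<le> \<gamma>" "\<gamma> < 1" and \<kappa>: "0 \<le> \<kappa>" "\<kappa> < 1" and \<beta>: "0 < \<beta>" "\<beta> < 1" and \<alpha>2: "\<alpha> < 1 / 2"
    and a0: "0 \<le> a0" "a0 < 1" "a0 + \<kappa> \<le> 1" and a1: "0 \<le> a1" "a1 < 1" "a1 + \<kappa> \<le> 1"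
    using \<alpha> unfolding a1_eq by (auto simp: \<gamma>_def \<kappa>_def a0_def field_simps)
  have T: "T \<ge> 0" and M0: "M \<ge> 0" using T0 M by auto
  define C2 where "C2 = 1 + T powr \<kappa> + C1"
  have C20: "C2 \<ge> 0" using C1 by (simp add: C2_def)
  obtain K where K: "K \<ge> 0" "\<And>\<Psi> v h \<Psi>' v' h' T' t \<eta>. 0 < t \<Longrightarrow> t \<le> T' \<Longrightarrow> T' \<le> T \<Longrightarrow> 0 \<le> \<eta> \<Longrightarrow> \<eta> \<le> 1 \<Longrightarrow>
    duhamel_solution f g h \<Psi> T' v \<Longrightarrow> data_bounded \<alpha> M T' \<Psi> v \<Longrightarrow>
    duhamel_solution f g h' \<Psi>' T' v' \<Longrightarrow> data_bounded \<alpha> M T' \<Psi>' v' \<Longrightarrow>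
    (AE t in lborel. t \<in> {0..T'} \<longrightarrow> two_param_norm 1 (incr (v t)) \<le> ennreal (C1 * t powr - \<kappa>)) \<Longrightarrow>
    (\<forall>t\<in>{0..T'}. hoelder_norm \<alpha> (\<lambda>x. fst (\<Psi> t) x - fst (\<Psi>' t) x) \<le> ennreal \<eta> \<and>
        two_param_norm (2 * \<alpha>) (\<lambda>x y. snd (\<Psi> t) x y - snd (\<Psi>' t) x y) \<le> ennreal \<eta> \<and>
        sup_norm (\<lambda>x. v t x - v' t x) \<le> 1) \<Longrightarrow>
    (AE s in lborel. s \<in> {0..<t} \<longrightarrow> (\<exists>e\<ge>0. ennreal e \<le> ennreal C2 *
         (ennreal (s powr - \<kappa>) * (ennreal \<eta> + sup_norm (\<lambda>x. v (clamp_time T' s) x - v' (clamp_time T' s) x)) +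
           two_param_norm 1 (incr (\<lambda>x. v (clamp_time T' s) x - v' (clamp_time T' s) x))) \<and>
       (\<forall>x\<in>{0..2*pi}. norm (drift f g (fst (\<Psi> s)) (snd (\<Psi> s)) (v s) (t - s) x - drift f g (fst (\<Psi>' s)) (snd (\<Psi>' s)) (v' s) (t - s) x)
           \<le> K * e * (t - s) powr - a0) \<and>
       (\<forall>x\<in>{0..2*pi}. \<forall>y\<in>{0..2*pi}.
          norm ((drift f g (fst (\<Psi> s)) (snd (\<Psi> s)) (v s) (t - s) x - drift f g (fst (\<Psi>' s)) (snd (\<Psi>' s)) (v' s) (t - s) x) -
             (drift f g (fst (\<Psi> s)) (snd (\<Psi> s)) (v s) (t - s) y - drift f g (fst (\<Psi>' s)) (snd (\<Psi>' s)) (v' s) (t - s) y))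
          \<le> K * e * (t - s) powr - \<gamma> * \<bar>x - y\<bar>)))"
    using difference_drift_bounds[OF f g \<alpha>(1) \<alpha>2 M T0 C1 \<kappa>(1), folded C2_def a0_def \<gamma>_def] by blast
  \<comment> \<open>The kernel constant of the inequality for \<open>Q\<close>. The summand 1
    belongs to the Lipschitz part, and \<open>T powr (\<beta> / 2)\<close> to the weighted sup norm,
    see \<open>key\<close>.\<close>
  define B where "B = K * C2 * (T powr (\<beta> / 2) + 1)"
  have B0: "B \<ge> 0" unfolding B_def using K(1) C20 by simp
  obtain G where G: "G \<ge> 0" "\<And>N a T'. N \<in> borel_measurable borel \<Longrightarrow> a \<ge> 0 \<Longrightarrow> 0 \<le> T' \<Longrightarrow> T' \<le> T \<Longrightarrow>
    (\<integral>\<^sup>+t\<in>{0..T'}. N t \<partial>lborel) < \<infinity> \<Longrightarrow>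
    (AE t in lborel. t \<in> {0..T'} \<longrightarrow> N t \<le> ennreal (a * t powr - \<kappa>) +
         (\<integral>\<^sup>+s\<in>{0..t}. ennreal (B * (t - s) powr - \<gamma>) * N s \<partial>lborel)) \<Longrightarrow>
    (AE t in lborel. t \<in> {0..T'} \<longrightarrow> N t \<le> ennreal (G * a * t powr - \<kappa>))"
    using singular_gronwall[OF \<gamma> \<kappa> B0 T] by blast
  define H where "H = kernel_const T"
  have H0: "H \<ge> 0" using kernel_const_pos[OF T] by (simp add: H_def)
  \<comment> \<open>The number \<open>1 + 36 * H\<close> collects \<eta> itself and the semigroup
    terms with \<open>12 * H\<close> and \<open>24 * H\<close> from the sup and Lipschitz
    norms.\<close>
  define C3 where "C3 = C2 * (G * (1 + 36 * H))"
  have C30: "C3 \<ge> 0" unfolding C3_def using C20 G(1) H0 by simp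
  define C where "C = 96 * H + 2 * K * C3 * ((2 / (1 - a0) + 2 / (1 - \<kappa>)) * T powr (1 - a0 - \<kappa>)) +
     2 * K * C3 * ((2 / (1 - a1) + 2 / (1 - \<kappa>)) * T powr (1 - a1 - \<kappa>))"
  have Cpos: "0 \<le> 96 * H" "0 \<le> 2 * K * C3 * ((2 / (1 - a0) + 2 / (1 - \<kappa>)) * T powr (1 - a0 - \<kappa>))"
    "0 \<le> 2 * K * C3 * ((2 / (1 - a1) + 2 / (1 - \<kappa>)) * T powr (1 - a1 - \<kappa>))"
    using H0 K(1) C30 a0 a1 \<kappa> by auto
  have C0: "C \<ge> 0" unfolding C_def using Cpos by linarith
  show ?thesis
  proof (intro exI[of _ C] conjI[OF C0] allI impI ballI)
    fix \<Psi> \<Psi>' :: "real \<Rightarrow> 'n path \<times> 'n area" and v h v' h' T' \<eta> t1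
    assume T': "0 < T'" "T' \<le> T" and \<eta>: "0 \<le> \<eta>" "\<eta> \<le> 1"
      and sf: "duhamel_solution f g h \<Psi> T' v" and gd: "data_bounded \<alpha> M T' \<Psi> v"
      and sf': "duhamel_solution f g h' \<Psi>' T' v'" and gd': "data_bounded \<alpha> M T' \<Psi>' v'"
      and dec: "AE t in lborel. t \<in> {0..T'} \<longrightarrow> two_param_norm 1 (incr (v t)) \<le> ennreal (C1 * t powr - ((1 - \<beta>) / 2))"
      and cl: "\<forall>t\<in>{0..T'}. hoelder_norm \<alpha> (\<lambda>x. fst (\<Psi> t) x - fst (\<Psi>' t) x) \<le> ennreal \<eta> \<and>
        two_param_norm (2 * \<alpha>) (\<lambda>x y. snd (\<Psi> t) x y - snd (\<Psi>' t) x y) \<le> ennreal \<eta> \<and>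
        sup_norm (\<lambda>x. v t x - v' t x) \<le> 1"
      and ch: "continuous_on {0..2*pi} h" "continuous_on {0..2*pi} h'" and hp: "h (2 * pi) = h 0" "h' (2 * pi) = h' 0"
      and hh: "hoelder_norm \<beta> (\<lambda>x. h x - h' x) \<le> ennreal \<eta>" and t1: "t1 \<in> {0<..T'}"
    have T'0: "0 \<le> T'" using T' by simp
    define w where "w t x = v t x - v' t x" for t x
    define m where "m t = sup_norm (w (clamp_time T' t))" for t
    define W where "W t = two_param_norm 1 (incr (w (clamp_time T' t)))" for t
    have cw: "continuous_on {0..T'} (\<lambda>t. w t x)" if "x \<in> {0..2*pi}" for x
      unfolding w_def using sf sf' that by (intro continuous_intros) (auto simp: duhamel_solution_def)
    have [measurable]: "m \<in> borel_measurable borel" "W \<in> borel_measurable borel"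
      unfolding m_def W_def by (rule lipschitz_norm_measurable[OF T'0 cw]; assumption)+
    define Q where "Q t = ennreal (t powr - \<kappa>) * (ennreal \<eta> + m t) + W t" for t
    have [measurable]: "Q \<in> borel_measurable borel" unfolding Q_def by measurable
    define D where "D t s x = drift f g (fst (\<Psi> s)) (snd (\<Psi> s)) (v s) (t - s) x - drift f g (fst (\<Psi>' s)) (snd (\<Psi>' s)) (v' s) (t - s) x" for t s x
    have bd: "AE s in lborel. s \<in> {0..<t} \<longrightarrow> (\<exists>e\<ge>0. ennreal e \<le> ennreal C2 * Q s \<and>
       (\<forall>x\<in>{0..2*pi}. norm (D t s x) \<le> K * e * (t - s) powr - a0) \<and>
       (\<forall>x\<in>{0..2*pi}. \<forall>y\<in>{0..2*pi}. norm (D t s x - D t s y) \<le> K * e * (t - s) powr - \<gamma> * \<bar>x - y\<bar>))" if t: "0 < t" "t \<le> T'" for t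
      using K(2)[OF t T'(2) \<eta> sf gd sf' gd' dec[folded \<kappa>_def] cl] unfolding Q_def m_def W_def w_def D_def by simp
    have T2: "t \<le> T" if "t \<le> T'" for t using that T' by simp
    have Di: "set_integrable lebesgue {0..t} (\<lambda>s. D t s x)" if "0 < t" "t \<le> T'" "x \<in> {0..2*pi}" for t x
      unfolding D_def using sf sf' that by (intro set_integral_diff) (auto simp: duhamel_solution_def)
    have weq: "w t x = heat_semigroup t (\<lambda>y. h y - h' y) x + (LINT s:{0..t}|lebesgue. D t s x)"
      if t: "0 < t" "t \<le> T'" and x: "x \<in> {0..2*pi}" for t x
    proof -
      have i: "set_integrable lebesgue {0..t} (\<lambda>s. drift f g (fst (\<Psi> s)) (snd (\<Psi> s)) (v s) (t - s) x)"
        "set_integrable lebesgue {0..t} (\<lambda>s. drift f g (fst (\<Psi>' s)) (snd (\<Psi>' s)) (v' s) (t - s) x)"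
        and e: "v t x = heat_semigroup t h x + (LINT s:{0..t}|lebesgue. drift f g (fst (\<Psi> s)) (snd (\<Psi> s)) (v s) (t - s) x)"
        "v' t x = heat_semigroup t h' x + (LINT s:{0..t}|lebesgue. drift f g (fst (\<Psi>' s)) (snd (\<Psi>' s)) (v' s) (t - s) x)"
        using sf sf' t x by (auto simp: duhamel_solution_def)
      show ?thesis unfolding w_def e D_def set_integral_diff(2)[OF i] heat_semigroup_diff[OF t(1) ch, symmetric] by simp
    qed
    have hb: "norm (h x - h' x) \<le> \<eta>" "norm ((h x - h' x) - (h y - h' y)) \<le> \<eta> * \<bar>x - y\<bar> powr \<beta>"
      if "x \<in> {0..2*pi}" "y \<in> {0..2*pi}" for x y
      using hoelder_norm_bounds[OF hh \<eta>(1)] that by auto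
    have mE: "(\<lambda>s. ennreal C2 * Q s) \<in> borel_measurable borel" by measurable
    have per: "h (2 * pi) - h' (2 * pi) = h 0 - h' 0" using hp by simp
    have norms: "sup_norm (w t) \<le> ennreal (12 * H * \<eta>) + (\<integral>\<^sup>+s\<in>{0..t}. ennreal (K * (t - s) powr - a0) * (ennreal C2 * Q s) \<partial>lborel)"
      "two_param_norm 1 (incr (w t)) \<le> ennreal (24 * H * \<eta> * t powr - \<kappa>) + (\<integral>\<^sup>+s\<in>{0..t}. ennreal (K * (t - s) powr - \<gamma>) * (ennreal C2 * Q s) \<partial>lborel)"
      "two_param_norm \<beta> (incr (w t)) \<le> ennreal (96 * H * \<eta>) + (\<integral>\<^sup>+s\<in>{0..t}. ennreal (2 * K * (t - s) powr - a1) * (ennreal C2 * Q s) \<partial>lborel)"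
      if t: "0 < t" "t \<le> T'" for t
      unfolding H_def \<kappa>_def a1_def
      by (rule duhamel_norms(1)[where h="\<lambda>y. h y - h' y" and D="D t", OF t(1) T2[OF t(2)] \<beta> K(1) \<eta>(1) per _ _ mE _ _ bd[OF t]]
            duhamel_norms(2)[where h="\<lambda>y. h y - h' y" and D="D t", OF t(1) T2[OF t(2)] \<beta> K(1) \<eta>(1) per _ _ mE _ _ bd[OF t]]
            duhamel_norms(3)[where h="\<lambda>y. h y - h' y" and D="D t", OF t(1) T2[OF t(2)] \<beta> K(1) \<eta>(1) per _ _ mE _ _ bd[OF t]];
          (rule Di[OF t] weq[OF t] hb; assumption))+
    \<comment> \<open>Only finiteness is at stake, so the unquantified integrability of the
      Lipschitz seminorm of \<open>v'\<close> suffices here.\<close>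
    have Qfin: "(\<integral>\<^sup>+t\<in>{0..T'}. Q t \<partial>lborel) < \<infinity>"
    proof -
      let ?N = "\<lambda>v t. two_param_norm 1 (incr (v (clamp_time T' t)))"
      have [measurable]: "?N v \<in> borel_measurable borel" "?N v' \<in> borel_measurable borel"
        by (rule solution_measurable[OF sf T'0] solution_measurable[OF sf' T'0])+
      have "(\<integral>\<^sup>+t\<in>{0..T'}. Q t \<partial>lborel) \<le> (\<integral>\<^sup>+t. ennreal (\<eta> + 1) * (ennreal (t powr - \<kappa>) * indicator {0..T'} t) +
          (?N v t * indicator {0..T'} t + ?N v' t * indicator {0..T'} t) \<partial>lborel)"
      proof (rule nn_integral_mono)
        fix t
        show "Q t * indicator {0..T'} t \<le> ennreal (\<eta> + 1) * (ennreal (t powr - \<kappa>) * indicator {0..T'} t) +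
          (?N v t * indicator {0..T'} t + ?N v' t * indicator {0..T'} t)"
        proof (cases "t \<in> {0..T'}")
          case True
          have "m t \<le> 1" unfolding m_def w_def using cl True by (simp add: clamp_time(2))
          then have "ennreal \<eta> + m t \<le> ennreal (\<eta> + 1)" using \<eta> by (simp add: add_left_mono)
          then have "ennreal (t powr - \<kappa>) * (ennreal \<eta> + m t) \<le> ennreal (\<eta> + 1) * ennreal (t powr - \<kappa>)"
            unfolding mult.commute[of "ennreal (\<eta> + 1)"] by (rule mult_left_mono) simp
          moreover have "W t \<le> ?N v t + ?N v' t"
          proof -
            have "W t \<le> ?N v t + two_param_norm 1 (\<lambda>x y. - incr (v' (clamp_time T' t)) x y)"
              using two_param_norm_triangle[of 1 "incr (v (clamp_time T' t))" "\<lambda>x y. - incr (v' (clamp_time T' t)) x y"]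
              by (simp add: W_def w_def[abs_def] incr_def[abs_def] algebra_simps)
            then show ?thesis unfolding two_param_norm_uminus .
          qed
          ultimately show ?thesis using True unfolding Q_def by (simp add: add_mono)
        qed simp
      qed
      also have "\<dots> = ennreal (\<eta> + 1) * (\<integral>\<^sup>+t\<in>{0..T'}. ennreal (t powr - \<kappa>) \<partial>lborel) +
          ((\<integral>\<^sup>+t\<in>{0..T'}. ?N v t \<partial>lborel) + (\<integral>\<^sup>+t\<in>{0..T'}. ?N v' t \<partial>lborel))"
        by (simp add: nn_integral_add nn_integral_cmult)
      also have "\<dots> < \<infinity>"
        using sf sf' unfolding nn_integral_powr_minus[OF \<kappa>(2) T'0] duhamel_solution_def by (auto simp: ennreal_mult_less_top)
      finally show ?thesis .
    qed
    have Qineq: "Q t \<le> ennreal ((1 + 36 * H) * \<eta> * t powr - \<kappa>) + (\<integral>\<^sup>+s\<in>{0..t}. ennreal (B * (t - s) powr - \<gamma>) * Q s \<partial>lborel)"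
      if t: "0 < t" "t \<le> T'" for t
    proof -
      let ?I0 = "\<integral>\<^sup>+s\<in>{0..t}. ennreal (K * (t - s) powr - a0) * (ennreal C2 * Q s) \<partial>lborel"
      let ?I1 = "\<integral>\<^sup>+s\<in>{0..t}. ennreal (K * (t - s) powr - \<gamma>) * (ennreal C2 * Q s) \<partial>lborel"
      have Qt: "Q t = ennreal (t powr - \<kappa>) * (ennreal \<eta> + sup_norm (w t)) + two_param_norm 1 (incr (w t))"
        using t by (simp add: Q_def m_def W_def clamp_time(2))
      have "Q t \<le> ennreal (t powr - \<kappa>) * (ennreal \<eta> + (ennreal (12 * H * \<eta>) + ?I0)) + (ennreal (24 * H * \<eta> * t powr - \<kappa>) + ?I1)"
        unfolding Qt using norms(1,2)[OF t] by (intro add_mono mult_left_mono) auto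
      also have "\<dots> = ennreal ((1 + 36 * H) * \<eta> * t powr - \<kappa>) + (ennreal (t powr - \<kappa>) * ?I0 + ?I1)"
      proof -
        have "ennreal (t powr - \<kappa>) * ennreal \<eta> + ennreal (t powr - \<kappa>) * ennreal (12 * H * \<eta>) + ennreal (24 * H * \<eta> * t powr - \<kappa>) =
          ennreal ((1 + 36 * H) * \<eta> * t powr - \<kappa>)"
          using \<eta> H0 by (simp add: ennreal_mult[symmetric] ennreal_plus[symmetric] algebra_simps del: ennreal_plus)
        then show ?thesis by (simp add: distrib_left ac_simps)
      qed
      also have "ennreal (t powr - \<kappa>) * ?I0 + ?I1 =
        (\<integral>\<^sup>+s. ennreal (t powr - \<kappa>) * (ennreal (K * (t - s) powr - a0) * (ennreal C2 * Q s) * indicator {0..t} s) +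
            ennreal (K * (t - s) powr - \<gamma>) * (ennreal C2 * Q s) * indicator {0..t} s \<partial>lborel)"
        by (simp add: nn_integral_add nn_integral_cmult)
      also have "\<dots> \<le> (\<integral>\<^sup>+s\<in>{0..t}. ennreal (B * (t - s) powr - \<gamma>) * Q s \<partial>lborel)"
      proof (rule nn_integral_mono)
        fix s
        show "ennreal (t powr - \<kappa>) * (ennreal (K * (t - s) powr - a0) * (ennreal C2 * Q s) * indicator {0..t} s) +
            ennreal (K * (t - s) powr - \<gamma>) * (ennreal C2 * Q s) * indicator {0..t} s
          \<le> ennreal (B * (t - s) powr - \<gamma>) * Q s * indicator {0..t} s"
        proof (cases "s \<in> {0..t}")
          case True
          \<comment> \<open>The weight \<open>t powr - \<kappa>\<close> stands outside the time
            integral. Because \<open>t - s \<le> t\<close> it can be moved onto the kernel, and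
            \<open>a0 + \<kappa> = \<gamma> - \<beta> / 2\<close> leaves a positive power of
            \<open>t - s\<close> to spare.\<close>
          have key: "t powr - \<kappa> * (t - s) powr - a0 \<le> T powr (\<beta> / 2) * (t - s) powr - \<gamma>"
          proof (cases "s = t")
            case False
            then have r: "0 < t - s" "t - s \<le> t" "t - s \<le> T" using True t T2[OF t(2)] by auto
            have "t powr - \<kappa> \<le> (t - s) powr - \<kappa>" using r \<kappa> by (intro powr_mono2') auto
            then have "t powr - \<kappa> * (t - s) powr - a0 \<le> (t - s) powr - \<kappa> * (t - s) powr - a0" by (intro mult_right_mono) auto
            also have "\<dots> = (t - s) powr (\<beta> / 2) * (t - s) powr - \<gamma>"
              unfolding powr_add[symmetric] by (rule arg_cong[where f="\<lambda>e. (t - s) powr e"]) (simp add: \<kappa>_def a0_def \<gamma>_def field_simps)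
            also have "\<dots> \<le> T powr (\<beta> / 2) * (t - s) powr - \<gamma>" using r \<beta> by (intro mult_right_mono powr_mono2) auto
            finally show ?thesis .
          qed simp
          have "t powr - \<kappa> * (K * (t - s) powr - a0) * C2 + K * (t - s) powr - \<gamma> * C2 = K * C2 * (t powr - \<kappa> * (t - s) powr - a0 + (t - s) powr - \<gamma>)"
            by (simp add: algebra_simps)
          also have "\<dots> \<le> K * C2 * (T powr (\<beta> / 2) * (t - s) powr - \<gamma> + (t - s) powr - \<gamma>)"
            using key K(1) C20 by (intro mult_left_mono add_right_mono) auto
          also have "\<dots> = B * (t - s) powr - \<gamma>" by (simp add: B_def algebra_simps)
          finally have "ennreal (t powr - \<kappa> * (K * (t - s) powr - a0) * C2 + K * (t - s) powr - \<gamma> * C2) \<le> ennreal (B * (t - s) powr - \<gamma>)"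
            by (rule ennreal_leI)
          moreover have "ennreal (t powr - \<kappa> * (K * (t - s) powr - a0) * C2 + K * (t - s) powr - \<gamma> * C2) =
            ennreal (t powr - \<kappa>) * (ennreal (K * (t - s) powr - a0) * ennreal C2) + ennreal (K * (t - s) powr - \<gamma>) * ennreal C2"
            using K(1) C20 by (simp add: ennreal_mult mult.assoc)
          ultimately have "(ennreal (t powr - \<kappa>) * (ennreal (K * (t - s) powr - a0) * ennreal C2) + ennreal (K * (t - s) powr - \<gamma>) * ennreal C2) * Q s
             \<le> ennreal (B * (t - s) powr - \<gamma>) * Q s" by (intro mult_right_mono) auto
          then show ?thesis using True by (simp add: distrib_right mult.assoc)
        qed simp
      qed
      finally show ?thesis by (simp add: add_left_mono)
    qed
    have Qdec: "AE t in lborel. t \<in> {0..T'} \<longrightarrow> Q t \<le> ennreal (G * ((1 + 36 * H) * \<eta>) * t powr - \<kappa>)"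
    proof (rule G(2)[OF _ _ T'0 T'(2) Qfin])
      show "Q \<in> borel_measurable borel" by measurable
      show "0 \<le> (1 + 36 * H) * \<eta>" using H0 \<eta> by simp
      show "AE t in lborel. t \<in> {0..T'} \<longrightarrow> Q t \<le> ennreal ((1 + 36 * H) * \<eta> * t powr - \<kappa>) +
         (\<integral>\<^sup>+s\<in>{0..t}. ennreal (B * (t - s) powr - \<gamma>) * Q s \<partial>lborel)"
        using AE_lborel_singleton[of 0] by eventually_elim (use Qineq in auto)
    qed
    have t: "0 < t1" "t1 \<le> T'" using t1 by auto
    have int: "(\<integral>\<^sup>+s\<in>{0..t1}. ennreal (k * (t1 - s) powr - a) * (ennreal C2 * Q s) \<partial>lborel) \<le>
        ennreal (k * C3 * ((2 / (1 - a) + 2 / (1 - \<kappa>)) * T powr (1 - a - \<kappa>)) * \<eta>)"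
      if k: "k \<ge> 0" and a: "0 \<le> a" "a < 1" "a + \<kappa> \<le> 1" for k a
    proof -
      have "(\<integral>\<^sup>+s\<in>{0..t1}. ennreal (k * (t1 - s) powr - a) * (ennreal C2 * Q s) \<partial>lborel) \<le>
        (\<integral>\<^sup>+s\<in>{0..t1}. ennreal (k * (t1 - s) powr - a) * ennreal (C3 * \<eta> * s powr - \<kappa>) \<partial>lborel)"
      proof (rule nn_integral_mono_AE, use Qdec in eventually_elim)
        case (elim s)
        show ?case
        proof (cases "s \<in> {0..t1}")
          case True
          then have "ennreal C2 * Q s \<le> ennreal C2 * ennreal (G * ((1 + 36 * H) * \<eta>) * s powr - \<kappa>)"
            using elim t by (intro mult_left_mono) auto
          also have "\<dots> = ennreal (C3 * \<eta> * s powr - \<kappa>)" using C20 G(1) H0 \<eta> by (simp add: ennreal_mult[symmetric] C3_def mult_ac)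
          finally show ?thesis using True by (simp add: mult_left_mono)
        qed simp
      qed
      also have "\<dots> \<le> ennreal (k * max 0 (C3 * \<eta>) * ((2 / (1 - a) + 2 / (1 - \<kappa>)) * T powr (1 - a - \<kappa>)))"
        by (rule kernel_nn_integral) (use k a \<kappa> t T2 in auto)
      also have "\<dots> = ennreal (k * C3 * ((2 / (1 - a) + 2 / (1 - \<kappa>)) * T powr (1 - a - \<kappa>)) * \<eta>)"
        using C30 \<eta> by (simp add: max_def mult_ac)
      finally show ?thesis .
    qed
    have Kle: "K * C3 * ((2 / (1 - a0) + 2 / (1 - \<kappa>)) * T powr (1 - a0 - \<kappa>)) \<ge> 0"
      using K(1) C30 a0 \<kappa> by (intro mult_nonneg_nonneg add_nonneg_nonneg divide_nonneg_nonneg) auto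
    have "sup_norm (w t1) \<le> ennreal (12 * H * \<eta>) + ennreal (K * C3 * ((2 / (1 - a0) + 2 / (1 - \<kappa>)) * T powr (1 - a0 - \<kappa>)) * \<eta>)"
      using norms(1)[OF t] int[OF K(1) a0] by (meson add_left_mono order_trans)
    also have "\<dots> = ennreal ((12 * H + K * C3 * ((2 / (1 - a0) + 2 / (1 - \<kappa>)) * T powr (1 - a0 - \<kappa>))) * \<eta>)"
      using H0 \<eta> Kle by (simp add: ennreal_plus[symmetric] distrib_right del: ennreal_plus)
    also have "\<dots> \<le> ennreal (C * \<eta>)"
      using \<eta> H0 Cpos Kle unfolding C_def by (intro ennreal_leI mult_right_mono) auto
    finally have 1: "sup_norm (w t1) \<le> ennreal (C * \<eta>)" .
    have K2: "2 * K \<ge> 0" using K(1) by simp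
    have "two_param_norm \<beta> (incr (w t1)) \<le> ennreal (96 * H * \<eta>) + ennreal (2 * K * C3 * ((2 / (1 - a1) + 2 / (1 - \<kappa>)) * T powr (1 - a1 - \<kappa>)) * \<eta>)"
      using norms(3)[OF t] int[OF K2 a1] by (meson add_left_mono order_trans)
    also have "\<dots> = ennreal ((96 * H + 2 * K * C3 * ((2 / (1 - a1) + 2 / (1 - \<kappa>)) * T powr (1 - a1 - \<kappa>))) * \<eta>)"
      using H0 \<eta> Cpos(3) by (simp add: ennreal_plus[symmetric] distrib_right del: ennreal_plus)
    also have "\<dots> \<le> ennreal (C * \<eta>)"
      using \<eta> Cpos unfolding C_def by (intro ennreal_leI mult_right_mono) auto
    finally show "sup_norm (\<lambda>x. v t1 x - v' t1 x) \<le> ennreal (C * \<eta>) \<and> two_param_norm \<beta> (incr (\<lambda>x. v t1 x - v' t1 x)) \<le> ennreal (C * \<eta>)"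
      using 1 unfolding w_def by simp
  qed
qed

text \<open>Continuity argument at the first time where \<open>n\<close> attains a level above
  \<open>c\<close> but not above 1. Up to this time the restriction \<open>n t \<le> 1\<close>
  holds, so \<open>step\<close> puts the value back to at most \<open>c\<close>.\<close>

lemma bootstrap_bound:
  fixes n :: "real \<Rightarrow> real"
  assumes n: "continuous_on {0..T} n" and n0: "n 0 \<le> c" and c: "c < 1"
    and step: "\<And>T'. 0 < T' \<Longrightarrow> T' \<le> T \<Longrightarrow> (\<And>t. t \<in> {0..T'} \<Longrightarrow> n t \<le> 1) \<Longrightarrow> n T' \<le> c"
    and t2: "t2 \<in> {0..T}"
  shows "n t2 \<le> c"
proof (rule ccontr)
  assume "\<not> n t2 \<le> c"
  \<comment> \<open>Above \<open>c\<close>, so that the conclusion of \<open>step\<close>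
    contradicts it; at most 1, so that its premise holds before it is attained; at most
    \<open>n t2\<close>, so that it is attained.\<close>
  define b where "b = min 1 (n t2)"
  have b: "c < b" "b \<le> 1" "b \<le> n t2" using c \<open>\<not> n t2 \<le> c\<close> by (auto simp: b_def)
  have cont: "continuous_on {0..s} n" if "s \<le> T" for s using n continuous_on_subset that by fastforce
  have ivt: "\<exists>s\<in>{0..t}. n s = b" if "t \<in> {0..T}" "b \<le> n t" for t
    using IVT'[of n 0 b t] cont[of t] that n0 b by force
  define S where "S = {t \<in> {0..t2}. n t = b}"
  have "closed S" unfolding S_def using continuous_closed_preimage[OF cont[of t2], of "{b}"] t2
    by (simp add: vimage_def Int_def)
  moreover have "bounded S" unfolding S_def by (rule bounded_subset[of "{0..t2}"]) auto
  moreover have "S \<noteq> {}" using ivt[OF t2 b(3)] by (auto simp: S_def)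
  ultimately obtain t3 where t3: "t3 \<in> S" "\<And>s. s \<in> S \<Longrightarrow> t3 \<le> s"
    using compact_attains_inf[of S] by (auto simp: compact_eq_bounded_closed)
  have t3': "0 \<le> t3" "t3 \<le> T" "n t3 = b" using t3(1) t2 by (auto simp: S_def)
  have "t3 \<noteq> 0" using t3'(3) n0 b(1) by auto
  then have pos: "0 < t3" using t3' by simp
  have "n t \<le> 1" if t: "t \<in> {0..t3}" for t
  proof (rule ccontr)
    assume "\<not> n t \<le> 1"
    then have bn: "b < n t" using b by simp
    then obtain s where s: "s \<in> {0..t}" "n s = b" using ivt[of t] t t3' by auto
    then have "s \<in> S" using t t3(1) by (auto simp: S_def)
    then have "t3 \<le> s" by (rule t3(2))
    then have "s = t" using s t by auto
    then show False using s bn by simp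
  qed
  then have "n t3 \<le> c" using step[OF pos t3'(2)] by blast
  then show False using t3'(3) b by simp
qed

text \<open>With the decay of the Lipschitz seminorm known, the time integrals in
  \<open>duhamel_norms\<close> are explicit. The bounded Hoelder seminorm later excludes blow-up.
  The distance to the free evolution has the order
  \<open>1 - a0 - \<kappa> = (\<alpha> + \<beta>) / 2\<close>; since this is positive, the value at
  time 0 can be reached.\<close>

lemma solution_bounds:
  fixes f :: "real ^ 'n::finite \<Rightarrow> real ^ 'n" and g :: "real ^ 'n \<Rightarrow> real ^ 'n ^ 'n"
  assumes f: "smooth f" and g: "smooth g" and \<alpha>: "1 / 3 < \<alpha>" "\<alpha> < \<beta>" "\<beta> < 1 / 2" and M0: "M \<ge> 0" and T0: "T > 0"
    and sf: "duhamel_solution f g h \<Psi> T v" and gd: "data_bounded \<alpha> M T \<Psi> v"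
    and h: "hoelder_norm \<beta> h \<le> ennreal M" "h (2 * pi) = h 0"
  shows "\<exists>C\<ge>0. \<forall>t\<in>{0<..T}. two_param_norm \<beta> (incr (v t)) \<le> ennreal C \<and>
    (\<forall>x\<in>{0..2*pi}. norm (v t x - heat_semigroup t h x) \<le> C * t powr ((\<alpha> + \<beta>) / 2))"
proof -
  define \<kappa> where "\<kappa> = (1 - \<beta>) / 2"
  define a0 where "a0 = (1 - \<alpha>) / 2"
  define a1 where "a1 = (1 - \<beta>) * a0 + \<beta> * ((2 - \<alpha>) / 2)"
  have a1_eq: "a1 = (1 - \<alpha> + \<beta>) / 2" unfolding a1_def a0_def by (simp add: field_simps)
  have \<kappa>: "0 \<le> \<kappa>" "\<kappa> < 1" and \<beta>: "0 < \<beta>" "\<beta> < 1" and \<alpha>2: "\<alpha> < 1 / 2"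
    and a0: "0 \<le> a0" "a0 < 1" "a0 + \<kappa> \<le> 1" and a1: "0 \<le> a1" "a1 < 1" "a1 + \<kappa> \<le> 1"
    and e0: "1 - a0 - \<kappa> = (\<alpha> + \<beta>) / 2"
    using \<alpha> unfolding a1_eq by (auto simp: \<kappa>_def a0_def field_simps)
  have T: "T \<ge> 0" using T0 by simp
  obtain C1 where C1: "C1 \<ge> 0" "AE t in lborel. t \<in> {0..T} \<longrightarrow> two_param_norm 1 (incr (v t)) \<le> ennreal (C1 * t powr - \<kappa>)"
    using solution_lipschitz_decay[OF f g \<alpha> M0 T0 sf gd h] unfolding \<kappa>_def by blast
  obtain K where K: "K \<ge> 0" "\<And>t. 0 < t \<Longrightarrow> t \<le> T \<Longrightarrow>
    (AE s in lborel. s \<in> {0..<t} \<longrightarrow> (\<exists>e\<ge>0. ennreal e \<le> 1 + two_param_norm 1 (incr (v (clamp_time T s))) \<and>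
       (\<forall>x\<in>{0..2*pi}. norm (drift f g (fst (\<Psi> s)) (snd (\<Psi> s)) (v s) (t - s) x) \<le> K * e * (t - s) powr - a0) \<and>
       (\<forall>x\<in>{0..2*pi}. \<forall>y\<in>{0..2*pi}. norm (drift f g (fst (\<Psi> s)) (snd (\<Psi> s)) (v s) (t - s) x - drift f g (fst (\<Psi> s)) (snd (\<Psi> s)) (v s) (t - s) y)
          \<le> K * e * (t - s) powr - ((2 - \<alpha>) / 2) * \<bar>x - y\<bar>)))"
    using drift_bounds[OF f g \<alpha>(1) \<alpha>2 M0 T] sf gd unfolding a0_def by blast
  define N where "N t = 1 + two_param_norm 1 (incr (v (clamp_time T t)))" for t
  have mN: "N \<in> borel_measurable borel" unfolding N_def using solution_measurable[OF sf T] by measurable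
  define C2 where "C2 = T powr \<kappa> + C1"
  have C20: "C2 \<ge> 0" using C1 by (simp add: C2_def)
  have Nb: "AE s in lborel. s \<in> {0..T} \<longrightarrow> N s \<le> ennreal (C2 * s powr - \<kappa>)"
    using C1(2) AE_lborel_singleton[of 0]
  proof eventually_elim
    case (elim s)
    show ?case
    proof
      assume s: "s \<in> {0..T}"
      then have s0: "s > 0" using elim by auto
      have "1 = s powr \<kappa> * s powr - \<kappa>" using s0 by (simp add: powr_add[symmetric])
      also have "\<dots> \<le> T powr \<kappa> * s powr - \<kappa>" using s0 s \<kappa> by (intro mult_right_mono powr_mono2) auto
      finally have "ennreal 1 \<le> ennreal (T powr \<kappa> * s powr - \<kappa>)" by (rule ennreal_leI)
      then have "N s \<le> ennreal (T powr \<kappa> * s powr - \<kappa>) + ennreal (C1 * s powr - \<kappa>)"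
        unfolding N_def using elim s by (intro add_mono) (auto simp: clamp_time(2))
      also have "\<dots> = ennreal (C2 * s powr - \<kappa>)" unfolding C2_def distrib_right using C1(1) by (simp add: ennreal_plus)
      finally show "N s \<le> ennreal (C2 * s powr - \<kappa>)" .
    qed
  qed
  have int: "(\<integral>\<^sup>+s\<in>{0..t}. ennreal (k * (t - s) powr - a) * N s \<partial>lborel) \<le>
      ennreal (k * C2 * ((2 / (1 - a) + 2 / (1 - \<kappa>)) * t powr (1 - a - \<kappa>)))"
    if k: "k \<ge> 0" and a: "0 \<le> a" "a < 1" "a + \<kappa> \<le> 1" and t: "0 < t" "t \<le> T" for k a t
  proof -
    have "(\<integral>\<^sup>+s\<in>{0..t}. ennreal (k * (t - s) powr - a) * N s \<partial>lborel) \<le>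
      (\<integral>\<^sup>+s\<in>{0..t}. ennreal (k * (t - s) powr - a) * ennreal (C2 * s powr - \<kappa>) \<partial>lborel)"
    proof (rule nn_integral_mono_AE, use Nb in eventually_elim)
      case (elim s)
      then show ?case using t by (auto simp: indicator_def intro!: mult_left_mono)
    qed
    also have "\<dots> \<le> ennreal (k * max 0 C2 * ((2 / (1 - a) + 2 / (1 - \<kappa>)) * t powr (1 - a - \<kappa>)))"
      by (rule kernel_nn_integral) (use k a \<kappa> t in auto)
    finally show ?thesis using C20 by (simp add: max_def)
  qed
  define Ca where "Ca = K * C2 * (2 / (1 - a0) + 2 / (1 - \<kappa>))"
  define Cb where "Cb = 96 * kernel_const T * M + 2 * K * C2 * ((2 / (1 - a1) + 2 / (1 - \<kappa>)) * T powr (1 - a1 - \<kappa>))"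
  have H0: "kernel_const T \<ge> 0" using kernel_const_pos[OF T] by simp
  have pos: "Ca \<ge> 0" "Cb \<ge> 0" unfolding Ca_def Cb_def using K(1) C20 a0 a1 \<kappa> M0 H0
    by (auto intro!: mult_nonneg_nonneg add_nonneg_nonneg)
  show ?thesis
  proof (intro exI[of _ "Ca + Cb"] conjI ballI)
    show "0 \<le> Ca + Cb" using pos by simp
    fix t assume "t \<in> {0<..T}"
    then have t: "0 < t" "t \<le> T" by auto
    have "two_param_norm \<beta> (incr (v t)) \<le> ennreal (96 * kernel_const T * M) +
        (\<integral>\<^sup>+s\<in>{0..t}. ennreal (2 * K * (t - s) powr - a1) * N s \<partial>lborel)" unfolding a1_def
      by (rule duhamel_norms(3)[OF t \<beta> K(1) M0 h(2), where D="\<lambda>s x. drift f g (fst (\<Psi> s)) (snd (\<Psi> s)) (v s) (t - s) x"])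
         (use mN[unfolded N_def] sf t K(2)[OF t] hoelder_norm_bounds[OF h(1) M0] in \<open>auto simp: duhamel_solution_def N_def a0_def\<close>)
    also have "\<dots> \<le> ennreal (96 * kernel_const T * M) + ennreal (2 * K * C2 * ((2 / (1 - a1) + 2 / (1 - \<kappa>)) * t powr (1 - a1 - \<kappa>)))"
      using int[of "2 * K" a1 t] K(1) a1 t by (intro add_left_mono) auto
    also have "\<dots> \<le> ennreal (96 * kernel_const T * M) + ennreal (2 * K * C2 * ((2 / (1 - a1) + 2 / (1 - \<kappa>)) * T powr (1 - a1 - \<kappa>)))"
      using K(1) C20 a1 \<kappa> t by (intro add_left_mono ennreal_leI mult_left_mono powr_mono2) auto
    also have "\<dots> = ennreal Cb" unfolding Cb_def using H0 M0 K(1) C20 a1 \<kappa> by (subst ennreal_plus) auto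
    also have "\<dots> \<le> ennreal (Ca + Cb)" using pos by (intro ennreal_leI) simp
    finally show "two_param_norm \<beta> (incr (v t)) \<le> ennreal (Ca + Cb)" .
    fix x :: real assume x: "x \<in> {0..2*pi}"
    have fx: "set_integrable lebesgue {0..t} (\<lambda>s. drift f g (fst (\<Psi> s)) (snd (\<Psi> s)) (v s) (t - s) x)"
      "v t x = heat_semigroup t h x + (LINT s:{0..t}|lebesgue. drift f g (fst (\<Psi> s)) (snd (\<Psi> s)) (v s) (t - s) x)"
      using sf t x by (auto simp: duhamel_solution_def)
    have "ennreal (norm (LINT s:{0..t}|lebesgue. drift f g (fst (\<Psi> s)) (snd (\<Psi> s)) (v s) (t - s) x)) \<le>
      (\<integral>\<^sup>+s\<in>{0..t}. ennreal (K * (t - s) powr - a0) * N s \<partial>lborel)"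
    proof (rule set_lint_norm_bound[OF fx(1)], use K(2)[OF t] in eventually_elim)
      case (elim s)
      show ?case
      proof
        assume "s \<in> {0..<t}"
        with elim obtain e where e: "e \<ge> 0" "ennreal e \<le> N s"
          "norm (drift f g (fst (\<Psi> s)) (snd (\<Psi> s)) (v s) (t - s) x) \<le> K * e * (t - s) powr - a0" using x unfolding N_def by blast
        have "ennreal (norm (drift f g (fst (\<Psi> s)) (snd (\<Psi> s)) (v s) (t - s) x)) \<le> ennreal (K * (t - s) powr - a0) * ennreal e"
          using e K(1) by (subst ennreal_mult[symmetric]) (auto intro!: ennreal_leI simp: mult_ac)
        also have "\<dots> \<le> ennreal (K * (t - s) powr - a0) * N s" using e by (intro mult_left_mono) auto
        finally show "ennreal (norm (drift f g (fst (\<Psi> s)) (snd (\<Psi> s)) (v s) (t - s) x)) \<le> ennreal (K * (t - s) powr - a0) * N s" .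
      qed
    qed
    also have "\<dots> \<le> ennreal (Ca * t powr ((\<alpha> + \<beta>) / 2))"
      using int[OF K(1) a0 t] unfolding e0 Ca_def by (simp add: mult.assoc)
    finally have "norm (LINT s:{0..t}|lebesgue. drift f g (fst (\<Psi> s)) (snd (\<Psi> s)) (v s) (t - s) x) \<le> Ca * t powr ((\<alpha> + \<beta>) / 2)"
      using pos by (subst (asm) ennreal_le_iff) auto
    also have "\<dots> \<le> (Ca + Cb) * t powr ((\<alpha> + \<beta>) / 2)" using pos by (intro mult_right_mono) auto
    finally show "norm (v t x - heat_semigroup t h x) \<le> (Ca + Cb) * t powr ((\<alpha> + \<beta>) / 2)" using fx(2) by simp
  qed
qed

text \<open>The mild equation only holds for positive times, so the initial value is reached in the limit.\<close>

lemma initial_difference: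
  fixes v v' :: "real \<Rightarrow> 'n::finite path"
  assumes T: "T > 0" "T \<le> T1" and \<beta>: "0 < \<beta>" "\<beta> < 1" and e: "e > 0" and C: "C \<ge> 0"
    and cv: "\<And>x. x \<in> {0..2*pi} \<Longrightarrow> continuous_on {0..T} (\<lambda>t. v t x)" "\<And>x. x \<in> {0..2*pi} \<Longrightarrow> continuous_on {0..T} (\<lambda>t. v' t x)"
    and near: "\<And>t x. t \<in> {0<..T} \<Longrightarrow> x \<in> {0..2*pi} \<Longrightarrow> norm (v t x - heat_semigroup t h x) \<le> C * t powr e"
      "\<And>t x. t \<in> {0<..T} \<Longrightarrow> x \<in> {0..2*pi} \<Longrightarrow> norm (v' t x - heat_semigroup t h' x) \<le> C * t powr e"
    and ch: "continuous_on {0..2*pi} h" "continuous_on {0..2*pi} h'" and hp: "h (2 * pi) = h 0" "h' (2 * pi) = h' 0"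
    and hh: "hoelder_norm \<beta> (\<lambda>x. h x - h' x) \<le> ennreal \<eta>" and \<eta>: "\<eta> \<ge> 0"
  shows "sup_norm (\<lambda>x. v 0 x - v' 0 x) \<le> ennreal (96 * kernel_const T1 * \<eta>)"
    "two_param_norm \<beta> (incr (\<lambda>x. v 0 x - v' 0 x)) \<le> ennreal (96 * kernel_const T1 * \<eta>)"
proof -
  have H0: "kernel_const T1 \<ge> 0" using kernel_const_pos[of T1] T by simp
  define w where "w t x = v t x - v' t x" for t x
  define S where "S t = heat_semigroup t (\<lambda>y. h y - h' y)" for t
  have hb: "norm (h x - h' x) \<le> \<eta>" "norm ((h x - h' x) - (h y - h' y)) \<le> \<eta> * \<bar>x - y\<bar> powr \<beta>"
    if "x \<in> {0..2*pi}" "y \<in> {0..2*pi}" for x y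
    using hoelder_norm_bounds[OF hh \<eta>] that by auto
  have per: "h (2 * pi) - h' (2 * pi) = h 0 - h' 0" using hp by simp
  \<comment> \<open>These remainders are not small with \<eta>, but they vanish as \<open>t\<close>
    tends to 0; the factor \<eta> is carried by \<open>S\<close>, the difference of the free
    evolutions.\<close>
  have wS: "norm (w t x - S t x) \<le> 2 * C * t powr e" if t: "t \<in> {0<..T}" and x: "x \<in> {0..2*pi}" for t x
  proof -
    have t0: "t > 0" using t by simp
    have eq: "w t x - S t x = (v t x - heat_semigroup t h x) - (v' t x - heat_semigroup t h' x)"
      unfolding w_def S_def heat_semigroup_diff[OF t0 ch, symmetric] by simp
    show ?thesis unfolding eq using near[OF t x] norm_triangle_ineq4[of "v t x - heat_semigroup t h x" "v' t x - heat_semigroup t h' x"] by simp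
  qed
  have nb: "at 0 within {0<..T} \<noteq> bot"
    using T by (simp add: trivial_limit_within islimpt_greaterThanLessThan1 islimpt_in_closure at_within_eq_bot_iff)
  have lw: "((\<lambda>t. w t x) \<longlongrightarrow> w 0 x) (at 0 within {0<..T})" if x: "x \<in> {0..2*pi}" for x
  proof -
    have "continuous_on {0..T} (\<lambda>t. w t x)" unfolding w_def by (intro continuous_intros cv x)
    then have "((\<lambda>t. w t x) \<longlongrightarrow> w 0 x) (at 0 within {0..T})" using T by (simp add: continuous_on_def)
    then show ?thesis by (rule tendsto_within_subset) auto
  qed
  have lp: "((\<lambda>t. c * t powr e) \<longlongrightarrow> 0) (at 0 within {0<..T})" for c
    using e by (intro tendsto_mult_right_zero tendsto_zero_powrI[where b=e]) (auto intro!: tendsto_eq_intros simp: eventually_at_filter)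
  have ev: "\<forall>\<^sub>F t in at 0 within {0<..T}. t \<in> {0<..T}" by (simp add: eventually_at_filter)
  have b1: "norm (w 0 x) \<le> 96 * kernel_const T1 * \<eta>" if x: "x \<in> {0..2*pi}" for x
  proof -
    have "((\<lambda>t. 12 * kernel_const T1 * \<eta> + 2 * C * t powr e) \<longlongrightarrow> 12 * kernel_const T1 * \<eta> + 0) (at 0 within {0<..T})"
      by (intro tendsto_add tendsto_const lp)
    moreover have "\<forall>\<^sub>F t in at 0 within {0<..T}. norm (w t x) \<le> 12 * kernel_const T1 * \<eta> + 2 * C * t powr e"
      using ev
    proof eventually_elim
      case (elim t)
      have t: "0 < t" "t \<le> T1" using elim T by auto
      have "norm (S t x) \<le> 12 * kernel_const T1 * \<eta>" unfolding S_def
        using hb(1) by (intro heat_semigroup_bounds(1)[OF t _ _ x] continuous_intros ch) auto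
      then show ?case using wS[OF elim x] norm_triangle_ineq[of "S t x" "w t x - S t x"] by simp
    qed
    ultimately have "norm (w 0 x) \<le> 12 * kernel_const T1 * \<eta> + 0"
      by (rule tendsto_le[OF nb _ tendsto_norm[OF lw[OF x]]])
    also have "\<dots> \<le> 96 * kernel_const T1 * \<eta>" using H0 \<eta> by (simp add: mult_right_mono)
    finally show ?thesis .
  qed
  have b2: "norm (w 0 x - w 0 y) \<le> 96 * kernel_const T1 * \<eta> * \<bar>x - y\<bar> powr \<beta>" if x: "x \<in> {0..2*pi}" and y: "y \<in> {0..2*pi}" for x y
  proof -
    have "((\<lambda>t. 96 * kernel_const T1 * \<eta> * \<bar>x - y\<bar> powr \<beta> + 4 * C * t powr e) \<longlongrightarrow> 96 * kernel_const T1 * \<eta> * \<bar>x - y\<bar> powr \<beta> + 0) (at 0 within {0<..T})"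
      by (intro tendsto_add tendsto_const lp)
    moreover have "\<forall>\<^sub>F t in at 0 within {0<..T}. norm (w t x - w t y) \<le> 96 * kernel_const T1 * \<eta> * \<bar>x - y\<bar> powr \<beta> + 4 * C * t powr e"
      using ev
    proof eventually_elim
      case (elim t)
      have t: "0 < t" "t \<le> T1" using elim T by auto
      have "norm (S t x - S t y) \<le> 96 * kernel_const T1 * \<eta> * \<bar>x - y\<bar> powr \<beta>" unfolding S_def
        by (rule heat_semigroup_hoelder_bounds(2)[OF t \<beta> \<eta> per hb(2) x y])
      moreover have eq: "w t x - w t y = (S t x - S t y) + ((w t x - S t x) - (w t y - S t y))" by simp
      ultimately show ?case unfolding eq using wS[OF elim x] wS[OF elim y] norm_triangle_ineq[of "S t x - S t y" "(w t x - S t x) - (w t y - S t y)"]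
          norm_triangle_ineq4[of "w t x - S t x" "w t y - S t y"] by linarith
    qed
    ultimately have "norm (w 0 x - w 0 y) \<le> 96 * kernel_const T1 * \<eta> * \<bar>x - y\<bar> powr \<beta> + 0"
      by (rule tendsto_le[OF nb _ tendsto_norm[OF tendsto_diff[OF lw[OF x] lw[OF y]]]])
    then show ?thesis by simp
  qed
  show "sup_norm (\<lambda>x. v 0 x - v' 0 x) \<le> ennreal (96 * kernel_const T1 * \<eta>)"
    using b1 H0 \<eta> by (subst sup_norm_le_iff) (auto simp: w_def)
  show "two_param_norm \<beta> (incr (\<lambda>x. v 0 x - v' 0 x)) \<le> ennreal (96 * kernel_const T1 * \<eta>)"
    using b2 H0 \<eta> by (subst two_param_norm_le_iff) (auto simp: w_def incr_def norm_minus_commute)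
qed

lemma time_continuous_subset:
  assumes "time_continuous J S d F" "J' \<subseteq> J"
  shows "time_continuous J' S d F"
  using assms unfolding time_continuous_def by (meson subsetD tendsto_within_subset)

lemma C_space_sup_norm_finite:
  fixes w :: "real \<Rightarrow> 'a::real_normed_vector"
  assumes "w \<in> C_space"
  shows "sup_norm w < \<infinity>"
proof -
  have "continuous_on {0..2*pi} w" using assms continuous_on_subset by (auto simp: C_space_def)
  then have "bounded (w ` {0..2*pi})" by (intro compact_imp_bounded compact_continuous_image) auto
  then obtain B where "B > 0" "\<forall>x\<in>{0..2*pi}. norm (w x) \<le> B" by (auto simp: bounded_pos)
  then have "sup_norm w \<le> ennreal B" by (simp add: sup_norm_le_iff)
  then show ?thesis using order.strict_trans1 by fastforce
qed

text \<open>Each of the four norms is dominated by a distance for which the path is continuous, so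
  \<open>time_continuous_bounded\<close> applies to them one by one.\<close>

lemma driver_bounds:
  assumes \<Psi>: "\<Psi> \<in> drivers \<alpha> \<beta>"
    and v: "time_continuous {0..T} C_space (\<lambda>w w'. sup_norm (\<lambda>x. w x - w' x)) v"
  shows "\<exists>M\<ge>0. data_bounded \<alpha> M T \<Psi> v \<and> (\<forall>t\<in>{0..T}. hoelder_norm \<beta> (fst (\<Psi> t)) \<le> ennreal M)"
proof -
  have tc: "time_continuous {0..T} (rough_paths \<alpha>) (rough_dist \<alpha>) \<Psi>"
    "time_continuous {0..T} (hoelder_space \<beta>) (\<lambda>w w'. hoelder_norm \<beta> (\<lambda>x. w x - w' x)) (\<lambda>t. fst (\<Psi> t))"
    using \<Psi> by (auto simp: drivers_def intro: time_continuous_subset)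
  have ht: "hoelder_norm c w \<le> hoelder_norm c (\<lambda>x. w x - w' x) + hoelder_norm c w'" for c and w w' :: "real \<Rightarrow> real ^ 'a"
    using hoelder_norm_triangle[of c "\<lambda>x. w x - w' x" w'] by simp
  obtain M1 where M1: "M1 \<ge> 0" "\<And>t. t \<in> {0..T} \<Longrightarrow> hoelder_norm \<alpha> (fst (\<Psi> t)) \<le> ennreal M1"
  proof -
    have "\<exists>B\<ge>0. \<forall>t\<in>{0..T}. hoelder_norm \<alpha> (fst (\<Psi> t)) \<le> ennreal B"
    proof (rule time_continuous_bounded[OF tc(1), where p="\<lambda>F. hoelder_norm \<alpha> (fst F)"])
      fix s t
      have "hoelder_norm \<alpha> (fst (\<Psi> s)) \<le> hoelder_norm \<alpha> (\<lambda>x. fst (\<Psi> s) x - fst (\<Psi> t) x) + hoelder_norm \<alpha> (fst (\<Psi> t))" by (rule ht)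
      also have "\<dots> \<le> rough_dist \<alpha> (\<Psi> s) (\<Psi> t) + hoelder_norm \<alpha> (fst (\<Psi> t))" unfolding rough_dist_def by (intro add_right_mono) simp
      finally show "hoelder_norm \<alpha> (fst (\<Psi> s)) \<le> rough_dist \<alpha> (\<Psi> s) (\<Psi> t) + hoelder_norm \<alpha> (fst (\<Psi> t))" .
    qed (auto simp: rough_paths_def hoelder_space_def)
    then show ?thesis using that by blast
  qed
  obtain M2 where M2: "M2 \<ge> 0" "\<And>t. t \<in> {0..T} \<Longrightarrow> two_param_norm (2 * \<alpha>) (snd (\<Psi> t)) \<le> ennreal M2"
  proof -
    have "\<exists>B\<ge>0. \<forall>t\<in>{0..T}. two_param_norm (2 * \<alpha>) (snd (\<Psi> t)) \<le> ennreal B"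
    proof (rule time_continuous_bounded[OF tc(1), where p="\<lambda>F. two_param_norm (2 * \<alpha>) (snd F)"])
      fix s t
      have "two_param_norm (2 * \<alpha>) (snd (\<Psi> s)) \<le> two_param_norm (2 * \<alpha>) (\<lambda>x y. snd (\<Psi> s) x y - snd (\<Psi> t) x y) + two_param_norm (2 * \<alpha>) (snd (\<Psi> t))"
        using two_param_norm_triangle[of "2 * \<alpha>" "\<lambda>x y. snd (\<Psi> s) x y - snd (\<Psi> t) x y" "snd (\<Psi> t)"] by simp
      also have "\<dots> \<le> rough_dist \<alpha> (\<Psi> s) (\<Psi> t) + two_param_norm (2 * \<alpha>) (snd (\<Psi> t))" unfolding rough_dist_def by (intro add_right_mono) simp
      finally show "two_param_norm (2 * \<alpha>) (snd (\<Psi> s)) \<le> rough_dist \<alpha> (\<Psi> s) (\<Psi> t) + two_param_norm (2 * \<alpha>) (snd (\<Psi> t))" .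
    qed (auto simp: rough_paths_def)
    then show ?thesis using that by blast
  qed
  obtain M3 where M3: "M3 \<ge> 0" "\<And>t. t \<in> {0..T} \<Longrightarrow> sup_norm (v t) \<le> ennreal M3"
  proof -
    have "sup_norm (v s) \<le> sup_norm (\<lambda>x. v s x - v t x) + sup_norm (v t)" for s t
      using sup_norm_triangle[of "\<lambda>x. v s x - v t x" "v t"] by simp
    then have "\<exists>B\<ge>0. \<forall>t\<in>{0..T}. sup_norm (v t) \<le> ennreal B"
      using C_space_sup_norm_finite by (intro time_continuous_bounded[OF v, where p=sup_norm]) auto
    then show ?thesis using that by blast
  qed
  obtain M4 where M4: "M4 \<ge> 0" "\<And>t. t \<in> {0..T} \<Longrightarrow> hoelder_norm \<beta> (fst (\<Psi> t)) \<le> ennreal M4"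
  proof -
    have "\<exists>B\<ge>0. \<forall>t\<in>{0..T}. hoelder_norm \<beta> (fst (\<Psi> t)) \<le> ennreal B"
      by (rule time_continuous_bounded[OF tc(2), where p="hoelder_norm \<beta>"]) (auto simp: hoelder_space_def intro: ht)
    then show ?thesis using that by blast
  qed
  let ?M = "M1 + M2 + M3 + M4"
  have le: "ennreal M1 \<le> ennreal ?M" "ennreal M2 \<le> ennreal ?M" "ennreal M3 \<le> ennreal ?M" "ennreal M4 \<le> ennreal ?M"
    using M1(1) M2(1) M3(1) M4(1) by (auto intro!: ennreal_leI)
  show ?thesis
  proof (intro exI[of _ ?M] conjI)
    show "0 \<le> ?M" using M1(1) M2(1) M3(1) M4(1) by simp
    show "data_bounded \<alpha> ?M T \<Psi> v" unfolding data_bounded_def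
      using tc(1) order_trans[OF M1(2) le(1)] order_trans[OF M2(2) le(2)] order_trans[OF M3(2) le(3)]
      by (auto simp: time_continuous_def)
    show "\<forall>t\<in>{0..T}. hoelder_norm \<beta> (fst (\<Psi> t)) \<le> ennreal ?M" using order_trans[OF M4(2) le(4)] by blast
  qed
qed

text \<open>The constant is 7 + 1: distances in the interval are at most 7, which bounds the surplus
  power \<open>\<beta> - \<alpha>\<close>, and the sup norm is unchanged.\<close>

lemma hoelder_norm_exponent_le:
  fixes w :: "real \<Rightarrow> 'a::real_normed_vector"
  assumes \<alpha>: "0 < \<alpha>" "\<alpha> \<le> \<beta>" "\<beta> < 1" and w: "hoelder_norm \<beta> w \<le> ennreal \<delta>" and \<delta>: "\<delta> \<ge> 0"
  shows "hoelder_norm \<alpha> w \<le> ennreal (8 * \<delta>)"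
proof -
  have "norm (w y - w x) \<le> 7 * \<delta> * \<bar>y - x\<bar> powr \<alpha>" if xy: "x \<in> {0..2*pi}" "y \<in> {0..2*pi}" for x y
  proof -
    let ?l = "\<bar>y - x\<bar>"
    have l: "0 \<le> ?l" "?l \<le> 7" using xy pi_less_4 pi_approx by auto
    have "?l powr (\<beta> - \<alpha>) \<le> 7 powr (\<beta> - \<alpha>)" using \<alpha> l by (intro powr_mono2) auto
    also have "\<dots> \<le> 7 powr 1" using \<alpha> by (intro powr_mono) auto
    finally have "?l powr (\<beta> - \<alpha>) * ?l powr \<alpha> \<le> 7 * ?l powr \<alpha>" by (intro mult_right_mono) auto
    then have "?l powr \<beta> \<le> 7 * ?l powr \<alpha>" by (simp add: powr_add[symmetric])
    then have "\<delta> * ?l powr \<beta> \<le> \<delta> * (7 * ?l powr \<alpha>)" using \<delta> by (rule mult_left_mono)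
    then show ?thesis using hoelder_norm_bounds(2)[OF w \<delta> xy] by (simp add: mult_ac)
  qed
  then have "hoelder_norm \<alpha> w \<le> ennreal (7 * \<delta> + \<delta>)"
    using \<delta> hoelder_norm_bounds(1)[OF w \<delta>] by (intro hoelder_norm_leI) auto
  then show ?thesis by simp
qed

lemma hoelder_norm_uminus: "hoelder_norm \<gamma> (\<lambda>x. - w x) = hoelder_norm \<gamma> w"
proof -
  have "incr (\<lambda>x. - w x) = (\<lambda>x y. - incr w x y)" by (simp add: incr_def fun_eq_iff)
  then show ?thesis by (simp add: hoelder_norm_def two_param_norm_uminus sup_norm_def)
qed

lemma hoelder_norm_diff: "hoelder_norm \<gamma> (\<lambda>x. w x - z x) \<le> hoelder_norm \<gamma> w + hoelder_norm \<gamma> z"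
  using hoelder_norm_triangle[of \<gamma> w "\<lambda>x. - z x"] by (simp add: hoelder_norm_uminus)

lemma sup_norm_uminus: "sup_norm (\<lambda>x. - w x) = sup_norm w"
  by (simp add: sup_norm_def)

lemma sup_norm_diff: "sup_norm (\<lambda>x. w x - z x) \<le> sup_norm w + sup_norm z"
  using sup_norm_triangle[of w "\<lambda>x. - z x"] by (simp add: sup_norm_uminus)

lemma hoelder_space_continuous_periodic:
  assumes "w \<in> hoelder_space \<gamma>" "\<gamma> > 0"
  shows "continuous_on {0..2*pi} w" "w (2 * pi) = w 0"
proof -
  have fin: "hoelder_norm \<gamma> w < \<infinity>" and per: "periodic w" using assms by (auto simp: hoelder_space_def)
  show "w (2 * pi) = w 0" using per[unfolded periodic_def, rule_format, of 0] by simp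
  obtain K where K: "K \<ge> 0" "hoelder_norm \<gamma> w \<le> ennreal K" using fin by (cases "hoelder_norm \<gamma> w") auto
  show "continuous_on {0..2*pi} w"
    by (rule hoelder_continuous_on[OF assms(2), of _ _ K]) (use hoelder_norm_bounds(2)[OF K(2,1)] in auto)
qed

lemma data_bounded_mono: "data_bounded \<alpha> M T \<Psi> v \<Longrightarrow> M \<le> M' \<Longrightarrow> T' \<le> T \<Longrightarrow> data_bounded \<alpha> M' T' \<Psi> v"
  unfolding data_bounded_def by (auto intro: order_trans[OF _ ennreal_leI])

text \<open>The intermediate value argument of \<open>bootstrap_bound\<close> works with real
  functions; finiteness makes the passage between \<open>ennreal\<close> and the reals
  harmless.\<close>

lemma sup_norm_time_continuous:
  fixes v v' :: "real \<Rightarrow> real \<Rightarrow> 'a::real_normed_vector"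
  assumes v: "time_continuous {0..T} C_space (\<lambda>w w'. sup_norm (\<lambda>x. w x - w' x)) v"
    and v': "time_continuous {0..T} C_space (\<lambda>w w'. sup_norm (\<lambda>x. w x - w' x)) v'"
  shows "continuous_on {0..T} (\<lambda>t. enn2real (sup_norm (\<lambda>x. v t x - v' t x)))"
    "\<And>t. t \<in> {0..T} \<Longrightarrow> sup_norm (\<lambda>x. v t x - v' t x) < \<infinity>"
proof -
  let ?w = "\<lambda>t x. v t x - v' t x"
  have vC: "v t \<in> C_space" "v' t \<in> C_space" if "t \<in> {0..T}" for t using v v' that by (auto simp: time_continuous_def)
  show fin: "sup_norm (?w t) < \<infinity>" if "t \<in> {0..T}" for t
    using sup_norm_diff[of "v t" "v' t"] C_space_sup_norm_finite[OF vC(1)[OF that]] C_space_sup_norm_finite[OF vC(2)[OF that]]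
    by (metis ennreal_add_less_top infinity_ennreal_def order.strict_trans1)
  show "continuous_on {0..T} (\<lambda>t. enn2real (sup_norm (?w t)))"
    unfolding continuous_on_def
  proof
    fix t assume t: "t \<in> {0..T}"
    define e where "e s = sup_norm (\<lambda>x. v s x - v t x) + sup_norm (\<lambda>x. v' s x - v' t x)" for s
    have "(e \<longlongrightarrow> 0 + 0) (at t within {0..T})" unfolding e_def
      using v v' t by (intro tendsto_add) (auto simp: time_continuous_def)
    then have e0: "(e \<longlongrightarrow> ennreal 0) (at t within {0..T})" by simp
    have lim: "((\<lambda>s. enn2real (e s)) \<longlongrightarrow> 0) (at t within {0..T})"
      using tendsto_enn2real[OF e0] by simp
    have ws: "sup_norm (\<lambda>x. ?w s x - ?w t x) \<le> e s" for s
    proof -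
      have "(\<lambda>x. ?w s x - ?w t x) = (\<lambda>x. (v s x - v t x) - (v' s x - v' t x))" by (auto simp: fun_eq_iff)
      then show ?thesis unfolding e_def using sup_norm_diff[of "\<lambda>x. v s x - v t x" "\<lambda>x. v' s x - v' t x"] by simp
    qed
    have efin: "e s < \<infinity>" if s: "s \<in> {0..T}" for s
    proof -
      have "sup_norm (\<lambda>x. v s x - v t x) < \<infinity>" "sup_norm (\<lambda>x. v' s x - v' t x) < \<infinity>"
        using sup_norm_diff[of "v s" "v t"] sup_norm_diff[of "v' s" "v' t"] C_space_sup_norm_finite[OF vC(1)[OF s]] C_space_sup_norm_finite[OF vC(1)[OF t]]
          C_space_sup_norm_finite[OF vC(2)[OF s]] C_space_sup_norm_finite[OF vC(2)[OF t]]
        by (metis ennreal_add_less_top infinity_ennreal_def order.strict_trans1)+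
      then show ?thesis unfolding e_def by simp
    qed
    have "\<bar>enn2real (sup_norm (?w s)) - enn2real (sup_norm (?w t))\<bar> \<le> enn2real (e s)" if s: "s \<in> {0..T}" for s
    proof -
      have "sup_norm (?w s) \<le> e s + sup_norm (?w t)"
        using sup_norm_triangle[of "\<lambda>x. ?w s x - ?w t x" "?w t"] add_right_mono[OF ws[of s]] by (simp, meson order_trans)
      moreover have "sup_norm (?w t) \<le> e s + sup_norm (?w s)"
      proof -
        have "sup_norm (?w t) \<le> sup_norm (\<lambda>x. - (?w s x - ?w t x)) + sup_norm (?w s)"
          using sup_norm_triangle[of "\<lambda>x. - (?w s x - ?w t x)" "?w s"] by simp
        also have "\<dots> \<le> e s + sup_norm (?w s)" unfolding sup_norm_uminus by (rule add_right_mono[OF ws])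
        finally show ?thesis .
      qed
      moreover obtain a b c where "a \<ge> 0" "b \<ge> 0" "c \<ge> 0" "sup_norm (?w s) = ennreal a" "sup_norm (?w t) = ennreal b" "e s = ennreal c"
        using fin[OF s] fin[OF t] efin[OF s] by (cases "sup_norm (?w s)"; cases "sup_norm (?w t)"; cases "e s") auto
      ultimately show ?thesis by (simp add: ennreal_plus[symmetric] ennreal_le_iff del: ennreal_plus)
    qed
    then have "\<forall>\<^sub>F s in at t within {0..T}. norm (enn2real (sup_norm (?w s)) - enn2real (sup_norm (?w t))) \<le> enn2real (e s)"
      by (simp add: eventually_at_filter)
    from Lim_null_comparison[OF this lim]
    show "((\<lambda>t. enn2real (sup_norm (?w t))) \<longlongrightarrow> enn2real (sup_norm (?w t))) (at t within {0..T})"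
      by (rule LIM_zero_cancel)
  qed
qed

theorem corollary3p11:
  fixes f :: "real ^ 'n \<Rightarrow> real ^ 'n::finite"
    and g :: "real ^ 'n \<Rightarrow> real ^ 'n ^ 'n"
    and \<alpha> \<beta> T \<epsilon> :: real
    and u0 :: "real \<Rightarrow> real ^ 'n"
    and \<Psi> :: "real \<Rightarrow> (real \<Rightarrow> real ^ 'n) \<times> (real \<Rightarrow> real \<Rightarrow> real ^ 'n ^ 'n)"
    and u :: "real \<Rightarrow> real \<Rightarrow> real ^ 'n"
    and \<tau> :: ereal
  assumes "smooth f" and "smooth g"
    and "1 / 3 < \<alpha>" and "\<alpha> < \<beta>" and "\<beta> < 1 / 2"
    and "u0 \<in> hoelder_space \<beta>" and "\<Psi> \<in> drivers \<alpha> \<beta>"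
    and "local_solution f g \<alpha> \<beta> u0 \<Psi> u \<tau>"
    and "0 \<le> T" and "ereal T < \<tau>" and "\<epsilon> > 0"
  shows "\<exists>\<delta>>0. \<forall>u0' \<Psi>' u' \<tau>'.
    u0' \<in> hoelder_space \<beta> \<longrightarrow> \<Psi>' \<in> drivers \<alpha> \<beta> \<longrightarrow>
    local_solution f g \<alpha> \<beta> u0' \<Psi>' u' \<tau>' \<longrightarrow>
    hoelder_norm \<beta> (\<lambda>x. u0 x - u0' x)
      + (SUP t\<in>{0..T}. hoelder_norm \<beta> (\<lambda>x. fst (\<Psi> t) x - fst (\<Psi>' t) x))
      + (SUP t\<in>{0..T}. two_param_norm (2 * \<alpha>) (\<lambda>x y. snd (\<Psi> t) x y - snd (\<Psi>' t) x y))
      \<le> ennreal \<delta> \<longrightarrow>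
    ereal T \<le> \<tau>' \<and> (SUP t\<in>{0..T}. hoelder_norm \<beta> (\<lambda>x. u t x - u' t x)) \<le> ennreal \<epsilon>"
proof -
  note f = assms(1) and g = assms(2) and \<alpha> = assms(3-5) and T0 = assms(9) and \<epsilon> = assms(11)
  have \<beta>: "0 < \<beta>" "\<beta> < 1" and \<alpha>0: "0 < \<alpha>" and e: "(\<alpha> + \<beta>) / 2 > 0" using \<alpha> by auto
  \<comment> \<open>A slightly longer interval on which \<open>u\<close> still exists. It has
    positive length even for \<open>T = 0\<close>, whereas mild solutions are only given on
    intervals of positive length.\<close>
  obtain T1 where T1: "T < T1" "ereal T1 < \<tau>" using ereal_dense2[OF assms(10)] by auto
  then have T1p: "0 < T1" "0 \<le> T1" using T0 by auto
  have m: "mild_solution f g \<alpha> u0 \<Psi> T1 u" using assms(8) T1 T1p by (simp add: local_solution_def)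
  define v where "v t x = u t x - fst (\<Psi> t) x" for t x
  define h where "h y = u0 y - fst (\<Psi> 0) y" for y
  have sf: "duhamel_solution f g h \<Psi> T1 v" using mild_solution_duhamel[OF m T1p(2)] by (simp add: v_def[abs_def] h_def[abs_def])
  have tcv: "time_continuous {0..T1} C_space (\<lambda>w w'. sup_norm (\<lambda>x. w x - w' x)) v"
    using mild_solution_facts(1)[OF m T1p(2)] by (simp add: v_def[abs_def])
  obtain M0 where M0: "M0 \<ge> 0" "data_bounded \<alpha> M0 T1 \<Psi> v" "\<And>t. t \<in> {0..T1} \<Longrightarrow> hoelder_norm \<beta> (fst (\<Psi> t)) \<le> ennreal M0"
    using driver_bounds[OF assms(7) tcv] by blast
  have \<Psi>H: "fst (\<Phi> t) \<in> hoelder_space \<beta>" if "\<Phi> \<in> drivers \<alpha> \<beta>" "t \<ge> 0" for \<Phi> :: "real \<Rightarrow> 'n path \<times> 'n area" and t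
    using that by (auto simp: drivers_def time_continuous_def)
  have \<Psi>R: "\<Phi> t \<in> rough_paths \<alpha>" if "\<Phi> \<in> drivers \<alpha> \<beta>" "t \<ge> 0" for \<Phi> :: "real \<Rightarrow> 'n path \<times> 'n area" and t
    using that by (auto simp: drivers_def time_continuous_def)
  have fin_bound: "\<exists>U\<ge>0. hoelder_norm \<beta> w \<le> ennreal U" if "w \<in> hoelder_space \<beta>" for w :: "'n path"
    using that unfolding hoelder_space_def by (cases "hoelder_norm \<beta> w") auto
  obtain U where U: "U \<ge> 0" "hoelder_norm \<beta> u0 \<le> ennreal U" using fin_bound[OF assms(6)] by blast
  have hfacts: "continuous_on {0..2*pi} (\<lambda>y. w y - fst (\<Phi> 0) y)" "w (2 * pi) - fst (\<Phi> 0) (2 * pi) = w 0 - fst (\<Phi> 0) 0"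
    if "w \<in> hoelder_space \<beta>" "\<Phi> \<in> drivers \<alpha> \<beta>" for w :: "'n path" and \<Phi> :: "real \<Rightarrow> 'n path \<times> 'n area"
    using hoelder_space_continuous_periodic[OF that(1) \<beta>(1)] hoelder_space_continuous_periodic[OF \<Psi>H[OF that(2) order_refl] \<beta>(1)]
    by (auto intro: continuous_intros)
  note hf = hfacts[OF assms(6,7), folded h_def]
  \<comment> \<open>The summand 1 leaves room for the perturbed data: as long as they differ by at
    most 1 they obey \<open>data_bounded\<close> with the same \<open>M\<close>, so that
    \<open>C\<close> can be fixed before the perturbation is chosen.\<close>
  define M where "M = U + M0 + 1"
  have M: "M \<ge> 1" "M \<ge> 0" "M0 \<le> M" "M0 + 1 \<le> M" using U M0 by (auto simp: M_def)
  have hM: "hoelder_norm \<beta> h \<le> ennreal M"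
  proof -
    have "hoelder_norm \<beta> h \<le> hoelder_norm \<beta> u0 + hoelder_norm \<beta> (fst (\<Psi> 0))" unfolding h_def by (rule hoelder_norm_diff)
    also have "\<dots> \<le> ennreal U + ennreal M0" using U(2) M0(3)[of 0] T1p by (intro add_mono) auto
    also have "\<dots> \<le> ennreal M" using U M0(1) by (simp add: M_def ennreal_plus[symmetric] ennreal_leI del: ennreal_plus)
    finally show ?thesis .
  qed
  have gd: "data_bounded \<alpha> M T1 \<Psi> v" by (rule data_bounded_mono[OF M0(2) M(3) order_refl])
  obtain C1 where C1: "C1 \<ge> 0" "AE t in lborel. t \<in> {0..T1} \<longrightarrow> two_param_norm 1 (incr (v t)) \<le> ennreal (C1 * t powr - ((1 - \<beta>) / 2))"
    using solution_lipschitz_decay[OF f g \<alpha> M(2) T1p(1) sf gd hM hf(2)] by blast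
  obtain Cs where Cs: "Cs \<ge> 0" "\<And>t. t \<in> {0<..T1} \<Longrightarrow> two_param_norm \<beta> (incr (v t)) \<le> ennreal Cs"
    using solution_bounds[OF f g \<alpha> M(2) T1p(1) sf gd hM hf(2)] by blast
  obtain C where C: "C \<ge> 0" "\<And>\<Psi> v h \<Psi>' v' h' T' \<eta>. 0 < T' \<Longrightarrow> T' \<le> T1 \<Longrightarrow> 0 \<le> \<eta> \<Longrightarrow> \<eta> \<le> 1 \<Longrightarrow>
    duhamel_solution f g h \<Psi> T' v \<Longrightarrow> data_bounded \<alpha> M T' \<Psi> v \<Longrightarrow>
    duhamel_solution f g h' \<Psi>' T' v' \<Longrightarrow> data_bounded \<alpha> M T' \<Psi>' v' \<Longrightarrow>
    (AE t in lborel. t \<in> {0..T'} \<longrightarrow> two_param_norm 1 (incr (v t)) \<le> ennreal (C1 * t powr - ((1 - \<beta>) / 2))) \<Longrightarrow>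
    (\<forall>t\<in>{0..T'}. hoelder_norm \<alpha> (\<lambda>x. fst (\<Psi> t) x - fst (\<Psi>' t) x) \<le> ennreal \<eta> \<and>
        two_param_norm (2 * \<alpha>) (\<lambda>x y. snd (\<Psi> t) x y - snd (\<Psi>' t) x y) \<le> ennreal \<eta> \<and>
        sup_norm (\<lambda>x. v t x - v' t x) \<le> 1) \<Longrightarrow>
    continuous_on {0..2*pi} h \<Longrightarrow> continuous_on {0..2*pi} h' \<Longrightarrow> h (2 * pi) = h 0 \<Longrightarrow> h' (2 * pi) = h' 0 \<Longrightarrow>
    hoelder_norm \<beta> (\<lambda>x. h x - h' x) \<le> ennreal \<eta> \<Longrightarrow>
    (\<forall>t\<in>{0<..T'}. sup_norm (\<lambda>x. v t x - v' t x) \<le> ennreal (C * \<eta>) \<and>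
        two_param_norm \<beta> (incr (\<lambda>x. v t x - v' t x)) \<le> ennreal (C * \<eta>))"
    using difference_estimate[OF f g \<alpha> M(1) T1p(1) C1(1)] by blast
  \<comment> \<open>The constant of \<open>initial_difference\<close>. It covers time 0, while the
    estimate with \<open>C\<close> covers positive times.\<close>
  define Hc where "Hc = 96 * kernel_const T1"
  have Hc0: "Hc \<ge> 0" using kernel_const_pos[OF T1p(2)] by (simp add: Hc_def)
  define Cd where "Cd = C + Hc"
  have Cd0: "Cd \<ge> 0" "C \<le> Cd" "Hc \<le> Cd" using C(1) Hc0 by (auto simp: Cd_def)
  \<comment> \<open>The three bounds yield in turn \<open>\<eta> \<le> 1\<close>, then
    \<open>Cd * \<eta> \<le> 1 / 2\<close>, which lies below the threshold 1 of the continuity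
    argument, and the final error bound
    \<open>2 * (Cd * \<eta>) + \<delta> \<le> \<epsilon>\<close>.\<close>
  define \<delta> where "\<delta> = min (1 / 8) (min (1 / (16 * Cd + 16)) (\<epsilon> / (16 * Cd + 1)))"
  have \<delta>: "\<delta> > 0" using Cd0 \<epsilon> by (auto simp: \<delta>_def)
  \<comment> \<open>The factor 8 is the cost of passing from the \<beta>- to the \<alpha>-Hoelder
    norm. It also covers the two errors that add up in \<open>h - h'\<close>.\<close>
  define \<eta> where "\<eta> = 8 * \<delta>"
  have \<eta>: "0 \<le> \<eta>" "\<eta> \<le> 1" "2 * \<delta> \<le> \<eta>" "\<delta> \<le> \<eta>" using \<delta> by (auto simp: \<eta>_def \<delta>_def)
  have Cd\<eta>: "Cd * \<eta> \<le> 1 / 2"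
  proof -
    have "\<delta> \<le> 1 / (16 * Cd + 16)" by (simp add: \<delta>_def)
    then have "\<delta> * (16 * Cd + 16) \<le> 1" using Cd0 by (simp add: pos_le_divide_eq)
    then show ?thesis using \<delta> by (simp add: \<eta>_def algebra_simps)
  qed
  have \<epsilon>b: "2 * (Cd * \<eta>) + \<delta> \<le> \<epsilon>"
  proof -
    have "\<delta> \<le> \<epsilon> / (16 * Cd + 1)" by (simp add: \<delta>_def)
    then have "\<delta> * (16 * Cd + 1) \<le> \<epsilon>" using Cd0 by (simp add: pos_le_divide_eq)
    then show ?thesis by (simp add: \<eta>_def algebra_simps)
  qed
  show ?thesis
  proof (intro exI[of _ \<delta>] conjI[OF \<delta>] allI impI)
    fix u0' \<Psi>' u' \<tau>'
    assume u0': "u0' \<in> hoelder_space \<beta>" and \<Psi>': "\<Psi>' \<in> drivers \<alpha> \<beta>" and ls': "local_solution f g \<alpha> \<beta> u0' \<Psi>' u' \<tau>'"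
      and close: "hoelder_norm \<beta> (\<lambda>x. u0 x - u0' x)
      + (SUP t\<in>{0..T}. hoelder_norm \<beta> (\<lambda>x. fst (\<Psi> t) x - fst (\<Psi>' t) x))
      + (SUP t\<in>{0..T}. two_param_norm (2 * \<alpha>) (\<lambda>x y. snd (\<Psi> t) x y - snd (\<Psi>' t) x y)) \<le> ennreal \<delta>"
    have three: "a + b + c \<le> r \<Longrightarrow> a \<le> r \<and> b \<le> r \<and> c \<le> r" for a b c r :: ennreal
      by (meson add_increasing add_increasing2 order_refl order_trans zero_le)
    have c1: "hoelder_norm \<beta> (\<lambda>x. u0 x - u0' x) \<le> ennreal \<delta>"
      and c2: "\<And>t. t \<in> {0..T} \<Longrightarrow> hoelder_norm \<beta> (\<lambda>x. fst (\<Psi> t) x - fst (\<Psi>' t) x) \<le> ennreal \<delta>"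
      and c3: "\<And>t. t \<in> {0..T} \<Longrightarrow> two_param_norm (2 * \<alpha>) (\<lambda>x y. snd (\<Psi> t) x y - snd (\<Psi>' t) x y) \<le> ennreal \<delta>"
      using three[OF close] by (auto simp: SUP_le_iff)
    have c2': "hoelder_norm \<alpha> (\<lambda>x. fst (\<Psi> t) x - fst (\<Psi>' t) x) \<le> ennreal \<eta>" if "t \<in> {0..T}" for t
      unfolding \<eta>_def by (rule hoelder_norm_exponent_le[OF \<alpha>0 less_imp_le[OF \<alpha>(2)] \<beta>(2) c2[OF that]]) (use \<delta> in simp)
    have c3': "two_param_norm (2 * \<alpha>) (\<lambda>x y. snd (\<Psi> t) x y - snd (\<Psi>' t) x y) \<le> ennreal \<eta>" if "t \<in> {0..T}" for t
      using c3[OF that] \<eta>(4) by (meson ennreal_leI order_trans)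
    define v' where "v' t x = u' t x - fst (\<Psi>' t) x" for t x
    define h' where "h' y = u0' y - fst (\<Psi>' 0) y" for y
    note hf' = hfacts[OF u0' \<Psi>', folded h'_def]
    have hh: "hoelder_norm \<beta> (\<lambda>x. h x - h' x) \<le> ennreal \<eta>"
    proof -
      have "(\<lambda>x. h x - h' x) = (\<lambda>x. (u0 x - u0' x) - (fst (\<Psi> 0) x - fst (\<Psi>' 0) x))" by (auto simp: h_def h'_def fun_eq_iff)
      then have "hoelder_norm \<beta> (\<lambda>x. h x - h' x) \<le> hoelder_norm \<beta> (\<lambda>x. u0 x - u0' x) + hoelder_norm \<beta> (\<lambda>x. fst (\<Psi> 0) x - fst (\<Psi>' 0) x)"
        using hoelder_norm_diff[of \<beta> "\<lambda>x. u0 x - u0' x" "\<lambda>x. fst (\<Psi> 0) x - fst (\<Psi>' 0) x"] by simp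
      also have "\<dots> \<le> ennreal \<delta> + ennreal \<delta>" using c1 c2[of 0] T0 by (intro add_mono) auto
      also have "\<dots> \<le> ennreal \<eta>" using \<delta> \<eta>(3) by (simp add: ennreal_plus[symmetric] ennreal_leI del: ennreal_plus)
      finally show ?thesis .
    qed
    have sol': "duhamel_solution f g h' \<Psi>' s v'" "time_continuous {0..s} C_space (\<lambda>w w'. sup_norm (\<lambda>x. w x - w' x)) v'"
      if s: "0 < s" "ereal s < \<tau>'" for s
    proof -
      have m': "mild_solution f g \<alpha> u0' \<Psi>' s u'" using ls' s by (simp add: local_solution_def)
      show "duhamel_solution f g h' \<Psi>' s v'" using mild_solution_duhamel[OF m'] s by (simp add: v'_def[abs_def] h'_def[abs_def])
      show "time_continuous {0..s} C_space (\<lambda>w w'. sup_norm (\<lambda>x. w x - w' x)) v'"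
        using mild_solution_facts(1)[OF m'] s by (simp add: v'_def[abs_def])
    qed
    have \<tau>'p: "0 < \<tau>'" using ls' by (simp add: local_solution_def)
    \<comment> \<open>The bounds for the perturbed solution near time 0 may depend on that solution,
      because they only serve to take the limit; the result involves \<open>Hc\<close> and \<eta>
      alone.\<close>
    have start: "sup_norm (\<lambda>x. v 0 x - v' 0 x) \<le> ennreal (Hc * \<eta>)"
      "two_param_norm \<beta> (incr (\<lambda>x. v 0 x - v' 0 x)) \<le> ennreal (Hc * \<eta>)"
    proof -
      obtain q where q: "0 < ereal q" "ereal q < \<tau>'" using ereal_dense2[OF \<tau>'p] by auto
      define T2 where "T2 = min q T1"
      have T2: "0 < T2" "T2 \<le> T1" "ereal T2 < \<tau>'" "0 \<le> T2"
      proof -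
        show "0 < T2" "T2 \<le> T1" "0 \<le> T2" using q T1p by (auto simp: T2_def)
        have "ereal T2 \<le> ereal q" by (simp add: T2_def)
        then show "ereal T2 < \<tau>'" using q(2) by (rule order.strict_trans1)
      qed
      obtain M' where M': "M' \<ge> 0" "data_bounded \<alpha> M' T2 \<Psi>' v'" using driver_bounds[OF \<Psi>' sol'(2)[OF T2(1,3)]] by blast
      obtain U' where U': "U' \<ge> 0" "hoelder_norm \<beta> h' \<le> ennreal U'"
      proof -
        have "hoelder_norm \<beta> h' \<le> hoelder_norm \<beta> u0' + hoelder_norm \<beta> (fst (\<Psi>' 0))" unfolding h'_def by (rule hoelder_norm_diff)
        also have "\<dots> < \<infinity>" using u0' \<Psi>H[OF \<Psi>' order_refl] by (simp add: hoelder_space_def)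
        finally show ?thesis using that by (cases "hoelder_norm \<beta> h'") auto
      qed
      define M2 where "M2 = M' + U'"
      have M2: "M2 \<ge> 0" "M' \<le> M2" "U' \<le> M2" using M' U' by (auto simp: M2_def)
      have h'2: "hoelder_norm \<beta> h' \<le> ennreal M2" using U'(2) M2(3) by (meson ennreal_leI order_trans)
      obtain Ca where Ca: "Ca \<ge> 0" "\<And>t x. t \<in> {0<..T1} \<Longrightarrow> x \<in> {0..2*pi} \<Longrightarrow> norm (v t x - heat_semigroup t h x) \<le> Ca * t powr ((\<alpha> + \<beta>) / 2)"
        using solution_bounds[OF f g \<alpha> M(2) T1p(1) sf gd hM hf(2)] by blast
      obtain Cb where Cb: "Cb \<ge> 0" "\<And>t x. t \<in> {0<..T2} \<Longrightarrow> x \<in> {0..2*pi} \<Longrightarrow> norm (v' t x - heat_semigroup t h' x) \<le> Cb * t powr ((\<alpha> + \<beta>) / 2)"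
        using solution_bounds[OF f g \<alpha> M2(1) T2(1) sol'(1)[OF T2(1,3)] data_bounded_mono[OF M'(2) M2(2) order_refl] h'2 hf'(2)] by blast
      have near: "norm (v t x - heat_semigroup t h x) \<le> (Ca + Cb) * t powr ((\<alpha> + \<beta>) / 2)"
        "norm (v' t x - heat_semigroup t h' x) \<le> (Ca + Cb) * t powr ((\<alpha> + \<beta>) / 2)"
        if t: "t \<in> {0<..T2}" and x: "x \<in> {0..2*pi}" for t x
      proof -
        have t1: "t \<in> {0<..T1}" using t T2 by auto
        have le: "Ca * t powr ((\<alpha> + \<beta>) / 2) \<le> (Ca + Cb) * t powr ((\<alpha> + \<beta>) / 2)"
          "Cb * t powr ((\<alpha> + \<beta>) / 2) \<le> (Ca + Cb) * t powr ((\<alpha> + \<beta>) / 2)"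
          using Ca(1) Cb(1) by (auto intro!: mult_right_mono)
        show "norm (v t x - heat_semigroup t h x) \<le> (Ca + Cb) * t powr ((\<alpha> + \<beta>) / 2)"
          by (rule order_trans[OF Ca(2)[OF t1 x] le(1)])
        show "norm (v' t x - heat_semigroup t h' x) \<le> (Ca + Cb) * t powr ((\<alpha> + \<beta>) / 2)"
          by (rule order_trans[OF Cb(2)[OF t x] le(2)])
      qed
      have cont: "continuous_on {0..T2} (\<lambda>t. v t x)" "continuous_on {0..T2} (\<lambda>t. v' t x)" if "x \<in> {0..2*pi}" for x
        using duhamel_solution_mono[OF sf T2(4) T2(2)] sol'(1)[OF T2(1,3)] that by (auto simp: duhamel_solution_def)
      have Cab: "Ca + Cb \<ge> 0" using Ca Cb by simp
      show "sup_norm (\<lambda>x. v 0 x - v' 0 x) \<le> ennreal (Hc * \<eta>)"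
        "two_param_norm \<beta> (incr (\<lambda>x. v 0 x - v' 0 x)) \<le> ennreal (Hc * \<eta>)"
        unfolding Hc_def
        by (rule initial_difference[OF T2(1,2) \<beta> e Cab cont near hf(1) hf'(1) hf(2) hf'(2) hh \<eta>(1)]; assumption)+
    qed
    have Hc\<eta>: "ennreal (Hc * \<eta>) \<le> ennreal (Cd * \<eta>)" "ennreal (C * \<eta>) \<le> ennreal (Cd * \<eta>)"
      using Cd0 \<eta> by (auto intro!: ennreal_leI mult_right_mono)
    \<comment> \<open>\<open>T'\<close> ranges over all times up to \<open>T\<close> that precede
      the blow-up of \<open>u'\<close>. The constant does not depend on \<open>T'\<close>, so the
      estimate extends up to the blow-up time.\<close>
    have stable: "sup_norm (\<lambda>x. v t x - v' t x) \<le> ennreal (Cd * \<eta>) \<and> two_param_norm \<beta> (incr (\<lambda>x. v t x - v' t x)) \<le> ennreal (Cd * \<eta>)"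
      if T': "0 < T'" "T' \<le> T" "ereal T' < \<tau>'" and t: "t \<in> {0..T'}" for T' t
    proof -
      have T'1: "T' \<le> T1" "0 \<le> T'" using T' T1 by auto
      note sfT = duhamel_solution_mono[OF sf T'1(2,1)] and sfT' = sol'(1)[OF T'(1,3)]
      have tcT: "time_continuous {0..T'} C_space (\<lambda>w w'. sup_norm (\<lambda>x. w x - w' x)) v"
        by (rule time_continuous_subset[OF tcv]) (use T'1 in auto)
      note nc = sup_norm_time_continuous[OF tcT sol'(2)[OF T'(1,3)]]
      define n where "n t = enn2real (sup_norm (\<lambda>x. v t x - v' t x))" for t
      have n_iff: "sup_norm (\<lambda>x. v t x - v' t x) \<le> ennreal c \<longleftrightarrow> n t \<le> c" if "t \<in> {0..T'}" "c \<ge> 0" for t c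
        using nc(2)[OF that(1)] that(2) unfolding n_def
        by (cases "sup_norm (\<lambda>x. v t x - v' t x)") (auto simp: ennreal_le_iff)
      have est: "\<forall>t\<in>{0<..s}. sup_norm (\<lambda>x. v t x - v' t x) \<le> ennreal (C * \<eta>) \<and> two_param_norm \<beta> (incr (\<lambda>x. v t x - v' t x)) \<le> ennreal (C * \<eta>)"
        if s: "0 < s" "s \<le> T'" and n1: "\<And>t. t \<in> {0..s} \<Longrightarrow> n t \<le> 1" for s
      proof (rule C(2)[OF s(1) _ \<eta>(1,2) _ _ _ _ _ _ hf(1) hf'(1) hf(2) hf'(2) hh])
        show "s \<le> T1" using s T'1 by simp
        have s0: "0 \<le> s" using s by simp
        show "duhamel_solution f g h \<Psi> s v" by (rule duhamel_solution_mono[OF sfT s0 s(2)])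
        show "duhamel_solution f g h' \<Psi>' s v'" by (rule duhamel_solution_mono[OF sfT' s0 s(2)])
        show "data_bounded \<alpha> M s \<Psi> v" by (rule data_bounded_mono[OF gd order_refl]) (use s T'1 in simp)
        show "AE t in lborel. t \<in> {0..s} \<longrightarrow> two_param_norm 1 (incr (v t)) \<le> ennreal (C1 * t powr - ((1 - \<beta>) / 2))"
          using C1(2) by eventually_elim (use s T'1 in auto)
        have w1: "sup_norm (\<lambda>x. v t x - v' t x) \<le> ennreal 1" if "t \<in> {0..s}" for t
          using n1[OF that] n_iff[of t 1] that s by auto
        show "\<forall>t\<in>{0..s}. hoelder_norm \<alpha> (\<lambda>x. fst (\<Psi> t) x - fst (\<Psi>' t) x) \<le> ennreal \<eta> \<and>
          two_param_norm (2 * \<alpha>) (\<lambda>x y. snd (\<Psi> t) x y - snd (\<Psi>' t) x y) \<le> ennreal \<eta> \<and>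
          sup_norm (\<lambda>x. v t x - v' t x) \<le> 1"
          using c2' c3' w1 s T' by auto
        \<comment> \<open>Each norm of the perturbed data exceeds the bound \<open>M0\<close> for
          the reference data by at most 1.\<close>
        show "data_bounded \<alpha> M s \<Psi>' v'"
          unfolding data_bounded_def
        proof (intro ballI conjI)
          fix t assume t: "t \<in> {0..s}"
          then have tT: "t \<in> {0..T}" "t \<in> {0..T1}" using s T' T1 by auto
          have M01: "ennreal M0 + ennreal 1 \<le> ennreal M" "ennreal \<eta> \<le> ennreal 1"
            using M M0(1) \<eta> by (auto simp: ennreal_plus[symmetric] intro!: ennreal_leI simp del: ennreal_plus ennreal_1)
          have g0: "hoelder_norm \<alpha> (fst (\<Psi> t)) \<le> ennreal M0" "two_param_norm (2 * \<alpha>) (snd (\<Psi> t)) \<le> ennreal M0" "sup_norm (v t) \<le> ennreal M0"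
            using M0(2) tT by (auto simp: data_bounded_def)
          show "\<Psi>' t \<in> rough_paths \<alpha>" using \<Psi>R[OF \<Psi>'] tT by simp
          have "hoelder_norm \<alpha> (fst (\<Psi>' t)) \<le> hoelder_norm \<alpha> (fst (\<Psi> t)) + hoelder_norm \<alpha> (\<lambda>x. fst (\<Psi> t) x - fst (\<Psi>' t) x)"
            using hoelder_norm_diff[of \<alpha> "fst (\<Psi> t)" "\<lambda>x. fst (\<Psi> t) x - fst (\<Psi>' t) x"] by simp
          also have "\<dots> \<le> ennreal M0 + ennreal 1" using g0(1) c2'[OF tT(1)] M01(2) by (intro add_mono) (auto intro: order_trans)
          finally show "hoelder_norm \<alpha> (fst (\<Psi>' t)) \<le> ennreal M" using M01(1) by (rule order_trans)
          have "two_param_norm (2 * \<alpha>) (snd (\<Psi>' t)) \<le> two_param_norm (2 * \<alpha>) (snd (\<Psi> t)) + two_param_norm (2 * \<alpha>) (\<lambda>x y. - (snd (\<Psi> t) x y - snd (\<Psi>' t) x y))"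
            using two_param_norm_triangle[of "2 * \<alpha>" "snd (\<Psi> t)" "\<lambda>x y. - (snd (\<Psi> t) x y - snd (\<Psi>' t) x y)"] by simp
          also have "\<dots> \<le> ennreal M0 + ennreal 1" unfolding two_param_norm_uminus
            using g0(2) c3'[OF tT(1)] M01(2) by (intro add_mono) (auto intro: order_trans)
          finally show "two_param_norm (2 * \<alpha>) (snd (\<Psi>' t)) \<le> ennreal M" using M01(1) by (rule order_trans)
          have "sup_norm (v' t) \<le> sup_norm (v t) + sup_norm (\<lambda>x. v t x - v' t x)"
            using sup_norm_diff[of "v t" "\<lambda>x. v t x - v' t x"] by simp
          also have "\<dots> \<le> ennreal M0 + ennreal 1" using g0(3) w1[OF t] by (intro add_mono)
          finally show "sup_norm (v' t) \<le> ennreal M" using M01(1) by (rule order_trans)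
        qed
      qed
      have Cd\<eta>0: "0 \<le> Cd * \<eta>" using Cd0 \<eta> by simp
      have nb: "n t \<le> Cd * \<eta>" if t: "t \<in> {0..T'}" for t
      proof (rule bootstrap_bound[OF nc(1)[folded n_def] _ _ _ t])
        show "n 0 \<le> Cd * \<eta>" using n_iff[of 0 "Cd * \<eta>"] order_trans[OF start(1) Hc\<eta>(1)] Cd\<eta>0 T'1 by simp
        show "Cd * \<eta> < 1" using Cd\<eta> by simp
        fix s assume s: "0 < s" "s \<le> T'" "\<And>t. t \<in> {0..s} \<Longrightarrow> n t \<le> 1"
        then have "sup_norm (\<lambda>x. v s x - v' s x) \<le> ennreal (Cd * \<eta>)"
          using est[OF s] order_trans[OF _ Hc\<eta>(2)] by auto
        then show "n s \<le> Cd * \<eta>" using n_iff[of s "Cd * \<eta>"] Cd\<eta>0 s by simp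
      qed
      have n1: "n t \<le> 1" if "t \<in> {0..T'}" for t using nb[OF that] Cd\<eta> by simp
      show ?thesis
      proof (cases "t = 0")
        case True
        then show ?thesis using start Hc\<eta>(1) by (auto intro: order_trans)
      next
        case False
        then have "t \<in> {0<..T'}" using t by auto
        then show ?thesis using est[OF T'(1) order_refl n1] Hc\<eta>(2) by (auto intro: order_trans)
      qed
    qed
    have conclude: "hoelder_norm \<beta> (\<lambda>x. u t x - u' t x) \<le> ennreal \<epsilon>"
      if t: "t \<in> {0..T}" and w: "sup_norm (\<lambda>x. v t x - v' t x) \<le> ennreal (Cd * \<eta>) \<and> two_param_norm \<beta> (incr (\<lambda>x. v t x - v' t x)) \<le> ennreal (Cd * \<eta>)" for t
    proof -
      have "(\<lambda>x. u t x - u' t x) = (\<lambda>x. (v t x - v' t x) + (fst (\<Psi> t) x - fst (\<Psi>' t) x))" by (auto simp: v_def v'_def fun_eq_iff)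
      then have "hoelder_norm \<beta> (\<lambda>x. u t x - u' t x) \<le> hoelder_norm \<beta> (\<lambda>x. v t x - v' t x) + hoelder_norm \<beta> (\<lambda>x. fst (\<Psi> t) x - fst (\<Psi>' t) x)"
        using hoelder_norm_triangle[of \<beta> "\<lambda>x. v t x - v' t x" "\<lambda>x. fst (\<Psi> t) x - fst (\<Psi>' t) x"] by simp
      also have "\<dots> \<le> (ennreal (Cd * \<eta>) + ennreal (Cd * \<eta>)) + ennreal \<delta>"
        unfolding hoelder_norm_def[of \<beta> "\<lambda>x. v t x - v' t x"] using w c2[OF t] by (intro add_mono) auto
      also have "\<dots> = ennreal (2 * (Cd * \<eta>) + \<delta>)" using Cd0 \<eta> \<delta> by (simp add: ennreal_plus[symmetric] del: ennreal_plus)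
      also have "\<dots> \<le> ennreal \<epsilon>" by (rule ennreal_leI[OF \<epsilon>b])
      finally show ?thesis .
    qed
    \<comment> \<open>If \<open>u'\<close> blew up at some \<open>r \<le> T\<close>, stability on
      every \<open>{0..t}\<close> with \<open>t < r\<close> would keep its \<beta>-Hoelder norm
      below the fixed number \<open>Bd\<close>. The strict inequality is what permits
      \<open>T' = T\<close> in \<open>stable\<close> afterwards.\<close>
    have blow: "ereal T < \<tau>'"
    proof (rule ccontr)
      assume "\<not> ereal T < \<tau>'"
      then have le: "\<tau>' \<le> ereal T" by simp
      then obtain r where r: "\<tau>' = ereal r" "0 < r" "r \<le> T" using \<tau>'p by (cases \<tau>') auto
      define Bd where "Bd = Cs + M0 + M0 + \<epsilon>"
      have bound: "hoelder_norm \<beta> (u' t) \<le> ennreal Bd" if t: "0 < t" "t < r" for t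
      proof -
        have tT: "t \<in> {0..T}" "t \<in> {0<..T1}" "t \<in> {0..T1}" using t r T1 by auto
        have d: "hoelder_norm \<beta> (\<lambda>x. u t x - u' t x) \<le> ennreal \<epsilon>"
          by (rule conclude[OF tT(1) stable[of t t]]) (use t r in auto)
        have "hoelder_norm \<beta> (v t) \<le> ennreal Cs + ennreal M0"
          unfolding hoelder_norm_def using Cs(2)[OF tT(2)] M0(2) tT by (intro add_mono) (auto simp: data_bounded_def)
        then have "hoelder_norm \<beta> (v t) + hoelder_norm \<beta> (fst (\<Psi> t)) \<le> ennreal Cs + ennreal M0 + ennreal M0"
          by (rule add_mono[OF _ M0(3)[OF tT(3)]])
        moreover have "hoelder_norm \<beta> (u t) \<le> hoelder_norm \<beta> (v t) + hoelder_norm \<beta> (fst (\<Psi> t))"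
          using hoelder_norm_triangle[of \<beta> "v t" "fst (\<Psi> t)"] by (simp add: v_def)
        ultimately have "hoelder_norm \<beta> (u t) \<le> ennreal Cs + ennreal M0 + ennreal M0" by (rule order_trans[rotated])
        then have "hoelder_norm \<beta> (u t) + hoelder_norm \<beta> (\<lambda>x. u t x - u' t x) \<le> ennreal Cs + ennreal M0 + ennreal M0 + ennreal \<epsilon>"
          by (rule add_mono[OF _ d])
        moreover have "hoelder_norm \<beta> (u' t) \<le> hoelder_norm \<beta> (u t) + hoelder_norm \<beta> (\<lambda>x. u t x - u' t x)"
          using hoelder_norm_diff[of \<beta> "u t" "\<lambda>x. u t x - u' t x"] by simp
        ultimately have "hoelder_norm \<beta> (u' t) \<le> ennreal Cs + ennreal M0 + ennreal M0 + ennreal \<epsilon>" by (rule order_trans[rotated])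
        then show ?thesis using Cs(1) M0(1) \<epsilon> by (simp add: Bd_def ennreal_plus[symmetric] del: ennreal_plus)
      qed
      have "((\<lambda>t. hoelder_norm \<beta> (u' t)) \<longlongrightarrow> \<infinity>) (at_left r)" using ls' r by (simp add: local_solution_def)
      then have "\<forall>\<^sub>F t in at_left r. ennreal Bd < hoelder_norm \<beta> (u' t)" by (rule order_tendstoD(1)) simp
      moreover have "\<forall>\<^sub>F t in at_left r. t \<in> {0<..<r}" using eventually_at_left_real[OF r(2)] .
      ultimately have "\<forall>\<^sub>F t in at_left r. False"
      proof eventually_elim
        case (elim t)
        then show ?case using bound[of t] by auto
      qed
      then show False by (simp add: trivial_limit_def[symmetric] trivial_limit_at_left_real)
    qed
    have "hoelder_norm \<beta> (\<lambda>x. u t x - u' t x) \<le> ennreal \<epsilon>" if t: "t \<in> {0..T}" for t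
    \<comment> \<open>\<open>stable\<close> concerns intervals of positive length; for
      \<open>T = 0\<close> the estimate at time 0 is used directly.\<close>
    proof (cases "T = 0")
      case True
      then show ?thesis using t start Hc\<eta>(1) by (intro conclude[OF t]) (auto intro: order_trans)
    next
      case False
      then show ?thesis using T0 blow t by (intro conclude[OF t] stable[of T t]) auto
    qed
    then show "ereal T \<le> \<tau>' \<and> (SUP t\<in>{0..T}. hoelder_norm \<beta> (\<lambda>x. u t x - u' t x)) \<le> ennreal \<epsilon>"
      using blow by (auto simp: SUP_le_iff)
  qed
qed

end
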